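(* Let $A$ be a commutative ring which is additively torsion-free, and suppose the fundamental functional $\sigma_n$ is injective for all $n>1$. For each $n>1$ let $I^A_n$ be the image of $\sigma_n$, i.e. the ideal of $A$ generated by $\nu(n)$ and all elements $a-a^n$, $a\in A$, and suppose each $I^A_n$ is a projective $A$-module. Then: (1) $A$ satisfies the fundamental comparison condition; (2) for any choice of splittings, the map $s$ is injective and $i^\sharp$ is an isomorphism (so $L^A$ is isomorphic to a sub-$A$-algebra of a polynomial $A$-algebra); (3) $L^A\cong\bigotimes_{n>1}\mathrm{Symm}_A^{2(n-1)}(I^A_n)=\mathrm{Symm}^2_A(I^A_2)\otimes_A\mathrm{Symm}^4_A(I^A_3)\otimes_A\cdots$ as graded $A$-algebras; (4) $L^A\cong\bigotimes_{n>1}\mathrm{Rees}_A^{2(n-1)}(I^A_n)=\mathrm{Rees}^2_A(I^A_2)\otimes_A\mathrm{Rees}^4_A(I^A_3)\otimes_A\cdots$ as graded $A$-algebras.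
   Context: Additively torsion-free: $ma=0$ with $m\in\mathbb{Z}$, $a\in A$ implies $m=0$ or $a=0$. $\nu(n)=p$ if $n>1$ is a power of the prime $p$, $\nu(n)=1$ otherwise. $L^A$ is the commutative $A$-algebra classifying formal $A$-modules (one-dimensional commutative formal group laws $F$ over $A$-algebras $R$ with ring maps $\rho:A\to\mathrm{End}(F)$, $\rho(a)(X)\equiv aX\bmod X^2$), graded so the coefficient of $X^iY^j$ in the universal formal group law has degree $2(i+j-1)$ and that of $X^i$ in $\rho(a)(X)$ has degree $2(i-1)$. $L^A_k$ is the degree-$2k$ summand and $D^A_k$ the $A$-submodule spanned by products of homogeneous elements of degree $<2k$. For $n\ge2$, $L^A_{n-1}/D^A_{n-1}$ is generated by $d$, $c_a$ ($a\in A$) with relations $d(a-a^n)=\nu(n)c_a$, $c_{a+b}-c_a-c_b=d\frac{a^n+b^n-(a+b)^n}{\nu(n)}$, $ac_b+b^nc_a=c_{ab}$; the fundamental functional $\sigma_n:L^A_{n-1}/D^A_{n-1}\to A$ is $\sigma_n(d)=\nu(n)$, $\sigma_n(c_a)=a-a^n$. $A$ satisfies the fundamental comparison condition if each $L^A_{n-1}/D^A_{n-1}$ ($n>1$) is projective; then, choosing $A$-linear splittings $i_{n-1}$ of $L^A_{n-1}\to L^A_{n-1}/D^A_{n-1}$, $i^\sharp:\mathrm{Symm}_A(\bigoplus_{n>1}L^A_{n-1}/D^A_{n-1})\to L^A$ is the induced algebra map, and $s=\mathrm{Symm}_A(\bigoplus_{n>1}\sigma_n):\mathrm{Symm}_A(\bigoplus_{n>1}L^A_{n-1}/D^A_{n-1})\to\mathrm{Symm}_A(\bigoplus_{n>1}A)\cong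 A[x_1,x_2,\dots]$. For an $A$-module $M$, $\mathrm{Symm}^j_A(M)=\bigoplus_{m\ge0}(M^{\otimes_Am})_{\Sigma_m}$ with the $m$-th summand in degree $jm$; for an ideal $I$, $\mathrm{Rees}^j_A(I)=\bigoplus_{m\ge0}I^mt^m\subseteq A[t]$ with $I^mt^m$ in degree $jm$. Infinite tensor products are colimits of finite ones. *)

theory Defs
  imports
    "HOL-Algebra.Algebra"
    "HOL-Number_Theory.Prime_Powers"
begin

section \<open>Modules and algebras\<close>

definition additively_torsion_free :: "('a, 'm) ring_scheme \<Rightarrow> bool" where
  "additively_torsion_free A \<longleftrightarrow>
     (\<forall>m::int. \<forall>a\<in>carrier A. add_pow A m a = \<zero>\<^bsub>A\<^esub> \<longrightarrow> m = 0 \<or> a = \<zero>\<^bsub>A\<^esub>)"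

definition mod_hom ::
  "('a, 'm) ring_scheme \<Rightarrow> ('a, 'b, 'p) module_scheme \<Rightarrow> ('a, 'c, 'q) module_scheme \<Rightarrow> ('b \<Rightarrow> 'c) set" where
  "mod_hom A M N = {h. h \<in> carrier M \<rightarrow> carrier N \<and>
     (\<forall>x\<in>carrier M. \<forall>y\<in>carrier M. h (x \<oplus>\<^bsub>M\<^esub> y) = h x \<oplus>\<^bsub>N\<^esub> h y) \<and>
     (\<forall>a\<in>carrier A. \<forall>x\<in>carrier M. h (a \<odot>\<^bsub>M\<^esub> x) = a \<odot>\<^bsub>N\<^esub> h x)}"

definition alg_hom ::
  "('a, 'm) ring_scheme \<Rightarrow> ('a, 'b, 'p) module_scheme \<Rightarrow> ('a, 'c, 'q) module_scheme \<Rightarrow> ('b \<Rightarrow> 'c) set" where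
  "alg_hom A B C = ring_hom B C \<inter> mod_hom A B C"

definition alg_iso ::
  "('a, 'm) ring_scheme \<Rightarrow> ('a, 'b, 'p) module_scheme \<Rightarrow> ('a, 'c, 'q) module_scheme \<Rightarrow> ('b \<Rightarrow> 'c) set" where
  "alg_iso A B C = {h \<in> alg_hom A B C. bij_betw h (carrier B) (carrier C)}"

definition subalgebra_of :: "('a, 'm) ring_scheme \<Rightarrow> 'b set \<Rightarrow> ('a, 'b, 'p) module_scheme \<Rightarrow> bool" where
  "subalgebra_of A H B \<longleftrightarrow> subring H B \<and> submodule H A B"

definition mod_span :: "('a, 'm) ring_scheme \<Rightarrow> ('a, 'b, 'p) module_scheme \<Rightarrow> 'b set \<Rightarrow> 'b set" where
  "mod_span A M S = (\<lambda>H. submodule H A M) hull S"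

definition self_module :: "('a, 'm) ring_scheme \<Rightarrow> ('a, 'a) module" where
  "self_module A = \<lparr>carrier = carrier A, monoid.mult = (\<otimes>\<^bsub>A\<^esub>), one = \<one>\<^bsub>A\<^esub>,
     ring.zero = \<zero>\<^bsub>A\<^esub>, add = (\<oplus>\<^bsub>A\<^esub>), smult = (\<otimes>\<^bsub>A\<^esub>)\<rparr>"

definition ideal_module :: "('a, 'm) ring_scheme \<Rightarrow> 'a set \<Rightarrow> ('a, 'a) module" where
  "ideal_module A I = (self_module A)\<lparr>carrier := I\<rparr>"

text \<open>Quotient of a module by a submodule, or of an algebra by an ideal. In the first case the
  multiplicative components of the result carry no information.\<close>

definition quot_module :: "('a, 'b, 'p) module_scheme \<Rightarrow> 'b set \<Rightarrow> ('a, 'b set) module" where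
  "quot_module M H = ring.extend (M Quot H)
     (module.fields (\<lambda>a C. \<Union>x\<in>C. H +>\<^bsub>M\<^esub> (a \<odot>\<^bsub>M\<^esub> x)))"

definition quot_lift :: "('b \<Rightarrow> 'c) \<Rightarrow> 'b set \<Rightarrow> 'c" where
  "quot_lift h C = the_elem (h ` C)"

text \<open>Since records of type \<open>module\<close> extend rings, plain modules have dummy multiplicative
  components.\<close>

definition free_module :: "('a, 'm) ring_scheme \<Rightarrow> 's set \<Rightarrow> ('a, 's \<Rightarrow> 'a) module" where
  "free_module A S =
     \<lparr>carrier = {p. (\<forall>s. p s \<in> carrier A) \<and> (\<forall>s. s \<notin> S \<longrightarrow> p s = \<zero>\<^bsub>A\<^esub>) \<and> finite {s. p s \<noteq> \<zero>\<^bsub>A\<^esub>}},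
      monoid.mult = undefined, one = undefined,
      ring.zero = (\<lambda>s. \<zero>\<^bsub>A\<^esub>),
      add = (\<lambda>p q s. p s \<oplus>\<^bsub>A\<^esub> q s),
      smult = (\<lambda>a p s. a \<otimes>\<^bsub>A\<^esub> p s)\<rparr>"

definition basis_elt :: "('a, 'm) ring_scheme \<Rightarrow> 's \<Rightarrow> 's \<Rightarrow> 'a" where
  "basis_elt A s = (\<lambda>t. if t = s then \<one>\<^bsub>A\<^esub> else \<zero>\<^bsub>A\<^esub>)"

definition direct_sum ::
  "'i set \<Rightarrow> ('i \<Rightarrow> ('a, 'b, 'p) module_scheme) \<Rightarrow> ('a, 'i \<Rightarrow> 'b) module" where
  "direct_sum N M =
     \<lparr>carrier = {f \<in> (\<Pi>\<^sub>E n\<in>N. carrier (M n)). finite {n \<in> N. f n \<noteq> \<zero>\<^bsub>M n\<^esub>}},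
      monoid.mult = undefined, one = undefined,
      ring.zero = (\<lambda>n\<in>N. \<zero>\<^bsub>M n\<^esub>),
      add = (\<lambda>f g. \<lambda>n\<in>N. f n \<oplus>\<^bsub>M n\<^esub> g n),
      smult = (\<lambda>a f. \<lambda>n\<in>N. a \<odot>\<^bsub>M n\<^esub> f n)\<rparr>"

text \<open>The homomorphisms out of a direct sum, and between direct sums, given by a family of
  homomorphisms.\<close>

definition direct_sum_lift ::
  "'i set \<Rightarrow> ('i \<Rightarrow> ('a, 'b, 'p) module_scheme) \<Rightarrow> ('a, 'c, 'q) module_scheme \<Rightarrow>
   ('i \<Rightarrow> 'b \<Rightarrow> 'c) \<Rightarrow> ('i \<Rightarrow> 'b) \<Rightarrow> 'c" where
  "direct_sum_lift N M B h f = (\<Oplus>\<^bsub>B\<^esub>n\<in>{n \<in> N. f n \<noteq> \<zero>\<^bsub>M n\<^esub>}. h n (f n))"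

definition direct_sum_map :: "'i set \<Rightarrow> ('i \<Rightarrow> 'b \<Rightarrow> 'c) \<Rightarrow> ('i \<Rightarrow> 'b) \<Rightarrow> ('i \<Rightarrow> 'c)" where
  "direct_sum_map N h f = (\<lambda>n\<in>N. h n (f n))"

text \<open>Projective modules are the retracts (direct summands) of free modules. Letting the basis
  range over sets of elements of \<open>P\<close> is no restriction, since every retract of a free module is
  already a retract of the free module on its own elements. The lifting property itself would
  quantify over modules of all types.\<close>

definition projective_module :: "('a, 'm) ring_scheme \<Rightarrow> ('a, 'b, 'p) module_scheme \<Rightarrow> bool" where
  "projective_module A P \<longleftrightarrow> module A P \<and>
     (\<exists>S :: 'b set. \<exists>i\<in>mod_hom A P (free_module A S). \<exists>r\<in>mod_hom A (free_module A S) P.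
        \<forall>x\<in>carrier P. r (i x) = x)"

section \<open>Monoid algebras and polynomial algebras\<close>

definition monoid_algebra ::
  "('a, 'm) ring_scheme \<Rightarrow> ('g, 'n) monoid_scheme \<Rightarrow> ('a, 'g \<Rightarrow> 'a) module" where
  "monoid_algebra A G = (free_module A (carrier G))
     \<lparr>monoid.mult := (\<lambda>p q g. finsum A (\<lambda>(h, k). p h \<otimes>\<^bsub>A\<^esub> q k)
        {(h, k). p h \<noteq> \<zero>\<^bsub>A\<^esub> \<and> q k \<noteq> \<zero>\<^bsub>A\<^esub> \<and> h \<otimes>\<^bsub>G\<^esub> k = g}),
      one := basis_elt A \<one>\<^bsub>G\<^esub>\<rparr>"

definition mset_monoid :: "'v set \<Rightarrow> 'v multiset monoid" where
  "mset_monoid V = \<lparr>carrier = {m. set_mset m \<subseteq> V}, monoid.mult = (+), one = {#}\<rparr>"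

definition list_monoid :: "'v set \<Rightarrow> 'v list monoid" where
  "list_monoid V = \<lparr>carrier = lists V, monoid.mult = (@), one = []\<rparr>"

definition poly_algebra :: "('a, 'm) ring_scheme \<Rightarrow> 'v set \<Rightarrow> ('a, 'v multiset \<Rightarrow> 'a) module" where
  "poly_algebra A V = monoid_algebra A (mset_monoid V)"

definition poly_var :: "('a, 'm) ring_scheme \<Rightarrow> 'v \<Rightarrow> 'v multiset \<Rightarrow> 'a" where
  "poly_var A v = basis_elt A {#v#}"

section \<open>Graded algebras\<close>

text \<open>A grading is given by the function sending \<open>d\<close> to the set of homogeneous elements of
  degree \<open>d\<close>.\<close>

definition graded_alg_isomorphic ::
  "('a, 'm) ring_scheme \<Rightarrow> ('a, 'b, 'p) module_scheme \<Rightarrow> (nat \<Rightarrow> 'b set) \<Rightarrow>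
   ('a, 'c, 'q) module_scheme \<Rightarrow> (nat \<Rightarrow> 'c set) \<Rightarrow> bool" where
  "graded_alg_isomorphic A B grB C grC \<longleftrightarrow> (\<exists>h\<in>alg_iso A B C. \<forall>d. h ` grB d = grC d)"

section \<open>Symmetric algebras\<close>

text \<open>The free module on the words of length \<open>m\<close> in \<open>M\<close>, modulo the first two kinds of relations,
  is the \<open>m\<close>-th tensor power of \<open>M\<close>; the third kind passes to the coinvariants of the symmetric
  group. Taking all \<open>m\<close> together yields the direct sum over \<open>m\<close> of these coinvariants, with
  multiplication induced by concatenation.\<close>

definition word_algebra ::
  "('a, 'm) ring_scheme \<Rightarrow> ('a, 'b, 'p) module_scheme \<Rightarrow> ('a, 'b list \<Rightarrow> 'a) module" where
  "word_algebra A M = monoid_algebra A (list_monoid (carrier M))"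

definition sym_relations ::
  "('a, 'm) ring_scheme \<Rightarrow> ('a, 'b, 'p) module_scheme \<Rightarrow> ('b list \<Rightarrow> 'a) set" where
  "sym_relations A M = (let T = word_algebra A M; e = basis_elt A in
     {e (u @ [x \<oplus>\<^bsub>M\<^esub> y] @ v) \<ominus>\<^bsub>T\<^esub> (e (u @ [x] @ v) \<oplus>\<^bsub>T\<^esub> e (u @ [y] @ v)) | u v x y.
        u \<in> lists (carrier M) \<and> v \<in> lists (carrier M) \<and> x \<in> carrier M \<and> y \<in> carrier M} \<union>
     {e (u @ [a \<odot>\<^bsub>M\<^esub> x] @ v) \<ominus>\<^bsub>T\<^esub> (a \<odot>\<^bsub>T\<^esub> e (u @ [x] @ v)) | u v a x.
        u \<in> lists (carrier M) \<and> v \<in> lists (carrier M) \<and> a \<in> carrier A \<and> x \<in> carrier M} \<union>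
     {e w \<ominus>\<^bsub>T\<^esub> e w' | w w'. w \<in> lists (carrier M) \<and> w' \<in> lists (carrier M) \<and> mset w = mset w'})"

definition sym_ideal ::
  "('a, 'm) ring_scheme \<Rightarrow> ('a, 'b, 'p) module_scheme \<Rightarrow> ('b list \<Rightarrow> 'a) set" where
  "sym_ideal A M = mod_span A (word_algebra A M) (sym_relations A M)"

definition sym_algebra ::
  "('a, 'm) ring_scheme \<Rightarrow> ('a, 'b, 'p) module_scheme \<Rightarrow> ('a, ('b list \<Rightarrow> 'a) set) module" where
  "sym_algebra A M = quot_module (word_algebra A M) (sym_ideal A M)"

definition sym_incl ::
  "('a, 'm) ring_scheme \<Rightarrow> ('a, 'b, 'p) module_scheme \<Rightarrow> 'b \<Rightarrow> ('b list \<Rightarrow> 'a) set" where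
  "sym_incl A M x = sym_ideal A M +>\<^bsub>word_algebra A M\<^esub> basis_elt A [x]"

text \<open>The grading in which the \<open>m\<close>-th summand sits in degree \<open>j * m\<close>.\<close>

definition sym_degree ::
  "nat \<Rightarrow> ('a, 'm) ring_scheme \<Rightarrow> ('a, 'b, 'p) module_scheme \<Rightarrow> nat \<Rightarrow> ('b list \<Rightarrow> 'a) set set" where
  "sym_degree j A M d = {sym_ideal A M +>\<^bsub>word_algebra A M\<^esub> p | p.
     p \<in> carrier (word_algebra A M) \<and> (\<forall>w. p w \<noteq> \<zero>\<^bsub>A\<^esub> \<longrightarrow> j * length w = d)}"

text \<open>The algebra homomorphism into a commutative algebra \<open>B\<close> induced by a linear map.\<close>

definition sym_lift ::
  "('a, 'm) ring_scheme \<Rightarrow> ('a, 'c, 'q) module_scheme \<Rightarrow> ('b \<Rightarrow> 'c) \<Rightarrow> ('b list \<Rightarrow> 'a) set \<Rightarrow> 'c" where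
  "sym_lift A B h = quot_lift (\<lambda>p. \<Oplus>\<^bsub>B\<^esub>w\<in>{w. p w \<noteq> \<zero>\<^bsub>A\<^esub>}.
     p w \<odot>\<^bsub>B\<^esub> foldr (\<lambda>x y. h x \<otimes>\<^bsub>B\<^esub> y) w \<one>\<^bsub>B\<^esub>)"

definition sym_map ::
  "('a, 'm) ring_scheme \<Rightarrow> ('a, 'c, 'q) module_scheme \<Rightarrow> ('b \<Rightarrow> 'c) \<Rightarrow>
   ('b list \<Rightarrow> 'a) set \<Rightarrow> ('c list \<Rightarrow> 'a) set" where
  "sym_map A N h = sym_lift A (sym_algebra A N) (\<lambda>x. sym_incl A N (h x))"

section \<open>Rees algebras\<close>

definition rees_algebra :: "('a, 'm) ring_scheme \<Rightarrow> 'a set \<Rightarrow> ('a, nat \<Rightarrow> 'a) up_ring" where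
  "rees_algebra A I = (UP A)
     \<lparr>carrier := {p \<in> carrier (UP A). \<forall>m. p m \<in> I [^]\<^bsub>ideals_set A\<^esub> m}\<rparr>"

definition rees_degree :: "nat \<Rightarrow> ('a, 'm) ring_scheme \<Rightarrow> 'a set \<Rightarrow> nat \<Rightarrow> (nat \<Rightarrow> 'a) set" where
  "rees_degree j A I d =
     {p \<in> carrier (rees_algebra A I). \<forall>m. p m \<noteq> \<zero>\<^bsub>A\<^esub> \<longrightarrow> j * m = d}"

section \<open>Possibly infinite tensor products of algebras\<close>

text \<open>Pure tensors \<open>\<Otimes>n\<in>N. f n\<close> with \<open>f n = \<one>\<close> for almost all \<open>n\<close>, modulo multilinearity. Each
  relation changes a single factor, so this is the union (colimit) of the tensor products over
  the finite subsets of \<open>N\<close>, along the maps that insert the factor \<open>\<one>\<close>.\<close>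

definition restricted_prod :: "'i set \<Rightarrow> ('i \<Rightarrow> ('a, 'b, 'p) module_scheme) \<Rightarrow> ('i \<Rightarrow> 'b) monoid" where
  "restricted_prod N B =
     \<lparr>carrier = {f \<in> (\<Pi>\<^sub>E n\<in>N. carrier (B n)). finite {n \<in> N. f n \<noteq> \<one>\<^bsub>B n\<^esub>}},
      monoid.mult = (\<lambda>f g. \<lambda>n\<in>N. f n \<otimes>\<^bsub>B n\<^esub> g n),
      one = (\<lambda>n\<in>N. \<one>\<^bsub>B n\<^esub>)\<rparr>"

definition pure_algebra ::
  "('a, 'm) ring_scheme \<Rightarrow> 'i set \<Rightarrow> ('i \<Rightarrow> ('a, 'b, 'p) module_scheme) \<Rightarrow> ('a, ('i \<Rightarrow> 'b) \<Rightarrow> 'a) module" where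
  "pure_algebra A N B = monoid_algebra A (restricted_prod N B)"

definition tensor_ideal ::
  "('a, 'm) ring_scheme \<Rightarrow> 'i set \<Rightarrow> ('i \<Rightarrow> ('a, 'b, 'p) module_scheme) \<Rightarrow> (('i \<Rightarrow> 'b) \<Rightarrow> 'a) set" where
  "tensor_ideal A N B = (let W = pure_algebra A N B; e = basis_elt A in mod_span A W (
     {e (f(n := x \<oplus>\<^bsub>B n\<^esub> y)) \<ominus>\<^bsub>W\<^esub> (e (f(n := x)) \<oplus>\<^bsub>W\<^esub> e (f(n := y))) | f n x y.
        f \<in> carrier (restricted_prod N B) \<and> n \<in> N \<and> x \<in> carrier (B n) \<and> y \<in> carrier (B n)} \<union>
     {e (f(n := a \<odot>\<^bsub>B n\<^esub> x)) \<ominus>\<^bsub>W\<^esub> (a \<odot>\<^bsub>W\<^esub> e (f(n := x))) | f n a x.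
        f \<in> carrier (restricted_prod N B) \<and> n \<in> N \<and> a \<in> carrier A \<and> x \<in> carrier (B n)}))"

definition tensor_algebra ::
  "('a, 'm) ring_scheme \<Rightarrow> 'i set \<Rightarrow> ('i \<Rightarrow> ('a, 'b, 'p) module_scheme) \<Rightarrow>
   ('a, (('i \<Rightarrow> 'b) \<Rightarrow> 'a) set) module" where
  "tensor_algebra A N B = quot_module (pure_algebra A N B) (tensor_ideal A N B)"

text \<open>The total grading: degree \<open>d\<close> is spanned by the pure tensors of homogeneous elements whose
  degrees add up to \<open>d\<close>.\<close>

definition tensor_degree ::
  "('a, 'm) ring_scheme \<Rightarrow> 'i set \<Rightarrow> ('i \<Rightarrow> ('a, 'b, 'p) module_scheme) \<Rightarrow> ('i \<Rightarrow> nat \<Rightarrow> 'b set) \<Rightarrow>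
   nat \<Rightarrow> (('i \<Rightarrow> 'b) \<Rightarrow> 'a) set set" where
  "tensor_degree A N B gr d = mod_span A (tensor_algebra A N B)
     {tensor_ideal A N B +>\<^bsub>pure_algebra A N B\<^esub> basis_elt A f | f.
        f \<in> carrier (restricted_prod N B) \<and>
        (\<exists>deg :: 'i \<Rightarrow> nat. finite {n \<in> N. deg n \<noteq> 0} \<and> (\<forall>n\<in>N. f n \<in> gr n (deg n)) \<and>
           (\<Sum>n\<in>{n \<in> N. deg n \<noteq> 0}. deg n) = d)}"

section \<open>Formal modules\<close>

text \<open>Power series over \<open>R\<close> in countably many variables, as functions from monomials to
  coefficients. Only the variables 0, 1, 2, written \<open>x\<close>, \<open>y\<close>, \<open>z\<close> below, are used.\<close>

definition power_series_ring :: "('r, 'm) ring_scheme \<Rightarrow> (nat multiset \<Rightarrow> 'r) ring" where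
  "power_series_ring R =
     \<lparr>carrier = {p. \<forall>m. p m \<in> carrier R},
      monoid.mult = (\<lambda>p q m. \<Oplus>\<^bsub>R\<^esub>k\<in>{k. k \<subseteq># m}. p k \<otimes>\<^bsub>R\<^esub> q (m - k)),
      one = (\<lambda>m. if m = {#} then \<one>\<^bsub>R\<^esub> else \<zero>\<^bsub>R\<^esub>),
      ring.zero = (\<lambda>m. \<zero>\<^bsub>R\<^esub>),
      add = (\<lambda>p q m. p m \<oplus>\<^bsub>R\<^esub> q m)\<rparr>"

definition ps_var :: "('r, 'm) ring_scheme \<Rightarrow> nat \<Rightarrow> nat multiset \<Rightarrow> 'r" where
  "ps_var R v = (\<lambda>m. if m = {#v#} then \<one>\<^bsub>R\<^esub> else \<zero>\<^bsub>R\<^esub>)"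

text \<open>Substitution of power series \<open>p\<close>, \<open>q\<close> without constant term into \<open>\<Sum>i. f i T\<^sup>i\<close> and
  \<open>\<Sum>i j. F i j T\<^sup>i U\<^sup>j\<close>. As \<open>p\<^sup>i q\<^sup>j\<close> has no monomials of degree less than \<open>i + j\<close>, the coefficient
  at \<open>m\<close> only involves the indices up to the degree of \<open>m\<close>.\<close>

definition ps_subst1 ::
  "('r, 'm) ring_scheme \<Rightarrow> (nat \<Rightarrow> 'r) \<Rightarrow> (nat multiset \<Rightarrow> 'r) \<Rightarrow> (nat multiset \<Rightarrow> 'r)" where
  "ps_subst1 R f p = (\<lambda>m. \<Oplus>\<^bsub>R\<^esub>i\<in>{..size m}. f i \<otimes>\<^bsub>R\<^esub> (p [^]\<^bsub>power_series_ring R\<^esub> i) m)"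

definition ps_subst2 ::
  "('r, 'm) ring_scheme \<Rightarrow> (nat \<Rightarrow> nat \<Rightarrow> 'r) \<Rightarrow> (nat multiset \<Rightarrow> 'r) \<Rightarrow> (nat multiset \<Rightarrow> 'r) \<Rightarrow>
   (nat multiset \<Rightarrow> 'r)" where
  "ps_subst2 R F p q = (\<lambda>m. finsum R
     (\<lambda>(i, j). F i j \<otimes>\<^bsub>R\<^esub>
       (p [^]\<^bsub>power_series_ring R\<^esub> i \<otimes>\<^bsub>power_series_ring R\<^esub> q [^]\<^bsub>power_series_ring R\<^esub> j) m)
     ({..size m} \<times> {..size m}))"

text \<open>The axioms of a formal \<open>A\<close>-module over \<open>R\<close>, other than \<open>F(x, 0) = x = F(0, x)\<close> and
  \<open>\<rho> a = a x + \<dots>\<close>, as pairs of power series that have to coincide: commutativity and associativity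
  of the formal group law \<open>F\<close>; \<open>\<rho> a\<close> is an endomorphism of \<open>F\<close>; \<open>\<rho>\<close> is a ring homomorphism to the
  endomorphism ring, whose addition is \<open>F\<close> and whose multiplication is composition.\<close>

definition formal_module_equations ::
  "('a, 'm) ring_scheme \<Rightarrow> ('r, 'n) ring_scheme \<Rightarrow> (nat \<Rightarrow> nat \<Rightarrow> 'r) \<Rightarrow> ('a \<Rightarrow> nat \<Rightarrow> 'r) \<Rightarrow>
   ((nat multiset \<Rightarrow> 'r) \<times> (nat multiset \<Rightarrow> 'r)) set" where
  "formal_module_equations A R F \<rho> =
    (let x = ps_var R 0; y = ps_var R 1; z = ps_var R 2;
         Fs = ps_subst2 R F; \<rho>s = (\<lambda>a. ps_subst1 R (\<rho> a)) in
      {(Fs x y, Fs y x), (Fs (Fs x y) z, Fs x (Fs y z))} \<union>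
      {(\<rho>s a (Fs x y), Fs (\<rho>s a x) (\<rho>s a y)) | a. a \<in> carrier A} \<union>
      {(\<rho>s (a \<oplus>\<^bsub>A\<^esub> b) x, Fs (\<rho>s a x) (\<rho>s b x)) | a b. a \<in> carrier A \<and> b \<in> carrier A} \<union>
      {(\<rho>s (a \<otimes>\<^bsub>A\<^esub> b) x, \<rho>s a (\<rho>s b x)) | a b. a \<in> carrier A \<and> b \<in> carrier A} \<union>
      {(\<rho>s \<one>\<^bsub>A\<^esub> x, x)})"

definition formal_module ::
  "('a, 'm) ring_scheme \<Rightarrow> ('a, 'r, 'p) module_scheme \<Rightarrow> (nat \<Rightarrow> nat \<Rightarrow> 'r) \<Rightarrow> ('a \<Rightarrow> nat \<Rightarrow> 'r) \<Rightarrow> bool" where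
  "formal_module A R F \<rho> \<longleftrightarrow>
     (\<forall>i j. F i j \<in> carrier R) \<and> (\<forall>a\<in>carrier A. \<forall>i. \<rho> a i \<in> carrier R) \<and>
     (\<forall>i. F i 0 = (if i = 1 then \<one>\<^bsub>R\<^esub> else \<zero>\<^bsub>R\<^esub>)) \<and>
     (\<forall>j. F 0 j = (if j = 1 then \<one>\<^bsub>R\<^esub> else \<zero>\<^bsub>R\<^esub>)) \<and>
     (\<forall>a\<in>carrier A. \<rho> a 0 = \<zero>\<^bsub>R\<^esub> \<and> \<rho> a 1 = a \<odot>\<^bsub>R\<^esub> \<one>\<^bsub>R\<^esub>) \<and>
     (\<forall>(p, q)\<in>formal_module_equations A R F \<rho>. p = q)"

section \<open>The classifying algebra of formal modules\<close>

text \<open>\<open>FCoeff i j\<close> stands for the coefficient of \<open>X\<^sup>i Y\<^sup>j\<close> in the universal formal group law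
  \<open>X + Y + \<dots>\<close> and \<open>RCoeff a i\<close> for that of \<open>X\<^sup>i\<close> in the universal \<open>\<rho> a = a X + \<dots>\<close>.\<close>

datatype 'a lazard_gen = FCoeff nat nat | RCoeff 'a nat

definition lazard_gens :: "('a, 'm) ring_scheme \<Rightarrow> 'a lazard_gen set" where
  "lazard_gens A = {FCoeff i j | i j. i \<ge> 1 \<and> j \<ge> 1} \<union> {RCoeff a i | a i. a \<in> carrier A \<and> i \<ge> 2}"

fun lazard_gen_degree :: "'a lazard_gen \<Rightarrow> nat" where
  "lazard_gen_degree (FCoeff i j) = 2 * (i + j - 1)"
| "lazard_gen_degree (RCoeff a i) = 2 * (i - 1)"

type_synonym 'a lazard_poly = "'a lazard_gen multiset \<Rightarrow> 'a"

definition lazard_poly_algebra :: "('a, 'm) ring_scheme \<Rightarrow> ('a, 'a lazard_poly) module" where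
  "lazard_poly_algebra A = poly_algebra A (lazard_gens A)"

definition generic_F :: "('a, 'm) ring_scheme \<Rightarrow> nat \<Rightarrow> nat \<Rightarrow> 'a lazard_poly" where
  "generic_F A i j =
     (if i \<ge> 1 \<and> j \<ge> 1 then poly_var A (FCoeff i j)
      else if i + j = 1 then \<one>\<^bsub>lazard_poly_algebra A\<^esub> else \<zero>\<^bsub>lazard_poly_algebra A\<^esub>)"

definition generic_rho :: "('a, 'm) ring_scheme \<Rightarrow> 'a \<Rightarrow> nat \<Rightarrow> 'a lazard_poly" where
  "generic_rho A a i =
     (if i = 0 then \<zero>\<^bsub>lazard_poly_algebra A\<^esub>
      else if i = 1 then a \<odot>\<^bsub>lazard_poly_algebra A\<^esub> \<one>\<^bsub>lazard_poly_algebra A\<^esub>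
      else poly_var A (RCoeff a i))"

definition lazard_ideal :: "('a, 'm) ring_scheme \<Rightarrow> 'a lazard_poly set" where
  "lazard_ideal A = Idl\<^bsub>lazard_poly_algebra A\<^esub>
     {p m \<ominus>\<^bsub>lazard_poly_algebra A\<^esub> q m | p q m.
        (p, q) \<in> formal_module_equations A (lazard_poly_algebra A) (generic_F A) (generic_rho A)}"

definition lazard :: "('a, 'm) ring_scheme \<Rightarrow> ('a, 'a lazard_poly set) module" where
  "lazard A = quot_module (lazard_poly_algebra A) (lazard_ideal A)"

definition lazard_class :: "('a, 'm) ring_scheme \<Rightarrow> 'a lazard_poly \<Rightarrow> 'a lazard_poly set" where
  "lazard_class A p = lazard_ideal A +>\<^bsub>lazard_poly_algebra A\<^esub> p"

definition universal_F :: "('a, 'm) ring_scheme \<Rightarrow> nat \<Rightarrow> nat \<Rightarrow> 'a lazard_poly set" where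
  "universal_F A i j = lazard_class A (generic_F A i j)"

definition universal_rho :: "('a, 'm) ring_scheme \<Rightarrow> 'a \<Rightarrow> nat \<Rightarrow> 'a lazard_poly set" where
  "universal_rho A a i = lazard_class A (generic_rho A a i)"

definition lazard_degree :: "('a, 'm) ring_scheme \<Rightarrow> nat \<Rightarrow> 'a lazard_poly set set" where
  "lazard_degree A d = {lazard_class A p | p. p \<in> carrier (lazard_poly_algebra A) \<and>
     (\<forall>m. p m \<noteq> \<zero>\<^bsub>A\<^esub> \<longrightarrow> (\<Sum>v\<in>#m. lazard_gen_degree v) = d)}"

section \<open>Indecomposables and the fundamental functional\<close>

definition lazard_part :: "('a, 'm) ring_scheme \<Rightarrow> nat \<Rightarrow> ('a, 'a lazard_poly set) module" where
  "lazard_part A k = (lazard A)\<lparr>carrier := lazard_degree A (2 * k)\<rparr>"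

text \<open>Products of more than two factors of degree less than \<open>2 * k\<close> can be regrouped into products
  of two such factors.\<close>

definition decomposables :: "('a, 'm) ring_scheme \<Rightarrow> nat \<Rightarrow> 'a lazard_poly set set" where
  "decomposables A k = mod_span A (lazard_part A k)
     {x \<otimes>\<^bsub>lazard A\<^esub> y | x y d e. d < 2 * k \<and> e < 2 * k \<and> d + e = 2 * k \<and>
        x \<in> lazard_degree A d \<and> y \<in> lazard_degree A e}"

definition indec :: "('a, 'm) ring_scheme \<Rightarrow> nat \<Rightarrow> ('a, 'a lazard_poly set set) module" where
  "indec A n = quot_module (lazard_part A (n - 1)) (decomposables A (n - 1))"

definition indec_proj :: "('a, 'm) ring_scheme \<Rightarrow> nat \<Rightarrow> 'a lazard_poly set \<Rightarrow> 'a lazard_poly set set" where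
  "indec_proj A n x = decomposables A (n - 1) +>\<^bsub>lazard_part A (n - 1)\<^esub> x"

definition nu :: "nat \<Rightarrow> nat" where
  "nu n = (if primepow n then aprimedivisor n else 1)"

text \<open>The generators \<open>d\<close> and \<open>c\<^sub>a\<close>: modulo decomposables the universal formal module is
  \<open>F(X, Y) = X + Y + d (X\<^sup>n + Y\<^sup>n - (X + Y)\<^sup>n) / \<nu>(n)\<close> and \<open>\<rho>(a)(X) = a X + c\<^sub>a X\<^sup>n\<close> in the degree under
  consideration. The coefficients \<open>(n choose i) / \<nu>(n)\<close> for \<open>0 < i < n\<close> are integers without a common
  factor, so the first equation determines \<open>d\<close>. With this sign the additivity of \<open>\<rho>\<close> reads
  \<open>c\<^bsub>a+b\<^esub> - c\<^sub>a - c\<^sub>b = d (a\<^sup>n + b\<^sup>n - (a + b)\<^sup>n) / \<nu>(n)\<close>.\<close>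

definition indec_d :: "('a, 'm) ring_scheme \<Rightarrow> nat \<Rightarrow> 'a lazard_poly set set" where
  "indec_d A n = (THE d. d \<in> carrier (indec A n) \<and>
     (\<forall>i. 0 < i \<and> i < n \<longrightarrow>
        indec_proj A n (universal_F A i (n - i)) =
        \<ominus>\<^bsub>indec A n\<^esub> add_pow (indec A n) ((n choose i) div nu n) d))"

definition indec_c :: "('a, 'm) ring_scheme \<Rightarrow> nat \<Rightarrow> 'a \<Rightarrow> 'a lazard_poly set set" where
  "indec_c A n a = indec_proj A n (universal_rho A a n)"

definition fundamental_functional ::
  "('a, 'm) ring_scheme \<Rightarrow> nat \<Rightarrow> 'a lazard_poly set set \<Rightarrow> 'a" where
  "fundamental_functional A n = (THE \<sigma>.
     \<sigma> \<in> mod_hom A (indec A n) (self_module A) \<and> \<sigma> \<in> extensional (carrier (indec A n)) \<and>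
     \<sigma> (indec_d A n) = add_pow A (nu n) \<one>\<^bsub>A\<^esub> \<and>
     (\<forall>a\<in>carrier A. \<sigma> (indec_c A n a) = a \<ominus>\<^bsub>A\<^esub> (a [^]\<^bsub>A\<^esub> n)))"

definition fundamental_ideal :: "('a, 'm) ring_scheme \<Rightarrow> nat \<Rightarrow> 'a set" where
  "fundamental_ideal A n = fundamental_functional A n ` carrier (indec A n)"

definition fundamental_comparison_condition :: "('a, 'm) ring_scheme \<Rightarrow> bool" where
  "fundamental_comparison_condition A \<longleftrightarrow> (\<forall>n>1. projective_module A (indec A n))"

definition indec_sum :: "('a, 'm) ring_scheme \<Rightarrow> ('a, nat \<Rightarrow> 'a lazard_poly set set) module" where
  "indec_sum A = direct_sum {1<..} (indec A)"

text \<open>The value \<open>i n\<close> is a splitting of the projection onto \<open>indec A n\<close>, i.e. of the projection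
  from degree \<open>2 * (n - 1)\<close>.\<close>

definition is_splitting ::
  "('a, 'm) ring_scheme \<Rightarrow> (nat \<Rightarrow> 'a lazard_poly set set \<Rightarrow> 'a lazard_poly set) \<Rightarrow> bool" where
  "is_splitting A i \<longleftrightarrow> (\<forall>n>1. i n \<in> mod_hom A (indec A n) (lazard_part A (n - 1)) \<and>
     (\<forall>x\<in>carrier (indec A n). indec_proj A n (i n x) = x))"

definition i_sharp ::
  "('a, 'm) ring_scheme \<Rightarrow> (nat \<Rightarrow> 'a lazard_poly set set \<Rightarrow> 'a lazard_poly set) \<Rightarrow>
   ((nat \<Rightarrow> 'a lazard_poly set set) list \<Rightarrow> 'a) set \<Rightarrow> 'a lazard_poly set" where
  "i_sharp A i = sym_lift A (lazard A) (direct_sum_lift {1<..} (indec A) (lazard A) i)"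

definition s_map ::
  "('a, 'm) ring_scheme \<Rightarrow> ((nat \<Rightarrow> 'a lazard_poly set set) list \<Rightarrow> 'a) set \<Rightarrow>
   ((nat \<Rightarrow> 'a) list \<Rightarrow> 'a) set" where
  "s_map A = sym_map A (direct_sum {1<..} (\<lambda>n. self_module A))
     (direct_sum_map {1<..} (fundamental_functional A))"

section \<open>The algebra \<open>lazard A\<close> classifies formal modules\<close>

text \<open>Theorems \<open>lazard_formal_module\<close> and \<open>lazard_classifies\<close> at the end of this section: the
  coefficients \<open>universal_F\<close> and \<open>universal_rho\<close> define a formal \<open>A\<close>-module over \<open>lazard A\<close>, and every
  formal \<open>A\<close>-module over a commutative \<open>A\<close>-algebra arises from it along a unique homomorphism of
  \<open>A\<close>-algebras.\<close>

subsection \<open>Free modules and monoid algebras\<close>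

lemma carrier_free_module: "p \<in> carrier (free_module A S) \<longleftrightarrow>
   (\<forall>s. p s \<in> carrier A) \<and> (\<forall>s. s \<notin> S \<longrightarrow> p s = \<zero>\<^bsub>A\<^esub>) \<and> finite {s. p s \<noteq> \<zero>\<^bsub>A\<^esub>}"
  by (simp add: free_module_def)

lemma free_module_simps [simp]:
  "\<zero>\<^bsub>free_module A S\<^esub> = (\<lambda>s. \<zero>\<^bsub>A\<^esub>)"
  "p \<oplus>\<^bsub>free_module A S\<^esub> q = (\<lambda>s. p s \<oplus>\<^bsub>A\<^esub> q s)"
  "a \<odot>\<^bsub>free_module A S\<^esub> p = (\<lambda>s. a \<otimes>\<^bsub>A\<^esub> p s)"
  by (simp_all add: free_module_def)

lemma monoid_algebra_simps [simp]:
  "carrier (monoid_algebra A G) = carrier (free_module A (carrier G))"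
  "\<zero>\<^bsub>monoid_algebra A G\<^esub> = (\<lambda>s. \<zero>\<^bsub>A\<^esub>)"
  "\<one>\<^bsub>monoid_algebra A G\<^esub> = basis_elt A \<one>\<^bsub>G\<^esub>"
  "p \<oplus>\<^bsub>monoid_algebra A G\<^esub> q = (\<lambda>s. p s \<oplus>\<^bsub>A\<^esub> q s)"
  "a \<odot>\<^bsub>monoid_algebra A G\<^esub> p = (\<lambda>s. a \<otimes>\<^bsub>A\<^esub> p s)"
  by (simp_all add: monoid_algebra_def free_module_def)

context cring
begin

lemma free_module_closed:
  "(\<lambda>s. \<zero>) \<in> carrier (free_module R S)"
  "s \<in> S \<Longrightarrow> basis_elt R s \<in> carrier (free_module R S)"
  "p \<in> carrier (free_module R S) \<Longrightarrow> q \<in> carrier (free_module R S) \<Longrightarrow>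
     (\<lambda>s. p s \<oplus> q s) \<in> carrier (free_module R S)"
  "a \<in> carrier R \<Longrightarrow> p \<in> carrier (free_module R S) \<Longrightarrow>
     (\<lambda>s. a \<otimes> p s) \<in> carrier (free_module R S)"
     apply (simp add: carrier_free_module)
    apply (auto simp: carrier_free_module basis_elt_def)[1]
   apply (auto simp: carrier_free_module)[1]
  subgoal by (rule finite_subset[of _ "{s. p s \<noteq> \<zero>} \<union> {s. q s \<noteq> \<zero>}"]) auto
  apply (auto simp: carrier_free_module)
  by (rule finite_subset[of _ "{s. p s \<noteq> \<zero>}"]) auto

lemma free_moduleD: "p \<in> carrier (free_module R S) \<Longrightarrow> p s \<in> carrier R"
  by (simp add: carrier_free_module)

lemma free_module_module: "module R (free_module R S)"
proof (rule moduleI)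
  show "cring R" by (rule is_cring)
  show "abelian_group (free_module R S)"
  proof (rule abelian_groupI)
    fix p assume p: "p \<in> carrier (free_module R S)"
    have "(\<lambda>s. \<ominus> \<one> \<otimes> p s) \<in> carrier (free_module R S)"
      using p by (intro free_module_closed) auto
    moreover have "(\<lambda>s. \<ominus> \<one> \<otimes> p s \<oplus> p s) = (\<lambda>s. \<zero>)"
    proof
      fix s have "p s \<in> carrier R" using p by (simp add: carrier_free_module)
      then show "\<ominus> \<one> \<otimes> p s \<oplus> p s = \<zero>" by (simp add: l_minus l_neg)
    qed
    ultimately show "\<exists>y\<in>carrier (free_module R S). y \<oplus>\<^bsub>free_module R S\<^esub> p = \<zero>\<^bsub>free_module R S\<^esub>"
      by (intro bexI[of _ "\<lambda>s. \<ominus> \<one> \<otimes> p s"]) auto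
  next
    fix p q assume pq: "p \<in> carrier (free_module R S)" "q \<in> carrier (free_module R S)"
    show "p \<oplus>\<^bsub>free_module R S\<^esub> q \<in> carrier (free_module R S)"
      using pq free_module_closed(3) by simp
  qed (auto simp: carrier_free_module a_ac)
next
  fix a p assume "a \<in> carrier R" "p \<in> carrier (free_module R S)"
  then show "a \<odot>\<^bsub>free_module R S\<^esub> p \<in> carrier (free_module R S)"
    using free_module_closed(4) by simp
qed (auto simp: carrier_free_module l_distr r_distr m_assoc)

lemma free_module_induct [consumes 1, case_names zero basis]:
  assumes p: "p \<in> carrier (free_module R S)"
    and zero: "Q (\<lambda>s. \<zero>)"
    and add: "\<And>a s p. \<lbrakk>a \<in> carrier R; s \<in> S; p \<in> carrier (free_module R S); Q p\<rbrakk>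
       \<Longrightarrow> Q (\<lambda>t. a \<otimes> basis_elt R s t \<oplus> p t)"
  shows "Q p"
proof -
  have "finite T \<Longrightarrow> p \<in> carrier (free_module R S) \<Longrightarrow> {s. p s \<noteq> \<zero>} \<subseteq> T \<Longrightarrow> Q p" for T p
  proof (induction T arbitrary: p rule: finite_induct)
    case empty
    then have "p = (\<lambda>s. \<zero>)" by auto
    then show ?case using zero by simp
  next
    case (insert s T)
    define p' where "p' = p(s := \<zero>)"
    have "{t. p' t \<noteq> \<zero>} \<subseteq> {t. p t \<noteq> \<zero>}" by (auto simp: p'_def)
    then have p': "p' \<in> carrier (free_module R S)"
      using insert.prems(1) unfolding carrier_free_module
      by (auto intro: finite_subset simp: p'_def)
    have Qp': "Q p'" by (rule insert.IH[OF p']) (use insert.prems in \<open>auto simp: p'_def\<close>)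
    show ?case
    proof (cases "s \<in> S")
      case True
      have "p = (\<lambda>t. p s \<otimes> basis_elt R s t \<oplus> p' t)"
        using insert.prems(1) by (auto simp: p'_def basis_elt_def carrier_free_module fun_eq_iff)
      moreover have "Q (\<lambda>t. p s \<otimes> basis_elt R s t \<oplus> p' t)"
        using insert.prems(1) True p' Qp' by (intro add) (auto simp: carrier_free_module)
      ultimately show ?thesis by simp
    next
      case False
      then have "p = p'" using insert.prems(1) by (auto simp: p'_def carrier_free_module fun_eq_iff)
      then show ?thesis using Qp' by simp
    qed
  qed
  then show ?thesis using p by (auto simp: carrier_free_module)
qed

definition lin_ext :: "('a, 'c, 'q) module_scheme \<Rightarrow> ('s \<Rightarrow> 'c) \<Rightarrow> ('s \<Rightarrow> 'a) \<Rightarrow> 'c" where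
  "lin_ext M f p = (\<Oplus>\<^bsub>M\<^esub>s\<in>{s. p s \<noteq> \<zero>}. p s \<odot>\<^bsub>M\<^esub> f s)"

end

lemma (in module) lin_ext_superset:
  assumes "f \<in> S \<rightarrow> carrier M" "p \<in> carrier (free_module R S)" "finite T" "{s. p s \<noteq> \<zero>} \<subseteq> T" "T \<subseteq> S"
  shows "R.lin_ext M f p = (\<Oplus>\<^bsub>M\<^esub>s\<in>T. p s \<odot>\<^bsub>M\<^esub> f s)"
  unfolding R.lin_ext_def using assms
  by (intro M.add.finprod_mono_neutral_cong_left)
    (auto simp: carrier_free_module Pi_iff)

lemma (in module) supp_sub: "p \<in> carrier (free_module R S) \<Longrightarrow> finite {s. p s \<noteq> \<zero>}" 
   "p \<in> carrier (free_module R S) \<Longrightarrow> {s. p s \<noteq> \<zero>} \<subseteq> S"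
  by (auto simp: carrier_free_module)

lemma (in module) lin_ext_hom:
  assumes f: "f \<in> S \<rightarrow> carrier M"
  shows "R.lin_ext M f \<in> mod_hom R (free_module R S) M"
proof -
  have cl: "R.lin_ext M f p \<in> carrier M" if "p \<in> carrier (free_module R S)" for p
    unfolding R.lin_ext_def using that f supp_sub[OF that]
    by (intro M.finsum_closed) (auto simp: carrier_free_module)
  have add: "R.lin_ext M f (\<lambda>s. p s \<oplus> q s) = R.lin_ext M f p \<oplus>\<^bsub>M\<^esub> R.lin_ext M f q"
    if p: "p \<in> carrier (free_module R S)" and q: "q \<in> carrier (free_module R S)" for p q
  proof -
    let ?T = "{s. p s \<noteq> \<zero>} \<union> {s. q s \<noteq> \<zero>}"
    have T: "finite ?T" "?T \<subseteq> S" using supp_sub[OF p] supp_sub[OF q] by auto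
    have c: "p s \<in> carrier R" "q s \<in> carrier R" for s using p q by (auto simp: carrier_free_module)
    have "R.lin_ext M f (\<lambda>s. p s \<oplus> q s) = (\<Oplus>\<^bsub>M\<^esub>s\<in>?T. (p s \<oplus> q s) \<odot>\<^bsub>M\<^esub> f s)"
      using f T p q by (intro lin_ext_superset R.free_module_closed) auto
    also have "\<dots> = (\<Oplus>\<^bsub>M\<^esub>s\<in>?T. p s \<odot>\<^bsub>M\<^esub> f s \<oplus>\<^bsub>M\<^esub> q s \<odot>\<^bsub>M\<^esub> f s)"
      using f T c by (intro M.add.finprod_cong') (auto simp: Pi_iff smult_l_distr)
    also have "\<dots> = (\<Oplus>\<^bsub>M\<^esub>s\<in>?T. p s \<odot>\<^bsub>M\<^esub> f s) \<oplus>\<^bsub>M\<^esub> (\<Oplus>\<^bsub>M\<^esub>s\<in>?T. q s \<odot>\<^bsub>M\<^esub> f s)"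
      using f T c by (intro M.finsum_addf) (auto simp: Pi_iff)
    also have "(\<Oplus>\<^bsub>M\<^esub>s\<in>?T. p s \<odot>\<^bsub>M\<^esub> f s) = R.lin_ext M f p"
      using f T p by (intro lin_ext_superset[symmetric]) auto
    also have "(\<Oplus>\<^bsub>M\<^esub>s\<in>?T. q s \<odot>\<^bsub>M\<^esub> f s) = R.lin_ext M f q"
      using f T q by (intro lin_ext_superset[symmetric]) auto
    finally show ?thesis .
  qed
  have sm: "R.lin_ext M f (\<lambda>s. a \<otimes> p s) = a \<odot>\<^bsub>M\<^esub> R.lin_ext M f p"
    if p: "p \<in> carrier (free_module R S)" and a: "a \<in> carrier R" for p a
  proof -
    let ?T = "{s. p s \<noteq> \<zero>}"
    have T: "finite ?T" "?T \<subseteq> S" using supp_sub[OF p] by auto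
    have c: "p s \<in> carrier R" for s using p by (auto simp: carrier_free_module)
    have "R.lin_ext M f (\<lambda>s. a \<otimes> p s) = (\<Oplus>\<^bsub>M\<^esub>s\<in>?T. (a \<otimes> p s) \<odot>\<^bsub>M\<^esub> f s)"
      using f T a p by (intro lin_ext_superset R.free_module_closed) auto
    also have "\<dots> = (\<Oplus>\<^bsub>M\<^esub>s\<in>?T. a \<odot>\<^bsub>M\<^esub> (p s \<odot>\<^bsub>M\<^esub> f s))"
      using f T c a by (intro M.add.finprod_cong') (auto simp: Pi_iff smult_assoc1)
    also have "\<dots> = a \<odot>\<^bsub>M\<^esub> (\<Oplus>\<^bsub>M\<^esub>s\<in>?T. p s \<odot>\<^bsub>M\<^esub> f s)"
      using f T c a by (intro finsum_smult_ldistr[symmetric]) (auto simp: Pi_iff)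
    finally show ?thesis by (simp add: R.lin_ext_def)
  qed
  show ?thesis using cl add sm by (auto simp: mod_hom_def)
qed

lemma (in module) lin_ext_basis:
  assumes f: "f \<in> S \<rightarrow> carrier M" and s: "s \<in> S"
  shows "R.lin_ext M f (basis_elt R s) = f s"
proof -
  have "R.lin_ext M f (basis_elt R s) = (\<Oplus>\<^bsub>M\<^esub>t\<in>{s}. basis_elt R s t \<odot>\<^bsub>M\<^esub> f t)"
    using f s by (intro lin_ext_superset R.free_module_closed) (auto simp: basis_elt_def)
  also have "\<dots> = f s" using f s by (auto simp: basis_elt_def Pi_iff)
  finally show ?thesis .
qed


lemma monoid_algebra_mult:
  "p \<otimes>\<^bsub>monoid_algebra A G\<^esub> q = (\<lambda>g. finsum A (\<lambda>(h, k). p h \<otimes>\<^bsub>A\<^esub> q k)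
        {(h, k). p h \<noteq> \<zero>\<^bsub>A\<^esub> \<and> q k \<noteq> \<zero>\<^bsub>A\<^esub> \<and> h \<otimes>\<^bsub>G\<^esub> k = g})"
  by (simp add: monoid_algebra_def)

locale mon_alg = cring R + G: comm_monoid G for R (structure) and G :: "('g, 'n) monoid_scheme"
begin

abbreviation MA where "MA \<equiv> monoid_algebra R G"
abbreviation C where "C \<equiv> carrier (free_module R (carrier G))"

lemma mult_superset:
  assumes "p \<in> C" "q \<in> C" "finite S" "finite T" "{s. p s \<noteq> \<zero>} \<subseteq> S" "{s. q s \<noteq> \<zero>} \<subseteq> T"
  shows "(p \<otimes>\<^bsub>MA\<^esub> q) g =
    (\<Oplus>z\<in>S \<times> T. if fst z \<otimes>\<^bsub>G\<^esub> snd z = g then p (fst z) \<otimes> q (snd z) else \<zero>)"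
  unfolding monoid_algebra_mult using assms
  by (intro add.finprod_mono_neutral_cong_left) (auto simp: carrier_free_module split: if_splits)

lemma mult_add_left:
  assumes "p \<in> C" "p' \<in> C" "q \<in> C"
  shows "(\<lambda>s. p s \<oplus> p' s) \<otimes>\<^bsub>MA\<^esub> q = (\<lambda>s. (p \<otimes>\<^bsub>MA\<^esub> q) s \<oplus> (p' \<otimes>\<^bsub>MA\<^esub> q) s)"
proof
  fix g
  let ?S = "{s. p s \<noteq> \<zero>} \<union> {s. p' s \<noteq> \<zero>}" and ?T = "{s. q s \<noteq> \<zero>}"
  have fin: "finite ?S" "finite ?T" using assms by (auto simp: carrier_free_module)
  have c: "p s \<in> carrier R" "p' s \<in> carrier R" "q s \<in> carrier R" for s
    using assms by (auto simp: carrier_free_module)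
  have "((\<lambda>s. p s \<oplus> p' s) \<otimes>\<^bsub>MA\<^esub> q) g =
     (\<Oplus>z\<in>?S \<times> ?T. if fst z \<otimes>\<^bsub>G\<^esub> snd z = g then (p (fst z) \<oplus> p' (fst z)) \<otimes> q (snd z) else \<zero>)"
    using fin by (intro mult_superset assms free_module_closed) auto
  also have "\<dots> = (\<Oplus>z\<in>?S \<times> ?T. (if fst z \<otimes>\<^bsub>G\<^esub> snd z = g then p (fst z) \<otimes> q (snd z) else \<zero>) \<oplus>
     (if fst z \<otimes>\<^bsub>G\<^esub> snd z = g then p' (fst z) \<otimes> q (snd z) else \<zero>))"
    using c by (intro add.finprod_cong') (auto simp: l_distr)
  also have "\<dots> = (\<Oplus>z\<in>?S \<times> ?T. (if fst z \<otimes>\<^bsub>G\<^esub> snd z = g then p (fst z) \<otimes> q (snd z) else \<zero>)) \<oplus>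
     (\<Oplus>z\<in>?S \<times> ?T. (if fst z \<otimes>\<^bsub>G\<^esub> snd z = g then p' (fst z) \<otimes> q (snd z) else \<zero>))"
    using c fin by (intro finsum_addf) auto
  also have "(\<Oplus>z\<in>?S \<times> ?T. (if fst z \<otimes>\<^bsub>G\<^esub> snd z = g then p (fst z) \<otimes> q (snd z) else \<zero>)) = (p \<otimes>\<^bsub>MA\<^esub> q) g"
    using fin by (intro mult_superset[symmetric] assms) auto
  also have "(\<Oplus>z\<in>?S \<times> ?T. (if fst z \<otimes>\<^bsub>G\<^esub> snd z = g then p' (fst z) \<otimes> q (snd z) else \<zero>)) = (p' \<otimes>\<^bsub>MA\<^esub> q) g"
    using fin by (intro mult_superset[symmetric] assms) auto
  finally show "((\<lambda>s. p s \<oplus> p' s) \<otimes>\<^bsub>MA\<^esub> q) g = (p \<otimes>\<^bsub>MA\<^esub> q) g \<oplus> (p' \<otimes>\<^bsub>MA\<^esub> q) g" .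
qed

lemma mult_smult_left:
  assumes "p \<in> C" "q \<in> C" "a \<in> carrier R"
  shows "(\<lambda>s. a \<otimes> p s) \<otimes>\<^bsub>MA\<^esub> q = (\<lambda>s. a \<otimes> (p \<otimes>\<^bsub>MA\<^esub> q) s)"
proof
  fix g
  let ?S = "{s. p s \<noteq> \<zero>}" and ?T = "{s. q s \<noteq> \<zero>}"
  have fin: "finite ?S" "finite ?T" using assms by (auto simp: carrier_free_module)
  have c: "p s \<in> carrier R" "q s \<in> carrier R" for s
    using assms by (auto simp: carrier_free_module)
  have "((\<lambda>s. a \<otimes> p s) \<otimes>\<^bsub>MA\<^esub> q) g =
     (\<Oplus>z\<in>?S \<times> ?T. if fst z \<otimes>\<^bsub>G\<^esub> snd z = g then (a \<otimes> p (fst z)) \<otimes> q (snd z) else \<zero>)"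
    using fin assms by (intro mult_superset free_module_closed) auto
  also have "\<dots> = (\<Oplus>z\<in>?S \<times> ?T. a \<otimes> (if fst z \<otimes>\<^bsub>G\<^esub> snd z = g then p (fst z) \<otimes> q (snd z) else \<zero>))"
    using c assms by (intro add.finprod_cong') (auto simp: m_assoc)
  also have "\<dots> = a \<otimes> (\<Oplus>z\<in>?S \<times> ?T. (if fst z \<otimes>\<^bsub>G\<^esub> snd z = g then p (fst z) \<otimes> q (snd z) else \<zero>))"
    using c fin assms by (intro finsum_rdistr[symmetric]) auto
  also have "(\<Oplus>z\<in>?S \<times> ?T. (if fst z \<otimes>\<^bsub>G\<^esub> snd z = g then p (fst z) \<otimes> q (snd z) else \<zero>)) = (p \<otimes>\<^bsub>MA\<^esub> q) g"
    using fin by (intro mult_superset[symmetric] assms) auto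
  finally show "((\<lambda>s. a \<otimes> p s) \<otimes>\<^bsub>MA\<^esub> q) g = a \<otimes> (p \<otimes>\<^bsub>MA\<^esub> q) g" .
qed

lemma mult_zero_left: "(\<lambda>s. \<zero>) \<otimes>\<^bsub>MA\<^esub> q = (\<lambda>s. \<zero>)"
  by (simp add: monoid_algebra_mult)

lemma mult_commute:
  assumes "p \<in> C" "q \<in> C"
  shows "p \<otimes>\<^bsub>MA\<^esub> q = q \<otimes>\<^bsub>MA\<^esub> p"
proof
  fix g
  let ?P = "{(h, k). p h \<noteq> \<zero> \<and> q k \<noteq> \<zero> \<and> h \<otimes>\<^bsub>G\<^esub> k = g}"
  have c: "p s \<in> carrier R" "q s \<in> carrier R" for s
    using assms by (auto simp: carrier_free_module)
  have g: "s \<in> carrier G" if "p s \<noteq> \<zero> \<or> q s \<noteq> \<zero>" for s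
    using assms that by (auto simp: carrier_free_module)
  have "(q \<otimes>\<^bsub>MA\<^esub> p) g = (\<Oplus>z\<in>prod.swap ` ?P. q (fst z) \<otimes> p (snd z))"
    unfolding monoid_algebra_mult
    by (intro add.finprod_cong') (use c in \<open>auto simp: image_iff G.m_comm g\<close>)
  also have "\<dots> = (\<Oplus>z\<in>?P. q (snd z) \<otimes> p (fst z))"
    using c by (subst finsum_reindex) (auto simp: prod.swap_def)
  also have "\<dots> = (p \<otimes>\<^bsub>MA\<^esub> q) g"
    unfolding monoid_algebra_mult
    by (intro add.finprod_cong') (use c in \<open>auto simp: m_comm\<close>)
  finally show "(p \<otimes>\<^bsub>MA\<^esub> q) g = (q \<otimes>\<^bsub>MA\<^esub> p) g" by simp
qed

lemma mult_basis:
  assumes "s \<in> carrier G" "t \<in> carrier G"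
  shows "basis_elt R s \<otimes>\<^bsub>MA\<^esub> basis_elt R t = basis_elt R (s \<otimes>\<^bsub>G\<^esub> t)"
proof
  fix g
  have "(basis_elt R s \<otimes>\<^bsub>MA\<^esub> basis_elt R t) g = (\<Oplus>z\<in>{s} \<times> {t}.
     if fst z \<otimes>\<^bsub>G\<^esub> snd z = g then basis_elt R s (fst z) \<otimes> basis_elt R t (snd z) else \<zero>)"
    using assms by (intro mult_superset free_module_closed) (auto simp: basis_elt_def)
  then show "(basis_elt R s \<otimes>\<^bsub>MA\<^esub> basis_elt R t) g = basis_elt R (s \<otimes>\<^bsub>G\<^esub> t) g"
    by (auto simp: basis_elt_def)
qed

lemma mult_closed:
  assumes "p \<in> C" "q \<in> C"
  shows "p \<otimes>\<^bsub>MA\<^esub> q \<in> C"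
  using assms(1)
proof (induction rule: free_module_induct)
  case zero
  then show ?case by (simp add: mult_zero_left free_module_closed)
next
  case (basis a s p)
  have "basis_elt R s \<otimes>\<^bsub>MA\<^esub> q \<in> C" using assms(2)
  proof (induction rule: free_module_induct)
    case zero
    then show ?case using basis
      by (subst mult_commute) (auto simp: mult_zero_left free_module_closed)
  next
    case b: (basis b t q)
    then show ?case using basis
      by (subst mult_commute)
        (auto simp: mult_add_left mult_smult_left mult_basis G.m_comm free_module_closed mult_commute[of q])
  qed
  with basis show ?case
    by (simp add: mult_add_left mult_smult_left free_module_closed assms)
qed

lemma mult_assoc:
  assumes "p \<in> C" "q \<in> C" "r \<in> C"
  shows "(p \<otimes>\<^bsub>MA\<^esub> q) \<otimes>\<^bsub>MA\<^esub> r = p \<otimes>\<^bsub>MA\<^esub> (q \<otimes>\<^bsub>MA\<^esub> r)"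
proof -
  note cl = mult_closed free_module_closed assms(2,3)
  have add_right: "x \<otimes>\<^bsub>MA\<^esub> (\<lambda>s. y s \<oplus> z s) = (\<lambda>s. (x \<otimes>\<^bsub>MA\<^esub> y) s \<oplus> (x \<otimes>\<^bsub>MA\<^esub> z) s)"
    if "x \<in> C" "y \<in> C" "z \<in> C" for x y z
    using that by (simp add: mult_commute[of x] free_module_closed mult_add_left)
  have smult_right: "x \<otimes>\<^bsub>MA\<^esub> (\<lambda>s. a \<otimes> y s) = (\<lambda>s. a \<otimes> (x \<otimes>\<^bsub>MA\<^esub> y) s)"
    if "x \<in> C" "y \<in> C" "a \<in> carrier R" for x y a
    using that by (simp add: mult_commute[of x] free_module_closed mult_smult_left)
  have zero_right: "x \<otimes>\<^bsub>MA\<^esub> (\<lambda>s. \<zero>) = (\<lambda>s. \<zero>)" if "x \<in> C" for x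
    using that by (simp add: mult_commute[of x] free_module_closed mult_zero_left)
  have 1: "(basis_elt R s \<otimes>\<^bsub>MA\<^esub> basis_elt R t) \<otimes>\<^bsub>MA\<^esub> r = basis_elt R s \<otimes>\<^bsub>MA\<^esub> (basis_elt R t \<otimes>\<^bsub>MA\<^esub> r)"
    if st: "s \<in> carrier G" "t \<in> carrier G" for s t
    using assms(3)
  proof (induction rule: free_module_induct)
    case zero
    show ?case using st by (simp add: zero_right cl)
  next
    case (basis b u r)
    then show ?case using st
      by (simp add: add_right smult_right cl mult_basis G.m_assoc)
  qed
  have 2: "(basis_elt R s \<otimes>\<^bsub>MA\<^esub> q) \<otimes>\<^bsub>MA\<^esub> r = basis_elt R s \<otimes>\<^bsub>MA\<^esub> (q \<otimes>\<^bsub>MA\<^esub> r)"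
    if s: "s \<in> carrier G" for s
    using assms(2)
  proof (induction rule: free_module_induct)
    case zero
    show ?case using s by (simp add: zero_right mult_zero_left cl)
  next
    case (basis b t q)
    then show ?case using s 1[of s t]
      by (simp add: add_right smult_right mult_add_left mult_smult_left cl)
  qed
  show ?thesis using assms(1)
  proof (induction rule: free_module_induct)
    case zero
    show ?case by (simp add: mult_zero_left)
  next
    case (basis b s p)
    then show ?case using 2[of s]
      by (simp add: mult_add_left mult_smult_left cl)
  qed
qed

lemma mult_one_left:
  assumes "p \<in> C"
  shows "basis_elt R \<one>\<^bsub>G\<^esub> \<otimes>\<^bsub>MA\<^esub> p = p"
proof -
  have "p \<otimes>\<^bsub>MA\<^esub> basis_elt R \<one>\<^bsub>G\<^esub> = p" using assms
    by (induction rule: free_module_induct)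
      (simp_all add: mult_zero_left mult_add_left mult_smult_left free_module_closed mult_basis)
  then show ?thesis using assms by (simp add: mult_commute[of p] free_module_closed)
qed

lemma MA_algebra: "algebra R MA"
proof -
  interpret F: module R "free_module R (carrier G)" by (rule free_module_module)
  have ag: "abelian_group MA"
  proof (rule abelian_groupI)
    fix p assume "p \<in> carrier MA"
    then have "p \<in> C" by simp
    then show "\<exists>y\<in>carrier MA. y \<oplus>\<^bsub>MA\<^esub> p = \<zero>\<^bsub>MA\<^esub>"
      using F.M.l_neg[of p] F.M.a_inv_closed[of p] by auto
  qed (auto simp: free_module_closed free_moduleD a_ac)
  show ?thesis
  proof (rule algebraI)
    show "cring R" by (rule is_cring)
    show "cring MA"
    proof (rule cringI[OF ag])
      show "Group.comm_monoid MA"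
        by (rule comm_monoidI)
          (auto simp: free_module_closed mult_closed mult_one_left mult_assoc intro: mult_commute)
    qed (auto simp: mult_add_left)
  qed (auto simp: free_module_closed free_moduleD l_distr r_distr m_assoc mult_smult_left)
qed

lemma MA_eval:
  assumes B: "algebra R B" and f: "f \<in> hom G B" and f1: "f \<one>\<^bsub>G\<^esub> = \<one>\<^bsub>B\<^esub>"
  shows "lin_ext B f \<in> alg_hom R MA B" (is ?th1)
    and "\<And>s. s \<in> carrier G \<Longrightarrow> lin_ext B f (basis_elt R s) = f s"
proof -
  interpret BC: cring B by (rule algebra.M_cring[OF B])
  interpret B: algebra R B by fact
  have f': "f \<in> carrier G \<rightarrow> carrier B" using f by (simp add: hom_def)
  show b: "lin_ext B f (basis_elt R s) = f s" if "s \<in> carrier G" for s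
    using B.lin_ext_basis[OF f' that] .
  let ?h = "lin_ext B f"
  have mh: "?h \<in> mod_hom R (free_module R (carrier G)) B" using B.lin_ext_hom[OF f'] .
  have cl: "?h p \<in> carrier B" if "p \<in> C" for p using mh that by (auto simp: mod_hom_def)
  have add: "?h (\<lambda>s. p s \<oplus> q s) = ?h p \<oplus>\<^bsub>B\<^esub> ?h q" if "p \<in> C" "q \<in> C" for p q
    using mh that by (simp add: mod_hom_def)
  have sm: "?h (\<lambda>s. a \<otimes> p s) = a \<odot>\<^bsub>B\<^esub> ?h p" if "p \<in> C" "a \<in> carrier R" for p a
    using mh that by (simp add: mod_hom_def)
  have z: "?h (\<lambda>s. \<zero>) = \<zero>\<^bsub>B\<^esub>"
    unfolding lin_ext_def by simp
  note mcl = mult_closed free_module_closed cl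
  have fc: "f s \<in> carrier B" if "s \<in> carrier G" for s using f' that by auto
  have mult1: "?h (basis_elt R s \<otimes>\<^bsub>MA\<^esub> q) = f s \<otimes>\<^bsub>B\<^esub> ?h q" if s: "s \<in> carrier G" and q: "q \<in> C" for s q
    using q
  proof (induction rule: free_module_induct)
    case zero
    show ?case using s fc[OF s]
      by (subst mult_commute) (simp_all add: free_module_closed mult_zero_left z)
  next
    case (basis b t q)
    have e: "basis_elt R s \<otimes>\<^bsub>MA\<^esub> (\<lambda>u. b \<otimes> basis_elt R t u \<oplus> q u) =
       (\<lambda>u. b \<otimes> basis_elt R (s \<otimes>\<^bsub>G\<^esub> t) u \<oplus> (basis_elt R s \<otimes>\<^bsub>MA\<^esub> q) u)"
      using basis s
      by (subst mult_commute) (simp_all add: mult_add_left mult_smult_left mcl mult_basis G.m_comm mult_commute[of q])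
    have ff: "f (s \<otimes>\<^bsub>G\<^esub> t) = f s \<otimes>\<^bsub>B\<^esub> f t" using f s basis by (simp add: hom_def)
    show ?case unfolding e using basis s fc[of s] fc[of t] ff
      by (simp add: add sm mcl b BC.r_distr B.smult_assoc2 BC.m_comm[of "f s"])
  qed
  have mult: "?h (p \<otimes>\<^bsub>MA\<^esub> q) = ?h p \<otimes>\<^bsub>B\<^esub> ?h q" if p: "p \<in> C" and q: "q \<in> C" for p q
    using p
  proof (induction rule: free_module_induct)
    case zero
    show ?case using q by (simp add: mult_zero_left z mcl)
  next
    case (basis a s p)
    then show ?case using q fc[of s]
      by (simp add: mult_add_left mult_smult_left mcl add sm mult1 b BC.l_distr B.smult_assoc2)
  qed
  have one: "?h (basis_elt R \<one>\<^bsub>G\<^esub>) = \<one>\<^bsub>B\<^esub>"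
  proof -
    have fo: "f \<one>\<^bsub>G\<^esub> = \<one>\<^bsub>B\<^esub>" using f1 .
    then show ?thesis by (simp add: b)
  qed
  show ?th1
    using mh mult one add sm cl by (auto simp: alg_hom_def ring_hom_def mod_hom_def)
qed

lemma MA_hom_unique:
  assumes h: "h \<in> alg_hom R MA B" and h': "h' \<in> alg_hom R MA B"
    and eq: "\<And>s. s \<in> carrier G \<Longrightarrow> h (basis_elt R s) = h' (basis_elt R s)" and p: "p \<in> C"
    and B: "algebra R B"
  shows "h p = h' p"
proof -
  interpret BC: cring B by (rule algebra.M_cring[OF B])
  interpret B: algebra R B by fact
  have z: "g (\<lambda>s. \<zero>) = \<zero>\<^bsub>B\<^esub>" if "g \<in> alg_hom R MA B" for g
  proof -
    have "\<forall>a\<in>carrier R. \<forall>x\<in>C. g (\<lambda>s. a \<otimes> x s) = a \<odot>\<^bsub>B\<^esub> g x" "g \<in> C \<rightarrow> carrier B"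
      using that by (simp_all add: alg_hom_def mod_hom_def)
    from this(1)[THEN bspec, OF zero_closed, THEN bspec, OF free_module_closed(1)]
      and funcset_mem[OF this(2) free_module_closed(1)]
    show ?thesis by simp
  qed
  have lin: "g (\<lambda>t. a \<otimes> basis_elt R s t \<oplus> p t) = a \<odot>\<^bsub>B\<^esub> g (basis_elt R s) \<oplus>\<^bsub>B\<^esub> g p"
    if "g \<in> alg_hom R MA B" "a \<in> carrier R" "s \<in> carrier G" "p \<in> C" for g a s p
    using that by (simp add: alg_hom_def mod_hom_def free_module_closed)
  show ?thesis using p
    by (induction rule: free_module_induct) (simp_all add: z h h' lin eq)
qed

end

subsection \<open>Polynomial algebras\<close>

lemma mset_monoid_simps [simp]:
  "carrier (mset_monoid V) = {m. set_mset m \<subseteq> V}"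
  "m \<otimes>\<^bsub>mset_monoid V\<^esub> m' = m + m'" "\<one>\<^bsub>mset_monoid V\<^esub> = {#}"
  by (simp_all add: mset_monoid_def)

lemma comm_monoid_mset: "comm_monoid (mset_monoid V)"
  by (rule comm_monoidI) (auto simp: ac_simps)

lemma (in cring) mon_alg_mset: "mon_alg R (mset_monoid V)"
  by (intro mon_alg.intro comm_monoid_mset is_cring)

lemma (in comm_monoid) mset_hom:
  assumes g: "g \<in> V \<rightarrow> carrier G"
  shows "(\<lambda>m. \<Otimes>v\<in>set_mset m. g v [^] count m v) \<in> hom (mset_monoid V) G"
proof -
  have sup: "(\<Otimes>v\<in>set_mset m. g v [^] count m v) = (\<Otimes>v\<in>T. g v [^] count m v)"
    if "finite T" "set_mset m \<subseteq> T" "T \<subseteq> V" for m T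
    using that g by (intro finprod_mono_neutral_cong_left) (auto simp: not_in_iff Pi_iff)
  show ?thesis
  proof (rule homI)
    fix m assume "m \<in> carrier (mset_monoid V)"
    then show "(\<Otimes>v\<in>set_mset m. g v [^] count m v) \<in> carrier G"
      using g by (intro finprod_closed) auto
  next
    fix m m' assume mm: "m \<in> carrier (mset_monoid V)" "m' \<in> carrier (mset_monoid V)"
    let ?T = "set_mset m \<union> set_mset m'"
    have "(\<Otimes>v\<in>set_mset (m + m'). g v [^] count (m + m') v)
       = (\<Otimes>v\<in>?T. g v [^] count m v \<otimes> g v [^] count m' v)"
      using mm g by (intro finprod_cong') (auto simp: nat_pow_mult Pi_iff subset_iff)
    also have "\<dots> = (\<Otimes>v\<in>?T. g v [^] count m v) \<otimes> (\<Otimes>v\<in>?T. g v [^] count m' v)"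
      using mm g by (intro finprod_multf) auto
    also have "\<dots> = (\<Otimes>v\<in>set_mset m. g v [^] count m v) \<otimes> (\<Otimes>v\<in>set_mset m'. g v [^] count m' v)"
      using mm sup[of ?T m] sup[of ?T m'] by simp
    finally show "(\<Otimes>v\<in>set_mset (m \<otimes>\<^bsub>mset_monoid V\<^esub> m'). g v [^] count (m \<otimes>\<^bsub>mset_monoid V\<^esub> m') v)
       = (\<Otimes>v\<in>set_mset m. g v [^] count m v) \<otimes> (\<Otimes>v\<in>set_mset m'. g v [^] count m' v)"
      by simp
  qed
qed

context cring
begin

lemma poly_algebra_algebra: "algebra R (poly_algebra R V)"
proof -
  interpret mon_alg R "mset_monoid V" by (rule mon_alg_mset)
  show ?thesis unfolding poly_algebra_def by (rule MA_algebra)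
qed

lemma poly_var_closed: "v \<in> V \<Longrightarrow> poly_var R v \<in> carrier (poly_algebra R V)"
  by (simp add: poly_algebra_def poly_var_def free_module_closed)

lemma poly_algebra_lift:
  assumes B: "algebra R B" and g: "g \<in> V \<rightarrow> carrier B"
  obtains h where "h \<in> alg_hom R (poly_algebra R V) B" "\<And>v. v \<in> V \<Longrightarrow> h (poly_var R v) = g v"
proof -
  interpret BC: cring B by (rule algebra.M_cring[OF B])
  interpret B: algebra R B by fact
  interpret mon_alg R "mset_monoid V" by (rule mon_alg_mset)
  define f where "f = (\<lambda>m. \<Otimes>\<^bsub>B\<^esub>v\<in>set_mset m. g v [^]\<^bsub>B\<^esub> count m v)"
  have f: "f \<in> hom (mset_monoid V) B" unfolding f_def by (rule BC.mset_hom[OF g])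
  have f1: "f \<one>\<^bsub>mset_monoid V\<^esub> = \<one>\<^bsub>B\<^esub>" by (simp add: f_def)
  have fv: "f {#v#} = g v" if "v \<in> V" for v
    using g that by (simp add: f_def Pi_iff)
  show ?thesis
  proof (rule that[of "lin_ext B f"])
    show "lin_ext B f \<in> alg_hom R (poly_algebra R V) B"
      unfolding poly_algebra_def by (rule MA_eval(1)[OF B f f1])
    show "lin_ext B f (poly_var R v) = g v" if "v \<in> V" for v
      using MA_eval(2)[OF B f f1, of "{#v#}"] that by (simp add: poly_var_def fv)
  qed
qed

lemma poly_algebra_hom_unique:
  assumes h: "h \<in> alg_hom R (poly_algebra R V) B" and h': "h' \<in> alg_hom R (poly_algebra R V) B"
    and eq: "\<And>v. v \<in> V \<Longrightarrow> h (poly_var R v) = h' (poly_var R v)"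
    and p: "p \<in> carrier (poly_algebra R V)" and B: "algebra R B"
  shows "h p = h' p"
proof -
  interpret mon_alg R "mset_monoid V" by (rule mon_alg_mset)
  have "h (basis_elt R m) = h' (basis_elt R m)" if "set_mset m \<subseteq> V" for m
    using that
  proof (induction m)
    case empty
    have e: "g (basis_elt R {#}) = \<one>\<^bsub>B\<^esub>" if "g \<in> alg_hom R (poly_algebra R V) B" for g
      using that by (simp add: alg_hom_def poly_algebra_def ring_hom_def)
    show ?case by (simp only: e[OF h] e[OF h'])
  next
    case (add v m)
    have e: "basis_elt R (add_mset v m) = poly_var R v \<otimes>\<^bsub>poly_algebra R V\<^esub> basis_elt R m"
      using add.prems mult_basis[of "{#v#}" m] by (simp add: poly_algebra_def poly_var_def)
    have e': "g (basis_elt R (add_mset v m)) = g (poly_var R v) \<otimes>\<^bsub>B\<^esub> g (basis_elt R m)"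
      if "g \<in> alg_hom R (poly_algebra R V) B" for g
    proof -
      have "basis_elt R m \<in> carrier (poly_algebra R V)" "poly_var R v \<in> carrier (poly_algebra R V)"
        using add.prems by (auto simp: poly_algebra_def poly_var_def intro!: free_module_closed)
      then show ?thesis unfolding e using that by (simp add: alg_hom_def ring_hom_def)
    qed
    show ?case using add eq by (simp add: e'[OF h] e'[OF h'])
  qed
  then show ?thesis
    using MA_hom_unique[OF h[unfolded poly_algebra_def] h'[unfolded poly_algebra_def] _ _ B] p
    by (simp add: poly_algebra_def)
qed

end

subsection \<open>Quotient algebras\<close>

lemma quot_module_simps [simp]:
  "carrier (quot_module M H) = a_rcosets\<^bsub>M\<^esub> H"
  "monoid.mult (quot_module M H) = monoid.mult (M Quot H)"
  "\<one>\<^bsub>quot_module M H\<^esub> = H +>\<^bsub>M\<^esub> \<one>\<^bsub>M\<^esub>"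
  "\<zero>\<^bsub>quot_module M H\<^esub> = H"
  "add (quot_module M H) = add (M Quot H)"
  by (simp_all add: quot_module_def ring.extend_def FactRing_def)


lemma quot_module_smult:
  "a \<odot>\<^bsub>quot_module M H\<^esub> K = (\<Union>x\<in>K. H +>\<^bsub>M\<^esub> (a \<odot>\<^bsub>M\<^esub> x))"
  by (simp add: quot_module_def ring.extend_def module.fields_def)

lemma cring_quot_module_iff: "cring (quot_module M H) \<longleftrightarrow> cring (M Quot H)"
proof -
  have "carrier (M Quot H) = a_rcosets\<^bsub>M\<^esub> H" "\<one>\<^bsub>M Quot H\<^esub> = H +>\<^bsub>M\<^esub> \<one>\<^bsub>M\<^esub>" "\<zero>\<^bsub>M Quot H\<^esub> = H"
    by (simp_all add: FactRing_def)
  then show ?thesis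
    by (simp add: cring_def ring_def abelian_group_def abelian_monoid_def abelian_group_axioms_def
        ring_axioms_def comm_monoid_def comm_group_def group_def monoid_def comm_monoid_axioms_def
        group_axioms_def Units_def)
qed

lemma (in algebra) quot_smult:
  assumes I: "ideal I M" and a: "a \<in> carrier R" and p: "p \<in> carrier M"
  shows "a \<odot>\<^bsub>quot_module M I\<^esub> (I +>\<^bsub>M\<^esub> p) = I +>\<^bsub>M\<^esub> (a \<odot>\<^bsub>M\<^esub> p)"
proof -
  interpret I: ideal I M by fact
  have "I +>\<^bsub>M\<^esub> (a \<odot>\<^bsub>M\<^esub> q) = I +>\<^bsub>M\<^esub> (a \<odot>\<^bsub>M\<^esub> p)" if q: "q \<in> I +>\<^bsub>M\<^esub> p" for q
  proof -
    obtain i where i: "i \<in> I" "q = i \<oplus>\<^bsub>M\<^esub> p"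
      using q by (auto simp: a_r_coset_def')
    have "a \<odot>\<^bsub>M\<^esub> i = (a \<odot>\<^bsub>M\<^esub> \<one>\<^bsub>M\<^esub>) \<otimes>\<^bsub>M\<^esub> i"
      using i a by (simp add: smult_assoc2)
    then have ai: "a \<odot>\<^bsub>M\<^esub> i \<in> I" using i a by (simp add: I.I_l_closed)
    then have "a \<odot>\<^bsub>M\<^esub> q \<in> I +>\<^bsub>M\<^esub> (a \<odot>\<^bsub>M\<^esub> p)"
      using i a p by (auto simp: a_r_coset_def' smult_r_distr)
    then show ?thesis using a p by (intro M.a_repr_independence[symmetric] I.a_subgroup) auto
  qed
  moreover have "p \<in> I +>\<^bsub>M\<^esub> p" using p by (rule I.a_rcos_self)
  ultimately show ?thesis unfolding quot_module_smult by blast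
qed

lemma (in algebra) quot_algebra:
  assumes I: "ideal I M"
  shows "algebra R (quot_module M I)"
    and "(\<lambda>p. I +>\<^bsub>M\<^esub> p) \<in> alg_hom R M (quot_module M I)"
proof -
  interpret I: ideal I M by fact
  have MC: "cring M" by (rule M_cring)
  have cr: "cring (quot_module M I)" using I.quotient_is_cring[OF MC] by (simp add: cring_quot_module_iff)
  interpret Q: cring "quot_module M I" by (rule cr)
  have carr: "\<exists>p\<in>carrier M. K = I +>\<^bsub>M\<^esub> p" if "K \<in> carrier (quot_module M I)" for K
    using that by (auto simp: A_RCOSETS_def RCOSETS_def a_r_coset_def)
  have cl: "I +>\<^bsub>M\<^esub> p \<in> carrier (quot_module M I)" if "p \<in> carrier M" for p
    using that M.a_rcosetsI[OF I.a_subset that] by simp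
  have add: "(I +>\<^bsub>M\<^esub> p) \<oplus>\<^bsub>quot_module M I\<^esub> (I +>\<^bsub>M\<^esub> q) = I +>\<^bsub>M\<^esub> (p \<oplus>\<^bsub>M\<^esub> q)"
    if "p \<in> carrier M" "q \<in> carrier M" for p q
    using that by (simp add: FactRing_def I.a_rcos_sum)
  have mul: "(I +>\<^bsub>M\<^esub> p) \<otimes>\<^bsub>quot_module M I\<^esub> (I +>\<^bsub>M\<^esub> q) = I +>\<^bsub>M\<^esub> (p \<otimes>\<^bsub>M\<^esub> q)"
    if "p \<in> carrier M" "q \<in> carrier M" for p q
    using that by (simp add: FactRing_def I.rcoset_mult_add)
  note sm = quot_smult[OF I]
  show "algebra R (quot_module M I)"
  proof (rule algebraI[OF R_cring cr])
    fix a K assume "a \<in> carrier R" "K \<in> carrier (quot_module M I)"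
    then show "a \<odot>\<^bsub>quot_module M I\<^esub> K \<in> carrier (quot_module M I)"
      using carr[of K] cl by (auto simp: sm simp del: quot_module_simps)
  next
    fix a b K assume "a \<in> carrier R" "b \<in> carrier R" "K \<in> carrier (quot_module M I)"
    then show "(a \<oplus> b) \<odot>\<^bsub>quot_module M I\<^esub> K = a \<odot>\<^bsub>quot_module M I\<^esub> K \<oplus>\<^bsub>quot_module M I\<^esub> b \<odot>\<^bsub>quot_module M I\<^esub> K"
      and "(a \<otimes> b) \<odot>\<^bsub>quot_module M I\<^esub> K = a \<odot>\<^bsub>quot_module M I\<^esub> (b \<odot>\<^bsub>quot_module M I\<^esub> K)"
      using carr[of K] by (auto simp: sm add smult_l_distr smult_assoc1 simp del: quot_module_simps)
  next
    fix a K L assume "a \<in> carrier R" "K \<in> carrier (quot_module M I)" "L \<in> carrier (quot_module M I)"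
    then show "a \<odot>\<^bsub>quot_module M I\<^esub> (K \<oplus>\<^bsub>quot_module M I\<^esub> L) = a \<odot>\<^bsub>quot_module M I\<^esub> K \<oplus>\<^bsub>quot_module M I\<^esub> a \<odot>\<^bsub>quot_module M I\<^esub> L"
      and "(a \<odot>\<^bsub>quot_module M I\<^esub> K) \<otimes>\<^bsub>quot_module M I\<^esub> L = a \<odot>\<^bsub>quot_module M I\<^esub> (K \<otimes>\<^bsub>quot_module M I\<^esub> L)"
      using carr[of K] carr[of L]
      by (auto simp: sm add mul smult_r_distr smult_assoc2 simp del: quot_module_simps)
  next
    fix K assume "K \<in> carrier (quot_module M I)"
    then show "\<one> \<odot>\<^bsub>quot_module M I\<^esub> K = K"
      using carr[of K] by (auto simp: sm simp del: quot_module_simps)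
  qed
  show "(\<lambda>p. I +>\<^bsub>M\<^esub> p) \<in> alg_hom R M (quot_module M I)"
    using cl add mul sm quot_module_simps(3)[of M I] unfolding alg_hom_def ring_hom_def mod_hom_def
    by (auto simp del: quot_module_simps)
qed

lemma (in algebra) quot_lift_hom:
  assumes I: "ideal I M" and B: "algebra R B" and h: "h \<in> alg_hom R M B"
    and ker: "\<And>p. p \<in> I \<Longrightarrow> h p = \<zero>\<^bsub>B\<^esub>"
  shows "quot_lift h \<in> alg_hom R (quot_module M I) B"
    and "\<And>p. p \<in> carrier M \<Longrightarrow> quot_lift h (I +>\<^bsub>M\<^esub> p) = h p"
proof -
  interpret I: ideal I M by fact
  interpret BC: cring B by (rule algebra.M_cring[OF B])
  interpret B: algebra R B by fact
  show q: "quot_lift h (I +>\<^bsub>M\<^esub> p) = h p" if p: "p \<in> carrier M" for p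
  proof -
    have "h (i \<oplus>\<^bsub>M\<^esub> p) = h p" if "i \<in> I" for i
    proof -
      have "i \<in> carrier M" using that I.a_subset by auto
      then have "h (i \<oplus>\<^bsub>M\<^esub> p) = h i \<oplus>\<^bsub>B\<^esub> h p" using h p by (simp add: alg_hom_def ring_hom_def)
      then show ?thesis using ker[OF that] h p by (auto simp: alg_hom_def ring_hom_def Pi_iff)
    qed
    then have "h ` (I +>\<^bsub>M\<^esub> p) = {h p}"
      using I.a_rcos_self[OF p] by (auto simp: a_r_coset_def')
    then show ?thesis by (simp add: quot_lift_def)
  qed
  have carr: "\<exists>p\<in>carrier M. K = I +>\<^bsub>M\<^esub> p" if "K \<in> carrier (quot_module M I)" for K
    using that by (auto simp: A_RCOSETS_def RCOSETS_def a_r_coset_def)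
  have pr: "(\<lambda>p. I +>\<^bsub>M\<^esub> p) \<in> alg_hom R M (quot_module M I)" by (rule quot_algebra(2)[OF I])
  have add: "(I +>\<^bsub>M\<^esub> p) \<oplus>\<^bsub>quot_module M I\<^esub> (I +>\<^bsub>M\<^esub> q) = I +>\<^bsub>M\<^esub> (p \<oplus>\<^bsub>M\<^esub> q)"
    and mul: "(I +>\<^bsub>M\<^esub> p) \<otimes>\<^bsub>quot_module M I\<^esub> (I +>\<^bsub>M\<^esub> q) = I +>\<^bsub>M\<^esub> (p \<otimes>\<^bsub>M\<^esub> q)"
    if "p \<in> carrier M" "q \<in> carrier M" for p q
    using pr that by (simp_all add: alg_hom_def ring_hom_def del: quot_module_simps)
  note sm = quot_smult[OF I]
  have H: "\<And>p. p \<in> carrier M \<Longrightarrow> h p \<in> carrier B" 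
    "\<And>p r. p \<in> carrier M \<Longrightarrow> r \<in> carrier M \<Longrightarrow> h (p \<oplus>\<^bsub>M\<^esub> r) = h p \<oplus>\<^bsub>B\<^esub> h r"
    "\<And>p r. p \<in> carrier M \<Longrightarrow> r \<in> carrier M \<Longrightarrow> h (p \<otimes>\<^bsub>M\<^esub> r) = h p \<otimes>\<^bsub>B\<^esub> h r"
    "\<And>a p. a \<in> carrier R \<Longrightarrow> p \<in> carrier M \<Longrightarrow> h (a \<odot>\<^bsub>M\<^esub> p) = a \<odot>\<^bsub>B\<^esub> h p"
    "h \<one>\<^bsub>M\<^esub> = \<one>\<^bsub>B\<^esub>"
    using h by (auto simp: alg_hom_def ring_hom_def mod_hom_def)
  have one: "\<one>\<^bsub>quot_module M I\<^esub> = I +>\<^bsub>M\<^esub> \<one>\<^bsub>M\<^esub>" by simp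
  show "quot_lift h \<in> alg_hom R (quot_module M I) B"
    unfolding alg_hom_def ring_hom_def mod_hom_def
    by (auto simp: add mul sm q H one dest!: carr simp del: quot_module_simps)
qed

subsection \<open>Naturality of power series substitution\<close>

lemma power_series_ring_simps [simp]:
  "p \<in> carrier (power_series_ring R) \<longleftrightarrow> (\<forall>m. p m \<in> carrier R)"
  "\<one>\<^bsub>power_series_ring R\<^esub> = (\<lambda>m. if m = {#} then \<one>\<^bsub>R\<^esub> else \<zero>\<^bsub>R\<^esub>)"
  "p \<otimes>\<^bsub>power_series_ring R\<^esub> q = (\<lambda>m. \<Oplus>\<^bsub>R\<^esub>k\<in>{k. k \<subseteq># m}. p k \<otimes>\<^bsub>R\<^esub> q (m - k))"
  by (simp_all add: power_series_ring_def)

lemma finite_submultisets: "finite {k. k \<subseteq># m}"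
proof (induction m)
  case (add x m)
  have sub: "{k. k \<subseteq># add_mset x m} \<subseteq> {k. k \<subseteq># m} \<union> add_mset x ` {k. k \<subseteq># m}"
  proof
    fix k assume k: "k \<in> {k. k \<subseteq># add_mset x m}"
    show "k \<in> {k. k \<subseteq># m} \<union> add_mset x ` {k. k \<subseteq># m}"
    proof (cases "x \<in># k")
      case True
      then obtain k' where "k = add_mset x k'" by (meson multi_member_split)
      then show ?thesis using k by auto
    next
      case False
      then show ?thesis using k subset_eq_diff_conv[of k "{#x#}" m] by (simp add: diff_single_trivial)
    qed
  qed
  show ?case by (rule finite_subset[OF sub]) (use add in auto)
qed simp

lemma set_image1: "(\<And>a. P a \<Longrightarrow> f a = h (g a)) \<Longrightarrow> {f a | a. P a} = h ` {g a | a. P a}"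
  by force

lemma set_image2: "(\<And>a b. P a b \<Longrightarrow> f a b = h (g a b)) \<Longrightarrow> {f a b | a b. P a b} = h ` {g a b | a b. P a b}"
  by force

lemma set_eq1: "(\<And>a. P a \<Longrightarrow> f a = g a) \<Longrightarrow> {f a | a. P a} = {g a | a. P a}"
  by metis

lemma set_eq2: "(\<And>a b. P a b \<Longrightarrow> f a b = g a b) \<Longrightarrow> {f a b | a b. P a b} = {g a b | a b. P a b}"
  by metis

lemma pow_power_series:
  "p [^]\<^bsub>S\<^esub> (0::nat) = \<one>\<^bsub>S\<^esub>" "p [^]\<^bsub>S\<^esub> (Suc n) = p [^]\<^bsub>S\<^esub> n \<otimes>\<^bsub>S\<^esub> p"
  by (simp_all add: nat_pow_def)

context cring
begin

abbreviation "PS \<equiv> power_series_ring R"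

lemma ps_mult_closed: "p \<in> carrier PS \<Longrightarrow> q \<in> carrier PS \<Longrightarrow> p \<otimes>\<^bsub>PS\<^esub> q \<in> carrier PS"
  by (simp add: finsum_closed)

lemma ps_pow_closed: "p \<in> carrier PS \<Longrightarrow> p [^]\<^bsub>PS\<^esub> (n::nat) \<in> carrier PS"
proof (induction n)
  case 0
  then show ?case by (simp add: pow_power_series)
next
  case (Suc n)
  then show ?case unfolding pow_power_series by (intro ps_mult_closed) auto
qed

lemma ps_subst1_closed: "\<lbrakk>\<And>i. f i \<in> carrier R; p \<in> carrier PS\<rbrakk> \<Longrightarrow> ps_subst1 R f p \<in> carrier PS"
  using ps_pow_closed[of p] by (simp add: ps_subst1_def finsum_closed)

lemma ps_subst2_closed:
  assumes "\<And>i j. F i j \<in> carrier R" "p \<in> carrier PS" "q \<in> carrier PS"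
  shows "ps_subst2 R F p q \<in> carrier PS"
proof -
  have "p [^]\<^bsub>PS\<^esub> i \<otimes>\<^bsub>PS\<^esub> q [^]\<^bsub>PS\<^esub> j \<in> carrier PS" for i j :: nat
    using assms by (intro ps_mult_closed ps_pow_closed)
  then show ?thesis using assms unfolding ps_subst2_def
    by (auto simp del: power_series_ring_simps(3) intro!: finsum_closed)
qed

lemma ps_var_closed: "ps_var R v \<in> carrier PS"
  by (simp add: ps_var_def)

end

context ring_hom_cring
begin

lemma ps_mult_nat:
  assumes "p \<in> carrier (power_series_ring R)" "q \<in> carrier (power_series_ring R)"
  shows "h \<circ> (p \<otimes>\<^bsub>power_series_ring R\<^esub> q) = (h \<circ> p) \<otimes>\<^bsub>power_series_ring S\<^esub> (h \<circ> q)"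
  using assms by (auto simp: fun_eq_iff hom_finsum intro!: S.add.finprod_cong')

lemma ps_pow_nat:
  assumes "p \<in> carrier (power_series_ring R)"
  shows "h \<circ> (p [^]\<^bsub>power_series_ring R\<^esub> (n::nat)) = (h \<circ> p) [^]\<^bsub>power_series_ring S\<^esub> n"
proof (induction n)
  case 0
  then show ?case by (auto simp: pow_power_series)
next
  case (Suc n)
  then show ?case unfolding pow_power_series using assms
    by (simp only: ps_mult_nat R.ps_pow_closed)
qed

lemma ps_subst1_nat:
  assumes "\<And>i. f i \<in> carrier R" "p \<in> carrier (power_series_ring R)"
  shows "h \<circ> ps_subst1 R f p = ps_subst1 S (h \<circ> f) (h \<circ> p)"
proof
  fix m
  have c: "(p [^]\<^bsub>power_series_ring R\<^esub> i) m \<in> carrier R" for i :: nat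
    using R.ps_pow_closed[OF assms(2)] by simp
  have e: "h ((p [^]\<^bsub>power_series_ring R\<^esub> i) m) = ((h \<circ> p) [^]\<^bsub>power_series_ring S\<^esub> i) m" for i :: nat
    using ps_pow_nat[OF assms(2)] by (metis comp_apply)
  have "h (ps_subst1 R f p m) = (\<Oplus>\<^bsub>S\<^esub>i\<in>{..size m}. h (f i \<otimes> (p [^]\<^bsub>power_series_ring R\<^esub> i) m))"
    unfolding ps_subst1_def using assms(1) c by (subst hom_finsum) (auto simp: comp_def)
  also have "\<dots> = ps_subst1 S (h \<circ> f) (h \<circ> p) m"
    unfolding ps_subst1_def using assms(1) c by (intro S.add.finprod_cong') (auto simp: e[symmetric])
  finally show "(h \<circ> ps_subst1 R f p) m = ps_subst1 S (h \<circ> f) (h \<circ> p) m" by simp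
qed

lemma ps_subst2_nat:
  assumes "\<And>i j. F i j \<in> carrier R" "p \<in> carrier (power_series_ring R)" "q \<in> carrier (power_series_ring R)"
  shows "h \<circ> ps_subst2 R F p q = ps_subst2 S (\<lambda>i j. h (F i j)) (h \<circ> p) (h \<circ> q)"
proof
  fix m
  let ?M = "\<lambda>i j. p [^]\<^bsub>power_series_ring R\<^esub> i \<otimes>\<^bsub>power_series_ring R\<^esub> q [^]\<^bsub>power_series_ring R\<^esub> j"
  have c: "?M i j m \<in> carrier R" for i j :: nat
    using R.ps_mult_closed[OF R.ps_pow_closed[OF assms(2), of i] R.ps_pow_closed[OF assms(3), of j]]
    by (simp del: power_series_ring_simps(3))
  have e: "h (?M i j m) = ((h \<circ> p) [^]\<^bsub>power_series_ring S\<^esub> i \<otimes>\<^bsub>power_series_ring S\<^esub> (h \<circ> q) [^]\<^bsub>power_series_ring S\<^esub> j) m"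
    for i j :: nat
    using ps_mult_nat[OF R.ps_pow_closed[OF assms(2), of i] R.ps_pow_closed[OF assms(3), of j]]
    unfolding ps_pow_nat[OF assms(2)] ps_pow_nat[OF assms(3)] by (metis comp_apply)
  have "h (ps_subst2 R F p q m) = finsum S (\<lambda>z. h (F (fst z) (snd z) \<otimes> ?M (fst z) (snd z) m)) ({..size m} \<times> {..size m})"
    unfolding ps_subst2_def case_prod_beta using assms(1) c
    by (subst hom_finsum) (auto simp: comp_def simp del: power_series_ring_simps(3))
  also have "\<dots> = ps_subst2 S (\<lambda>i j. h (F i j)) (h \<circ> p) (h \<circ> q) m"
    unfolding ps_subst2_def case_prod_beta using assms(1) c
    by (intro S.add.finprod_cong') (auto simp: e[symmetric] simp del: power_series_ring_simps(3))
  finally show "(h \<circ> ps_subst2 R F p q) m = ps_subst2 S (\<lambda>i j. h (F i j)) (h \<circ> p) (h \<circ> q) m" by simp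
qed

lemma ps_var_nat: "h \<circ> ps_var R v = ps_var S v"
  by (auto simp: ps_var_def)

lemma formal_module_equations_nat:
  assumes A: "cring A" and F: "\<And>i j. F i j \<in> carrier R" and \<rho>: "\<And>a i. a \<in> carrier A \<Longrightarrow> \<rho> a i \<in> carrier R"
  shows "formal_module_equations A S (\<lambda>i j. h (F i j)) (\<lambda>a i. h (\<rho> a i)) =
    (\<lambda>(p, q). (h \<circ> p, h \<circ> q)) ` formal_module_equations A R F \<rho>"
    and "\<And>p q. (p, q) \<in> formal_module_equations A R F \<rho> \<Longrightarrow>
      p \<in> carrier (power_series_ring R) \<and> q \<in> carrier (power_series_ring R)"
proof -
  interpret A: cring A by fact
  note cl = R.ps_subst1_closed R.ps_subst2_closed R.ps_var_closed F \<rho>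
  have s1: "h \<circ> ps_subst1 R (\<rho> a) p = ps_subst1 S (\<lambda>i. h (\<rho> a i)) (h \<circ> p)"
    if "a \<in> carrier A" "p \<in> carrier (power_series_ring R)" for a p
    using ps_subst1_nat[of "\<rho> a" p] that \<rho> by (simp add: comp_def del: power_series_ring_simps)
  note nat = s1 ps_subst2_nat[OF F] ps_var_nat
  show "formal_module_equations A S (\<lambda>i j. h (F i j)) (\<lambda>a i. h (\<rho> a i)) =
    (\<lambda>(p, q). (h \<circ> p, h \<circ> q)) ` formal_module_equations A R F \<rho>"
    unfolding formal_module_equations_def Let_def image_Un image_insert image_empty
    by (intro arg_cong2[of _ _ _ _ "(\<union>)"] arg_cong2[of _ _ _ _ insert] set_image1 set_image2 refl)
      (simp_all add: nat cl del: power_series_ring_simps)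
  show "p \<in> carrier (power_series_ring R) \<and> q \<in> carrier (power_series_ring R)"
    if "(p, q) \<in> formal_module_equations A R F \<rho>" for p q
    using that unfolding formal_module_equations_def Let_def
    by (auto simp del: power_series_ring_simps simp: cl)
qed

end


lemma alg_hom_ring_hom_cring:
  assumes "algebra A B" "algebra A C" "h \<in> alg_hom A B C"
  shows "ring_hom_cring B C h"
  proof -
  interpret B: cring B by (rule algebra.M_cring[OF assms(1)])
  interpret C: cring C by (rule algebra.M_cring[OF assms(2)])
  show ?thesis using assms(3)
    by (intro ring_hom_cringI ring_hom_ringI2 B.is_cring C.is_cring B.ring_axioms C.ring_axioms)
      (simp add: alg_hom_def)
qed

lemma (in ring_hom_cring) hom_minus:
  "x \<in> carrier R \<Longrightarrow> y \<in> carrier R \<Longrightarrow> h (x \<ominus>\<^bsub>R\<^esub> y) = h x \<ominus>\<^bsub>S\<^esub> h y"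
  by (simp add: a_minus_def)

context cring
begin

abbreviation "LP \<equiv> lazard_poly_algebra R"

lemma lazard_poly_algebra_algebra: "algebra R LP"
  unfolding lazard_poly_algebra_def by (rule poly_algebra_algebra)

lemma generic_closed:
  "generic_F R i j \<in> carrier LP"
  "a \<in> carrier R \<Longrightarrow> generic_rho R a i \<in> carrier LP"
proof -
  interpret LC: cring LP by (rule algebra.M_cring[OF lazard_poly_algebra_algebra])
  interpret L: algebra R LP by (rule lazard_poly_algebra_algebra)
  show "generic_F R i j \<in> carrier LP"
    using LC.one_closed LC.zero_closed unfolding generic_F_def lazard_poly_algebra_def
    by (auto intro!: poly_var_closed simp: lazard_gens_def)
  show "a \<in> carrier R \<Longrightarrow> generic_rho R a i \<in> carrier LP"
    using LC.zero_closed L.smult_closed[OF _ LC.one_closed, of a] unfolding generic_rho_def lazard_poly_algebra_def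
    by (auto intro!: poly_var_closed simp: lazard_gens_def)
qed

lemma generic_normalized:
  "generic_F R i 0 = (if i = 1 then \<one>\<^bsub>LP\<^esub> else \<zero>\<^bsub>LP\<^esub>)"
  "generic_F R 0 i = (if i = 1 then \<one>\<^bsub>LP\<^esub> else \<zero>\<^bsub>LP\<^esub>)"
  "generic_rho R a 0 = \<zero>\<^bsub>LP\<^esub>" "generic_rho R a 1 = a \<odot>\<^bsub>LP\<^esub> \<one>\<^bsub>LP\<^esub>"
  by (simp_all add: generic_F_def generic_rho_def)

definition lazard_relations where
  "lazard_relations = {p m \<ominus>\<^bsub>LP\<^esub> q m | p q m.
     (p, q) \<in> formal_module_equations R LP (generic_F R) (generic_rho R)}"

lemma lazard_equations_closed:
  assumes "(p, q) \<in> formal_module_equations R LP (generic_F R) (generic_rho R)"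
  shows "p m \<in> carrier LP" "q m \<in> carrier LP"
proof -
  interpret LC: cring LP by (rule algebra.M_cring[OF lazard_poly_algebra_algebra])
  interpret I: ring_hom_cring LP LP id
    by (intro ring_hom_cringI ring_hom_ringI2 LC.is_cring LC.ring_axioms) (simp add: ring_hom_def)
  show "p m \<in> carrier LP" "q m \<in> carrier LP"
    using I.formal_module_equations_nat(2)[OF is_cring _ _ assms] generic_closed by auto
qed

lemma lazard_relations_closed: "lazard_relations \<subseteq> carrier LP"
proof -
  interpret LC: cring LP by (rule algebra.M_cring[OF lazard_poly_algebra_algebra])
  show ?thesis using lazard_equations_closed by (auto simp: lazard_relations_def)
qed

lemma lazard_ideal_ideal: "ideal (lazard_ideal R) LP"
proof -
  interpret LC: cring LP by (rule algebra.M_cring[OF lazard_poly_algebra_algebra])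
  show ?thesis
    using LC.genideal_ideal[OF lazard_relations_closed] by (simp add: lazard_ideal_def lazard_relations_def)
qed

lemma formal_module_push:
  assumes B: "algebra R B" and h: "h \<in> alg_hom R LP B"
  shows "formal_module R B (\<lambda>i j. h (generic_F R i j)) (\<lambda>a i. h (generic_rho R a i)) \<longleftrightarrow>
     (\<forall>x\<in>lazard_relations. h x = \<zero>\<^bsub>B\<^esub>)"
proof -
  interpret LC: cring LP by (rule algebra.M_cring[OF lazard_poly_algebra_algebra])
  interpret L: algebra R LP by (rule lazard_poly_algebra_algebra)
  interpret BC: cring B by (rule algebra.M_cring[OF B])
  interpret h: ring_hom_cring LP B h
    by (rule alg_hom_ring_hom_cring[OF lazard_poly_algebra_algebra B h])
  have sm: "h (a \<odot>\<^bsub>LP\<^esub> \<one>\<^bsub>LP\<^esub>) = a \<odot>\<^bsub>B\<^esub> \<one>\<^bsub>B\<^esub>" if "a \<in> carrier R" for a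
    using h that by (simp add: alg_hom_def mod_hom_def)
  note eqs = h.formal_module_equations_nat[OF is_cring, of "generic_F R" "generic_rho R", OF generic_closed]
  let ?E = "formal_module_equations R LP (generic_F R) (generic_rho R)"
  have "formal_module R B (\<lambda>i j. h (generic_F R i j)) (\<lambda>a i. h (generic_rho R a i)) \<longleftrightarrow>
     (\<forall>(p, q)\<in>?E. h \<circ> p = h \<circ> q)"
    unfolding formal_module_def using generic_closed
    by (simp add: eqs(1) generic_normalized sm split_beta del: One_nat_def) 
  also have "\<dots> \<longleftrightarrow> (\<forall>(p, q)\<in>?E. \<forall>m. h (p m \<ominus>\<^bsub>LP\<^esub> q m) = \<zero>\<^bsub>B\<^esub>)"
  proof -
    have "h (p m \<ominus>\<^bsub>LP\<^esub> q m) = \<zero>\<^bsub>B\<^esub> \<longleftrightarrow> h (p m) = h (q m)" if "(p, q) \<in> ?E" for p q m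
      using lazard_equations_closed[OF that, of m]
      by (simp add: h.hom_minus BC.r_right_minus_eq)
    then show ?thesis by (fastforce simp: fun_eq_iff)
  qed
  also have "\<dots> \<longleftrightarrow> (\<forall>x\<in>lazard_relations. h x = \<zero>\<^bsub>B\<^esub>)"
    by (fastforce simp: lazard_relations_def)
  finally show ?thesis .
qed

lemma lazard_class_hom: "lazard_class R \<in> alg_hom R LP (lazard R)"
  using algebra.quot_algebra(2)[OF lazard_poly_algebra_algebra lazard_ideal_ideal]
  by (simp add: lazard_def lazard_class_def[abs_def])

theorem lazard_algebra: "algebra R (lazard R)"
  using algebra.quot_algebra(1)[OF lazard_poly_algebra_algebra lazard_ideal_ideal]
  by (simp add: lazard_def)

theorem lazard_formal_module: "formal_module R (lazard R) (universal_F R) (universal_rho R)"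
proof -
  interpret LC: cring LP by (rule algebra.M_cring[OF lazard_poly_algebra_algebra])
  interpret I: ideal "lazard_ideal R" LP by (rule lazard_ideal_ideal)
  have "lazard_class R x = \<zero>\<^bsub>lazard R\<^esub>" if "x \<in> lazard_relations" for x
  proof -
    have "x \<in> lazard_ideal R"
      using that LC.genideal_self[OF lazard_relations_closed] by (auto simp: lazard_ideal_def lazard_relations_def)
    then show ?thesis by (simp add: lazard_class_def lazard_def I.a_rcos_const)
  qed
  then show ?thesis
    using formal_module_push[OF lazard_algebra lazard_class_hom]
    by (simp add: universal_F_def[abs_def] universal_rho_def[abs_def])
qed

theorem lazard_classifies:
  assumes B: "algebra R B" and FM: "formal_module R B F \<rho>"
  shows "\<exists>h\<in>alg_hom R (lazard R) B.
     (\<forall>i j. h (universal_F R i j) = F i j) \<and> (\<forall>a\<in>carrier R. \<forall>i. h (universal_rho R a i) = \<rho> a i) \<and>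
     (\<forall>h'\<in>alg_hom R (lazard R) B.
        (\<forall>i j. h' (universal_F R i j) = F i j) \<and> (\<forall>a\<in>carrier R. \<forall>i. h' (universal_rho R a i) = \<rho> a i)
        \<longrightarrow> (\<forall>x\<in>carrier (lazard R). h' x = h x))"
proof -
  interpret LC: cring LP by (rule algebra.M_cring[OF lazard_poly_algebra_algebra])
  interpret L: algebra R LP by (rule lazard_poly_algebra_algebra)
  interpret BC: cring B by (rule algebra.M_cring[OF B])
  let ?g = "\<lambda>v. case v of FCoeff i j \<Rightarrow> F i j | RCoeff a i \<Rightarrow> \<rho> a i"
  have g: "?g \<in> lazard_gens R \<rightarrow> carrier B"
    using FM by (auto simp: lazard_gens_def formal_module_def)
  obtain k where k: "k \<in> alg_hom R LP B" and kv: "\<And>v. v \<in> lazard_gens R \<Longrightarrow> k (poly_var R v) = ?g v"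
    using poly_algebra_lift[OF B g] unfolding lazard_poly_algebra_def by blast
  interpret k: ring_hom_cring LP B k
    by (rule alg_hom_ring_hom_cring[OF lazard_poly_algebra_algebra B k])
  have sm: "k (a \<odot>\<^bsub>LP\<^esub> \<one>\<^bsub>LP\<^esub>) = a \<odot>\<^bsub>B\<^esub> \<one>\<^bsub>B\<^esub>" if "a \<in> carrier R" for a
    using k that by (simp add: alg_hom_def mod_hom_def)
  have kF: "k (generic_F R i j) = F i j" for i j
  proof (cases "i = 0 \<or> j = 0")
    case True
    then show ?thesis using FM generic_normalized(1)[of i] generic_normalized(2)[of j]
      by (auto simp: formal_module_def)
  next
    case False
    then show ?thesis using kv[of "FCoeff i j"] by (simp add: generic_F_def lazard_gens_def)
  qed
  have kr: "k (generic_rho R a i) = \<rho> a i" if a: "a \<in> carrier R" for a i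
  proof -
    consider "i = 0" | "i = 1" | "i \<ge> 2" by linarith
    then show ?thesis
    proof cases
      case 3
      then show ?thesis using kv[of "RCoeff a i"] a by (simp add: generic_rho_def lazard_gens_def)
    qed (use FM a sm in \<open>simp_all add: generic_normalized formal_module_def del: One_nat_def\<close>)
  qed
  have kr2: "(\<lambda>i. k (generic_rho R a i)) = \<rho> a" if "a \<in> carrier R" for a
    using kr[OF that] by auto
  have eq: "formal_module_equations R B (\<lambda>i j. k (generic_F R i j)) (\<lambda>a i. k (generic_rho R a i)) =
      formal_module_equations R B F \<rho>"
    unfolding formal_module_equations_def Let_def kF
    by (rule arg_cong2[of _ _ _ _ "(\<union>)"] set_eq1 set_eq2 refl | simp only: kr2 add.m_closed m_closed one_closed a_closed | (erule conjE))+
  have "formal_module R B (\<lambda>i j. k (generic_F R i j)) (\<lambda>a i. k (generic_rho R a i))"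
    using FM unfolding formal_module_def eq by (simp add: kF kr)
  then have rel: "k x = \<zero>\<^bsub>B\<^esub>" if "x \<in> lazard_relations" for x
    using formal_module_push[OF B k] that by blast
  have "lazard_ideal R \<subseteq> a_kernel LP B k"
  proof -
    have "lazard_relations \<subseteq> a_kernel LP B k"
      unfolding a_kernel_def' using rel lazard_relations_closed by blast
    moreover have "ideal (a_kernel LP B k) LP"
      using k by (intro ring_hom_ring.kernel_is_ideal ring_hom_ringI2 LC.ring_axioms BC.ring_axioms)
        (simp add: alg_hom_def)
    ultimately have "Idl\<^bsub>LP\<^esub> lazard_relations \<subseteq> a_kernel LP B k"
      by (rule LC.genideal_minimal[rotated])
    then show ?thesis by (simp add: lazard_ideal_def lazard_relations_def)
  qed
  then have ker: "k x = \<zero>\<^bsub>B\<^esub>" if "x \<in> lazard_ideal R" for x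
    using that unfolding a_kernel_def' by blast
  have lift1: "quot_lift k \<in> alg_hom R (lazard R) B"
    unfolding lazard_def by (rule L.quot_lift_hom(1)[OF lazard_ideal_ideal B k ker])
  have lift2: "quot_lift k (lazard_class R p) = k p" if "p \<in> carrier LP" for p
    unfolding lazard_class_def by (rule L.quot_lift_hom(2)[OF lazard_ideal_ideal B k ker that])
  show ?thesis
  proof (intro bexI[of _ "quot_lift k"] conjI ballI allI impI)
    show "quot_lift k \<in> alg_hom R (lazard R) B" by (rule lift1)
    show "quot_lift k (universal_F R i j) = F i j" for i j
      unfolding universal_F_def using lift2[OF generic_closed(1)] by (simp add: kF)
    show "quot_lift k (universal_rho R a i) = \<rho> a i" if "a \<in> carrier R" for a i
      unfolding universal_rho_def using lift2[OF generic_closed(2)[OF that]] that by (simp add: kr)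
    fix h' x assume h': "h' \<in> alg_hom R (lazard R) B"
      and univ: "(\<forall>i j. h' (universal_F R i j) = F i j) \<and> (\<forall>a\<in>carrier R. \<forall>i. h' (universal_rho R a i) = \<rho> a i)"
      and x: "x \<in> carrier (lazard R)"
    obtain p where p: "p \<in> carrier LP" "x = lazard_class R p"
      using x unfolding lazard_def lazard_class_def quot_module_simps A_RCOSETS_def RCOSETS_def a_r_coset_def
      by auto
    have h'': "h' \<circ> lazard_class R \<in> alg_hom R LP B"
      using h' lazard_class_hom by (auto simp: alg_hom_def mod_hom_def ring_hom_def Pi_iff)
    have "(h' \<circ> lazard_class R) p = k p"
    proof (rule poly_algebra_hom_unique[OF h''[unfolded lazard_poly_algebra_def] k[unfolded lazard_poly_algebra_def]
          _ p(1)[unfolded lazard_poly_algebra_def] B])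
      fix v assume v: "v \<in> lazard_gens R"
      show "(h' \<circ> lazard_class R) (poly_var R v) = k (poly_var R v)"
      proof (cases v)
        case (FCoeff i j)
        then have "poly_var R v = generic_F R i j" using v by (simp add: lazard_gens_def generic_F_def)
        then show ?thesis using univ by (simp add: kF universal_F_def)
      next
        case (RCoeff a i)
        then have "poly_var R v = generic_rho R a i" "a \<in> carrier R"
          using v by (auto simp: lazard_gens_def generic_rho_def)
        then show ?thesis using univ by (simp add: kr universal_rho_def)
      qed
    qed
    then show "h' x = quot_lift k x" using p lift2[OF p(1)] by simp
  qed
qed

end

declare free_module_simps [simp del] monoid_algebra_simps [simp del] mset_monoid_simps [simp del]
  quot_module_simps [simp del] power_series_ring_simps [simp del]

end

(* A power series l(X) = X + x_1 X^2 + x_2 X^3 + ... over A[x_1, x_2, ...] is the logarithm of a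
   formal A-module with F(X, Y) = l^{-1}(l(X) + l(Y)) and rho(a)(X) = l^{-1}(a l(X)). The part of
   its classifying map lazard A -> A[x_1, x_2, ...] that is linear in x_{n-1} is sigma_n, so that
   composition with i_sharp yields Symm(sigma) up to terms of higher order. Symm(sigma) is
   injective: as sigma_n(u) d = nu(n) u and the indecomposables are projective, followed by
   x_{n-1} |-> d it becomes an embedding into a polynomial algebra and a rescaling of the variables
   by nonzero integers. Hence i_sharp is injective; surjectivity is an induction on the degree. The
   tensor products of the symmetric and of the Rees algebras of the ideals also receive a surjection
   from the symmetric algebra through which Symm(sigma) factors, so they are isomorphic to it. *)
theory Submission imports Defs "HOL-Number_Theory.Cong"
begin

text \<open>Modulo the other variables and x_{n-1}^2 the logarithm is X + x_{n-1} X^n, so F = X + Y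
  - x_{n-1} ((X + Y)^n - X^n - Y^n) and rho(a) = a X + (a - a^n) x_{n-1} X^n: this is the origin of
  the values nu(n) and a - a^n. To read sigma_n(d) off F, the class d must first exist.
  \<open>indec_d\<close> is a definite description, justified by Lazard's lemma: a symmetric
  2-cocycle of degree n with values in any abelian group is a unique multiple of ((X + Y)^n - X^n -
  Y^n) / nu(n). It is applied over the square-zero extension of A by the indecomposables, where
  associativity of the universal law becomes linear. The relation sigma_n(u) d = nu(n) u holds
  because sigma_n is injective and both sides have the image nu(n) sigma_n(u). Terms of higher order
  are controlled by word length: a word of length k has a logarithm that starts in polynomial degree
  k, with Symm(sigma) as leading form. Compatibility with the gradings of the tensor products is
  tested after the injection into the polynomial ring, where x_{n-1} has degree 2 (n - 1).\<close>

lemmas (in cring) LP_algebra = lazard_poly_algebra_algebra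

section \<open>Modules, quotients and generators\<close>

lemma mod_homD:
 assumes "h \<in> mod_hom A M N"
 shows "x \<in> carrier M \<Longrightarrow> h x \<in> carrier N"
  and "x \<in> carrier M \<Longrightarrow> y \<in> carrier M \<Longrightarrow> h (x \<oplus>\<^bsub>M\<^esub> y) = h x \<oplus>\<^bsub>N\<^esub> h y"
  and "a \<in> carrier A \<Longrightarrow> x \<in> carrier M \<Longrightarrow> h (a \<odot>\<^bsub>M\<^esub> x) = a \<odot>\<^bsub>N\<^esub> h x"
 using assms by (auto simp: mod_hom_def)

lemma mod_homI:
 assumes "\<And>x. x \<in> carrier M \<Longrightarrow> h x \<in> carrier N"
  and "\<And>x y. x \<in> carrier M \<Longrightarrow> y \<in> carrier M \<Longrightarrow> h (x \<oplus>\<^bsub>M\<^esub> y) = h x \<oplus>\<^bsub>N\<^esub> h y"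
  and "\<And>a x. a \<in> carrier A \<Longrightarrow> x \<in> carrier M \<Longrightarrow> h (a \<odot>\<^bsub>M\<^esub> x) = a \<odot>\<^bsub>N\<^esub> h x"
 shows "h \<in> mod_hom A M N"
 using assms by (auto simp: mod_hom_def)

lemma alg_homD:
 assumes "h \<in> alg_hom A B C"
 shows "x \<in> carrier B \<Longrightarrow> h x \<in> carrier C"
  and "x \<in> carrier B \<Longrightarrow> y \<in> carrier B \<Longrightarrow> h (x \<oplus>\<^bsub>B\<^esub> y) = h x \<oplus>\<^bsub>C\<^esub> h y"
  and "a \<in> carrier A \<Longrightarrow> x \<in> carrier B \<Longrightarrow> h (a \<odot>\<^bsub>B\<^esub> x) = a \<odot>\<^bsub>C\<^esub> h x"
  and "x \<in> carrier B \<Longrightarrow> y \<in> carrier B \<Longrightarrow> h (x \<otimes>\<^bsub>B\<^esub> y) = h x \<otimes>\<^bsub>C\<^esub> h y"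
  and "h \<one>\<^bsub>B\<^esub> = \<one>\<^bsub>C\<^esub>"
 using assms by (auto simp: alg_hom_def mod_hom_def ring_hom_def)

lemma alg_homI:
 assumes "h \<in> mod_hom A B C"
  and "\<And>x y. x \<in> carrier B \<Longrightarrow> y \<in> carrier B \<Longrightarrow> h (x \<otimes>\<^bsub>B\<^esub> y) = h x \<otimes>\<^bsub>C\<^esub> h y"
  and "h \<one>\<^bsub>B\<^esub> = \<one>\<^bsub>C\<^esub>"
 shows "h \<in> alg_hom A B C"
 using assms by (auto simp: alg_hom_def mod_hom_def ring_hom_def)

lemma alg_mod_hom: "h \<in> alg_hom A B C \<Longrightarrow> h \<in> mod_hom A B C"
 by (simp add: alg_hom_def)

lemma mod_hom_comp: "h \<in> mod_hom A M N \<Longrightarrow> k \<in> mod_hom A N P \<Longrightarrow> k \<circ> h \<in> mod_hom A M P"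
 by (auto simp: mod_hom_def Pi_iff)

lemma alg_hom_comp: "h \<in> alg_hom A B C \<Longrightarrow> k \<in> alg_hom A C D \<Longrightarrow> k \<circ> h \<in> alg_hom A B D"
 by (auto simp: alg_hom_def mod_hom_def ring_hom_def Pi_iff)

lemma mod_hom_zero:
 assumes "module A M" "module A N" "h \<in> mod_hom A M N"
 shows "h \<zero>\<^bsub>M\<^esub> = \<zero>\<^bsub>N\<^esub>"
proof -
 interpret M: module A M by fact
 interpret N: module A N by fact
 have "h (\<zero>\<^bsub>A\<^esub> \<odot>\<^bsub>M\<^esub> \<zero>\<^bsub>M\<^esub>) = \<zero>\<^bsub>A\<^esub> \<odot>\<^bsub>N\<^esub> h \<zero>\<^bsub>M\<^esub>"
  using assms by (simp only: mod_homD(3) M.R.zero_closed M.M.zero_closed)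
 then show ?thesis using mod_homD(1)[OF assms(3), of "\<zero>\<^bsub>M\<^esub>"] by simp
qed

lemma mod_hom_minus:
 assumes "module A M" "module A N" "h \<in> mod_hom A M N" "x \<in> carrier M" "y \<in> carrier M"
 shows "h (x \<ominus>\<^bsub>M\<^esub> y) = h x \<ominus>\<^bsub>N\<^esub> h y"
proof -
 interpret M: module A M by fact
 interpret N: module A N by fact
 have "h (\<ominus>\<^bsub>M\<^esub> y) = \<ominus>\<^bsub>N\<^esub> h y"
  using mod_homD(3)[OF assms(3), of "\<ominus>\<^bsub>A\<^esub> \<one>\<^bsub>A\<^esub>" y] mod_homD(1)[OF assms(3), of y] assms(5)
  by (simp add: M.smult_l_minus N.smult_l_minus)
 then show ?thesis using assms mod_homD(2)[OF assms(3), of x "\<ominus>\<^bsub>M\<^esub> y"] by (simp add: a_minus_def)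
qed

lemma mod_hom_finsum:
 assumes "module A M" "module A N" "h \<in> mod_hom A M N" "f \<in> S \<rightarrow> carrier M"
 shows "h (\<Oplus>\<^bsub>M\<^esub>i\<in>S. f i) = (\<Oplus>\<^bsub>N\<^esub>i\<in>S. h (f i))"
proof -
 interpret M: module A M by fact
 interpret N: module A N by fact
 note z = mod_hom_zero[OF assms(1-3)]
 show ?thesis
 proof (cases "finite S")
  case True
  then show ?thesis using assms(4)
   by (induction S rule: finite_induct) (auto simp: z mod_homD[OF assms(3)] Pi_iff)
 qed (simp add: z M.add.finprod_infinite N.add.finprod_infinite)
qed

lemma (in abelian_group) minus_zero_iff: "x \<in> carrier G \<Longrightarrow> y \<in> carrier G \<Longrightarrow> x \<ominus> y = \<zero> \<longleftrightarrow> x = y"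
 using minus_equality[of x "\<ominus> y"] by (auto simp: minus_eq r_neg)

lemma mod_hom_inj_onI:
 assumes "module A M" "module A N" "h \<in> mod_hom A M N"
  and "\<And>x. x \<in> carrier M \<Longrightarrow> h x = \<zero>\<^bsub>N\<^esub> \<Longrightarrow> x = \<zero>\<^bsub>M\<^esub>"
 shows "inj_on h (carrier M)"
proof (rule inj_onI)
 interpret M: module A M by fact
 interpret N: module A N by fact
 fix x y assume "x \<in> carrier M" "y \<in> carrier M" "h x = h y"
 then show "x = y"
  using assms(4)[of "x \<ominus>\<^bsub>M\<^esub> y"] mod_homD(1)[OF assms(3)]
  by (simp add: mod_hom_minus[OF assms(1-3)] M.M.minus_zero_iff N.M.minus_zero_iff)
qed

section \<open>Submodules and spans\<close>

context module
begin

text \<open>Negation is scalar multiplication by -1, so closure under it comes for free.\<close>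

lemma submoduleI':
 assumes "H \<subseteq> carrier M" "\<zero>\<^bsub>M\<^esub> \<in> H"
  and "\<And>x y. x \<in> H \<Longrightarrow> y \<in> H \<Longrightarrow> x \<oplus>\<^bsub>M\<^esub> y \<in> H"
  and "\<And>a x. a \<in> carrier R \<Longrightarrow> x \<in> H \<Longrightarrow> a \<odot>\<^bsub>M\<^esub> x \<in> H"
 shows "submodule H R M"
proof (rule submoduleI)
 show "\<ominus>\<^bsub>M\<^esub> x \<in> H" if "x \<in> H" for x
  using assms(4)[of "\<ominus> \<one>" x] that assms(1) by (auto simp: smult_l_minus)
qed (use assms in auto)

lemma submodule_carrier: "submodule (carrier M) R M"
 by (rule submoduleI') auto

lemma submoduleD:
 assumes "submodule H R M"
 shows "H \<subseteq> carrier M" "\<zero>\<^bsub>M\<^esub> \<in> H" "\<And>x y. x \<in> H \<Longrightarrow> y \<in> H \<Longrightarrow> x \<oplus>\<^bsub>M\<^esub> y \<in> H"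
  "\<And>x. x \<in> H \<Longrightarrow> \<ominus>\<^bsub>M\<^esub> x \<in> H" "\<And>x y. x \<in> H \<Longrightarrow> y \<in> H \<Longrightarrow> x \<ominus>\<^bsub>M\<^esub> y \<in> H"
  "\<And>a x. a \<in> carrier R \<Longrightarrow> x \<in> H \<Longrightarrow> a \<odot>\<^bsub>M\<^esub> x \<in> H"
proof -
 interpret H: submodule H R M by fact
 show 1: "H \<subseteq> carrier M" "\<zero>\<^bsub>M\<^esub> \<in> H" "\<And>x y. x \<in> H \<Longrightarrow> y \<in> H \<Longrightarrow> x \<oplus>\<^bsub>M\<^esub> y \<in> H"
   "\<And>a x. a \<in> carrier R \<Longrightarrow> x \<in> H \<Longrightarrow> a \<odot>\<^bsub>M\<^esub> x \<in> H"
  using H.subset H.one_closed H.m_closed by auto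
 show 2: "\<ominus>\<^bsub>M\<^esub> x \<in> H" if "x \<in> H" for x
  using 1(4)[of "\<ominus> \<one>" x] that subsetD[OF 1(1) that] by (simp add: smult_l_minus)
 show "x \<ominus>\<^bsub>M\<^esub> y \<in> H" if "x \<in> H" "y \<in> H" for x y
  using 1(3) 2 that by (simp add: a_minus_def)
qed

lemma submodule_finsum:
 assumes "submodule H R M" "\<And>i. i \<in> S \<Longrightarrow> f i \<in> H"
 shows "(\<Oplus>\<^bsub>M\<^esub>i\<in>S. f i) \<in> H"
proof (cases "finite S")
 case True
 then show ?thesis using assms(2)
 proof (induction S rule: finite_induct)
  case (insert i S)
  have "f j \<in> carrier M" if "j \<in> insert i S" for j using insert.prems that submoduleD(1)[OF assms(1)] by auto
  then show ?case using insert submoduleD(3)[OF assms(1)] by (simp add: Pi_iff)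
 qed (use submoduleD[OF assms(1)] in simp)
qed (use submoduleD[OF assms(1)] in \<open>simp add: M.add.finprod_infinite\<close>)

lemma mod_span_minimal: "submodule H R M \<Longrightarrow> S \<subseteq> H \<Longrightarrow> mod_span R M S \<subseteq> H"
 by (simp add: mod_span_def hull_minimal)

lemma mod_span_superset: "S \<subseteq> mod_span R M S"
 by (simp add: mod_span_def hull_subset)

lemma mod_span_submodule:
 assumes "S \<subseteq> carrier M"
 shows "submodule (mod_span R M S) R M"
proof (rule submoduleI')
 note d = submoduleD[of _]
 show "mod_span R M S \<subseteq> carrier M" by (rule mod_span_minimal[OF submodule_carrier assms])
 show "\<zero>\<^bsub>M\<^esub> \<in> mod_span R M S" unfolding mod_span_def hull_def using submoduleD(2) by blast
 show "x \<oplus>\<^bsub>M\<^esub> y \<in> mod_span R M S" if "x \<in> mod_span R M S" "y \<in> mod_span R M S" for x y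
  using that unfolding mod_span_def hull_def using submoduleD(3) by blast
 show "a \<odot>\<^bsub>M\<^esub> x \<in> mod_span R M S" if "a \<in> carrier R" "x \<in> mod_span R M S" for a x
  using that unfolding mod_span_def hull_def using submoduleD(6) by blast
qed

lemma mod_span_closed: "S \<subseteq> carrier M \<Longrightarrow> mod_span R M S \<subseteq> carrier M"
 by (rule mod_span_minimal[OF submodule_carrier])

lemma mod_span_induct [consumes 2, case_names zero gen add smult]:
 assumes x: "x \<in> mod_span R M S" and S: "S \<subseteq> carrier M"
  and "P \<zero>\<^bsub>M\<^esub>" "\<And>s. s \<in> S \<Longrightarrow> P s"
  and "\<And>x y. x \<in> mod_span R M S \<Longrightarrow> y \<in> mod_span R M S \<Longrightarrow> P x \<Longrightarrow> P y \<Longrightarrow> P (x \<oplus>\<^bsub>M\<^esub> y)"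
  and "\<And>a x. a \<in> carrier R \<Longrightarrow> x \<in> mod_span R M S \<Longrightarrow> P x \<Longrightarrow> P (a \<odot>\<^bsub>M\<^esub> x)"
 shows "P x"
proof -
 note s = submoduleD[OF mod_span_submodule[OF S]]
 have "submodule {x \<in> mod_span R M S. P x} R M"
  by (rule submoduleI') (use s assms in auto)
 from mod_span_minimal[OF this] show ?thesis using x mod_span_superset[of S] assms(4) by auto
qed

lemma submodule_vimage:
 assumes "module R N" "h \<in> mod_hom R M N" "submodule H R N"
 shows "submodule {x \<in> carrier M. h x \<in> H} R M"
proof -
 interpret N: module R N by fact
 show ?thesis
  by (rule submoduleI') (use N.submoduleD[OF assms(3)] mod_homD[OF assms(2)]
   mod_hom_zero[OF module_axioms assms(1,2)] in auto)
qed

lemma submodule_image: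
 assumes "module R N" "h \<in> mod_hom R N M" "submodule H R N"
 shows "submodule (h ` H) R M"
proof -
 interpret N: module R N by fact
 note H = N.submoduleD[OF assms(3)]
 note h = mod_homD[OF assms(2)]
 have Hc: "x \<in> H \<Longrightarrow> x \<in> carrier N" for x using H by blast
 show ?thesis
 proof (rule submoduleI')
  show "\<zero>\<^bsub>M\<^esub> \<in> h ` H" using mod_hom_zero[OF assms(1) module_axioms assms(2)] H(2) by (metis imageI)
  fix x y assume "x \<in> h ` H" "y \<in> h ` H"
  then obtain x' y' where "x = h x'" "y = h y'" "x' \<in> H" "y' \<in> H" by blast
  then show "x \<oplus>\<^bsub>M\<^esub> y \<in> h ` H" using h(2)[of x' y'] H(3)[of x' y'] Hc by (metis imageI)
 next
  fix a x assume a: "a \<in> carrier R" and "x \<in> h ` H"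
  then obtain x' where "x = h x'" "x' \<in> H" by blast
  then show "a \<odot>\<^bsub>M\<^esub> x \<in> h ` H" using h(3)[OF a, of x'] H(6)[OF a, of x'] Hc by (metis imageI)
 qed (use h(1) Hc in auto)
qed

end

text \<open>Quotients by a mere submodule. The quotient results for algebras assume an ideal in a
  commutative algebra, which covers neither the indecomposables, where products carry no meaning,
  nor the noncommutative word algebra.\<close>

locale module_quotient = module + fixes H assumes sub: "submodule H R M"
begin

abbreviation "Q \<equiv> quot_module M H"
abbreviation "proj \<equiv> (\<lambda>x. H +>\<^bsub>M\<^esub> x)"

sublocale H: abelian_subgroup H M
proof -
 interpret H: submodule H R M by (rule sub)
 have "additive_subgroup H M" by (intro additive_subgroup.intro) unfold_locales
 then show "abelian_subgroup H M" by (intro abelian_subgroupI3 M.abelian_group_axioms)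
qed

lemma H_closed: "x \<in> H \<Longrightarrow> x \<in> carrier M"
 using submoduleD(1)[OF sub] by blast

lemma proj_cases:
 assumes "K \<in> carrier Q"
 obtains x where "x \<in> carrier M" "K = proj x"
 using assms by (auto simp: quot_module_simps A_RCOSETS_def RCOSETS_def a_r_coset_def)

lemma proj_closed: "x \<in> carrier M \<Longrightarrow> proj x \<in> carrier Q"
 using M.a_rcosetsI[OF submoduleD(1)[OF sub]] by (simp add: quot_module_simps)

lemma proj_eq_iff: "x \<in> carrier M \<Longrightarrow> y \<in> carrier M \<Longrightarrow> proj x = proj y \<longleftrightarrow> x \<ominus>\<^bsub>M\<^esub> y \<in> H"
proof
 assume c: "x \<in> carrier M" "y \<in> carrier M"
 show "x \<ominus>\<^bsub>M\<^esub> y \<in> H" if "proj x = proj y"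
  using that H.a_rcos_self[OF c(1)] c H_closed by (auto simp: a_r_coset_def' M.minus_eq M.a_assoc M.r_neg)
 assume d: "x \<ominus>\<^bsub>M\<^esub> y \<in> H"
 have "x = (x \<ominus>\<^bsub>M\<^esub> y) \<oplus>\<^bsub>M\<^esub> y" using c by (simp add: M.minus_eq M.a_assoc M.l_neg)
 then have "x \<in> proj y" using d by (auto simp: a_r_coset_def')
 then show "proj x = proj y" using c H.a_subgroup by (metis M.a_repr_independence)
qed

lemma proj_add: "x \<in> carrier M \<Longrightarrow> y \<in> carrier M \<Longrightarrow> proj x \<oplus>\<^bsub>Q\<^esub> proj y = proj (x \<oplus>\<^bsub>M\<^esub> y)"
 by (simp add: quot_module_simps FactRing_def H.a_rcos_sum)

lemma proj_smult:
 assumes a: "a \<in> carrier R" and x: "x \<in> carrier M"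
 shows "a \<odot>\<^bsub>Q\<^esub> proj x = proj (a \<odot>\<^bsub>M\<^esub> x)"
proof -
 have "proj (a \<odot>\<^bsub>M\<^esub> y) = proj (a \<odot>\<^bsub>M\<^esub> x)" if y: "y \<in> proj x" for y
 proof -
  obtain i where i: "i \<in> H" "y = i \<oplus>\<^bsub>M\<^esub> x" using y by (auto simp: a_r_coset_def')
  have "a \<odot>\<^bsub>M\<^esub> y \<in> proj (a \<odot>\<^bsub>M\<^esub> x)"
   using i a x submoduleD(6)[OF sub a] H_closed by (auto simp: a_r_coset_def' smult_r_distr)
  then show ?thesis using a x by (intro M.a_repr_independence[symmetric] H.a_subgroup) auto
 qed
 moreover have "x \<in> proj x" using x by (rule H.a_rcos_self)
 ultimately show ?thesis unfolding quot_module_smult by blast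
qed

lemma proj_zero: "proj \<zero>\<^bsub>M\<^esub> = \<zero>\<^bsub>Q\<^esub>"
 using submoduleD(1)[OF sub] by (simp add: quot_module_simps M.a_coset_add_zero)

lemma proj_eq_zero_iff: "x \<in> carrier M \<Longrightarrow> proj x = \<zero>\<^bsub>Q\<^esub> \<longleftrightarrow> x \<in> H"
 using proj_eq_iff[of x "\<zero>\<^bsub>M\<^esub>"] M.minus_equality[of "\<zero>\<^bsub>M\<^esub>" "\<zero>\<^bsub>M\<^esub>"]
 by (simp add: proj_zero M.minus_eq)

lemma Q_module: "module R Q"
proof (rule moduleI[OF R.is_cring])
 show "abelian_group Q"
 proof (rule abelian_groupI)
  show "\<zero>\<^bsub>Q\<^esub> \<in> carrier Q" using proj_closed[of "\<zero>\<^bsub>M\<^esub>"] by (simp add: proj_zero)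
  fix K assume K: "K \<in> carrier Q"
  then obtain x where x: "x \<in> carrier M" "K = proj x" by (rule proj_cases)
  show "\<zero>\<^bsub>Q\<^esub> \<oplus>\<^bsub>Q\<^esub> K = K" using x proj_add[of "\<zero>\<^bsub>M\<^esub>" x] by (simp add: proj_zero)
  show "\<exists>L\<in>carrier Q. L \<oplus>\<^bsub>Q\<^esub> K = \<zero>\<^bsub>Q\<^esub>"
   using x by (intro bexI[of _ "proj (\<ominus>\<^bsub>M\<^esub> x)"]) (simp_all add: proj_add M.l_neg proj_zero proj_closed)
  fix L assume "L \<in> carrier Q"
  then obtain y where y: "y \<in> carrier M" "L = proj y" by (rule proj_cases)
  show "K \<oplus>\<^bsub>Q\<^esub> L \<in> carrier Q" "K \<oplus>\<^bsub>Q\<^esub> L = L \<oplus>\<^bsub>Q\<^esub> K"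
   using x y by (simp_all add: proj_add proj_closed M.a_comm)
  fix N assume "N \<in> carrier Q"
  then obtain z where z: "z \<in> carrier M" "N = proj z" by (rule proj_cases)
  show "(K \<oplus>\<^bsub>Q\<^esub> L) \<oplus>\<^bsub>Q\<^esub> N = K \<oplus>\<^bsub>Q\<^esub> (L \<oplus>\<^bsub>Q\<^esub> N)"
   using x y z by (simp add: proj_add M.a_assoc)
 qed
next
 fix a K assume a: "a \<in> carrier R" and K: "K \<in> carrier Q"
 then obtain x where x: "x \<in> carrier M" "K = proj x" by (metis proj_cases)
 show "a \<odot>\<^bsub>Q\<^esub> K \<in> carrier Q" using a x by (simp add: proj_smult proj_closed)
 show "(a \<oplus> b) \<odot>\<^bsub>Q\<^esub> K = a \<odot>\<^bsub>Q\<^esub> K \<oplus>\<^bsub>Q\<^esub> b \<odot>\<^bsub>Q\<^esub> K" "(a \<otimes> b) \<odot>\<^bsub>Q\<^esub> K = a \<odot>\<^bsub>Q\<^esub> (b \<odot>\<^bsub>Q\<^esub> K)"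
  if "b \<in> carrier R" for b
  using a x that by (simp_all add: proj_smult proj_add smult_l_distr smult_assoc1)
 show "a \<odot>\<^bsub>Q\<^esub> (K \<oplus>\<^bsub>Q\<^esub> L) = a \<odot>\<^bsub>Q\<^esub> K \<oplus>\<^bsub>Q\<^esub> a \<odot>\<^bsub>Q\<^esub> L" if L: "L \<in> carrier Q" for L
 proof -
  obtain y where "y \<in> carrier M" "L = proj y" using L by (rule proj_cases)
  then show ?thesis using a x by (simp add: proj_smult proj_add smult_r_distr)
 qed
next
 fix K assume "K \<in> carrier Q"
 then obtain x where x: "x \<in> carrier M" "K = proj x" by (rule proj_cases)
 then show "\<one> \<odot>\<^bsub>Q\<^esub> K = K" by (simp add: proj_smult)
qed

lemma proj_hom: "proj \<in> mod_hom R M Q"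
 by (rule mod_homI) (simp_all add: proj_closed proj_add proj_smult)

lemma quot_lift_proj:
 assumes N: "module R N" and h: "h \<in> mod_hom R M N" and ker: "\<And>x. x \<in> H \<Longrightarrow> h x = \<zero>\<^bsub>N\<^esub>"
  and x: "x \<in> carrier M"
 shows "quot_lift h (proj x) = h x"
proof -
 interpret N: module R N by fact
 have "h (i \<oplus>\<^bsub>M\<^esub> x) = h x" if "i \<in> H" for i
  using that x ker mod_homD(1)[OF h x] by (simp add: mod_homD(2)[OF h] H_closed)
 then have "h ` (proj x) = {h x}" using H.a_rcos_self[OF x] by (auto simp: a_r_coset_def')
 then show ?thesis by (simp add: quot_lift_def)
qed

lemma quot_lift_mod_hom:
 assumes N: "module R N" and h: "h \<in> mod_hom R M N" and ker: "\<And>x. x \<in> H \<Longrightarrow> h x = \<zero>\<^bsub>N\<^esub>"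
 shows "quot_lift h \<in> mod_hom R Q N"
proof -
 note q = quot_lift_proj[OF N h ker]
 show ?thesis
  by (rule mod_homI) (auto elim!: proj_cases simp: q proj_add proj_smult mod_homD[OF h])
qed

end

text \<open>Generation in a form that yields both uniqueness of homomorphisms and surjectivity: the
 algebra is spanned by the iterated products of elements of \<open>S\<close>.\<close>

definition alg_generates :: "('a, 'm) ring_scheme \<Rightarrow> ('a, 'b, 'p) module_scheme \<Rightarrow> 'b set \<Rightarrow> bool" where
 "alg_generates A B S \<longleftrightarrow> S \<subseteq> carrier B \<and> (\<forall>H. submodule H A B \<longrightarrow> \<one>\<^bsub>B\<^esub> \<in> H \<longrightarrow>
   (\<forall>s\<in>S. \<forall>x\<in>H. s \<otimes>\<^bsub>B\<^esub> x \<in> H) \<longrightarrow> carrier B \<subseteq> H)"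

lemma alg_generatesD:
 "alg_generates A B S \<Longrightarrow> submodule H A B \<Longrightarrow> \<one>\<^bsub>B\<^esub> \<in> H \<Longrightarrow>
  (\<And>s x. s \<in> S \<Longrightarrow> x \<in> H \<Longrightarrow> s \<otimes>\<^bsub>B\<^esub> x \<in> H) \<Longrightarrow> x \<in> carrier B \<Longrightarrow> x \<in> H"
 unfolding alg_generates_def by blast

text \<open>The equaliser of two homomorphisms is a submodule that contains 1 and is stable under
  multiplication by \<open>S\<close>, which is what \<open>alg_generates\<close> asks of a test
  submodule.\<close>

lemma alg_generates_hom_unique:
 assumes B: "algebra A B" and C: "algebra A C" and gen: "alg_generates A B S"
  and h: "h \<in> alg_hom A B C" and h': "h' \<in> alg_hom A B C"
  and eq: "\<And>s. s \<in> S \<Longrightarrow> h s = h' s" and x: "x \<in> carrier B"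
 shows "h x = h' x"
proof -
 interpret B: algebra A B by fact
 interpret C: algebra A C by fact
 have "x \<in> {x \<in> carrier B. h x = h' x}"
 proof (rule alg_generatesD[OF gen])
  show "submodule {x \<in> carrier B. h x = h' x} A B"
   using mod_hom_zero[OF B.module_axioms C.module_axioms alg_mod_hom[OF h]]
    mod_hom_zero[OF B.module_axioms C.module_axioms alg_mod_hom[OF h']]
   by (intro B.submoduleI') (auto simp: alg_homD[OF h] alg_homD[OF h'])
 qed (use gen eq in \<open>auto simp: alg_homD[OF h] alg_homD[OF h'] alg_generates_def x subset_iff\<close>)
 then show ?thesis by simp
qed

lemma alg_generates_image:
 assumes B: "algebra A B" and C: "algebra A C" and gen: "alg_generates A C S"
  and h: "h \<in> alg_hom A B C" and S: "S \<subseteq> h ` carrier B"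
 shows "h ` carrier B = carrier C"
proof
 interpret B: algebra A B by fact
 interpret C: algebra A C by fact
 show "h ` carrier B \<subseteq> carrier C" using alg_homD(1)[OF h] by blast
 have "carrier C \<subseteq> h ` carrier B"
 proof (rule subsetI, rule alg_generatesD[OF gen])
  show "submodule (h ` carrier B) A C"
   by (rule C.submodule_image[OF B.module_axioms alg_mod_hom[OF h] B.submodule_carrier])
  show "\<one>\<^bsub>C\<^esub> \<in> h ` carrier B" using alg_homD(5)[OF h] cring.cring_simprules(6)[OF B.M_cring] by (metis imageI)
  fix s x assume "s \<in> S" "x \<in> h ` carrier B"
  then obtain s' x' where "s = h s'" "x = h x'" "s' \<in> carrier B" "x' \<in> carrier B" using S by blast
  then show "s \<otimes>\<^bsub>C\<^esub> x \<in> h ` carrier B" using alg_homD(4)[OF h, of s' x'] by (metis B.m_closed imageI)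
 qed
 then show "carrier C \<subseteq> h ` carrier B" .
qed

section \<open>Binomial coefficients modulo a prime and the integers binomial(n, i) / nu(n)\<close>

lemma prime_dvd_choose_prime_power:
 fixes p :: nat
 assumes p: "Factorial_Ring.prime p" and i: "0 < i" "i < p ^ a"
 shows "p dvd (p ^ a choose i)"
proof (rule ccontr)
 assume n: "\<not> p dvd (p ^ a choose i)"
 then have "coprime (p ^ a) (p ^ a choose i)"
  using p by (simp add: prime_imp_coprime)
 \<comment> \<open>With q = p^a: i * binomial(q, i) = q * binomial(q - 1, i - 1). If p did not
   divide the binomial coefficient, q would divide i, although i < q.\<close>
 moreover have "p ^ a dvd i * (p ^ a choose i)"
  using times_binomial_minus1_eq[OF i(1), of "p ^ a"] by simp
 ultimately have "p ^ a dvd i" by (simp add: coprime_dvd_mult_left_iff)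
 then show False using i by (auto dest: dvd_imp_le)
qed

text \<open>A case of Lucas' congruence. In Vandermonde's identity for k = q + r only the two end
  terms survive modulo p, since p divides binomial(q, i) in between. So passing from r to q + r
  raises both sides by one.\<close>

lemma choose_prime_power_cong:
 fixes p :: nat
 assumes p: "Factorial_Ring.prime p"
 shows "[k choose p ^ a = k div p ^ a] (mod p)"
proof (induction k rule: less_induct)
 case (less k)
 let ?q = "p ^ a"
 have q: "0 < ?q" using p by (simp add: prime_gt_0_nat)
 show ?case
 proof (cases "k < ?q")
  case True
  then show ?thesis by (simp add: binomial_eq_0)
 next
  case False
  define r where "r = k - ?q"
  have k: "k = ?q + r" using False by (simp add: r_def)
  have "(k choose ?q) = (\<Sum>i\<le>?q. (?q choose i) * (r choose (?q - i)))"
   unfolding k by (rule vandermonde[symmetric])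
  also have "{..?q} = insert 0 (insert ?q {0<..<?q})" using q by auto
  also have "(\<Sum>i\<in>insert 0 (insert ?q {0<..<?q}). (?q choose i) * (r choose (?q - i))) =
    (r choose ?q) + 1 + (\<Sum>i\<in>{0<..<?q}. (?q choose i) * (r choose (?q - i)))"
   using q by simp
  also have "[\<dots> = (r choose ?q) + 1 + 0] (mod p)"
   using prime_dvd_choose_prime_power[OF p]
   by (intro cong_add cong_refl) (auto simp: cong_0_iff intro!: dvd_sum)
  also have "[(r choose ?q) + 1 + 0 = r div ?q + 1 + 0] (mod p)"
   using less[of r] q k by (intro cong_add cong_refl) auto
  also have "r div ?q + 1 + 0 = k div ?q" using q by (simp add: k)
  finally show ?thesis .
 qed
qed

text \<open>In other words, p divides binomial(k, p^a) exactly when the base p digit of k at p^a is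
  zero. The cocycle argument below is steered by these digits.\<close>

lemma choose_prime_power_dvd_iff:
 fixes p :: nat
 assumes "Factorial_Ring.prime p"
 shows "p dvd (k choose p ^ a) \<longleftrightarrow> p dvd k div p ^ a"
 using choose_prime_power_cong[OF assms] by (rule cong_dvd_iff)

lemma not_dvd_div_prime_power_multiplicity:
 fixes p :: nat
 assumes "Factorial_Ring.prime p" "k > 0"
 shows "\<not> p dvd k div p ^ multiplicity p k"
 using multiplicity_decompose[of k p] assms prime_gt_1_nat[of p] by auto

lemma nu_prime_power:
 assumes "Factorial_Ring.prime p" "k > 0"
 shows "nu (p ^ k) = p"
 using assms by (simp add: nu_def aprimedivisor_prime_power)

lemma nu_dvd_choose:
 assumes "0 < i" "i < n"
 shows "nu n dvd (n choose i)"
proof (cases "primepow n")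
 case True
 then obtain p k where "Factorial_Ring.prime p" "k > 0" "n = p ^ k" by (auto simp: primepow_def)
 then show ?thesis using prime_dvd_choose_prime_power assms by (simp add: nu_prime_power)
qed (simp add: nu_def)

lemma nu_pos: "nu n > 0"
proof (cases "primepow n")
 case True
 then obtain p k where "Factorial_Ring.prime p" "k > 0" "n = p ^ k" by (auto simp: primepow_def)
 then show ?thesis by (simp add: nu_prime_power prime_gt_0_nat)
qed (simp add: nu_def)

text \<open>The coefficients of Lazard's polynomial ((X + Y)^n - X^n - Y^n) / nu(n); for 0 < i < n
  the division is exact.\<close>

definition cocycle_coeff :: "nat \<Rightarrow> nat \<Rightarrow> nat" where
 "cocycle_coeff n i = (n choose i) div nu n"

lemma nu_times_cocycle_coeff: "0 < i \<Longrightarrow> i < n \<Longrightarrow> nu n * cocycle_coeff n i = (n choose i)"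
 using nu_dvd_choose by (simp add: cocycle_coeff_def)

text \<open>Lazard's polynomial is itself a cocycle: the trinomial coefficient at X^i Y^j Z^(n-i-j)
  is computed in two ways, and nu(n) is cancelled.\<close>

lemma cocycle_coeff_rel:
 assumes "0 < i" "0 < j" "i + j < n"
 shows "(i + j choose i) * cocycle_coeff n (i + j) = (n - i choose j) * cocycle_coeff n i"
proof -
 have "(n choose (i + j)) * (i + j choose i) = (n choose i) * (n - i choose j)"
  using choose_mult[of i "i + j" n] assms by simp
 then have "nu n * ((i + j choose i) * cocycle_coeff n (i + j)) = nu n * ((n - i choose j) * cocycle_coeff n i)"
  using nu_times_cocycle_coeff[of i n, symmetric] nu_times_cocycle_coeff[of "i + j" n, symmetric] assms
  by (simp add: ac_simps)
 then show ?thesis using nu_pos[of n] by simp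
qed

lemma cocycle_coeff_sym: "i < n \<Longrightarrow> cocycle_coeff n (n - i) = cocycle_coeff n i"
 by (simp add: cocycle_coeff_def binomial_symmetric[of i n])

text \<open>The index of the coefficient that generates all the others after localisation at \<open>p\<close>.\<close>

definition pivot :: "nat \<Rightarrow> nat \<Rightarrow> nat" where
 "pivot p n = (if \<exists>K. n = p ^ Suc K then n div p else p ^ multiplicity p n)"

lemma pivot_less:
 assumes p: "Factorial_Ring.prime p" and n: "1 < n"
 shows "0 < pivot p n" "pivot p n < n"
proof -
 have p1: "p > 1" using p by (rule prime_gt_1_nat)
 show "0 < pivot p n" using p1 by (auto simp: pivot_def)
 show "pivot p n < n"
 proof (cases "\<exists>K. n = p ^ Suc K")
  case True
  then show ?thesis using p1 n by (auto simp: pivot_def)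
 next
  case False
  have "p ^ multiplicity p n \<le> n" using n by (intro dvd_imp_le multiplicity_dvd) auto
  moreover have "p ^ multiplicity p n \<noteq> n"
   using False n by (cases "multiplicity p n") auto
  ultimately show ?thesis using False by (simp add: pivot_def)
 qed
qed

text \<open>For n = p^(K+1) the quotient binomial(n, p^K) / p equals binomial(n - 1, p^K - 1). Were
  it divisible by p, Pascal's rule would make binomial(n - 1, p^K) divisible as well, but the digit
  of n - 1 at p^K is p - 1. For other n the pivot is the exact power of p in n; the digit of n there
  is non-zero, so already binomial(n, pivot) is prime to p.\<close>

lemma coprime_cocycle_coeff_pivot:
 assumes p: "Factorial_Ring.prime p" and n: "1 < n"
 shows "\<not> p dvd cocycle_coeff n (pivot p n)"
proof (cases "\<exists>K. n = p ^ Suc K")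
 case True
 then obtain K where K: "n = p ^ Suc K" by auto
 have p1: "p > 1" using p by (rule prime_gt_1_nat)
 have piv: "pivot p n = p ^ K" using K p1 by (auto simp: pivot_def)
 have nu: "nu n = p" unfolding K by (rule nu_prime_power[OF p]) simp
 let ?q = "p ^ K"
 have q: "0 < ?q" "?q < n" using p1 by (auto simp: K)
 have "?q * (n choose ?q) = n * (n - 1 choose (?q - 1))"
  using times_binomial_minus1_eq[OF q(1)] .
 then have "?q * (n choose ?q) = ?q * (p * (n - 1 choose (?q - 1)))" by (simp add: K mult_ac)
 then have e: "(n choose ?q) = p * (n - 1 choose (?q - 1))" using q p1 by simp
 then have "cocycle_coeff n ?q = (n - 1 choose (?q - 1))"
  using p1 by (simp add: cocycle_coeff_def nu)
 moreover have "\<not> p dvd (n - 1 choose (?q - 1))"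
 proof
  assume d: "p dvd (n - 1 choose (?q - 1))"
  have "(n choose ?q) = (n - 1 choose (?q - 1)) + (n - 1 choose ?q)"
   using q binomial_Suc_Suc[of "n - 1" "?q - 1"] by simp
  then have "p dvd (n - 1 choose ?q)" using d e by (metis dvd_add_right_iff dvd_triv_left)
  then have "p dvd (n - 1) div ?q" using choose_prime_power_dvd_iff[OF p] by blast
  moreover have "(n - 1) div ?q = p - 1"
  proof -
   have "n - 1 = (p - 1) * ?q + (?q - 1)"
    using q p1 by (simp add: K algebra_simps)
   then have "n - 1 = (?q - 1) + (p - 1) * ?q" by linarith
   moreover have "((?q - 1) + (p - 1) * ?q) div ?q = (p - 1) + (?q - 1) div ?q"
    using q(1) by (intro div_mult_self1) auto
   ultimately show ?thesis using q(1) by simp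
  qed
  ultimately show False using p1 by (auto dest: dvd_imp_le)
 qed
 ultimately show ?thesis using piv by simp
next
 case False
 have "\<not> p dvd (n choose pivot p n)"
  using False choose_prime_power_dvd_iff[OF p] not_dvd_div_prime_power_multiplicity[OF p, of n] n
  by (simp add: pivot_def)
 then show ?thesis
  using nu_times_cocycle_coeff[OF pivot_less[OF p n]] by (metis dvd_mult)
qed

section \<open>Symmetric 2-cocycles with values in an abelian group: Lazard's lemma\<close>

context abelian_group
begin

text \<open>\<open>e i\<close> is the coefficient at X^i Y^(n-i) of a symmetric form f of degree n.
  The second condition compares the coefficients at X^i Y^j Z^(n-i-j) in f(X, Y) + f(X + Y, Z) =
  f(Y, Z) + f(X, Y + Z); the outer terms f(X, Y) and f(Y, Z) have no monomial in which all three
  variables occur.\<close>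

definition symm_cocycle :: "nat \<Rightarrow> (nat \<Rightarrow> 'a) \<Rightarrow> bool" where
 "symm_cocycle n e \<longleftrightarrow> (\<forall>i. 0 < i \<and> i < n \<longrightarrow> e i \<in> carrier G \<and> e (n - i) = e i) \<and>
   (\<forall>i j. 0 < i \<and> 0 < j \<and> i + j < n \<longrightarrow>
    add_pow G (int (i + j choose i)) (e (i + j)) = add_pow G (int (n - i choose j)) (e i))"

text \<open>After localisation at p, \<open>e j\<close> is (s / t) times \<open>e q\<close>, with
  the same factor as for the coefficients of Lazard's polynomial. The equation for the coefficients
  is carried along so that two relations to a common \<open>q\<close> can be compared.\<close>

definition loc_multiple :: "nat \<Rightarrow> nat \<Rightarrow> (nat \<Rightarrow> 'a) \<Rightarrow> nat \<Rightarrow> nat \<Rightarrow> bool" where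
 "loc_multiple p n e q j \<longleftrightarrow> (\<exists>t s::int. \<not> int p dvd t \<and> add_pow G t (e j) = add_pow G s (e q) \<and>
   t * int (cocycle_coeff n j) = s * int (cocycle_coeff n q))"

lemma add_pow_int_0 [simp]: "add_pow G (0::int) x = \<zero>"
 by (simp add: add_pow_int_ge)

lemma add_pow_int_1 [simp]: "x \<in> carrier G \<Longrightarrow> add_pow G (1::int) x = x"
 by (simp add: add_pow_int_ge)

lemma symm_cocycle_closed: "symm_cocycle n e \<Longrightarrow> 0 < i \<Longrightarrow> i < n \<Longrightarrow> e i \<in> carrier G"
 by (simp add: symm_cocycle_def)

context
 fixes n :: nat and e and p :: nat
 assumes e: "symm_cocycle n e" and p: "Factorial_Ring.prime p" and n: "1 < n"
begin

lemmas e_closed = symm_cocycle_closed[OF e]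

lemma loc_multiple_refl: "loc_multiple p n e q q"
 unfolding loc_multiple_def using p prime_gt_1_nat[OF p]
 by (intro exI[of _ 1]) (auto simp: zdvd_not_zless)

lemma loc_multiple_trans:
 assumes "loc_multiple p n e q j" "loc_multiple p n e r q" "0 < q" "q < n" "0 < j" "j < n" "0 < r" "r < n"
 shows "loc_multiple p n e r j"
proof -
 obtain t s t' s' :: int where t: "\<not> int p dvd t" "add_pow G t (e j) = add_pow G s (e q)"
   "t * int (cocycle_coeff n j) = s * int (cocycle_coeff n q)"
  and t': "\<not> int p dvd t'" "add_pow G t' (e q) = add_pow G s' (e r)"
   "t' * int (cocycle_coeff n q) = s' * int (cocycle_coeff n r)"
  using assms(1,2) unfolding loc_multiple_def by blast
 note c = e_closed[OF assms(3,4)] e_closed[OF assms(5,6)] e_closed[OF assms(7,8)]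
 have "add_pow G (t * t') (e j) = add_pow G t' (add_pow G t (e j))"
  using c by (simp add: add.int_pow_pow)
 also have "\<dots> = add_pow G (s * t') (e q)" using c t by (simp add: add.int_pow_pow)
 also have "\<dots> = add_pow G (t' * s) (e q)" by (simp add: mult.commute)
 also have "\<dots> = add_pow G s (add_pow G t' (e q))" using c by (simp add: add.int_pow_pow)
 also have "\<dots> = add_pow G (s' * s) (e r)" using c t' by (simp add: add.int_pow_pow)
 finally have "add_pow G (t * t') (e j) = add_pow G (s' * s) (e r)" .
 moreover have "(t * t') * int (cocycle_coeff n j) = (s' * s) * int (cocycle_coeff n r)"
  using t(3) t'(3) by (metis mult.assoc mult.left_commute)
 moreover have "\<not> int p dvd t * t'" using t t' p by (simp add: prime_dvd_mult_iff)
 ultimately show ?thesis unfolding loc_multiple_def by blast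
qed

lemma loc_multiple_sym_index: "0 < j \<Longrightarrow> j < n \<Longrightarrow> loc_multiple p n e q (n - j) \<Longrightarrow> loc_multiple p n e q j"
 using e cocycle_coeff_sym[of j n] by (simp add: loc_multiple_def symm_cocycle_def)

text \<open>The cocycle condition at the exponents p^a and k - p^a expresses binomial(k, p^a) e(k)
  as a multiple of e(p^a). The binomial coefficient is prime to p because the digit of k at p^a is
  non-zero.\<close>

lemma loc_multiple_digit:
 assumes k: "0 < k" "k < n" and a: "\<not> p dvd k div p ^ a"
 shows "loc_multiple p n e (p ^ a) k"
proof (cases "k = p ^ a")
 case True
 then show ?thesis using loc_multiple_refl by simp
next
 case False
 have "p ^ a \<le> k" using a by (metis div_less dvd_0_right not_le)
 then have lt: "p ^ a < k" using False by simp
 have pos: "0 < p ^ a" using prime_gt_0_nat[OF p] by simp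
 have R: "add_pow G (int (k choose p ^ a)) (e k) = add_pow G (int (n - p ^ a choose (k - p ^ a))) (e (p ^ a))"
  using e[unfolded symm_cocycle_def, THEN conjunct2, rule_format, of "p ^ a" "k - p ^ a"] lt pos k
  by simp
 have "int (k choose p ^ a) * int (cocycle_coeff n k) =
   int (n - p ^ a choose (k - p ^ a)) * int (cocycle_coeff n (p ^ a))"
  using cocycle_coeff_rel[of "p ^ a" "k - p ^ a" n] lt pos k by (simp flip: of_nat_mult)
 moreover have "\<not> int p dvd int (k choose p ^ a)"
  using a choose_prime_power_dvd_iff[OF p] by simp
 ultimately show ?thesis using R unfolding loc_multiple_def by blast
qed

lemma loc_multiple_lower:
 assumes k: "0 < k" "k < n"
 shows "loc_multiple p n e (p ^ multiplicity p k) k"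
  "p ^ multiplicity p k < n" "0 < p ^ multiplicity p k"
proof -
 show "loc_multiple p n e (p ^ multiplicity p k) k"
  by (rule loc_multiple_digit[OF k]) (rule not_dvd_div_prime_power_multiplicity[OF p k(1)])
 have "p ^ multiplicity p k \<le> k" using k by (intro dvd_imp_le multiplicity_dvd) auto
 then show "p ^ multiplicity p k < n" using k by simp
 show "0 < p ^ multiplicity p k" using prime_gt_0_nat[OF p] by simp
qed

text \<open>Every k is reduced to p^a, the exact power of p in k, by its lowest non-zero digit. It
  remains to link p^a to the pivot, where the symmetry of e allows n - p^a to be used in place of
  p^a. If n = p^(K+1) and a < K, the digit of n - p^a at p^K is p - 1. Otherwise let p^v be the
  exact power of p in n: multiples of p^v are linked to it directly, and p^a with a < v is linked
  through a power p^b with b at least v.\<close>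

lemma loc_multiple_pivot:
 assumes k: "0 < k" "k < n"
 shows "loc_multiple p n e (pivot p n) k"
proof -
 have p1: "p > 1" using p by (rule prime_gt_1_nat)
 note piv = pivot_less[OF p n]
 show ?thesis
 proof (cases "\<exists>K. n = p ^ Suc K")
  case True
  then obtain K where K: "n = p ^ Suc K" by auto
  have pK: "pivot p n = p ^ K" using K p1 by (auto simp: pivot_def)
  define a where "a = multiplicity p k"
  note low = loc_multiple_lower[OF k, folded a_def]
  have aK: "a \<le> K" using low(2) p1 unfolding K by (simp add: power_strict_increasing_iff less_Suc_eq_le del: power_Suc)
  have "loc_multiple p n e (p ^ K) (p ^ a)"
  proof (cases "a = K")
   case True
   then show ?thesis using loc_multiple_refl by simp
  next
   case False
   then have "p ^ a < p ^ K" using aK p1 by simp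
   then have "(n - p ^ a) div p ^ K = p - 1"
   proof -
    have "n - p ^ a = (p - 1) * p ^ K + (p ^ K - p ^ a)"
     using \<open>p ^ a < p ^ K\<close> p1 by (simp add: K algebra_simps)
    then have nq: "n - p ^ a = (p ^ K - p ^ a) + (p - 1) * p ^ K" by linarith
    have "((p ^ K - p ^ a) + (p - 1) * p ^ K) div p ^ K = (p - 1) + (p ^ K - p ^ a) div p ^ K"
     using p1 by (intro div_mult_self1) auto
    also have "(p ^ K - p ^ a) div p ^ K = 0"
     by (rule div_less, rule diff_less) (use low(3) p1 in auto)
    finally show ?thesis unfolding nq by simp
   qed
   then have "\<not> p dvd (n - p ^ a) div p ^ K" using p1 by (auto dest: dvd_imp_le)
   then have "loc_multiple p n e (p ^ K) (n - p ^ a)"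
    using low by (intro loc_multiple_digit) auto
   from this show ?thesis by (rule loc_multiple_sym_index[rotated 2]) (use low in auto)
  qed
  then show ?thesis using low loc_multiple_trans[of "p ^ a" k "p ^ K"] k piv pK by simp
 next
  case False
  define v where "v = multiplicity p n"
  have pv: "pivot p n = p ^ v" using False by (simp add: pivot_def v_def)
  have ndiv: "\<not> p dvd n div p ^ v" unfolding v_def using p n by (intro not_dvd_div_prime_power_multiplicity) auto
  have dn: "p ^ v dvd n" unfolding v_def by (rule multiplicity_dvd)
  \<comment> \<open>If the digit of k at p^v is zero, then that of n - k is not: both numbers are
    multiples of p^v, and n / p^v is prime to p.\<close>
  have ge: "loc_multiple p n e (p ^ v) k" if k: "0 < k" "k < n" and d: "p ^ v dvd k" for k
  proof (cases "p dvd k div p ^ v")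
   case False
   then show ?thesis using k by (intro loc_multiple_digit)
  next
   case True
   have "(n - k) div p ^ v = n div p ^ v - k div p ^ v"
    using d dn p1 by (auto elim!: dvdE simp flip: diff_mult_distrib2)
   moreover have "k div p ^ v \<le> n div p ^ v" using k by (simp add: div_le_mono)
   ultimately have "\<not> p dvd (n - k) div p ^ v"
    using True ndiv by (metis dvd_diffD)
   then have "loc_multiple p n e (p ^ v) (n - k)" using k by (intro loc_multiple_digit) auto
   from this show ?thesis by (rule loc_multiple_sym_index[rotated 2]) (use k in auto)
  qed
  define a where "a = multiplicity p k"
  note low = loc_multiple_lower[OF k, folded a_def]
  have "loc_multiple p n e (p ^ v) (p ^ a)"
  proof (cases "v \<le> a")
   case True
   then show ?thesis using low by (intro ge) (auto intro: le_imp_power_dvd)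
  next
   case False
   \<comment> \<open>p^b is to be the place of the lowest non-zero digit of n - p^a at or above p^v.
     It exists because n is at least 2 p^v, whence n - p^a is at least p^v.\<close>
   define M where "M = (n - p ^ a) div p ^ v"
   have "2 * p ^ v \<le> n"
   proof -
    obtain l where l: "n = p ^ v * l" using dn by (rule dvdE)
    have "l \<noteq> 0" "l \<noteq> 1" using piv(2) n unfolding pv by (auto simp: l)
    then have "2 \<le> l" by linarith
    then show ?thesis by (simp add: l)
   qed
   moreover have "p ^ a \<le> p ^ v" using False p1 by (intro power_increasing) auto
   ultimately have "p ^ v \<le> n - p ^ a" by linarith
   then have M: "M > 0" using p1 by (simp add: M_def div_greater_zero_iff)
   define b where "b = v + multiplicity p M"
   have "(n - p ^ a) div p ^ b = M div p ^ multiplicity p M"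
    by (simp add: b_def M_def power_add div_mult2_eq)
   then have nd: "\<not> p dvd (n - p ^ a) div p ^ b" using not_dvd_div_prime_power_multiplicity[OF p M] by simp
   then have "loc_multiple p n e (p ^ b) (n - p ^ a)" using low by (intro loc_multiple_digit) auto
   from this have 1: "loc_multiple p n e (p ^ b) (p ^ a)" by (rule loc_multiple_sym_index[rotated 2]) (use low in auto)
   have "p ^ b \<le> n - p ^ a" using nd by (metis div_less dvd_0_right not_le)
   then have b: "0 < p ^ b" "p ^ b < n" using p1 low(2,3) by (simp, linarith)
   then have "loc_multiple p n e (p ^ v) (p ^ b)" by (intro ge) (auto simp: b_def power_add)
   then show ?thesis using 1 b low(2,3) piv[unfolded pv] by (intro loc_multiple_trans[of "p ^ b" "p ^ a" "p ^ v"])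
  qed
  then show ?thesis using low loc_multiple_trans[of "p ^ a" k "p ^ v"] k piv pv by simp
 qed
qed

end

text \<open>Localised at p, both \<open>e i\<close> and \<open>e j\<close> are multiples of
  e(pivot), in the ratio of the coefficients. Hence the difference x of the two sides is annihilated
  by an integer prime to p. As this holds for every prime p, the annihilator of x consists of all
  integers.\<close>

lemma symm_cocycle_proportional:
 assumes e: "symm_cocycle n e" and n: "1 < n" and i: "0 < i" "i < n" and j: "0 < j" "j < n"
 shows "add_pow G (int (cocycle_coeff n i)) (e j) = add_pow G (int (cocycle_coeff n j)) (e i)"
proof -
 let ?c = "\<lambda>i. int (cocycle_coeff n i)"
 define x where "x = add_pow G (?c i) (e j) \<ominus> add_pow G (?c j) (e i)"
 have c: "e k \<in> carrier G" if "0 < k" "k < n" for k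
  using that by (rule symm_cocycle_closed[OF e])
 have x: "x \<in> carrier G" using c i j by (simp add: x_def)
 define D where "D = {k::int. add_pow G k x = \<zero>}"
 have D_add: "k + l \<in> D" if "k \<in> D" "l \<in> D" for k l
  using that x by (simp add: D_def add.int_pow_mult)
 have D_mult: "k * l \<in> D" if "k \<in> D" for k l
  using that x by (simp add: D_def add.int_pow_pow[symmetric])
 have "\<exists>k\<in>D. \<not> int p dvd k" if p: "Factorial_Ring.prime p" for p :: nat
 proof -
  let ?q = "pivot p n"
  note q = pivot_less[OF p n]
  obtain t s where t: "\<not> int p dvd t" "add_pow G t (e j) = add_pow G s (e ?q)" "t * ?c j = s * ?c ?q"
   using loc_multiple_pivot[OF e p n j] unfolding loc_multiple_def by blast
  obtain t' s' where t': "\<not> int p dvd t'" "add_pow G t' (e i) = add_pow G s' (e ?q)" "t' * ?c i = s' * ?c ?q"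
   using loc_multiple_pivot[OF e p n i] unfolding loc_multiple_def by blast
  have "add_pow G (t * t') (add_pow G (?c i) (e j)) = add_pow G (t' * ?c i) (add_pow G t (e j))"
   using c j by (simp add: add.int_pow_pow ac_simps)
  also have "\<dots> = add_pow G (s * (t' * ?c i)) (e ?q)" using c q t by (simp add: add.int_pow_pow)
  also have "s * (t' * ?c i) = s' * (t * ?c j)" using t(3) t'(3) by simp
  also have "add_pow G (s' * (t * ?c j)) (e ?q) = add_pow G (t * ?c j) (add_pow G t' (e i))"
   using c q t' by (simp add: add.int_pow_pow)
  also have "\<dots> = add_pow G (t * t') (add_pow G (?c j) (e i))"
   using c i by (simp add: add.int_pow_pow ac_simps)
  finally have "add_pow G (t * t') x = \<zero>"
   using c i j unfolding x_def a_minus_def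
   by (simp add: add.int_pow_distrib add.int_pow_inv r_neg)
  moreover have "\<not> int p dvd t * t'" using t t' p by (simp add: prime_dvd_mult_iff)
  ultimately show ?thesis by (auto simp: D_def)
 qed
 have "1 \<in> D"
 proof -
  \<comment> \<open>The prime 2 merely exhibits some non-zero annihilator, so that a least positive
    one exists.\<close>
  obtain k0 where k0: "k0 \<in> D" "\<not> int 2 dvd k0"
   using \<open>\<And>p. Factorial_Ring.prime p \<Longrightarrow> \<exists>k\<in>D. \<not> int p dvd k\<close>[of 2] two_is_prime_nat by auto
  define k where "k = (LEAST k. 0 < k \<and> int k \<in> D)"
  have "0 < nat \<bar>k0\<bar> \<and> int (nat \<bar>k0\<bar>) \<in> D"
   using k0 D_mult[of k0 "-1"] D_mult[of k0 1] by (cases "k0 = 0"; cases "k0 \<ge> 0") auto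
  then have k: "0 < k" "int k \<in> D" unfolding k_def by (metis (mono_tags, lifting) LeastI)+
  have kd: "int k dvd l" if l: "l \<in> D" for l
  proof -
   have "l mod int k = l + int k * - (l div int k)" by (simp add: minus_div_mult_eq_mod[symmetric] mult.commute)
   then have m: "l mod int k \<in> D" using D_add[OF l D_mult[OF k(2)]] by (simp only:)
   have "\<not> (0 < nat (l mod int k) \<and> int (nat (l mod int k)) \<in> D)"
    using not_less_Least[of "nat (l mod int k)" "\<lambda>k. 0 < k \<and> int k \<in> D"] k(1)
    by (simp add: k_def[symmetric] nat_less_iff)
   moreover have ge: "0 \<le> l mod int k" using k(1) by simp
   ultimately have "l mod int k = 0" using m by force
   then show ?thesis by (rule mod_0_imp_dvd)
  qed
  have "k = 1"
  proof (rule ccontr)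
   assume "k \<noteq> 1"
   then obtain p where p: "Factorial_Ring.prime p" "p dvd k" using prime_factor_nat by blast
   obtain l where "l \<in> D" "\<not> int p dvd l"
    using \<open>\<And>p. Factorial_Ring.prime p \<Longrightarrow> \<exists>k\<in>D. \<not> int p dvd k\<close>[OF p(1)] by auto
   then show False using kd p by (meson dvd_trans int_dvd_int_iff)
  qed
  then show ?thesis using k by simp
 qed
 then have "x = \<zero>" using x by (simp add: D_def)
 then show ?thesis using c i j unfolding x_def by (simp add: minus_zero_iff)
qed

end

lemma exists_int_combination_Gcd:
 fixes c :: "'i \<Rightarrow> int"
 assumes "finite S"
 shows "\<exists>u. (\<Sum>i\<in>S. u i * c i) = Gcd (c ` S)"
 using assms
proof (induction S)
 case (insert k S)
 then obtain u where u: "(\<Sum>i\<in>S. u i * c i) = Gcd (c ` S)" by auto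
 obtain v w where vw: "v * c k + w * Gcd (c ` S) = gcd (c k) (Gcd (c ` S))"
  using bezout_int by blast
 have "(\<Sum>i\<in>insert k S. (if i = k then v else w * u i) * c i) = v * c k + (\<Sum>i\<in>S. w * (u i * c i))"
  using insert.hyps by (auto intro!: sum.cong)
 then show ?case using vw u by (auto simp: sum_distrib_left[symmetric] intro!: exI[of _ "\<lambda>i. if i = k then v else w * u i"])
qed simp

text \<open>A prime dividing all coefficients would divide the one at its pivot.\<close>

lemma cocycle_coeff_bezout:
 assumes n: "1 < n"
 shows "\<exists>u::nat \<Rightarrow> int. (\<Sum>i\<in>{0<..<n}. u i * int (cocycle_coeff n i)) = 1"
proof -
 let ?g = "Gcd ((\<lambda>i. int (cocycle_coeff n i)) ` {0<..<n})"
 have "is_unit ?g"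
 proof (rule ccontr)
  assume nu: "\<not> is_unit ?g"
  have "nat ?g \<noteq> 1" using nu by auto
  then obtain p where p: "Factorial_Ring.prime p" "p dvd nat ?g" using prime_factor_nat by blast
  have "int p dvd int (nat ?g)" using p(2) int_dvd_int_iff by blast
  then have "int p dvd ?g" by simp
  also have "?g dvd int (cocycle_coeff n (pivot p n))"
   using pivot_less[OF p(1) n] by (intro Gcd_dvd) auto
  finally show False using coprime_cocycle_coeff_pivot[OF p(1) n] by simp
 qed
 then have "?g = 1" by (simp add: zdvd1_eq)
 then show ?thesis using exists_int_combination_Gcd[of "{0<..<n}" "\<lambda>i. int (cocycle_coeff n i)"] by auto
qed

context abelian_group
begin

lemma add_pow_int_sum:
 assumes "finite S" "x \<in> carrier G"
 shows "add_pow G (\<Sum>i\<in>S. k i) x = (\<Oplus>i\<in>S. add_pow G (k i :: int) x)"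
 using assms by (induction S rule: finite_induct) (auto simp: add.int_pow_mult)

lemma add_pow_int_finsum:
 assumes "finite S" "f \<in> S \<rightarrow> carrier G"
 shows "add_pow G (k :: int) (\<Oplus>i\<in>S. f i) = (\<Oplus>i\<in>S. add_pow G k (f i))"
 using assms by (induction S rule: finite_induct) (auto simp: add.int_pow_distrib Pi_iff)

text \<open>With integers u_i such that the sum of u_i c_i is 1, the class d can only be the sum of
  u_i e_i. That this d works for every index j is the proportionality c_j e_i = c_i e_j.\<close>

theorem symm_cocycle_unique_multiple:
 assumes e: "symm_cocycle n e" and n: "1 < n"
 shows "\<exists>!d. d \<in> carrier G \<and> (\<forall>i. 0 < i \<and> i < n \<longrightarrow> e i = add_pow G (int (cocycle_coeff n i)) d)"
proof -
 let ?c = "\<lambda>i. int (cocycle_coeff n i)"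
 obtain u :: "nat \<Rightarrow> int" where u: "(\<Sum>i\<in>{0<..<n}. u i * ?c i) = 1"
  using cocycle_coeff_bezout[OF n] by blast
 have c: "e k \<in> carrier G" if "0 < k" "k < n" for k using that by (rule symm_cocycle_closed[OF e])
 define d where "d = (\<Oplus>i\<in>{0<..<n}. add_pow G (u i) (e i))"
 have d: "d \<in> carrier G" using c by (auto simp: d_def)
 have comb: "y = (\<Oplus>i\<in>{0<..<n}. add_pow G (u i) (add_pow G (?c i) y))" if "y \<in> carrier G" for y
 proof -
  have "y = add_pow G (\<Sum>i\<in>{0<..<n}. u i * ?c i) y" using u that by simp
  also have "\<dots> = (\<Oplus>i\<in>{0<..<n}. add_pow G (u i * ?c i) y)" using that by (intro add_pow_int_sum) auto
  also have "\<dots> = (\<Oplus>i\<in>{0<..<n}. add_pow G (u i) (add_pow G (?c i) y))"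
   using that by (simp add: add.int_pow_pow mult.commute)
  finally show ?thesis .
 qed
 show ?thesis
 proof (intro ex1I[of _ d] conjI allI impI)
  show "d \<in> carrier G" by (rule d)
  show "e j = add_pow G (?c j) d" if j: "0 < j \<and> j < n" for j
  proof -
   have "add_pow G (?c j) d = (\<Oplus>i\<in>{0<..<n}. add_pow G (?c j) (add_pow G (u i) (e i)))"
    unfolding d_def using c by (intro add_pow_int_finsum) auto
   also have "\<dots> = (\<Oplus>i\<in>{0<..<n}. add_pow G (u i) (add_pow G (?c i) (e j)))"
   proof (intro add.finprod_cong' refl)
    fix i assume i: "i \<in> {0<..<n}"
    have "add_pow G (?c j) (add_pow G (u i) (e i)) = add_pow G (u i) (add_pow G (?c j) (e i))"
     using c i by (simp add: add.int_pow_pow mult.commute)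
    also have "add_pow G (?c j) (e i) = add_pow G (?c i) (e j)"
     using symm_cocycle_proportional[OF e n] i j by simp
    finally show "add_pow G (?c j) (add_pow G (u i) (e i)) = add_pow G (u i) (add_pow G (?c i) (e j))" .
   qed (use c j in auto)
   also have "\<dots> = e j" using comb c j by simp
   finally show ?thesis by simp
  qed
  show "d' = d" if d': "d' \<in> carrier G \<and> (\<forall>i. 0 < i \<and> i < n \<longrightarrow> e i = add_pow G (?c i) d')" for d'
  proof -
   have "d' = (\<Oplus>i\<in>{0<..<n}. add_pow G (u i) (add_pow G (?c i) d'))" using comb d' by blast
   also have "\<dots> = d" unfolding d_def using d' c by (intro add.finprod_cong') auto
   finally show ?thesis .
  qed
 qed
qed

end

section \<open>Symmetric algebras\<close>

lemma (in ring) mult_minus_distr: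
 assumes "x \<in> carrier R" "y \<in> carrier R" "z \<in> carrier R"
 shows "x \<otimes> (y \<ominus> z) = x \<otimes> y \<ominus> x \<otimes> z" "(y \<ominus> z) \<otimes> x = y \<otimes> x \<ominus> z \<otimes> x"
 using assms by (simp_all add: a_minus_def r_distr l_distr r_minus l_minus)

text \<open>The word algebra is a monoid algebra over a noncommutative monoid.\<close>

locale nc_mon_alg = cring R + G: Group.monoid G for R (structure) and G :: "('g, 'n) monoid_scheme"
begin

abbreviation MA where "MA \<equiv> monoid_algebra R G"
abbreviation C where "C \<equiv> carrier (free_module R (carrier G))"

lemma mult_superset:
 assumes "p \<in> C" "q \<in> C" "finite S" "finite T" "{s. p s \<noteq> \<zero>} \<subseteq> S" "{s. q s \<noteq> \<zero>} \<subseteq> T"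
 shows "(p \<otimes>\<^bsub>MA\<^esub> q) g =
  (\<Oplus>z\<in>S \<times> T. if fst z \<otimes>\<^bsub>G\<^esub> snd z = g then p (fst z) \<otimes> q (snd z) else \<zero>)"
 unfolding monoid_algebra_mult using assms
 by (intro add.finprod_mono_neutral_cong_left) (auto simp: carrier_free_module split: if_splits)

lemma mult_add_left:
 assumes "p \<in> C" "p' \<in> C" "q \<in> C"
 shows "(\<lambda>s. p s \<oplus> p' s) \<otimes>\<^bsub>MA\<^esub> q = (\<lambda>s. (p \<otimes>\<^bsub>MA\<^esub> q) s \<oplus> (p' \<otimes>\<^bsub>MA\<^esub> q) s)"
proof
 fix g
 let ?S = "{s. p s \<noteq> \<zero>} \<union> {s. p' s \<noteq> \<zero>}" and ?T = "{s. q s \<noteq> \<zero>}"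
 have fin: "finite ?S" "finite ?T" using assms by (auto simp: carrier_free_module)
 have c: "p s \<in> carrier R" "p' s \<in> carrier R" "q s \<in> carrier R" for s
  using assms by (auto simp: carrier_free_module)
 note sup = mult_superset[OF _ _ fin]
 have "((\<lambda>s. p s \<oplus> p' s) \<otimes>\<^bsub>MA\<^esub> q) g =
   (\<Oplus>z\<in>?S \<times> ?T. if fst z \<otimes>\<^bsub>G\<^esub> snd z = g then (p (fst z) \<oplus> p' (fst z)) \<otimes> q (snd z) else \<zero>)"
  by (intro sup assms free_module_closed) auto
 also have "\<dots> = (\<Oplus>z\<in>?S \<times> ?T. (if fst z \<otimes>\<^bsub>G\<^esub> snd z = g then p (fst z) \<otimes> q (snd z) else \<zero>) \<oplus>
   (if fst z \<otimes>\<^bsub>G\<^esub> snd z = g then p' (fst z) \<otimes> q (snd z) else \<zero>))"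
  using c by (intro add.finprod_cong') (auto simp: l_distr)
 also have "\<dots> = (\<Oplus>z\<in>?S \<times> ?T. (if fst z \<otimes>\<^bsub>G\<^esub> snd z = g then p (fst z) \<otimes> q (snd z) else \<zero>)) \<oplus>
   (\<Oplus>z\<in>?S \<times> ?T. (if fst z \<otimes>\<^bsub>G\<^esub> snd z = g then p' (fst z) \<otimes> q (snd z) else \<zero>))"
  using c by (intro finsum_addf) auto
 also have "\<dots> = (p \<otimes>\<^bsub>MA\<^esub> q) g \<oplus> (p' \<otimes>\<^bsub>MA\<^esub> q) g"
  by (intro arg_cong2[of _ _ _ _ add] arg_cong2[of _ _ _ _ "(\<oplus>)"] sup[symmetric] assms) auto
 finally show "((\<lambda>s. p s \<oplus> p' s) \<otimes>\<^bsub>MA\<^esub> q) g = (p \<otimes>\<^bsub>MA\<^esub> q) g \<oplus> (p' \<otimes>\<^bsub>MA\<^esub> q) g" .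
qed

lemma mult_add_right:
 assumes "p \<in> C" "p' \<in> C" "q \<in> C"
 shows "q \<otimes>\<^bsub>MA\<^esub> (\<lambda>s. p s \<oplus> p' s) = (\<lambda>s. (q \<otimes>\<^bsub>MA\<^esub> p) s \<oplus> (q \<otimes>\<^bsub>MA\<^esub> p') s)"
proof
 fix g
 let ?S = "{s. p s \<noteq> \<zero>} \<union> {s. p' s \<noteq> \<zero>}" and ?T = "{s. q s \<noteq> \<zero>}"
 have fin: "finite ?T" "finite ?S" using assms by (auto simp: carrier_free_module)
 have c: "p s \<in> carrier R" "p' s \<in> carrier R" "q s \<in> carrier R" for s
  using assms by (auto simp: carrier_free_module)
 note sup = mult_superset[OF _ _ fin]
 have "(q \<otimes>\<^bsub>MA\<^esub> (\<lambda>s. p s \<oplus> p' s)) g =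
   (\<Oplus>z\<in>?T \<times> ?S. if fst z \<otimes>\<^bsub>G\<^esub> snd z = g then q (fst z) \<otimes> (p (snd z) \<oplus> p' (snd z)) else \<zero>)"
  by (intro sup assms free_module_closed) auto
 also have "\<dots> = (\<Oplus>z\<in>?T \<times> ?S. (if fst z \<otimes>\<^bsub>G\<^esub> snd z = g then q (fst z) \<otimes> p (snd z) else \<zero>) \<oplus>
   (if fst z \<otimes>\<^bsub>G\<^esub> snd z = g then q (fst z) \<otimes> p' (snd z) else \<zero>))"
  using c by (intro add.finprod_cong') (auto simp: r_distr)
 also have "\<dots> = (\<Oplus>z\<in>?T \<times> ?S. (if fst z \<otimes>\<^bsub>G\<^esub> snd z = g then q (fst z) \<otimes> p (snd z) else \<zero>)) \<oplus>
   (\<Oplus>z\<in>?T \<times> ?S. (if fst z \<otimes>\<^bsub>G\<^esub> snd z = g then q (fst z) \<otimes> p' (snd z) else \<zero>))"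
  using c by (intro finsum_addf) auto
 also have "\<dots> = (q \<otimes>\<^bsub>MA\<^esub> p) g \<oplus> (q \<otimes>\<^bsub>MA\<^esub> p') g"
  by (intro arg_cong2[of _ _ _ _ "(\<oplus>)"] sup[symmetric] assms) auto
 finally show "(q \<otimes>\<^bsub>MA\<^esub> (\<lambda>s. p s \<oplus> p' s)) g = (q \<otimes>\<^bsub>MA\<^esub> p) g \<oplus> (q \<otimes>\<^bsub>MA\<^esub> p') g" .
qed

lemma mult_smult:
 assumes "p \<in> C" "q \<in> C" "a \<in> carrier R"
 shows "(\<lambda>s. a \<otimes> p s) \<otimes>\<^bsub>MA\<^esub> q = (\<lambda>s. a \<otimes> (p \<otimes>\<^bsub>MA\<^esub> q) s)"
  and "p \<otimes>\<^bsub>MA\<^esub> (\<lambda>s. a \<otimes> q s) = (\<lambda>s. a \<otimes> (p \<otimes>\<^bsub>MA\<^esub> q) s)"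
proof -
 let ?S = "{s. p s \<noteq> \<zero>}" and ?T = "{s. q s \<noteq> \<zero>}"
 have fin: "finite ?S" "finite ?T" using assms by (auto simp: carrier_free_module)
 have c: "p s \<in> carrier R" "q s \<in> carrier R" for s
  using assms by (auto simp: carrier_free_module)
 note sup = mult_superset[OF _ _ fin]
 have r: "a \<otimes> (p \<otimes>\<^bsub>MA\<^esub> q) g =
   (\<Oplus>z\<in>?S \<times> ?T. a \<otimes> (if fst z \<otimes>\<^bsub>G\<^esub> snd z = g then p (fst z) \<otimes> q (snd z) else \<zero>))" for g
  unfolding sup[OF assms(1,2) order_refl order_refl]
  using c fin assms by (intro finsum_rdistr) auto
 show "(\<lambda>s. a \<otimes> p s) \<otimes>\<^bsub>MA\<^esub> q = (\<lambda>s. a \<otimes> (p \<otimes>\<^bsub>MA\<^esub> q) s)"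
 proof
  fix g
  have "((\<lambda>s. a \<otimes> p s) \<otimes>\<^bsub>MA\<^esub> q) g =
    (\<Oplus>z\<in>?S \<times> ?T. if fst z \<otimes>\<^bsub>G\<^esub> snd z = g then (a \<otimes> p (fst z)) \<otimes> q (snd z) else \<zero>)"
   using assms by (intro sup free_module_closed) auto
  also have "\<dots> = a \<otimes> (p \<otimes>\<^bsub>MA\<^esub> q) g"
   unfolding r using c assms by (intro add.finprod_cong') (auto simp: m_assoc)
  finally show "((\<lambda>s. a \<otimes> p s) \<otimes>\<^bsub>MA\<^esub> q) g = a \<otimes> (p \<otimes>\<^bsub>MA\<^esub> q) g" .
 qed
 show "p \<otimes>\<^bsub>MA\<^esub> (\<lambda>s. a \<otimes> q s) = (\<lambda>s. a \<otimes> (p \<otimes>\<^bsub>MA\<^esub> q) s)"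
 proof
  fix g
  have "(p \<otimes>\<^bsub>MA\<^esub> (\<lambda>s. a \<otimes> q s)) g =
    (\<Oplus>z\<in>?S \<times> ?T. if fst z \<otimes>\<^bsub>G\<^esub> snd z = g then p (fst z) \<otimes> (a \<otimes> q (snd z)) else \<zero>)"
   using assms by (intro sup free_module_closed) auto
  also have "\<dots> = a \<otimes> (p \<otimes>\<^bsub>MA\<^esub> q) g"
   unfolding r using c assms by (intro add.finprod_cong') (auto simp: m_lcomm)
  finally show "(p \<otimes>\<^bsub>MA\<^esub> (\<lambda>s. a \<otimes> q s)) g = a \<otimes> (p \<otimes>\<^bsub>MA\<^esub> q) g" .
 qed
qed

lemma mult_zero: "(\<lambda>s. \<zero>) \<otimes>\<^bsub>MA\<^esub> q = (\<lambda>s. \<zero>)" "q \<otimes>\<^bsub>MA\<^esub> (\<lambda>s. \<zero>) = (\<lambda>s. \<zero>)"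
 by (simp_all add: monoid_algebra_mult)

lemma mult_basis:
 assumes "s \<in> carrier G" "t \<in> carrier G"
 shows "basis_elt R s \<otimes>\<^bsub>MA\<^esub> basis_elt R t = basis_elt R (s \<otimes>\<^bsub>G\<^esub> t)"
proof
 fix g
 have "(basis_elt R s \<otimes>\<^bsub>MA\<^esub> basis_elt R t) g = (\<Oplus>z\<in>{s} \<times> {t}.
   if fst z \<otimes>\<^bsub>G\<^esub> snd z = g then basis_elt R s (fst z) \<otimes> basis_elt R t (snd z) else \<zero>)"
  using assms by (intro mult_superset free_module_closed) (auto simp: basis_elt_def)
 then show "(basis_elt R s \<otimes>\<^bsub>MA\<^esub> basis_elt R t) g = basis_elt R (s \<otimes>\<^bsub>G\<^esub> t) g"
  by (auto simp: basis_elt_def)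
qed

lemma mult_closed:
 assumes "p \<in> C" "q \<in> C"
 shows "p \<otimes>\<^bsub>MA\<^esub> q \<in> C"
 using assms(1)
proof (induction rule: free_module_induct)
 case zero
 then show ?case by (simp add: mult_zero free_module_closed)
next
 case (basis a s p)
 have "basis_elt R s \<otimes>\<^bsub>MA\<^esub> q \<in> C" using assms(2)
  by (induction rule: free_module_induct)
   (use basis in \<open>simp_all add: mult_zero mult_add_right mult_smult mult_basis free_module_closed\<close>)
 with basis show ?case
  by (simp add: mult_add_left mult_smult free_module_closed assms)
qed

lemma mult_assoc:
 assumes "p \<in> C" "q \<in> C" "r \<in> C"
 shows "(p \<otimes>\<^bsub>MA\<^esub> q) \<otimes>\<^bsub>MA\<^esub> r = p \<otimes>\<^bsub>MA\<^esub> (q \<otimes>\<^bsub>MA\<^esub> r)"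
proof -
 note cl = mult_closed free_module_closed assms(2,3)
 note simps = mult_zero mult_add_right mult_add_left mult_smult cl
 have 1: "(basis_elt R s \<otimes>\<^bsub>MA\<^esub> basis_elt R t) \<otimes>\<^bsub>MA\<^esub> r = basis_elt R s \<otimes>\<^bsub>MA\<^esub> (basis_elt R t \<otimes>\<^bsub>MA\<^esub> r)"
  if st: "s \<in> carrier G" "t \<in> carrier G" for s t
  using assms(3) by (induction rule: free_module_induct)
   (use st in \<open>simp_all add: simps mult_basis G.m_assoc\<close>)
 have 2: "(basis_elt R s \<otimes>\<^bsub>MA\<^esub> q) \<otimes>\<^bsub>MA\<^esub> r = basis_elt R s \<otimes>\<^bsub>MA\<^esub> (q \<otimes>\<^bsub>MA\<^esub> r)"
  if s: "s \<in> carrier G" for s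
  using assms(2) by (induction rule: free_module_induct)
   (use s 1[of s] in \<open>simp_all add: simps\<close>)
 show ?thesis using assms(1)
  by (induction rule: free_module_induct) (use 2 in \<open>simp_all add: simps\<close>)
qed

lemma mult_one:
 assumes "p \<in> C"
 shows "basis_elt R \<one>\<^bsub>G\<^esub> \<otimes>\<^bsub>MA\<^esub> p = p" "p \<otimes>\<^bsub>MA\<^esub> basis_elt R \<one>\<^bsub>G\<^esub> = p"
 using assms by (induction rule: free_module_induct)
  (simp_all add: mult_zero mult_add_right mult_add_left mult_smult free_module_closed mult_basis)

lemma MA_module: "module R MA" and MA_ring: "ring MA"
proof -
 interpret F: module R "free_module R (carrier G)" by (rule free_module_module)
 note simps = monoid_algebra_simps free_module_simps
 have ag: "abelian_group MA"
 proof (rule abelian_groupI)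
  fix p assume "p \<in> carrier MA"
  then have "p \<in> C" by (simp add: simps)
  then show "\<exists>y\<in>carrier MA. y \<oplus>\<^bsub>MA\<^esub> p = \<zero>\<^bsub>MA\<^esub>"
   using F.M.l_neg[of p] F.M.a_inv_closed[of p] by (auto simp: simps)
 qed (auto simp: free_module_closed free_moduleD a_ac simps)
 show "module R MA"
  by (rule moduleI[OF is_cring ag])
   (auto simp: free_module_closed free_moduleD l_distr r_distr m_assoc simps)
 show "ring MA"
 proof (rule ringI[OF ag])
  show "Group.monoid MA"
   by (rule monoidI) (auto simp: free_module_closed mult_closed mult_one mult_assoc simps)
 qed (auto simp: mult_add_left mult_add_right simps)
qed

lemma MA_mult_smult:
 assumes "a \<in> carrier R" "p \<in> carrier MA" "q \<in> carrier MA"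
 shows "(a \<odot>\<^bsub>MA\<^esub> p) \<otimes>\<^bsub>MA\<^esub> q = a \<odot>\<^bsub>MA\<^esub> (p \<otimes>\<^bsub>MA\<^esub> q)"
  "p \<otimes>\<^bsub>MA\<^esub> (a \<odot>\<^bsub>MA\<^esub> q) = a \<odot>\<^bsub>MA\<^esub> (p \<otimes>\<^bsub>MA\<^esub> q)"
 using assms mult_smult by (simp_all add: monoid_algebra_simps)

lemma basis_closed: "s \<in> carrier G \<Longrightarrow> basis_elt R s \<in> carrier MA"
 by (simp add: monoid_algebra_simps free_module_closed)

lemma MA_induct [consumes 1, case_names zero basis]:
 assumes "p \<in> carrier MA" "Q \<zero>\<^bsub>MA\<^esub>"
  "\<And>a s p. \<lbrakk>a \<in> carrier R; s \<in> carrier G; p \<in> carrier MA; Q p\<rbrakk> \<Longrightarrow> Q (a \<odot>\<^bsub>MA\<^esub> basis_elt R s \<oplus>\<^bsub>MA\<^esub> p)"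
 shows "Q p"
 using assms(1) unfolding monoid_algebra_simps
 by (induction rule: free_module_induct) (use assms(2,3) in \<open>simp_all add: monoid_algebra_simps\<close>)

end

section \<open>The symmetric algebra as a quotient of the word algebra\<close>

context module
begin

abbreviation "WA \<equiv> word_algebra R M"
abbreviation "SymI \<equiv> sym_ideal R M"
abbreviation "Sym \<equiv> sym_algebra R M"
abbreviation "word \<equiv> \<lambda>w. basis_elt R w"

lemma list_monoid_simps:
 "carrier (list_monoid V) = lists V" "u \<otimes>\<^bsub>list_monoid V\<^esub> v = u @ v" "\<one>\<^bsub>list_monoid V\<^esub> = []"
 by (simp_all add: list_monoid_def)

lemma nc_mon_alg_words: "nc_mon_alg R (list_monoid (carrier M))"
 by (intro nc_mon_alg.intro R.is_cring monoidI) (auto simp: list_monoid_simps)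

lemma WA_module: "module R WA" and WA_ring: "ring WA"
 using nc_mon_alg.MA_module[OF nc_mon_alg_words] nc_mon_alg.MA_ring[OF nc_mon_alg_words]
 by (simp_all add: word_algebra_def)

lemmas WA_mult_smult = nc_mon_alg.MA_mult_smult[OF nc_mon_alg_words, folded word_algebra_def]
 and WA_induct = nc_mon_alg.MA_induct[OF nc_mon_alg_words, folded word_algebra_def, unfolded list_monoid_simps, consumes 1, case_names zero basis]
 and word_closed = nc_mon_alg.basis_closed[OF nc_mon_alg_words, folded word_algebra_def, unfolded list_monoid_simps]
 and word_mult = nc_mon_alg.mult_basis[OF nc_mon_alg_words, folded word_algebra_def, unfolded list_monoid_simps]

lemma WA_one: "\<one>\<^bsub>WA\<^esub> = word []"
 by (simp add: word_algebra_def monoid_algebra_simps list_monoid_simps)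

lemma carrier_WA: "carrier WA = carrier (free_module R (lists (carrier M)))"
 by (simp add: word_algebra_def monoid_algebra_simps list_monoid_simps)

lemma sym_relationsI:
 "\<lbrakk>u \<in> lists (carrier M); v \<in> lists (carrier M); x \<in> carrier M; y \<in> carrier M\<rbrakk> \<Longrightarrow>
  word (u @ [x \<oplus>\<^bsub>M\<^esub> y] @ v) \<ominus>\<^bsub>WA\<^esub> (word (u @ [x] @ v) \<oplus>\<^bsub>WA\<^esub> word (u @ [y] @ v)) \<in> sym_relations R M"
 "\<lbrakk>u \<in> lists (carrier M); v \<in> lists (carrier M); x \<in> carrier M; a \<in> carrier R\<rbrakk> \<Longrightarrow>
  word (u @ [a \<odot>\<^bsub>M\<^esub> x] @ v) \<ominus>\<^bsub>WA\<^esub> (a \<odot>\<^bsub>WA\<^esub> word (u @ [x] @ v)) \<in> sym_relations R M"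
 "\<lbrakk>w \<in> lists (carrier M); w' \<in> lists (carrier M); mset w = mset w'\<rbrakk> \<Longrightarrow>
  word w \<ominus>\<^bsub>WA\<^esub> word w' \<in> sym_relations R M"
 unfolding sym_relations_def Let_def by blast+

lemma sym_relations_cases:
 assumes "r \<in> sym_relations R M"
 obtains (add) u v x y where "r = word (u @ [x \<oplus>\<^bsub>M\<^esub> y] @ v) \<ominus>\<^bsub>WA\<^esub> (word (u @ [x] @ v) \<oplus>\<^bsub>WA\<^esub> word (u @ [y] @ v))"
   "u \<in> lists (carrier M)" "v \<in> lists (carrier M)" "x \<in> carrier M" "y \<in> carrier M"
  | (smult) u v x a where "r = word (u @ [a \<odot>\<^bsub>M\<^esub> x] @ v) \<ominus>\<^bsub>WA\<^esub> (a \<odot>\<^bsub>WA\<^esub> word (u @ [x] @ v))"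
   "u \<in> lists (carrier M)" "v \<in> lists (carrier M)" "x \<in> carrier M" "a \<in> carrier R"
  | (perm) w w' where "r = word w \<ominus>\<^bsub>WA\<^esub> word w'"
   "w \<in> lists (carrier M)" "w' \<in> lists (carrier M)" "mset w = mset w'"
 using assms unfolding sym_relations_def Let_def by blast

lemma sym_relations_closed: "sym_relations R M \<subseteq> carrier WA"
proof
 interpret W: module R WA by (rule WA_module)
 fix r assume "r \<in> sym_relations R M"
 then show "r \<in> carrier WA"
  by (cases rule: sym_relations_cases) (auto intro!: W.M.minus_closed W.smult_closed W.M.a_closed word_closed)
qed

lemma SymI_submodule: "submodule SymI R WA"
 unfolding sym_ideal_def by (rule module.mod_span_submodule[OF WA_module sym_relations_closed])

text \<open>The relations are stated inside arbitrary contexts u and v, and multiplication by a word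
  only enlarges the context. This is why their linear span, which is how \<open>sym_ideal\<close> is
  defined, is a two-sided ideal.\<close>

lemma sym_relations_mult:
 assumes r: "r \<in> sym_relations R M" and w: "w \<in> lists (carrier M)"
 shows "word w \<otimes>\<^bsub>WA\<^esub> r \<in> sym_relations R M" "r \<otimes>\<^bsub>WA\<^esub> word w \<in> sym_relations R M"
proof -
 interpret WR: ring WA by (rule WA_ring)
 interpret W: module R WA by (rule WA_module)
 note simps = WR.mult_minus_distr WR.r_distr WR.l_distr word_closed word_mult WA_mult_smult w
 have "word w \<otimes>\<^bsub>WA\<^esub> r \<in> sym_relations R M \<and> r \<otimes>\<^bsub>WA\<^esub> word w \<in> sym_relations R M"
  using r
 proof (cases rule: sym_relations_cases)
  case (add u v x y)
  have "word w \<otimes>\<^bsub>WA\<^esub> r = word ((w @ u) @ [x \<oplus>\<^bsub>M\<^esub> y] @ v) \<ominus>\<^bsub>WA\<^esub> (word ((w @ u) @ [x] @ v) \<oplus>\<^bsub>WA\<^esub> word ((w @ u) @ [y] @ v))"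
    "r \<otimes>\<^bsub>WA\<^esub> word w = word (u @ [x \<oplus>\<^bsub>M\<^esub> y] @ (v @ w)) \<ominus>\<^bsub>WA\<^esub> (word (u @ [x] @ (v @ w)) \<oplus>\<^bsub>WA\<^esub> word (u @ [y] @ (v @ w)))"
   using add by (simp_all add: simps)
  then show ?thesis using add w sym_relationsI(1)[of "w @ u" v x y] sym_relationsI(1)[of u "v @ w" x y] by simp
 next
  case (smult u v x a)
  have "word w \<otimes>\<^bsub>WA\<^esub> r = word ((w @ u) @ [a \<odot>\<^bsub>M\<^esub> x] @ v) \<ominus>\<^bsub>WA\<^esub> (a \<odot>\<^bsub>WA\<^esub> word ((w @ u) @ [x] @ v))"
    "r \<otimes>\<^bsub>WA\<^esub> word w = word (u @ [a \<odot>\<^bsub>M\<^esub> x] @ (v @ w)) \<ominus>\<^bsub>WA\<^esub> (a \<odot>\<^bsub>WA\<^esub> word (u @ [x] @ (v @ w)))"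
   using smult by (simp_all add: simps)
  then show ?thesis using smult w sym_relationsI(2)[of "w @ u" v x a] sym_relationsI(2)[of u "v @ w" x a] by simp
 next
  case (perm u v)
  have "word w \<otimes>\<^bsub>WA\<^esub> r = word (w @ u) \<ominus>\<^bsub>WA\<^esub> word (w @ v)"
    "r \<otimes>\<^bsub>WA\<^esub> word w = word (u @ w) \<ominus>\<^bsub>WA\<^esub> word (v @ w)"
   using perm by (simp_all add: simps)
  then show ?thesis using perm w by (auto intro!: sym_relationsI(3))
 qed
 then show "word w \<otimes>\<^bsub>WA\<^esub> r \<in> sym_relations R M" "r \<otimes>\<^bsub>WA\<^esub> word w \<in> sym_relations R M" by auto
qed

lemma SymI_ideal: "ideal SymI WA"
proof -
 interpret WR: ring WA by (rule WA_ring)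
 interpret W: module R WA by (rule WA_module)
 note I = W.submoduleD[OF SymI_submodule]
 have Ic: "x \<in> SymI \<Longrightarrow> x \<in> carrier WA" for x using I by blast
 have w: "word w \<otimes>\<^bsub>WA\<^esub> x \<in> SymI \<and> x \<otimes>\<^bsub>WA\<^esub> word w \<in> SymI" if x: "x \<in> SymI" and wl: "w \<in> lists (carrier M)" for x w
 proof -
  have "x \<in> mod_span R WA (sym_relations R M)" using x by (simp add: sym_ideal_def)
  then show ?thesis using sym_relations_closed
  proof (induction rule: W.mod_span_induct)
   case (gen s)
   then show ?case using sym_relations_mult[OF gen wl] W.mod_span_superset[of "sym_relations R M"]
    by (auto simp: sym_ideal_def)
  qed (use wl I Ic in \<open>simp_all add: word_closed WR.r_distr WR.l_distr WA_mult_smult flip: sym_ideal_def\<close>)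
 qed
 have p: "p \<otimes>\<^bsub>WA\<^esub> x \<in> SymI \<and> x \<otimes>\<^bsub>WA\<^esub> p \<in> SymI" if x: "x \<in> SymI" and p: "p \<in> carrier WA" for x p
  using p
 proof (induction rule: WA_induct)
  case (basis a s p)
  then show ?case using w[OF x, of s] x I Ic[OF x]
   by (simp add: word_closed WR.r_distr WR.l_distr WA_mult_smult)
 qed (use Ic[OF x] I in simp_all)
 interpret H: submodule SymI R WA by (rule SymI_submodule)
 show ?thesis
  by (rule idealI[OF WA_ring]) (use p H.subgroup_axioms in auto)
qed

text \<open>For words this is a relation of the third kind, because u @ v and v @ u have the same
  letters. Bilinearity extends it to all elements and makes the quotient commutative.\<close>

lemma SymI_commutator:
 assumes p: "p \<in> carrier WA" and q: "q \<in> carrier WA"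
 shows "p \<otimes>\<^bsub>WA\<^esub> q \<ominus>\<^bsub>WA\<^esub> q \<otimes>\<^bsub>WA\<^esub> p \<in> SymI"
proof -
 interpret WR: ring WA by (rule WA_ring)
 interpret W: module R WA by (rule WA_module)
 note I = W.submoduleD[OF SymI_submodule]
 have lin: "(a \<odot>\<^bsub>WA\<^esub> s \<oplus>\<^bsub>WA\<^esub> x) \<otimes>\<^bsub>WA\<^esub> y \<ominus>\<^bsub>WA\<^esub> y \<otimes>\<^bsub>WA\<^esub> (a \<odot>\<^bsub>WA\<^esub> s \<oplus>\<^bsub>WA\<^esub> x) =
   a \<odot>\<^bsub>WA\<^esub> (s \<otimes>\<^bsub>WA\<^esub> y \<ominus>\<^bsub>WA\<^esub> y \<otimes>\<^bsub>WA\<^esub> s) \<oplus>\<^bsub>WA\<^esub> (x \<otimes>\<^bsub>WA\<^esub> y \<ominus>\<^bsub>WA\<^esub> y \<otimes>\<^bsub>WA\<^esub> x)"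
  if "a \<in> carrier R" "s \<in> carrier WA" "x \<in> carrier WA" "y \<in> carrier WA" for a s x y
  using that by (simp add: a_minus_def WR.l_distr WR.r_distr WA_mult_smult W.smult_r_distr W.smult_r_minus
    WR.minus_add WR.a_ac)
 \<comment> \<open>\<open>lin\<close> expands the first factor only. To expand the second factor the
   commutator is reversed, which changes its sign.\<close>
 have anti: "x \<ominus>\<^bsub>WA\<^esub> y \<in> SymI \<Longrightarrow> y \<ominus>\<^bsub>WA\<^esub> x \<in> SymI" if "x \<in> carrier WA" "y \<in> carrier WA" for x y
  using I(4)[of "x \<ominus>\<^bsub>WA\<^esub> y"] that by (simp add: a_minus_def WR.minus_add WR.a_ac)
 have 1: "word s \<otimes>\<^bsub>WA\<^esub> q \<ominus>\<^bsub>WA\<^esub> q \<otimes>\<^bsub>WA\<^esub> word s \<in> SymI" if s: "s \<in> lists (carrier M)" for s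
  using q
 proof (induction rule: WA_induct)
  case zero
  then show ?case using s I by (simp add: word_closed WR.minus_zero_iff a_minus_def)
 next
  case (basis a t q)
  have "word t \<otimes>\<^bsub>WA\<^esub> word s \<ominus>\<^bsub>WA\<^esub> word s \<otimes>\<^bsub>WA\<^esub> word t \<in> SymI"
   using s basis sym_relationsI(3)[of "t @ s" "s @ t"] W.mod_span_superset[of "sym_relations R M"]
   by (auto simp: word_mult sym_ideal_def)
  moreover have "q \<otimes>\<^bsub>WA\<^esub> word s \<ominus>\<^bsub>WA\<^esub> word s \<otimes>\<^bsub>WA\<^esub> q \<in> SymI"
   using basis s by - (rule anti; simp add: word_closed)
  ultimately show ?case
   using s basis by - (rule anti; simp add: lin word_closed I)
 qed
 show ?thesis using p
 proof (induction rule: WA_induct)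
  case zero
  then show ?case using q I by (simp add: WR.minus_zero_iff a_minus_def)
 next
  case (basis a s p)
  then show ?case using 1[of s] q by (simp add: lin word_closed I)
 qed
qed

lemma SymQ: "module_quotient R WA SymI"
 by (intro module_quotient.intro WA_module module_quotient_axioms.intro SymI_submodule)

abbreviation "sym_class \<equiv> \<lambda>p. SymI +>\<^bsub>WA\<^esub> p"

lemma sym_class_mult:
 "p \<in> carrier WA \<Longrightarrow> q \<in> carrier WA \<Longrightarrow> sym_class p \<otimes>\<^bsub>Sym\<^esub> sym_class q = sym_class (p \<otimes>\<^bsub>WA\<^esub> q)"
 using ideal.rcoset_mult_add[OF SymI_ideal]
 by (simp add: sym_algebra_def quot_module_simps FactRing_def)

lemma sym_class_one: "\<one>\<^bsub>Sym\<^esub> = sym_class (word [])"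
 by (simp add: sym_algebra_def quot_module_simps WA_one)

lemmas sym_class_closed = module_quotient.proj_closed[OF SymQ, folded sym_algebra_def]
 and sym_class_add = module_quotient.proj_add[OF SymQ, folded sym_algebra_def]
 and sym_class_smult = module_quotient.proj_smult[OF SymQ, folded sym_algebra_def]
 and sym_class_cases = module_quotient.proj_cases[OF SymQ, folded sym_algebra_def]
 and sym_class_eq_iff = module_quotient.proj_eq_iff[OF SymQ]

lemma sym_algebra_algebra: "algebra R Sym"
proof -
 interpret WR: ring WA by (rule WA_ring)
 interpret W: module R WA by (rule WA_module)
 interpret S: module R Sym unfolding sym_algebra_def by (rule module_quotient.Q_module[OF SymQ])
 have cr: "cring Sym"
 proof (rule cringI[OF S.M.abelian_group_axioms])
  show "Group.comm_monoid Sym"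
  proof (rule comm_monoidI)
   show "\<one>\<^bsub>Sym\<^esub> \<in> carrier Sym" by (simp add: sym_class_one sym_class_closed word_closed)
   fix x assume "x \<in> carrier Sym"
   then obtain p where p: "p \<in> carrier WA" "x = sym_class p" by (rule sym_class_cases)
   show "\<one>\<^bsub>Sym\<^esub> \<otimes>\<^bsub>Sym\<^esub> x = x"
    using p WR.l_one[OF p(1)] by (simp add: sym_class_one sym_class_mult word_closed WA_one)
   fix y assume "y \<in> carrier Sym"
   then obtain q where q: "q \<in> carrier WA" "y = sym_class q" by (rule sym_class_cases)
   show "x \<otimes>\<^bsub>Sym\<^esub> y \<in> carrier Sym" using p q by (simp add: sym_class_mult sym_class_closed)
   show "x \<otimes>\<^bsub>Sym\<^esub> y = y \<otimes>\<^bsub>Sym\<^esub> x"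
    using p q SymI_commutator[of p q] by (simp add: sym_class_mult sym_class_eq_iff)
   fix z assume "z \<in> carrier Sym"
   then obtain r where r: "r \<in> carrier WA" "z = sym_class r" by (rule sym_class_cases)
   show "(x \<otimes>\<^bsub>Sym\<^esub> y) \<otimes>\<^bsub>Sym\<^esub> z = x \<otimes>\<^bsub>Sym\<^esub> (y \<otimes>\<^bsub>Sym\<^esub> z)"
    using p q r by (simp add: sym_class_mult WR.m_assoc)
  qed
  fix x y z assume "x \<in> carrier Sym" "y \<in> carrier Sym" "z \<in> carrier Sym"
  then obtain p q r where "p \<in> carrier WA" "x = sym_class p" "q \<in> carrier WA" "y = sym_class q"
    "r \<in> carrier WA" "z = sym_class r" by (metis sym_class_cases)
  then show "(x \<oplus>\<^bsub>Sym\<^esub> y) \<otimes>\<^bsub>Sym\<^esub> z = x \<otimes>\<^bsub>Sym\<^esub> z \<oplus>\<^bsub>Sym\<^esub> y \<otimes>\<^bsub>Sym\<^esub> z"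
   by (simp add: sym_class_mult sym_class_add WR.l_distr)
 qed
 show ?thesis
 proof (rule algebraI[OF R.is_cring cr])
  fix a x y assume a: "a \<in> carrier R" and "x \<in> carrier Sym" "y \<in> carrier Sym"
  then obtain p q where "p \<in> carrier WA" "x = sym_class p" "q \<in> carrier WA" "y = sym_class q"
    by (metis sym_class_cases)
  then show "(a \<odot>\<^bsub>Sym\<^esub> x) \<otimes>\<^bsub>Sym\<^esub> y = a \<odot>\<^bsub>Sym\<^esub> (x \<otimes>\<^bsub>Sym\<^esub> y)"
   using a by (simp add: sym_class_mult sym_class_smult WA_mult_smult)
 qed (auto simp: S.smult_l_distr S.smult_r_distr S.smult_assoc1)
qed

lemma sym_incl_hom: "sym_incl R M \<in> mod_hom R M Sym"
proof -
 interpret W: module R WA by (rule WA_module)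
 have sub: "sym_relations R M \<subseteq> SymI" unfolding sym_ideal_def by (rule W.mod_span_superset)
 show ?thesis
 proof (rule mod_homI)
  fix x assume x: "x \<in> carrier M"
  show "sym_incl R M x \<in> carrier Sym" using x by (simp add: sym_incl_def sym_class_closed word_closed)
  show "sym_incl R M (a \<odot>\<^bsub>M\<^esub> x) = a \<odot>\<^bsub>Sym\<^esub> sym_incl R M x" if a: "a \<in> carrier R" for a
   using a x sym_relationsI(2)[of "[]" "[]" x a] sub
   by (auto simp: sym_incl_def sym_class_smult word_closed sym_class_eq_iff)
  show "sym_incl R M (x \<oplus>\<^bsub>M\<^esub> y) = sym_incl R M x \<oplus>\<^bsub>Sym\<^esub> sym_incl R M y" if y: "y \<in> carrier M" for y
   using y x sym_relationsI(1)[of "[]" "[]" x y] sub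
   by (auto simp: sym_incl_def sym_class_add word_closed sym_class_eq_iff)
 qed
qed

lemma sym_class_word_Cons:
 assumes "x \<in> carrier M" "w \<in> lists (carrier M)"
 shows "sym_class (word (x # w)) = sym_incl R M x \<otimes>\<^bsub>Sym\<^esub> sym_class (word w)"
 using assms by (simp add: sym_incl_def sym_class_mult word_closed word_mult)

lemma sym_generated: "alg_generates R Sym (sym_incl R M ` carrier M)"
 unfolding alg_generates_def
proof (intro conjI allI impI)
 interpret W: module R WA by (rule WA_module)
 interpret S: algebra R Sym by (rule sym_algebra_algebra)
 show "sym_incl R M ` carrier M \<subseteq> carrier Sym" using mod_homD(1)[OF sym_incl_hom] by blast
 fix H assume H: "submodule H R Sym" and one: "\<one>\<^bsub>Sym\<^esub> \<in> H"
  and mult: "\<forall>s\<in>sym_incl R M ` carrier M. \<forall>x\<in>H. s \<otimes>\<^bsub>Sym\<^esub> x \<in> H"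
 have w: "sym_class (word w) \<in> H" if "w \<in> lists (carrier M)" for w
  using that by (induction w) (use one mult in \<open>auto simp: sym_class_one sym_class_word_Cons\<close>)
 have "sym_class p \<in> H" if "p \<in> carrier WA" for p
  using that
 proof (induction rule: WA_induct)
  case zero
  then show ?case using S.submoduleD(2)[OF H] module_quotient.proj_zero[OF SymQ] by (simp add: sym_algebra_def)
 next
  case (basis a s p)
  then show ?case using S.submoduleD(3,6)[OF H] w[of s]
   by (simp add: word_closed flip: sym_class_add sym_class_smult)
 qed
 then show "carrier Sym \<subseteq> H" by (auto elim: sym_class_cases)
qed

end

lemma (in cring) foldr_closed: "h \<in> set w \<rightarrow> carrier R \<Longrightarrow> foldr (\<lambda>x y. h x \<otimes> y) w \<one> \<in> carrier R"
 by (induction w) (auto simp: Pi_iff)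

lemma (in cring) foldr_mult_append:
 "h \<in> set u \<union> set w \<rightarrow> carrier R \<Longrightarrow> foldr (\<lambda>x y. h x \<otimes> y) (u @ w) \<one> =
  foldr (\<lambda>x y. h x \<otimes> y) u \<one> \<otimes> foldr (\<lambda>x y. h x \<otimes> y) w \<one>"
 by (induction u) (auto simp: Pi_iff m_assoc foldr_closed)

lemma (in cring) foldr_mset:
 "h \<in> set w \<rightarrow> carrier R \<Longrightarrow> mset w = mset w' \<Longrightarrow>
  foldr (\<lambda>x y. h x \<otimes> y) w \<one> = foldr (\<lambda>x y. h x \<otimes> y) w' \<one>"
proof (induction w arbitrary: w')
 case (Cons x w)
 then obtain u v where w': "w' = u @ x # v" by (metis in_set_conv_decomp list.set_intros(1) mset_eq_setD)
 then have m: "mset w = mset (u @ v)" using Cons.prems(2) by simp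
 have "set w' = set (x # w)" using Cons.prems(2) mset_eq_setD by metis
 then have h: "h \<in> set u \<rightarrow> carrier R" "h \<in> set v \<rightarrow> carrier R" "h x \<in> carrier R"
  using Cons.prems(1) unfolding w' by (auto simp: Pi_iff)
 have "foldr (\<lambda>x y. h x \<otimes> y) w \<one> = foldr (\<lambda>x y. h x \<otimes> y) (u @ v) \<one>"
  using Cons.prems(1) m by (intro Cons.IH) auto
 then show ?case using h unfolding w'
  using foldr_mult_append[of h u v] foldr_mult_append[of h u "x # v"] foldr_closed[of h u] foldr_closed[of h v]
  by (simp add: Pi_iff ball_Un m_lcomm del: foldr_append)
qed simp

section \<open>The universal property of the symmetric algebra\<close>

context module
begin

context
 fixes B :: "('a, 'e, 'f) module_scheme" and h
 assumes B: "algebra R B" and h: "h \<in> mod_hom R M B"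
begin

definition "word_eval w = foldr (\<lambda>x y. h x \<otimes>\<^bsub>B\<^esub> y) w \<one>\<^bsub>B\<^esub>"

lemma word_eval_hom: "R.lin_ext B word_eval \<in> mod_hom R WA B"
 and word_eval_word: "w \<in> lists (carrier M) \<Longrightarrow> R.lin_ext B word_eval (word w) = word_eval w"
 and word_eval_closed: "w \<in> lists (carrier M) \<Longrightarrow> word_eval w \<in> carrier B"
proof -
 interpret BC: cring B by (rule algebra.M_cring[OF B])
 interpret B: algebra R B by (rule B)
 show c: "word_eval w \<in> carrier B" if "w \<in> lists (carrier M)" for w
  unfolding word_eval_def using that mod_homD(1)[OF h] by (intro BC.foldr_closed) auto
 then have f: "word_eval \<in> lists (carrier M) \<rightarrow> carrier B" by blast
 have "R.lin_ext B word_eval \<in> mod_hom R (free_module R (lists (carrier M))) B" by (rule B.lin_ext_hom[OF f])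
 then show "R.lin_ext B word_eval \<in> mod_hom R WA B"
  unfolding mod_hom_def carrier_WA by (simp add: word_algebra_def monoid_algebra_simps free_module_simps)
 show "R.lin_ext B word_eval (word w) = word_eval w" if "w \<in> lists (carrier M)"
  using that by (rule B.lin_ext_basis[OF f])
qed

lemma word_eval_mult:
 assumes "p \<in> carrier WA" "q \<in> carrier WA"
 shows "R.lin_ext B word_eval (p \<otimes>\<^bsub>WA\<^esub> q) = R.lin_ext B word_eval p \<otimes>\<^bsub>B\<^esub> R.lin_ext B word_eval q"
proof -
 interpret BC: cring B by (rule algebra.M_cring[OF B])
 interpret B: algebra R B by (rule B)
 interpret WR: ring WA by (rule WA_ring)
 interpret W: module R WA by (rule WA_module)
 note e = mod_homD[OF word_eval_hom]
 note z = mod_hom_zero[OF WA_module B.module_axioms word_eval_hom]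
 have app: "word_eval (u @ v) = word_eval u \<otimes>\<^bsub>B\<^esub> word_eval v"
  if "u \<in> lists (carrier M)" "v \<in> lists (carrier M)" for u v
  unfolding word_eval_def using that mod_homD(1)[OF h] by (intro BC.foldr_mult_append) auto
 have 1: "R.lin_ext B word_eval (word s \<otimes>\<^bsub>WA\<^esub> q) = R.lin_ext B word_eval (word s) \<otimes>\<^bsub>B\<^esub> R.lin_ext B word_eval q"
  if s: "s \<in> lists (carrier M)" for s
  using assms(2)
 proof (induction rule: WA_induct)
  case zero
  then show ?case using s by (simp add: z word_closed e)
 next
  case (basis a t q)
  then show ?case using s
   by (simp add: WR.r_distr WA_mult_smult e word_closed word_mult word_eval_word app word_eval_closed
     BC.r_distr B.smult_assoc2 BC.m_comm[of "word_eval s"])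
 qed
 show ?thesis using assms(1)
 proof (induction rule: WA_induct)
  case zero
  then show ?case using assms(2) by (simp add: z e)
 next
  case (basis a s p)
  then show ?case using assms(2)
   by (simp add: WR.l_distr WA_mult_smult e word_closed 1 BC.l_distr B.smult_assoc2)
 qed
qed

lemma word_eval_ker:
 assumes "p \<in> SymI"
 shows "R.lin_ext B word_eval p = \<zero>\<^bsub>B\<^esub>"
proof -
 interpret BC: cring B by (rule algebra.M_cring[OF B])
 interpret B: algebra R B by (rule B)
 interpret W: module R WA by (rule WA_module)
 note e = mod_homD[OF word_eval_hom]
 note z = mod_hom_zero[OF WA_module B.module_axioms word_eval_hom]
 note mi = mod_hom_minus[OF WA_module B.module_axioms word_eval_hom]
 have hc: "h x \<in> carrier B" if "x \<in> carrier M" for x using that by (rule mod_homD(1)[OF h])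
 have app: "word_eval (u @ v) = word_eval u \<otimes>\<^bsub>B\<^esub> word_eval v"
  if "u \<in> lists (carrier M)" "v \<in> lists (carrier M)" for u v
  unfolding word_eval_def using that mod_homD(1)[OF h] by (intro BC.foldr_mult_append) auto
 have cons: "word_eval (x # w) = h x \<otimes>\<^bsub>B\<^esub> word_eval w" for x w
  by (simp add: word_eval_def)
 have r: "R.lin_ext B word_eval r = \<zero>\<^bsub>B\<^esub>" if "r \<in> sym_relations R M" for r
  using that
 proof (cases rule: sym_relations_cases)
  case (add u v x y)
  then show ?thesis
   by (simp add: mi e word_closed word_eval_word word_eval_closed app cons hc mod_homD[OF h] BC.l_distr BC.r_distr BC.minus_zero_iff)
 next
  case (smult u v x a)
  then show ?thesis
   by (simp add: mi e word_closed word_eval_word word_eval_closed app cons hc mod_homD[OF h]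
     B.smult_assoc2 BC.m_comm[of "word_eval u"] BC.minus_zero_iff)
 next
  case (perm w w')
  then have "word_eval w = word_eval w'"
   unfolding word_eval_def using mod_homD(1)[OF h] by (intro BC.foldr_mset) auto
  with perm show ?thesis by (simp add: mi e word_closed word_eval_word word_eval_closed BC.minus_zero_iff)
 qed
 have "SymI \<subseteq> {p \<in> carrier WA. R.lin_ext B word_eval p \<in> {\<zero>\<^bsub>B\<^esub>}}"
  unfolding sym_ideal_def
 proof (rule W.mod_span_minimal[OF W.submodule_vimage[OF B.module_axioms word_eval_hom]])
  show "submodule {\<zero>\<^bsub>B\<^esub>} R B" by (rule B.submoduleI') auto
 qed (use r sym_relations_closed in auto)
 then show ?thesis using assms by auto
qed

lemma sym_lift_eq: "sym_lift R B h = quot_lift (R.lin_ext B word_eval)"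
 by (simp add: sym_lift_def R.lin_ext_def[abs_def] word_eval_def[abs_def])

lemma sym_lift_class: "p \<in> carrier WA \<Longrightarrow> sym_lift R B h (sym_class p) = R.lin_ext B word_eval p"
 unfolding sym_lift_eq
 by (rule module_quotient.quot_lift_proj[OF SymQ algebra.module[OF B] word_eval_hom word_eval_ker])

lemma sym_lift_hom: "sym_lift R B h \<in> alg_hom R Sym B"
proof (rule alg_homI)
 show "sym_lift R B h \<in> mod_hom R Sym B" unfolding sym_lift_eq sym_algebra_def
  by (rule module_quotient.quot_lift_mod_hom[OF SymQ algebra.module[OF B] word_eval_hom word_eval_ker])
 show "sym_lift R B h \<one>\<^bsub>Sym\<^esub> = \<one>\<^bsub>B\<^esub>"
  by (simp add: sym_class_one sym_lift_class word_closed word_eval_word) (simp add: word_eval_def)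
 interpret WR: ring WA by (rule WA_ring)
 fix x y assume "x \<in> carrier Sym" "y \<in> carrier Sym"
 then obtain p q where "p \<in> carrier WA" "x = sym_class p" "q \<in> carrier WA" "y = sym_class q"
  by (metis sym_class_cases)
 then show "sym_lift R B h (x \<otimes>\<^bsub>Sym\<^esub> y) = sym_lift R B h x \<otimes>\<^bsub>B\<^esub> sym_lift R B h y"
  by (simp add: sym_class_mult sym_lift_class word_eval_mult)
qed

lemma sym_lift_incl:
 assumes "x \<in> carrier M"
 shows "sym_lift R B h (sym_incl R M x) = h x"
proof -
 interpret BC: cring B by (rule algebra.M_cring[OF B])
 show ?thesis using assms mod_homD(1)[OF h assms]
  by (simp add: sym_incl_def sym_lift_class word_closed word_eval_word) (simp add: word_eval_def)
qed

end

lemma sym_lift_unique: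
 assumes B: "algebra R B" and h: "h \<in> mod_hom R M B" and k: "k \<in> alg_hom R Sym B"
  and eq: "\<And>x. x \<in> carrier M \<Longrightarrow> k (sym_incl R M x) = h x" and z: "z \<in> carrier Sym"
 shows "k z = sym_lift R B h z"
 by (rule alg_generates_hom_unique[OF sym_algebra_algebra B sym_generated k sym_lift_hom[OF B h] _ z])
  (auto simp: eq sym_lift_incl[OF B h])

end

section \<open>Tensor products of algebras\<close>

locale tensor_family = cring R for R :: "('a, 'm) ring_scheme" (structure) +
 fixes N :: "'i set" and B :: "'i \<Rightarrow> ('a, 'b, 'p) module_scheme"
 assumes B_algebra: "n \<in> N \<Longrightarrow> algebra R (B n)"
begin

abbreviation "P \<equiv> restricted_prod N B"
abbreviation "PA \<equiv> pure_algebra R N B"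
abbreviation "TI \<equiv> tensor_ideal R N B"
abbreviation "T \<equiv> tensor_algebra R N B"
abbreviation "pelt \<equiv> \<lambda>f. basis_elt R f"

lemma B_cring: "n \<in> N \<Longrightarrow> cring (B n)"
 using B_algebra by (rule algebra.M_cring)

lemma B_r_one: "n \<in> N \<Longrightarrow> x \<in> carrier (B n) \<Longrightarrow> x \<otimes>\<^bsub>B n\<^esub> \<one>\<^bsub>B n\<^esub> = x"
 using Group.monoid.r_one[OF ring.axioms(2)[OF cring.axioms(1)[OF B_cring]]] .

lemma carrier_P: "f \<in> carrier P \<longleftrightarrow>
  f \<in> extensional N \<and> (\<forall>n\<in>N. f n \<in> carrier (B n)) \<and> finite {n \<in> N. f n \<noteq> \<one>\<^bsub>B n\<^esub>}"
 by (auto simp: restricted_prod_def PiE_def)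

lemma P_simps: "f \<otimes>\<^bsub>P\<^esub> g = (\<lambda>n\<in>N. f n \<otimes>\<^bsub>B n\<^esub> g n)" "\<one>\<^bsub>P\<^esub> = (\<lambda>n\<in>N. \<one>\<^bsub>B n\<^esub>)"
 by (simp_all add: restricted_prod_def)

lemma P_comm_monoid: "Group.comm_monoid P"
proof (rule comm_monoidI)
 fix f g assume fg: "f \<in> carrier P" "g \<in> carrier P"
 have "{n \<in> N. (f \<otimes>\<^bsub>P\<^esub> g) n \<noteq> \<one>\<^bsub>B n\<^esub>} \<subseteq> {n \<in> N. f n \<noteq> \<one>\<^bsub>B n\<^esub>} \<union> {n \<in> N. g n \<noteq> \<one>\<^bsub>B n\<^esub>}"
  using B_cring by (auto simp: P_simps cring.cring_simprules)
 moreover have "finite ({n \<in> N. f n \<noteq> \<one>\<^bsub>B n\<^esub>} \<union> {n \<in> N. g n \<noteq> \<one>\<^bsub>B n\<^esub>})"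
  using fg by (simp add: carrier_P)
 ultimately have "finite {n \<in> N. (f \<otimes>\<^bsub>P\<^esub> g) n \<noteq> \<one>\<^bsub>B n\<^esub>}" by (rule finite_subset)
 moreover have "(f \<otimes>\<^bsub>P\<^esub> g) n \<in> carrier (B n)" if "n \<in> N" for n
  using fg that B_cring by (simp add: P_simps carrier_P cring.cring_simprules)
 moreover have "f \<otimes>\<^bsub>P\<^esub> g \<in> extensional N" by (simp add: P_simps)
 ultimately show "f \<otimes>\<^bsub>P\<^esub> g \<in> carrier P" unfolding carrier_P by blast
 show "f \<otimes>\<^bsub>P\<^esub> g = g \<otimes>\<^bsub>P\<^esub> f"
  using fg B_cring by (auto simp: P_simps carrier_P fun_eq_iff cring.cring_simprules(14))
 show "f \<otimes>\<^bsub>P\<^esub> g \<otimes>\<^bsub>P\<^esub> h = f \<otimes>\<^bsub>P\<^esub> (g \<otimes>\<^bsub>P\<^esub> h)" if "h \<in> carrier P" for h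
  using fg that B_cring by (auto simp: P_simps carrier_P fun_eq_iff cring.cring_simprules(11))
next
 show "\<one>\<^bsub>P\<^esub> \<in> carrier P" using B_cring by (auto simp: P_simps carrier_P cring.cring_simprules)
 show "\<one>\<^bsub>P\<^esub> \<otimes>\<^bsub>P\<^esub> f = f" if "f \<in> carrier P" for f
  using that B_cring by (auto simp: P_simps carrier_P fun_eq_iff cring.cring_simprules B_r_one extensional_def)
qed

lemma mon_alg_P: "mon_alg R P"
 by (intro mon_alg.intro P_comm_monoid is_cring)

lemma PA_algebra: "algebra R PA"
 unfolding pure_algebra_def by (rule mon_alg.MA_algebra[OF mon_alg_P])

lemma pelt_closed: "f \<in> carrier P \<Longrightarrow> pelt f \<in> carrier PA"
 by (simp add: pure_algebra_def monoid_algebra_simps free_module_closed)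

lemma pelt_mult: "f \<in> carrier P \<Longrightarrow> g \<in> carrier P \<Longrightarrow> pelt f \<otimes>\<^bsub>PA\<^esub> pelt g = pelt (f \<otimes>\<^bsub>P\<^esub> g)"
 unfolding pure_algebra_def by (rule mon_alg.mult_basis[OF mon_alg_P])

lemma PA_one: "\<one>\<^bsub>PA\<^esub> = pelt \<one>\<^bsub>P\<^esub>"
 by (simp add: pure_algebra_def monoid_algebra_simps)

lemma PA_induct [consumes 1, case_names zero basis]:
 assumes "p \<in> carrier PA" "Q \<zero>\<^bsub>PA\<^esub>"
  "\<And>a s p. \<lbrakk>a \<in> carrier R; s \<in> carrier P; p \<in> carrier PA; Q p\<rbrakk> \<Longrightarrow> Q (a \<odot>\<^bsub>PA\<^esub> pelt s \<oplus>\<^bsub>PA\<^esub> p)"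
 shows "Q p"
proof -
 have "p \<in> carrier (free_module R (carrier P))" using assms(1) by (simp add: pure_algebra_def monoid_algebra_simps)
 then show ?thesis
  by (induction rule: free_module_induct)
   (use assms(2,3) in \<open>simp_all add: pure_algebra_def monoid_algebra_simps\<close>)
qed

lemma upd_closed: "f \<in> carrier P \<Longrightarrow> n \<in> N \<Longrightarrow> x \<in> carrier (B n) \<Longrightarrow> f(n := x) \<in> carrier P"
 unfolding carrier_P by (auto simp: extensional_def intro: finite_subset[of _ "insert n {n \<in> N. f n \<noteq> \<one>\<^bsub>B n\<^esub>}"])

definition "tensor_relations =
  {pelt (f(n := x \<oplus>\<^bsub>B n\<^esub> y)) \<ominus>\<^bsub>PA\<^esub> (pelt (f(n := x)) \<oplus>\<^bsub>PA\<^esub> pelt (f(n := y))) | f n x y.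
    f \<in> carrier P \<and> n \<in> N \<and> x \<in> carrier (B n) \<and> y \<in> carrier (B n)} \<union>
  {pelt (f(n := a \<odot>\<^bsub>B n\<^esub> x)) \<ominus>\<^bsub>PA\<^esub> (a \<odot>\<^bsub>PA\<^esub> pelt (f(n := x))) | f n a x.
    f \<in> carrier P \<and> n \<in> N \<and> a \<in> carrier R \<and> x \<in> carrier (B n)}"

lemma TI_eq: "TI = mod_span R PA tensor_relations"
 by (simp add: tensor_ideal_def tensor_relations_def Let_def)

lemma tensor_relations_cases:
 assumes "r \<in> tensor_relations"
 obtains (add) f n x y where "r = pelt (f(n := x \<oplus>\<^bsub>B n\<^esub> y)) \<ominus>\<^bsub>PA\<^esub> (pelt (f(n := x)) \<oplus>\<^bsub>PA\<^esub> pelt (f(n := y)))"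
   "f \<in> carrier P" "n \<in> N" "x \<in> carrier (B n)" "y \<in> carrier (B n)"
  | (smult) f n a x where "r = pelt (f(n := a \<odot>\<^bsub>B n\<^esub> x)) \<ominus>\<^bsub>PA\<^esub> (a \<odot>\<^bsub>PA\<^esub> pelt (f(n := x)))"
   "f \<in> carrier P" "n \<in> N" "a \<in> carrier R" "x \<in> carrier (B n)"
 using assms unfolding tensor_relations_def by blast

lemma tensor_relationsI:
 "\<lbrakk>f \<in> carrier P; n \<in> N; x \<in> carrier (B n); y \<in> carrier (B n)\<rbrakk> \<Longrightarrow>
   pelt (f(n := x \<oplus>\<^bsub>B n\<^esub> y)) \<ominus>\<^bsub>PA\<^esub> (pelt (f(n := x)) \<oplus>\<^bsub>PA\<^esub> pelt (f(n := y))) \<in> tensor_relations"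
 "\<lbrakk>f \<in> carrier P; n \<in> N; a \<in> carrier R; x \<in> carrier (B n)\<rbrakk> \<Longrightarrow>
   pelt (f(n := a \<odot>\<^bsub>B n\<^esub> x)) \<ominus>\<^bsub>PA\<^esub> (a \<odot>\<^bsub>PA\<^esub> pelt (f(n := x))) \<in> tensor_relations"
 unfolding tensor_relations_def by blast+

lemma B_smult_closed: "n \<in> N \<Longrightarrow> a \<in> carrier R \<Longrightarrow> x \<in> carrier (B n) \<Longrightarrow> a \<odot>\<^bsub>B n\<^esub> x \<in> carrier (B n)"
 using module.smult_closed[OF algebra.module[OF B_algebra]] .

lemma B_add_closed: "n \<in> N \<Longrightarrow> x \<in> carrier (B n) \<Longrightarrow> y \<in> carrier (B n) \<Longrightarrow> x \<oplus>\<^bsub>B n\<^esub> y \<in> carrier (B n)"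
 by (rule cring.cring_simprules(1)[OF B_cring])

lemma tensor_relations_closed: "tensor_relations \<subseteq> carrier PA"
proof
 interpret PC: cring PA by (rule algebra.M_cring[OF PA_algebra])
 interpret PA: algebra R PA by (rule PA_algebra)
 fix r assume "r \<in> tensor_relations"
 then show "r \<in> carrier PA"
  by (cases rule: tensor_relations_cases)
   (simp_all add: pelt_closed upd_closed B_smult_closed B_add_closed)
qed

lemma TI_submodule: "submodule TI R PA"
 unfolding TI_eq by (rule module.mod_span_submodule[OF algebra.module[OF PA_algebra] tensor_relations_closed])

lemma P_mult_upd:
 "f \<in> carrier P \<Longrightarrow> g \<in> carrier P \<Longrightarrow> n \<in> N \<Longrightarrow>
   g \<otimes>\<^bsub>P\<^esub> f(n := x) = (g \<otimes>\<^bsub>P\<^esub> f)(n := g n \<otimes>\<^bsub>B n\<^esub> x)"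
 by (auto simp: P_simps fun_eq_iff)

text \<open>Multiplication by the pure tensor of \<open>g\<close> turns a relation in the n-th
  factor based at \<open>f\<close> into one based at the product of \<open>g\<close> and
  \<open>f\<close>. Hence the linear span of the relations is an ideal.\<close>

lemma tensor_relations_mult:
 assumes "r \<in> tensor_relations" and g: "g \<in> carrier P"
 shows "pelt g \<otimes>\<^bsub>PA\<^esub> r \<in> tensor_relations"
proof -
 interpret PC: cring PA by (rule algebra.M_cring[OF PA_algebra])
 interpret PA: algebra R PA by (rule PA_algebra)
 interpret Pm: comm_monoid P by (rule P_comm_monoid)
 have gn: "g n \<in> carrier (B n)" if "n \<in> N" for n using g that by (simp add: carrier_P)
 have sm: "x \<otimes>\<^bsub>PA\<^esub> (a \<odot>\<^bsub>PA\<^esub> y) = a \<odot>\<^bsub>PA\<^esub> (x \<otimes>\<^bsub>PA\<^esub> y)"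
  if "a \<in> carrier R" "x \<in> carrier PA" "y \<in> carrier PA" for a x y
  using that PA.smult_assoc2[of a y x] by (simp add: PC.m_comm)
 note simps = PC.mult_minus_distr PC.r_distr pelt_closed upd_closed B_smult_closed B_add_closed pelt_mult g P_mult_upd gn sm
 show ?thesis using assms(1)
 proof (cases rule: tensor_relations_cases)
  case (add f n x y)
  interpret Bn: cring "B n" using add by (intro B_cring)
  have "pelt g \<otimes>\<^bsub>PA\<^esub> r = pelt ((g \<otimes>\<^bsub>P\<^esub> f)(n := g n \<otimes>\<^bsub>B n\<^esub> x \<oplus>\<^bsub>B n\<^esub> g n \<otimes>\<^bsub>B n\<^esub> y)) \<ominus>\<^bsub>PA\<^esub>
    (pelt ((g \<otimes>\<^bsub>P\<^esub> f)(n := g n \<otimes>\<^bsub>B n\<^esub> x)) \<oplus>\<^bsub>PA\<^esub> pelt ((g \<otimes>\<^bsub>P\<^esub> f)(n := g n \<otimes>\<^bsub>B n\<^esub> y)))"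
   using add gn by (simp add: simps Bn.r_distr)
  then show ?thesis using add gn g by (simp add: tensor_relationsI(1))
 next
  case (smult f n a x)
  interpret Bn: algebra R "B n" using smult by (intro B_algebra)
  interpret BnC: cring "B n" using smult by (intro B_cring)
  have e: "g n \<otimes>\<^bsub>B n\<^esub> (a \<odot>\<^bsub>B n\<^esub> x) = a \<odot>\<^bsub>B n\<^esub> (g n \<otimes>\<^bsub>B n\<^esub> x)"
   using smult gn Bn.smult_assoc2[of a x "g n"] by (simp add: Bn.m_comm)
  have "pelt g \<otimes>\<^bsub>PA\<^esub> r = pelt ((g \<otimes>\<^bsub>P\<^esub> f)(n := a \<odot>\<^bsub>B n\<^esub> (g n \<otimes>\<^bsub>B n\<^esub> x))) \<ominus>\<^bsub>PA\<^esub>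
    (a \<odot>\<^bsub>PA\<^esub> pelt ((g \<otimes>\<^bsub>P\<^esub> f)(n := g n \<otimes>\<^bsub>B n\<^esub> x)))"
   using smult gn by (simp add: simps e)
  then show ?thesis using smult gn g by (simp add: tensor_relationsI(2))
 qed
qed

lemma TI_ideal: "ideal TI PA"
proof -
 interpret PC: cring PA by (rule algebra.M_cring[OF PA_algebra])
 interpret PA: algebra R PA by (rule PA_algebra)
 note I = PA.submoduleD[OF TI_submodule]
 have Ic: "x \<in> TI \<Longrightarrow> x \<in> carrier PA" for x using I by blast
 have sm: "x \<otimes>\<^bsub>PA\<^esub> (a \<odot>\<^bsub>PA\<^esub> y) = a \<odot>\<^bsub>PA\<^esub> (x \<otimes>\<^bsub>PA\<^esub> y)"
  if "a \<in> carrier R" "x \<in> carrier PA" "y \<in> carrier PA" for a x y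
  using that PA.smult_assoc2[of a y x] by (simp add: PC.m_comm)
 have w: "pelt g \<otimes>\<^bsub>PA\<^esub> x \<in> TI" if x: "x \<in> TI" and g: "g \<in> carrier P" for x g
 proof -
  have "x \<in> mod_span R PA tensor_relations" using x by (simp add: TI_eq)
  then show ?thesis using tensor_relations_closed
  proof (induction rule: PA.mod_span_induct)
   case (gen s)
   then show ?case using tensor_relations_mult[OF gen g] PA.mod_span_superset[of tensor_relations]
    by (auto simp: TI_eq)
  qed (use g I Ic in \<open>simp_all add: pelt_closed PC.r_distr sm flip: TI_eq\<close>)
 qed
 have p: "p \<otimes>\<^bsub>PA\<^esub> x \<in> TI" if x: "x \<in> TI" and p: "p \<in> carrier PA" for x p
  using p
 proof (induction rule: PA_induct)
  case (basis a s p)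
  then show ?case using w[OF x, of s] x I Ic[OF x]
   by (simp add: pelt_closed PC.l_distr PA.smult_assoc2)
 qed (use Ic[OF x] I in simp_all)
 have p': "x \<otimes>\<^bsub>PA\<^esub> p \<in> TI" if x: "x \<in> TI" and "p \<in> carrier PA" for x p
  using p[OF that] Ic[OF x] that by (simp add: PC.m_comm)
 interpret H: submodule TI R PA by (rule TI_submodule)
 show ?thesis
  by (rule idealI[OF PC.ring_axioms]) (use p p' H.subgroup_axioms in auto)
qed

lemma T_algebra: "algebra R T"
 unfolding tensor_algebra_def by (rule algebra.quot_algebra(1)[OF PA_algebra TI_ideal])

abbreviation "tclass \<equiv> \<lambda>p. TI +>\<^bsub>PA\<^esub> p"

lemma tclass_hom: "tclass \<in> alg_hom R PA T"
 unfolding tensor_algebra_def by (rule algebra.quot_algebra(2)[OF PA_algebra TI_ideal])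

lemma TQ: "module_quotient R PA TI"
 by (intro module_quotient.intro algebra.module[OF PA_algebra] module_quotient_axioms.intro TI_submodule)

lemma T_cases: assumes "x \<in> carrier T" obtains p where "p \<in> carrier PA" "x = tclass p"
 using module_quotient.proj_cases[OF TQ] assms unfolding tensor_algebra_def by metis

definition pure :: "('i \<Rightarrow> 'b) \<Rightarrow> (('i \<Rightarrow> 'b) \<Rightarrow> 'a) set" where
 "pure f = tclass (pelt f)"

definition single :: "'i \<Rightarrow> 'b \<Rightarrow> 'i \<Rightarrow> 'b" where
 "single n x = \<one>\<^bsub>P\<^esub>(n := x)"

text \<open>The canonical maps of the factors into the tensor product, seen as the coproduct of
  commutative algebras.\<close>

definition tens :: "'i \<Rightarrow> 'b \<Rightarrow> (('i \<Rightarrow> 'b) \<Rightarrow> 'a) set" where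
 "tens n x = pure (single n x)"

lemma single_closed: "n \<in> N \<Longrightarrow> x \<in> carrier (B n) \<Longrightarrow> single n x \<in> carrier P"
 unfolding single_def by (intro upd_closed Group.monoid.one_closed comm_monoid.axioms(1) P_comm_monoid)

lemma pure_closed: "f \<in> carrier P \<Longrightarrow> pure f \<in> carrier T"
 unfolding pure_def by (rule alg_homD(1)[OF tclass_hom]) (rule pelt_closed)

lemma pure_mult: "f \<in> carrier P \<Longrightarrow> g \<in> carrier P \<Longrightarrow> pure f \<otimes>\<^bsub>T\<^esub> pure g = pure (f \<otimes>\<^bsub>P\<^esub> g)"
 unfolding pure_def by (simp add: alg_homD(4)[OF tclass_hom, symmetric] pelt_closed pelt_mult)

lemma pure_one: "pure \<one>\<^bsub>P\<^esub> = \<one>\<^bsub>T\<^esub>"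
 unfolding pure_def PA_one[symmetric] by (rule alg_homD(5)[OF tclass_hom])

lemma tens_hom: assumes n: "n \<in> N" shows "tens n \<in> alg_hom R (B n) T"
proof -
 interpret PC: cring PA by (rule algebra.M_cring[OF PA_algebra])
 interpret PA: algebra R PA by (rule PA_algebra)
 interpret Bn: cring "B n" using n by (intro B_cring)
 interpret Pm: comm_monoid P by (rule P_comm_monoid)
 have sub: "tensor_relations \<subseteq> TI" unfolding TI_eq by (rule PA.mod_span_superset)
 note eq = module_quotient.proj_eq_iff[OF TQ]
 note cl = pelt_closed single_closed n
 show ?thesis
 proof (intro alg_homI mod_homI)
  fix x assume x: "x \<in> carrier (B n)"
  show "tens n x \<in> carrier T" using x n by (simp add: tens_def pure_closed single_closed)
  show "tens n (a \<odot>\<^bsub>B n\<^esub> x) = a \<odot>\<^bsub>T\<^esub> tens n x" if a: "a \<in> carrier R" for a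
   using a x tensor_relationsI(2)[of "\<one>\<^bsub>P\<^esub>" n a x] sub n
   by (auto simp: tens_def pure_def cl B_smult_closed eq single_def[symmetric] simp flip: alg_homD(3)[OF tclass_hom])
  fix y assume y: "y \<in> carrier (B n)"
  show "tens n (x \<oplus>\<^bsub>B n\<^esub> y) = tens n x \<oplus>\<^bsub>T\<^esub> tens n y"
   using y x tensor_relationsI(1)[of "\<one>\<^bsub>P\<^esub>" n x y] sub n
   by (auto simp: tens_def pure_def cl eq single_def[symmetric] simp flip: alg_homD(2)[OF tclass_hom])
  have "single n x \<otimes>\<^bsub>P\<^esub> single n y = single n (x \<otimes>\<^bsub>B n\<^esub> y)"
   using n B_cring by (auto simp: P_simps single_def fun_eq_iff cring.cring_simprules)
  then show "tens n (x \<otimes>\<^bsub>B n\<^esub> y) = tens n x \<otimes>\<^bsub>T\<^esub> tens n y"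
   using x y n by (simp add: tens_def pure_mult single_closed)
 next
  have "single n \<one>\<^bsub>B n\<^esub> = \<one>\<^bsub>P\<^esub>" using n by (auto simp: single_def P_simps)
  then show "tens n \<one>\<^bsub>B n\<^esub> = \<one>\<^bsub>T\<^esub>" by (simp add: tens_def pure_one)
 qed
qed

text \<open>The elements b of the n-th factor for which multiplication by \<open>tens n b\<close>
  preserves \<open>H\<close> form a test submodule for the generators \<open>S n\<close>, hence are
  all of \<open>B n\<close>. A pure tensor is a finite product of such \<open>tens k (f k)\<close>,
  one for each entry different from 1, so it lies in \<open>H\<close>; and pure tensors
  span.\<close>

lemma tensor_generated:
 assumes gen: "\<And>n. n \<in> N \<Longrightarrow> alg_generates R (B n) (S n)"
 shows "alg_generates R T (\<Union>n\<in>N. tens n ` S n)"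
 unfolding alg_generates_def
proof (intro conjI allI impI)
 interpret TC: cring T by (rule algebra.M_cring[OF T_algebra])
 interpret TA: algebra R T by (rule T_algebra)
 interpret Pm: comm_monoid P by (rule P_comm_monoid)
 show "(\<Union>n\<in>N. tens n ` S n) \<subseteq> carrier T"
  using gen alg_homD(1)[OF tens_hom] by (auto simp: alg_generates_def subset_iff)
 fix H assume H: "submodule H R T" and one: "\<one>\<^bsub>T\<^esub> \<in> H"
  and mult: "\<forall>s\<in>\<Union>n\<in>N. tens n ` S n. \<forall>x\<in>H. s \<otimes>\<^bsub>T\<^esub> x \<in> H"
 note Hd = TA.submoduleD[OF H]
 have Hc: "x \<in> H \<Longrightarrow> x \<in> carrier T" for x using Hd by blast
 have t: "tens n b \<otimes>\<^bsub>T\<^esub> x \<in> H" if n: "n \<in> N" and b: "b \<in> carrier (B n)" and x: "x \<in> H" for n b x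
 proof -
  interpret BC: cring "B n" using n by (rule B_cring)
  interpret Bn: algebra R "B n" using n by (rule B_algebra)
  note h = alg_homD[OF tens_hom[OF n]]
  have "b \<in> {b \<in> carrier (B n). \<forall>x\<in>H. tens n b \<otimes>\<^bsub>T\<^esub> x \<in> H}"
  proof (rule alg_generatesD[OF gen[OF n]])
   show "submodule {b \<in> carrier (B n). \<forall>x\<in>H. tens n b \<otimes>\<^bsub>T\<^esub> x \<in> H} R (B n)"
   proof (rule Bn.submoduleI')
    show "\<zero>\<^bsub>B n\<^esub> \<in> {b \<in> carrier (B n). \<forall>x\<in>H. tens n b \<otimes>\<^bsub>T\<^esub> x \<in> H}"
     using mod_hom_zero[OF Bn.module_axioms TA.module_axioms alg_mod_hom[OF tens_hom[OF n]]] Hd(2) Hc by auto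
   qed (use Hd Hc in \<open>auto simp: h TC.l_distr TA.smult_assoc2\<close>)
   show "\<one>\<^bsub>B n\<^esub> \<in> {b \<in> carrier (B n). \<forall>x\<in>H. tens n b \<otimes>\<^bsub>T\<^esub> x \<in> H}" using Hc by (auto simp: h)
   fix s y assume s: "s \<in> S n" and y: "y \<in> {b \<in> carrier (B n). \<forall>x\<in>H. tens n b \<otimes>\<^bsub>T\<^esub> x \<in> H}"
   have "s \<in> carrier (B n)" using gen[OF n] s by (auto simp: alg_generates_def)
   then show "s \<otimes>\<^bsub>B n\<^esub> y \<in> {b \<in> carrier (B n). \<forall>x\<in>H. tens n b \<otimes>\<^bsub>T\<^esub> x \<in> H}"
    using s y mult n Hc by (auto simp: h TC.m_assoc)
  qed (rule b)
  then show ?thesis using x by blast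
 qed
 have p: "pure f \<in> H" if f: "f \<in> carrier P" for f
 proof -
  have "pure (\<lambda>n\<in>N. if n \<in> K then f n else \<one>\<^bsub>B n\<^esub>) \<in> H \<and> (\<lambda>n\<in>N. if n \<in> K then f n else \<one>\<^bsub>B n\<^esub>) \<in> carrier P"
   if "finite K" "K \<subseteq> N" for K
   using that
  proof (induction K)
   case empty
   then show ?case using one Pm.one_closed by (simp add: P_simps(2)[symmetric] pure_one)
  next
   case (insert k K)
   let ?f = "\<lambda>K. \<lambda>n\<in>N. if n \<in> K then f n else \<one>\<^bsub>B n\<^esub>"
   have fk: "f k \<in> carrier (B k)" "k \<in> N" using f insert.prems by (auto simp: carrier_P)
   have e: "?f (insert k K) = single k (f k) \<otimes>\<^bsub>P\<^esub> ?f K"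
    using f fk insert.hyps B_cring
    by (auto simp: P_simps single_def carrier_P fun_eq_iff cring.cring_simprules B_r_one)
   have K: "?f K \<in> carrier P" "pure (?f K) \<in> H" using insert.IH insert.prems by blast+
   have "pure (?f (insert k K)) = tens k (f k) \<otimes>\<^bsub>T\<^esub> pure (?f K)"
    unfolding e tens_def using K fk by (simp add: pure_mult single_closed)
   then show ?case using t[OF fk(2,1) K(2)] e Pm.m_closed[OF single_closed[OF fk(2,1)] K(1)] by simp
  qed
  from this[of "{n \<in> N. f n \<noteq> \<one>\<^bsub>B n\<^esub>}"]
  have "pure (\<lambda>n\<in>N. if n \<in> {n \<in> N. f n \<noteq> \<one>\<^bsub>B n\<^esub>} then f n else \<one>\<^bsub>B n\<^esub>) \<in> H"
   using f by (simp add: carrier_P)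
  also have "(\<lambda>n\<in>N. if n \<in> {n \<in> N. f n \<noteq> \<one>\<^bsub>B n\<^esub>} then f n else \<one>\<^bsub>B n\<^esub>) = f"
   using f by (auto simp: carrier_P fun_eq_iff extensional_def)
  finally show ?thesis .
 qed
 note h = alg_homD[OF tclass_hom]
 interpret PA: algebra R PA by (rule PA_algebra)
 have "tclass q \<in> H" if "q \<in> carrier PA" for q
  using that
 proof (induction rule: PA_induct)
  case zero
  then show ?case using mod_hom_zero[OF PA.module_axioms TA.module_axioms alg_mod_hom[OF tclass_hom]] Hd by simp
 next
  case (basis a s q)
  then show ?case using p[of s] Hd by (simp add: h pelt_closed pure_def)
 qed
 then show "carrier T \<subseteq> H" by (auto elim: T_cases)
qed

text \<open>The universal property of the coproduct. Besides the values on \<open>tens\<close>,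
  those on all pure tensors are exported, since the degree argument of
  \<open>tensor_degree_image\<close> works with pure tensors.\<close>

lemma tensor_lift:
 fixes C :: "('a, 'c, 'q) module_scheme"
 assumes C: "algebra R C" and g: "\<And>n. n \<in> N \<Longrightarrow> g n \<in> alg_hom R (B n) C"
 obtains k where "k \<in> alg_hom R T C"
  "\<And>f. f \<in> carrier P \<Longrightarrow> k (pure f) = (\<Otimes>\<^bsub>C\<^esub>n\<in>{n \<in> N. f n \<noteq> \<one>\<^bsub>B n\<^esub>}. g n (f n))"
  "\<And>n x. n \<in> N \<Longrightarrow> x \<in> carrier (B n) \<Longrightarrow> k (tens n x) = g n x"
proof -
 interpret CC: cring C by (rule algebra.M_cring[OF C])
 interpret CA: algebra R C by (rule C)
 interpret PC: cring PA by (rule algebra.M_cring[OF PA_algebra])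
 interpret PA: algebra R PA by (rule PA_algebra)
 interpret Pm: comm_monoid P by (rule P_comm_monoid)
 define F where "F f = (\<Otimes>\<^bsub>C\<^esub>n\<in>{n \<in> N. f n \<noteq> \<one>\<^bsub>B n\<^esub>}. g n (f n))" for f
 have gc: "g n x \<in> carrier C" if "n \<in> N" "x \<in> carrier (B n)" for n x using alg_homD(1)[OF g] that .
 \<comment> \<open>Each \<open>g n\<close> preserves 1, so the product may be taken over any finite
   set containing the support. This makes products for different supports comparable.\<close>
 have Fsup: "F f = (\<Otimes>\<^bsub>C\<^esub>n\<in>K. g n (f n))" if "f \<in> carrier P" "finite K" "{n \<in> N. f n \<noteq> \<one>\<^bsub>B n\<^esub>} \<subseteq> K" "K \<subseteq> N" for f K
  unfolding F_def using that gc alg_homD(5)[OF g]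
  by (intro CC.finprod_mono_neutral_cong_left) (auto simp: carrier_P)
 have Fc: "F f \<in> carrier C" if "f \<in> carrier P" for f
  unfolding F_def using that gc by (intro CC.finprod_closed) (auto simp: carrier_P)
 have F: "F \<in> hom P C"
 proof (rule homI)
  fix f f' assume ff: "f \<in> carrier P" "f' \<in> carrier P"
  let ?K = "{n \<in> N. f n \<noteq> \<one>\<^bsub>B n\<^esub>} \<union> {n \<in> N. f' n \<noteq> \<one>\<^bsub>B n\<^esub>}"
  have K: "finite ?K" using ff by (auto simp: carrier_P)
  have "F (f \<otimes>\<^bsub>P\<^esub> f') = (\<Otimes>\<^bsub>C\<^esub>n\<in>?K. g n ((f \<otimes>\<^bsub>P\<^esub> f') n))"
   using ff K B_cring by (intro Fsup Pm.m_closed) (auto simp: P_simps cring.cring_simprules)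
  also have "\<dots> = (\<Otimes>\<^bsub>C\<^esub>n\<in>?K. g n (f n) \<otimes>\<^bsub>C\<^esub> g n (f' n))"
   using ff gc by (intro CC.finprod_cong') (auto simp: P_simps alg_homD(4)[OF g] carrier_P)
  also have "\<dots> = (\<Otimes>\<^bsub>C\<^esub>n\<in>?K. g n (f n)) \<otimes>\<^bsub>C\<^esub> (\<Otimes>\<^bsub>C\<^esub>n\<in>?K. g n (f' n))"
   using ff gc by (intro CC.finprod_multf) (auto simp: carrier_P)
  also have "\<dots> = F f \<otimes>\<^bsub>C\<^esub> F f'" using ff K by (intro arg_cong2[of _ _ _ _ "(\<otimes>\<^bsub>C\<^esub>)"] Fsup[symmetric]) auto
  finally show "F (f \<otimes>\<^bsub>P\<^esub> f') = F f \<otimes>\<^bsub>C\<^esub> F f'" .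
 qed (rule Fc)
 have F1: "F \<one>\<^bsub>P\<^esub> = \<one>\<^bsub>C\<^esub>"
 proof -
  have e: "{n \<in> N. \<one>\<^bsub>P\<^esub> n \<noteq> \<one>\<^bsub>B n\<^esub>} = {}" by (auto simp: P_simps)
  show ?thesis unfolding F_def e by simp
 qed
 define l where "l = lin_ext C F"
 have l: "l \<in> alg_hom R PA C" and lb: "\<And>f. f \<in> carrier P \<Longrightarrow> l (pelt f) = F f"
  unfolding l_def pure_algebra_def using C F F1
  by (rule mon_alg.MA_eval(1)[OF mon_alg_P], rule mon_alg.MA_eval(2)[OF mon_alg_P])
 note lm = alg_mod_hom[OF l]
 have rel: "l r = \<zero>\<^bsub>C\<^esub>" if "r \<in> tensor_relations" for r
 proof -
  \<comment> \<open>Splits off the factor at n. The rest does not involve x, so F is additive and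
    homogeneous in the n-th entry.\<close>
  have Fu: "F (f(n := x)) = g n x \<otimes>\<^bsub>C\<^esub> (\<Otimes>\<^bsub>C\<^esub>m\<in>{m \<in> N. f m \<noteq> \<one>\<^bsub>B m\<^esub>} - {n}. g m (f m))"
    (is "_ = _ \<otimes>\<^bsub>C\<^esub> ?rest f n")
   and rc: "(\<Otimes>\<^bsub>C\<^esub>m\<in>{m \<in> N. f m \<noteq> \<one>\<^bsub>B m\<^esub>} - {n}. g m (f m)) \<in> carrier C"
   if "f \<in> carrier P" "n \<in> N" "x \<in> carrier (B n)" for f n x
  proof -
   let ?K = "{m \<in> N. f m \<noteq> \<one>\<^bsub>B m\<^esub>} - {n}"
   have K: "finite ?K" using that by (simp add: carrier_P)
   have "F (f(n := x)) = (\<Otimes>\<^bsub>C\<^esub>m\<in>insert n ?K. g m ((f(n := x)) m))"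
    using that K by (intro Fsup upd_closed) auto
   also have "\<dots> = g n x \<otimes>\<^bsub>C\<^esub> (\<Otimes>\<^bsub>C\<^esub>m\<in>?K. g m ((f(n := x)) m))"
    using that gc K by (subst CC.finprod_insert) (auto simp: carrier_P)
   also have "(\<Otimes>\<^bsub>C\<^esub>m\<in>?K. g m ((f(n := x)) m)) = ?rest f n"
    using that gc by (intro CC.finprod_cong') (auto simp: carrier_P)
   finally show "F (f(n := x)) = g n x \<otimes>\<^bsub>C\<^esub> ?rest f n" .
   show "?rest f n \<in> carrier C" using that gc by (intro CC.finprod_closed) (auto simp: carrier_P)
  qed
  note mi = mod_hom_minus[OF PA.module_axioms CA.module_axioms lm]
  show ?thesis using that
  proof (cases rule: tensor_relations_cases)
   case (add f n x y)
   then show ?thesis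
    by (simp add: mi alg_homD[OF l] pelt_closed upd_closed B_add_closed lb Fu rc gc
      alg_homD(2)[OF g] CC.l_distr CC.minus_zero_iff)
  next
   case (smult f n a x)
   then show ?thesis
    by (simp add: mi alg_homD[OF l] pelt_closed upd_closed B_smult_closed lb Fu rc gc
      alg_homD(3)[OF g] CA.smult_assoc2 CC.minus_zero_iff)
  qed
 qed
 have "TI \<subseteq> {p \<in> carrier PA. l p \<in> {\<zero>\<^bsub>C\<^esub>}}"
  unfolding TI_eq
 proof (rule PA.mod_span_minimal[OF PA.submodule_vimage[OF CA.module_axioms lm]])
  show "submodule {\<zero>\<^bsub>C\<^esub>} R C" by (rule CA.submoduleI') auto
 qed (use rel tensor_relations_closed in auto)
 then have ker: "l p = \<zero>\<^bsub>C\<^esub>" if "p \<in> TI" for p using that by blast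
 have ql: "quot_lift l \<in> alg_hom R (quot_module PA TI) C"
  by (rule PA.quot_lift_hom(1)[OF TI_ideal C l ker])
 have ql2: "quot_lift l (tclass p) = l p" if "p \<in> carrier PA" for p
  by (rule PA.quot_lift_hom(2)[OF TI_ideal C l ker that])
 have pf: "quot_lift l (pure f) = F f" if "f \<in> carrier P" for f
  unfolding pure_def using ql2[OF pelt_closed[OF that]] that by (simp add: lb)
 show ?thesis
 proof (rule that)
  show "quot_lift l \<in> alg_hom R T C" unfolding tensor_algebra_def by (rule ql)
  show "quot_lift l (pure f) = (\<Otimes>\<^bsub>C\<^esub>n\<in>{n \<in> N. f n \<noteq> \<one>\<^bsub>B n\<^esub>}. g n (f n))" if "f \<in> carrier P" for f
   using pf[OF that] by (simp add: F_def)
  fix n x assume nx: "n \<in> N" "x \<in> carrier (B n)"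
  have "F (single n x) = (\<Otimes>\<^bsub>C\<^esub>m\<in>{n}. g m (single n x m))"
   using nx by (intro Fsup single_closed) (auto simp: single_def P_simps)
  also have "\<dots> = g n x" using nx gc by (simp add: single_def)
  finally show "quot_lift l (tens n x) = g n x" using nx by (simp add: tens_def pf single_closed)
 qed
qed

section \<open>The total grading of the tensor product\<close>

abbreviation "TD gr d \<equiv> tensor_degree R N B gr d"

definition homog_pure :: "('i \<Rightarrow> nat \<Rightarrow> 'b set) \<Rightarrow> nat \<Rightarrow> (('i \<Rightarrow> 'b) \<Rightarrow> 'a) set set" where
 "homog_pure gr d = {pure f | f. f \<in> carrier P \<and>
    (\<exists>dg :: 'i \<Rightarrow> nat. finite {n \<in> N. dg n \<noteq> 0} \<and> (\<forall>n\<in>N. f n \<in> gr n (dg n)) \<and>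
      (\<Sum>n\<in>{n \<in> N. dg n \<noteq> 0}. dg n) = d)}"

lemma tensor_degree_eq: "TD gr d = mod_span R T (homog_pure gr d)"
 by (simp add: tensor_degree_def homog_pure_def pure_def)

lemma homog_pure_closed: "homog_pure gr d \<subseteq> carrier T"
 by (auto simp: homog_pure_def pure_closed)

lemma tensor_degree_submodule: "submodule (TD gr d) R T"
 unfolding tensor_degree_eq by (rule module.mod_span_submodule[OF algebra.module[OF T_algebra] homog_pure_closed])

text \<open>Allows the degrees to be summed over any finite set that covers the support of
  \<open>dg\<close>, not only over the exact support.\<close>

lemma homog_pureI:
 assumes "f \<in> carrier P" "finite K" "K \<subseteq> N" "\<And>n. n \<in> N \<Longrightarrow> n \<notin> K \<Longrightarrow> dg n = 0"
  "\<And>n. n \<in> N \<Longrightarrow> f n \<in> gr n (dg n)" "(\<Sum>n\<in>K. dg n) = d"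
 shows "pure f \<in> homog_pure gr d"
proof -
 have "{n \<in> N. dg n \<noteq> 0} \<subseteq> K" using assms(4) by fastforce
 moreover from this have "(\<Sum>n\<in>{n \<in> N. dg n \<noteq> 0}. dg n) = (\<Sum>n\<in>K. dg n)"
  using assms(2,3) by (intro sum.mono_neutral_left) auto
 ultimately show ?thesis using assms unfolding homog_pure_def by (blast intro: finite_subset)
qed

lemma tensor_degree_one:
 assumes "\<And>n. n \<in> N \<Longrightarrow> \<one>\<^bsub>B n\<^esub> \<in> gr n 0"
 shows "\<one>\<^bsub>T\<^esub> \<in> TD gr 0"
proof -
 have "pure \<one>\<^bsub>P\<^esub> \<in> homog_pure gr 0"
  using assms Group.monoid.one_closed[OF comm_monoid.axioms(1)[OF P_comm_monoid]]
  by (intro homog_pureI[where K = "{}" and dg = "\<lambda>_. 0"]) (auto simp: P_simps)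
 then show ?thesis
  using module.mod_span_superset[OF algebra.module[OF T_algebra], of "homog_pure gr 0"]
  unfolding tensor_degree_eq pure_one by blast
qed

lemma tensor_degree_mult:
 assumes gr: "\<And>n d e x y. \<lbrakk>n \<in> N; x \<in> gr n d; y \<in> gr n e\<rbrakk> \<Longrightarrow> x \<otimes>\<^bsub>B n\<^esub> y \<in> gr n (d + e)"
  and w: "w \<in> TD gr d" and z: "z \<in> TD gr e"
 shows "w \<otimes>\<^bsub>T\<^esub> z \<in> TD gr (d + e)"
proof -
 interpret TC: cring T by (rule algebra.M_cring[OF T_algebra])
 interpret TA: algebra R T by (rule T_algebra)
 interpret Pm: comm_monoid P by (rule P_comm_monoid)
 have zc: "y \<in> mod_span R T (homog_pure gr c) \<Longrightarrow> y \<in> carrier T" for y c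
  using TA.mod_span_closed[OF homog_pure_closed] by blast
 note s = TA.submoduleD[OF tensor_degree_submodule[of gr "d + e"]]
 have gen: "x \<otimes>\<^bsub>T\<^esub> y \<in> TD gr (d + e)" if "x \<in> homog_pure gr d" "y \<in> homog_pure gr e" for x y
 proof -
  from that obtain f dg g dg' where f: "x = pure f" "f \<in> carrier P" "finite {n \<in> N. dg n \<noteq> 0}"
    "\<forall>n\<in>N. f n \<in> gr n (dg n)" "(\<Sum>n\<in>{n \<in> N. dg n \<noteq> 0}. dg n) = d"
   and g: "y = pure g" "g \<in> carrier P" "finite {n \<in> N. dg' n \<noteq> 0}"
    "\<forall>n\<in>N. g n \<in> gr n (dg' n)" "(\<Sum>n\<in>{n \<in> N. dg' n \<noteq> 0}. dg' n) = e"
   unfolding homog_pure_def by blast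
  let ?K = "{n \<in> N. dg n \<noteq> 0} \<union> {n \<in> N. dg' n \<noteq> 0}"
  have K: "finite ?K" using f g by simp
  have "(\<Sum>n\<in>?K. dg n) = d" "(\<Sum>n\<in>?K. dg' n) = e"
   unfolding f(5)[symmetric] g(5)[symmetric] by (rule sum.mono_neutral_right[OF K]; auto)+
  then have dg: "(\<Sum>n\<in>?K. dg n + dg' n) = d + e" by (simp add: sum.distrib)
  have fg: "f \<otimes>\<^bsub>P\<^esub> g \<in> carrier P" using f(2) g(2) by (rule Pm.m_closed)
  have "pure (f \<otimes>\<^bsub>P\<^esub> g) \<in> homog_pure gr (d + e)"
   by (rule homog_pureI[OF fg K, where dg = "\<lambda>n. dg n + dg' n"])
    (use f g dg gr in \<open>auto simp: P_simps\<close>)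
  then have "pure (f \<otimes>\<^bsub>P\<^esub> g) \<in> TD gr (d + e)"
   using TA.mod_span_superset by (auto simp: tensor_degree_eq)
  then show ?thesis using f g by (simp add: pure_mult)
 qed
 have r: "x \<otimes>\<^bsub>T\<^esub> z \<in> TD gr (d + e)" if x: "x \<in> homog_pure gr d" for x
 proof -
  have xc: "x \<in> carrier T" using x homog_pure_closed by blast
  have "z \<in> mod_span R T (homog_pure gr e)" using z by (simp add: tensor_degree_eq)
  then show ?thesis using homog_pure_closed
  proof (induction rule: TA.mod_span_induct)
   case (smult a y)
   then show ?case using xc zc[of y] s(6) TA.smult_assoc2[of a y x] by (simp add: TC.m_comm[of x])
  qed (use gen x s(2,3) xc zc in \<open>simp_all add: TC.r_distr\<close>)
 qed
 have "w \<in> mod_span R T (homog_pure gr d)" using w by (simp add: tensor_degree_eq)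
 then show ?thesis using homog_pure_closed
 proof (induction rule: TA.mod_span_induct)
  case (smult a y)
  then show ?case using zc[of y] zc[of z] z s(6) by (simp add: TA.smult_assoc2 tensor_degree_eq)
 next
  case (add y y')
  then show ?case using zc[of y] zc[of y'] zc[of z] z s(3) by (simp add: TC.l_distr tensor_degree_eq)
 next
  case zero
  then show ?case using zc[of z] z s(2) by (simp add: tensor_degree_eq)
 qed (rule r)
qed

text \<open>A homogeneous pure tensor goes to the product of the images of its factors, and the
  degrees of a product add up. The family \<open>K\<close> is any multiplicative family of
  submodules; spans are then taken care of by linearity.\<close>

lemma tensor_degree_image:
 assumes C: "algebra R C" and k: "k \<in> alg_hom R T C"
  and kp: "\<And>f. f \<in> carrier P \<Longrightarrow> k (pure f) = (\<Otimes>\<^bsub>C\<^esub>n\<in>{n \<in> N. f n \<noteq> \<one>\<^bsub>B n\<^esub>}. g n (f n))"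
  and g: "\<And>n. n \<in> N \<Longrightarrow> g n \<in> alg_hom R (B n) C"
  and gK: "\<And>n x d. n \<in> N \<Longrightarrow> x \<in> gr n d \<Longrightarrow> g n x \<in> K d"
  and K: "\<And>d. submodule (K d) R C" "\<one>\<^bsub>C\<^esub> \<in> K 0"
   "\<And>d e x y. x \<in> K d \<Longrightarrow> y \<in> K e \<Longrightarrow> x \<otimes>\<^bsub>C\<^esub> y \<in> K (d + e)"
  and z: "z \<in> TD gr d"
 shows "k z \<in> K d"
proof -
 interpret CC: cring C by (rule algebra.M_cring[OF C])
 interpret CA: algebra R C by (rule C)
 interpret TA: algebra R T by (rule T_algebra)
 have "mod_span R T (homog_pure gr d) \<subseteq> {z \<in> carrier T. k z \<in> K d}"
 proof (rule TA.mod_span_minimal[OF TA.submodule_vimage[OF CA.module_axioms alg_mod_hom[OF k] K(1)]], rule subsetI)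
  fix w assume w: "w \<in> homog_pure gr d"
  then obtain f dg where f: "w = pure f" "f \<in> carrier P" "finite {n \<in> N. dg n \<noteq> 0}"
    "\<forall>n\<in>N. f n \<in> gr n (dg n)" "(\<Sum>n\<in>{n \<in> N. dg n \<noteq> 0}. dg n) = d"
   unfolding homog_pure_def by blast
  \<comment> \<open>Both supports have to be united: an entry equal to 1 may have been assigned a
    non-zero degree, because the summands of \<open>gr\<close> are not assumed to be
    independent.\<close>
  let ?S = "{n \<in> N. f n \<noteq> \<one>\<^bsub>B n\<^esub>} \<union> {n \<in> N. dg n \<noteq> 0}"
  have S: "finite ?S" using f by (auto simp: carrier_P)
  have gc: "g n (f n) \<in> carrier C" if "n \<in> N" for n using that f(2) alg_homD(1)[OF g] by (auto simp: carrier_P)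
  have "k w = (\<Otimes>\<^bsub>C\<^esub>n\<in>?S. g n (f n))"
   unfolding f(1) kp[OF f(2)] using S gc alg_homD(5)[OF g]
   by (intro CC.finprod_mono_neutral_cong_left) auto
  also have "\<dots> \<in> K (\<Sum>n\<in>?S. dg n)"
  proof -
   have "(\<Otimes>\<^bsub>C\<^esub>n\<in>S. g n (f n)) \<in> K (\<Sum>n\<in>S. dg n)" if "finite S" "S \<subseteq> N" for S
    using that by (induction S) (use K gK f(4) gc in \<open>auto simp: Pi_iff subset_iff\<close>)
   then show ?thesis using S by blast
  qed
  also have "(\<Sum>n\<in>?S. dg n) = d" unfolding f(5)[symmetric] using S by (intro sum.mono_neutral_right) auto
  finally show "w \<in> {z \<in> carrier T. k z \<in> K d}" using w homog_pure_closed by auto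
 qed
 then show ?thesis using z by (auto simp: tensor_degree_eq)
qed

end

section \<open>Power series and substitution\<close>

text \<open>\<open>power_series_ring\<close> equipped with scalar multiplication, so that the
  results on algebras and on linear maps apply to it.\<close>

definition psa :: "('r, 'm) ring_scheme \<Rightarrow> ('r, nat multiset \<Rightarrow> 'r) module" where
 "psa R = ring.extend (power_series_ring R) (module.fields (\<lambda>a p m. a \<otimes>\<^bsub>R\<^esub> p m))"

lemma psa_simps:
 "p \<in> carrier (psa R) \<longleftrightarrow> (\<forall>m. p m \<in> carrier R)"
 "\<one>\<^bsub>psa R\<^esub> = (\<lambda>m. if m = {#} then \<one>\<^bsub>R\<^esub> else \<zero>\<^bsub>R\<^esub>)"
 "p \<otimes>\<^bsub>psa R\<^esub> q = (\<lambda>m. \<Oplus>\<^bsub>R\<^esub>k\<in>{k. k \<subseteq># m}. p k \<otimes>\<^bsub>R\<^esub> q (m - k))"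
 "\<zero>\<^bsub>psa R\<^esub> = (\<lambda>m. \<zero>\<^bsub>R\<^esub>)"
 "p \<oplus>\<^bsub>psa R\<^esub> q = (\<lambda>m. p m \<oplus>\<^bsub>R\<^esub> q m)"
 "a \<odot>\<^bsub>psa R\<^esub> p = (\<lambda>m. a \<otimes>\<^bsub>R\<^esub> p m)"
 by (simp_all add: psa_def power_series_ring_def ring.extend_def module.fields_def)

lemma ps_algebra_mult: "p \<otimes>\<^bsub>power_series_ring R\<^esub> q = p \<otimes>\<^bsub>psa R\<^esub> q"
 by (simp add: psa_simps power_series_ring_simps)

lemma ps_algebra_pow: "p [^]\<^bsub>power_series_ring R\<^esub> (n::nat) = p [^]\<^bsub>psa R\<^esub> n"
 by (induction n) (simp_all add: pow_power_series ps_algebra_mult, simp add: psa_simps power_series_ring_simps)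

lemma submultiset_antidiag: "(\<lambda>k. (k, g - k)) ` {k. k \<subseteq># g} = {(h, k). h + k = (g::'v multiset)}"
 by (auto simp: image_iff)

context cring
begin

abbreviation "PSA \<equiv> psa R"

lemma poly_mult_formula:
 assumes "p \<in> carrier (poly_algebra R V)" "q \<in> carrier (poly_algebra R V)"
 shows "(p \<otimes>\<^bsub>poly_algebra R V\<^esub> q) g = (\<Oplus>k\<in>{k. k \<subseteq># g}. p k \<otimes> q (g - k))"
proof -
 have c: "p s \<in> carrier R" "q s \<in> carrier R" for s
  using assms by (simp_all add: poly_algebra_def monoid_algebra_simps carrier_free_module)
 have fin: "finite {(h, k). h + k = g}"
  unfolding submultiset_antidiag[symmetric] using finite_submultisets by auto
 have "(p \<otimes>\<^bsub>poly_algebra R V\<^esub> q) g = (\<Oplus>z\<in>{(h, k). h + k = g}. p (fst z) \<otimes> q (snd z))"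
  unfolding poly_algebra_def monoid_algebra_mult mset_monoid_simps using c fin
  by (intro add.finprod_mono_neutral_cong_left) auto
 also have "\<dots> = (\<Oplus>k\<in>{k. k \<subseteq># g}. p k \<otimes> q (g - k))"
  unfolding submultiset_antidiag[symmetric] using c by (subst finsum_reindex) (auto simp: inj_on_def)
 finally show ?thesis .
qed

lemma PSA_mult_cong:
 assumes "\<And>k. k \<subseteq># m \<Longrightarrow> p k = p' k" "\<And>k. k \<subseteq># m \<Longrightarrow> q k = q' k"
  and "p' \<in> carrier PSA" "q' \<in> carrier PSA"
 shows "(p \<otimes>\<^bsub>PSA\<^esub> q) m = (p' \<otimes>\<^bsub>PSA\<^esub> q') m"
 unfolding psa_simps using assms
 by (intro add.finprod_cong') (auto simp: psa_simps)

definition ps_trunc :: "nat multiset set \<Rightarrow> (nat multiset \<Rightarrow> 'a) \<Rightarrow> nat multiset \<Rightarrow> 'a" where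
 "ps_trunc K p = (\<lambda>k. if k \<in> K then p k else \<zero>)"

lemma ps_trunc_closed:
 "finite K \<Longrightarrow> p \<in> carrier PSA \<Longrightarrow> (\<And>k. k \<in> K \<Longrightarrow> set_mset k \<subseteq> V) \<Longrightarrow>
   ps_trunc K p \<in> carrier (poly_algebra R V)"
 by (auto simp: poly_algebra_def monoid_algebra_simps carrier_free_module ps_trunc_def psa_simps
   mset_monoid_simps intro: finite_subset)

lemma poly_sub_PSA: "p \<in> carrier (poly_algebra R V) \<Longrightarrow> p \<in> carrier PSA"
 by (simp add: poly_algebra_def monoid_algebra_simps carrier_free_module psa_simps)

lemma poly_mult_PSA:
 "p \<in> carrier (poly_algebra R V) \<Longrightarrow> q \<in> carrier (poly_algebra R V) \<Longrightarrow>
  p \<otimes>\<^bsub>PSA\<^esub> q = p \<otimes>\<^bsub>poly_algebra R V\<^esub> q"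
 by (rule ext) (simp add: poly_mult_formula psa_simps)

lemma PSA_mult_closed: "p \<in> carrier PSA \<Longrightarrow> q \<in> carrier PSA \<Longrightarrow> p \<otimes>\<^bsub>PSA\<^esub> q \<in> carrier PSA"
 by (simp add: psa_simps finsum_closed Pi_iff)

text \<open>Commutativity and associativity at a monomial only involve finitely many coefficients and are
 inherited from polynomials.\<close>

lemma PSA_algebra: "algebra R PSA"
proof (rule algebraI[OF is_cring])
 interpret PO: cring "poly_algebra R UNIV" by (rule algebra.M_cring[OF poly_algebra_algebra])
 have ag: "abelian_group PSA"
 proof (rule abelian_groupI)
  fix p assume "p \<in> carrier PSA"
  then show "\<exists>y\<in>carrier PSA. y \<oplus>\<^bsub>PSA\<^esub> p = \<zero>\<^bsub>PSA\<^esub>"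
   by (intro bexI[of _ "\<lambda>m. \<ominus> p m"]) (auto simp: psa_simps l_neg)
 qed (auto simp: psa_simps a_ac)
 show "cring PSA"
 proof (rule cringI[OF ag])
  show "Group.comm_monoid PSA"
  proof (rule comm_monoidI)
   fix p q assume pq: "p \<in> carrier PSA" "q \<in> carrier PSA"
   let ?t = "\<lambda>m. ps_trunc {k. k \<subseteq># m}"
   have t: "?t m u \<in> carrier (poly_algebra R UNIV)" if "u \<in> carrier PSA" for u m
    using that finite_submultisets by (intro ps_trunc_closed) auto
   have tt: "(u \<otimes>\<^bsub>PSA\<^esub> v) k = (?t m u \<otimes>\<^bsub>poly_algebra R UNIV\<^esub> ?t m v) k"
    if "u \<in> carrier PSA" "v \<in> carrier PSA" "k \<subseteq># m" for u v k m
    unfolding poly_mult_PSA[OF t[OF that(1)] t[OF that(2)], symmetric] using that poly_sub_PSA[OF t]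
    by (intro PSA_mult_cong) (auto simp: ps_trunc_def intro: subset_mset.order_trans)
   show "p \<otimes>\<^bsub>PSA\<^esub> q \<in> carrier PSA" using pq by (rule PSA_mult_closed)
   show "p \<otimes>\<^bsub>PSA\<^esub> q = q \<otimes>\<^bsub>PSA\<^esub> p"
    by (rule ext) (simp add: tt[OF _ _ subset_mset.order_refl] pq t PO.m_comm)
   fix r assume r: "r \<in> carrier PSA"
   show "p \<otimes>\<^bsub>PSA\<^esub> q \<otimes>\<^bsub>PSA\<^esub> r = p \<otimes>\<^bsub>PSA\<^esub> (q \<otimes>\<^bsub>PSA\<^esub> r)"
   proof
    fix m :: "nat multiset"
    let ?P = "poly_algebra R (UNIV :: nat set)"
    note c = t[OF pq(1), of m] t[OF pq(2), of m] t[OF r, of m]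
    have "(p \<otimes>\<^bsub>PSA\<^esub> q \<otimes>\<^bsub>PSA\<^esub> r) m = ((?t m p \<otimes>\<^bsub>?P\<^esub> ?t m q) \<otimes>\<^bsub>PSA\<^esub> ?t m r) m"
     using c pq r poly_sub_PSA PO.m_closed by (intro PSA_mult_cong) (auto simp: tt ps_trunc_def)
    also have "\<dots> = ((?t m p \<otimes>\<^bsub>?P\<^esub> ?t m q) \<otimes>\<^bsub>?P\<^esub> ?t m r) m"
     using c PO.m_closed by (simp add: poly_mult_PSA[where V = UNIV])
    also have "\<dots> = (?t m p \<otimes>\<^bsub>?P\<^esub> (?t m q \<otimes>\<^bsub>?P\<^esub> ?t m r)) m" using c by (simp add: PO.m_assoc)
    also have "\<dots> = (?t m p \<otimes>\<^bsub>PSA\<^esub> (?t m q \<otimes>\<^bsub>?P\<^esub> ?t m r)) m"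
     using c PO.m_closed by (simp add: poly_mult_PSA[where V = UNIV])
    also have "\<dots> = (p \<otimes>\<^bsub>PSA\<^esub> (q \<otimes>\<^bsub>PSA\<^esub> r)) m"
     using c pq r poly_sub_PSA PSA_mult_closed by (intro PSA_mult_cong) (auto simp: tt ps_trunc_def)
    finally show "(p \<otimes>\<^bsub>PSA\<^esub> q \<otimes>\<^bsub>PSA\<^esub> r) m = (p \<otimes>\<^bsub>PSA\<^esub> (q \<otimes>\<^bsub>PSA\<^esub> r)) m" .
   qed
  next
   show "\<one>\<^bsub>PSA\<^esub> \<in> carrier PSA" by (simp add: psa_simps)
   fix p assume p: "p \<in> carrier PSA"
   show "\<one>\<^bsub>PSA\<^esub> \<otimes>\<^bsub>PSA\<^esub> p = p"
   proof
    fix m :: "nat multiset"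
    have "(\<one>\<^bsub>PSA\<^esub> \<otimes>\<^bsub>PSA\<^esub> p) m = (\<Oplus>k\<in>{{#}}. p (m - k))"
     unfolding psa_simps
     by (rule add.finprod_mono_neutral_cong_right) (use p finite_submultisets in \<open>auto simp: psa_simps\<close>)
    then show "(\<one>\<^bsub>PSA\<^esub> \<otimes>\<^bsub>PSA\<^esub> p) m = p m" using p by (simp add: psa_simps)
   qed
  qed
  fix p q r assume c: "p \<in> carrier PSA" "q \<in> carrier PSA" "r \<in> carrier PSA"
  show "(p \<oplus>\<^bsub>PSA\<^esub> q) \<otimes>\<^bsub>PSA\<^esub> r = p \<otimes>\<^bsub>PSA\<^esub> r \<oplus>\<^bsub>PSA\<^esub> q \<otimes>\<^bsub>PSA\<^esub> r"
  proof
   fix m :: "nat multiset"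
   show "((p \<oplus>\<^bsub>PSA\<^esub> q) \<otimes>\<^bsub>PSA\<^esub> r) m = (p \<otimes>\<^bsub>PSA\<^esub> r \<oplus>\<^bsub>PSA\<^esub> q \<otimes>\<^bsub>PSA\<^esub> r) m"
    unfolding psa_simps(3,5)
    by (subst finsum_addf[symmetric]) (use c in \<open>auto simp: psa_simps(1) l_distr intro!: add.finprod_cong'\<close>)
  qed
 qed
next
 fix a p q assume c: "a \<in> carrier R" "p \<in> carrier PSA" "q \<in> carrier PSA"
 show "(a \<odot>\<^bsub>PSA\<^esub> p) \<otimes>\<^bsub>PSA\<^esub> q = a \<odot>\<^bsub>PSA\<^esub> (p \<otimes>\<^bsub>PSA\<^esub> q)"
  using c by (simp add: psa_simps finsum_rdistr finite_submultisets Pi_iff m_assoc)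
qed (auto simp: psa_simps l_distr r_distr m_assoc)

lemma PSA_cring: "cring PSA"
 by (rule algebra.M_cring[OF PSA_algebra])

lemma PSA_finsum:
 assumes "f \<in> S \<rightarrow> carrier PSA"
 shows "(\<Oplus>\<^bsub>PSA\<^esub>i\<in>S. f i) m = (\<Oplus>i\<in>S. f i m)"
proof -
 interpret P: cring PSA by (rule PSA_cring)
 show ?thesis
 proof (cases "finite S")
  case True
  then show ?thesis using assms
  proof (induction S)
   case (insert i S)
   then have "f j m \<in> carrier R" if "j \<in> insert i S" for j using that by (auto simp: Pi_iff psa_simps(1))
   then show ?case using insert by (simp add: Pi_iff) (simp add: psa_simps(5))
  qed (simp add: psa_simps)
 qed (simp add: add.finprod_infinite P.add.finprod_infinite psa_simps)
qed

text \<open>The filtration by order. The members of \<open>ps_ord 1\<close>, the series without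
  constant term, are those that may be substituted into other series.\<close>

definition ps_ord :: "nat \<Rightarrow> (nat multiset \<Rightarrow> 'a) set" where
 "ps_ord k = {p \<in> carrier PSA. \<forall>m. size m < k \<longrightarrow> p m = \<zero>}"

lemma ps_ord_closed: "p \<in> ps_ord k \<Longrightarrow> p \<in> carrier PSA"
 by (simp add: ps_ord_def)

lemma ps_ord_0: "ps_ord 0 = carrier PSA"
 by (simp add: ps_ord_def)

lemma ps_ord_mult:
 assumes p: "p \<in> ps_ord i" and q: "q \<in> ps_ord j"
 shows "p \<otimes>\<^bsub>PSA\<^esub> q \<in> ps_ord (i + j)"
proof -
 have "(p \<otimes>\<^bsub>PSA\<^esub> q) m = \<zero>" if m: "size m < i + j" for m
 proof -
  have z: "p k \<otimes> q (m - k) = \<zero>" if k: "k \<subseteq># m" for k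
  proof (cases "size k < i")
   case True
   then show ?thesis using p q by (simp add: ps_ord_def psa_simps(1))
  next
   case False
   then have "size (m - k) < j" using m k by (simp add: size_Diff_submset size_mset_mono less_diff_conv2)
   then show ?thesis using p q by (simp add: ps_ord_def psa_simps(1))
  qed
  have "(p \<otimes>\<^bsub>PSA\<^esub> q) m = (\<Oplus>k\<in>{k. k \<subseteq># m}. \<zero>)"
   unfolding psa_simps using z by (intro add.finprod_cong') auto
  then show ?thesis by simp
 qed
 then show ?thesis using p q PSA_mult_closed by (simp add: ps_ord_def)
qed

lemma ps_ord_pow:
 assumes "p \<in> ps_ord 1"
 shows "p [^]\<^bsub>PSA\<^esub> (k::nat) \<in> ps_ord k"
proof (induction k)
 case 0
 show ?case by (simp add: ps_ord_0) (simp add: psa_simps)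
next
 case (Suc k)
 then show ?case using ps_ord_mult[OF Suc assms] by simp
qed

lemma ps_ord_add: "p \<in> ps_ord i \<Longrightarrow> q \<in> ps_ord i \<Longrightarrow> p \<oplus>\<^bsub>PSA\<^esub> q \<in> ps_ord i"
 by (simp add: ps_ord_def psa_simps)

lemma ps_ord_smult: "a \<in> carrier R \<Longrightarrow> p \<in> ps_ord i \<Longrightarrow> a \<odot>\<^bsub>PSA\<^esub> p \<in> ps_ord i"
 by (simp add: ps_ord_def psa_simps)

lemma ps_var_ord: "ps_var R v \<in> ps_ord 1"
 by (auto simp: ps_ord_def ps_var_def psa_simps)

lemma zero_ord: "\<zero>\<^bsub>PSA\<^esub> \<in> ps_ord k"
 by (auto simp: ps_ord_def psa_simps)

lemma ps_var_mult:
 assumes p: "p \<in> carrier PSA"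
 shows "(p \<otimes>\<^bsub>PSA\<^esub> ps_var R v) m = (if v \<in># m then p (m - {#v#}) else \<zero>)"
proof -
 interpret P: cring PSA by (rule PSA_cring)
 have pc: "p k \<in> carrier R" for k using p by (simp add: psa_simps)
 have "p \<otimes>\<^bsub>PSA\<^esub> ps_var R v = ps_var R v \<otimes>\<^bsub>PSA\<^esub> p"
  using p ps_var_ord[THEN ps_ord_closed] by (intro P.m_comm)
 then have e: "(p \<otimes>\<^bsub>PSA\<^esub> ps_var R v) m = (\<Oplus>k\<in>{k. k \<subseteq># m}. ps_var R v k \<otimes> p (m - k))"
  by (simp add: psa_simps)
 also have "\<dots> = (\<Oplus>k\<in>{{#v#}} \<inter> {k. k \<subseteq># m}. p (m - k))"
  by (rule add.finprod_mono_neutral_cong_right) (use pc finite_submultisets in \<open>auto simp: ps_var_def\<close>)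
 also have "\<dots> = (if v \<in># m then p (m - {#v#}) else \<zero>)"
  using pc by (auto simp: Int_insert_left)
 finally show ?thesis .
qed

lemma ps_var_pow_mult:
 assumes p: "p \<in> carrier PSA"
 shows "(p \<otimes>\<^bsub>PSA\<^esub> ps_var R v [^]\<^bsub>PSA\<^esub> (k::nat)) m =
  (if k \<le> count m v then p (m - replicate_mset k v) else \<zero>)"
proof (induction k arbitrary: m)
 case 0
 interpret P: cring PSA by (rule PSA_cring)
 show ?case using p by simp
next
 case (Suc k)
 interpret P: cring PSA by (rule PSA_cring)
 note v = ps_var_ord[THEN ps_ord_closed, of v]
 have "p \<otimes>\<^bsub>PSA\<^esub> ps_var R v [^]\<^bsub>PSA\<^esub> Suc k = (p \<otimes>\<^bsub>PSA\<^esub> ps_var R v [^]\<^bsub>PSA\<^esub> k) \<otimes>\<^bsub>PSA\<^esub> ps_var R v"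
  using p v by (simp add: P.m_assoc)
 then have "(p \<otimes>\<^bsub>PSA\<^esub> ps_var R v [^]\<^bsub>PSA\<^esub> Suc k) m =
   (if v \<in># m then (p \<otimes>\<^bsub>PSA\<^esub> ps_var R v [^]\<^bsub>PSA\<^esub> k) (m - {#v#}) else \<zero>)"
  using p v ps_var_mult[of "p \<otimes>\<^bsub>PSA\<^esub> ps_var R v [^]\<^bsub>PSA\<^esub> k" v m] by simp
 moreover have "m - {#v#} - replicate_mset k v = m - replicate_mset (Suc k) v"
  by (rule multiset_eqI) simp
 moreover have "(v \<in># m \<and> k \<le> count (m - {#v#}) v) \<longleftrightarrow> Suc k \<le> count m v"
  by (auto simp flip: count_greater_zero_iff)
 ultimately show ?case unfolding Suc by auto
qed

section \<open>Series in two variables and substitution as an algebra homomorphism\<close>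

definition mon :: "nat \<Rightarrow> nat \<Rightarrow> nat multiset" where
 "mon i j = replicate_mset i 0 + replicate_mset j 1"

lemma count_mon: "count (mon i j) v = (if v = 0 then i else if v = 1 then j else 0)"
 by (auto simp: mon_def)

lemma size_mon [simp]: "size (mon i j) = i + j"
 by (simp add: mon_def)

lemma mon_eq_iff: "mon i j = mon i' j' \<longleftrightarrow> i = i' \<and> j = j'"
 by (metis count_mon zero_neq_one)

lemma mon_count: "set_mset m \<subseteq> {0, 1} \<Longrightarrow> m = mon (count m 0) (count m 1)"
 by (rule multiset_eqI) (auto simp: count_mon not_in_iff subset_iff)

lemma ps_var_pow2:
 assumes "u \<noteq> v"
 shows "(ps_var R u [^]\<^bsub>PSA\<^esub> (i::nat) \<otimes>\<^bsub>PSA\<^esub> ps_var R v [^]\<^bsub>PSA\<^esub> (j::nat)) m =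
  (if m = replicate_mset i u + replicate_mset j v then \<one> else \<zero>)"
proof -
 interpret P: cring PSA by (rule PSA_cring)
 note c = ps_var_ord[THEN ps_ord_closed]
 have u: "(ps_var R u [^]\<^bsub>PSA\<^esub> i) m = (if m = replicate_mset i u then \<one> else \<zero>)" for m
 proof -
  have "(ps_var R u [^]\<^bsub>PSA\<^esub> i) m = (\<one>\<^bsub>PSA\<^esub> \<otimes>\<^bsub>PSA\<^esub> ps_var R u [^]\<^bsub>PSA\<^esub> i) m" using c by simp
  also have "\<dots> = (if i \<le> count m u then \<one>\<^bsub>PSA\<^esub> (m - replicate_mset i u) else \<zero>)"
   by (rule ps_var_pow_mult) simp
  also have "\<dots> = (if m = replicate_mset i u then \<one> else \<zero>)"
   by (auto simp: psa_simps count_le_replicate_mset_subset_eq Diff_eq_empty_iff_mset)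
  finally show ?thesis .
 qed
 have e: "(j \<le> count m v \<and> m - replicate_mset j v = replicate_mset i u) \<longleftrightarrow> m = replicate_mset i u + replicate_mset j v"
 proof
  assume a: "j \<le> count m v \<and> m - replicate_mset j v = replicate_mset i u"
  then have "m - replicate_mset j v + replicate_mset j v = m"
   by (intro subset_mset.diff_add) (simp add: count_le_replicate_mset_subset_eq)
  then show "m = replicate_mset i u + replicate_mset j v" using a by simp
 qed (use assms in simp)
 show ?thesis using c by (simp add: ps_var_pow_mult u flip: e)
qed

text \<open>The series \<open>p\<close> and \<open>q\<close> have to be without constant term in order that summation up to the
 degree of the monomial is summation over everything.\<close>

lemma ps_subst2_bound:
 assumes F: "\<And>i j. F i j \<in> carrier R" and p: "p \<in> ps_ord 1" and q: "q \<in> ps_ord 1" and N: "size m \<le> N"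
 shows "ps_subst2 R F p q m = (\<Oplus>z\<in>{..N} \<times> {..N}. F (fst z) (snd z) \<otimes> (p [^]\<^bsub>PSA\<^esub> fst z \<otimes>\<^bsub>PSA\<^esub> q [^]\<^bsub>PSA\<^esub> snd z) m)"
proof -
 have o: "p [^]\<^bsub>PSA\<^esub> i \<otimes>\<^bsub>PSA\<^esub> q [^]\<^bsub>PSA\<^esub> j \<in> ps_ord (i + j)" for i j :: nat
  by (intro ps_ord_mult ps_ord_pow p q)
 have c: "(p [^]\<^bsub>PSA\<^esub> i \<otimes>\<^bsub>PSA\<^esub> q [^]\<^bsub>PSA\<^esub> j) m \<in> carrier R" for i j :: nat
  using ps_ord_closed[OF o] by (simp add: psa_simps(1))
 have z: "(p [^]\<^bsub>PSA\<^esub> i \<otimes>\<^bsub>PSA\<^esub> q [^]\<^bsub>PSA\<^esub> j) m = \<zero>" if "size m < i + j" for i j :: nat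
  using o that by (simp add: ps_ord_def)
 have "F i j \<otimes> (p [^]\<^bsub>PSA\<^esub> i \<otimes>\<^bsub>PSA\<^esub> q [^]\<^bsub>PSA\<^esub> j) m = \<zero>" if "\<not> i \<le> size m \<or> \<not> j \<le> size m" for i j :: nat
  using z[of i j] F that by auto
 then have z': "F i j \<otimes> (p [^]\<^bsub>PSA\<^esub> i \<otimes>\<^bsub>PSA\<^esub> q [^]\<^bsub>PSA\<^esub> j) m \<noteq> \<zero> \<Longrightarrow> i \<le> size m"
  "F i j \<otimes> (p [^]\<^bsub>PSA\<^esub> i \<otimes>\<^bsub>PSA\<^esub> q [^]\<^bsub>PSA\<^esub> j) m \<noteq> \<zero> \<Longrightarrow> j \<le> size m" for i j :: nat
  by blast+
 show ?thesis
  unfolding ps_subst2_def case_prod_beta ps_algebra_mult ps_algebra_pow using N c z' F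
  by (intro add.finprod_mono_neutral_cong_left) auto
qed

lemma ps_subst1_bound:
 assumes f: "\<And>i. f i \<in> carrier R" and p: "p \<in> ps_ord 1" and N: "size m \<le> N"
 shows "ps_subst1 R f p m = (\<Oplus>i\<in>{..N}. f i \<otimes> (p [^]\<^bsub>PSA\<^esub> i) m)"
proof -
 have c: "(p [^]\<^bsub>PSA\<^esub> i) m \<in> carrier R" for i :: nat
  using ps_ord_closed[OF ps_ord_pow[OF p]] by (simp add: psa_simps(1))
 have z: "(p [^]\<^bsub>PSA\<^esub> i) m = \<zero>" if "size m < i" for i :: nat
  using ps_ord_pow[OF p] that by (simp add: ps_ord_def)
 show ?thesis
  unfolding ps_subst1_def ps_algebra_pow using N c z f
  by (intro add.finprod_mono_neutral_cong_left) auto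
qed

text \<open>Substitution of p and q for the variables 0 and 1, as a map of the series G; all other
  variables are set to zero. In this form the associativity of substitution becomes the statement
  that a map is an algebra homomorphism.\<close>

definition ps_at :: "(nat multiset \<Rightarrow> 'a) \<Rightarrow> (nat multiset \<Rightarrow> 'a) \<Rightarrow> (nat multiset \<Rightarrow> 'a) \<Rightarrow> nat multiset \<Rightarrow> 'a" where
 "ps_at p q G = ps_subst2 R (\<lambda>i j. G (mon i j)) p q"

context
 fixes p q
 assumes p: "p \<in> ps_ord 1" and q: "q \<in> ps_ord 1"
begin

lemma ps_at_cong:
 assumes "G \<in> carrier PSA" "G' \<in> carrier PSA" "\<And>i j. i \<le> size m \<Longrightarrow> j \<le> size m \<Longrightarrow> G (mon i j) = G' (mon i j)"
 shows "ps_at p q G m = ps_at p q G' m"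
proof -
 have c: "(p [^]\<^bsub>PSA\<^esub> i \<otimes>\<^bsub>PSA\<^esub> q [^]\<^bsub>PSA\<^esub> j) m \<in> carrier R" for i j :: nat
  using ps_ord_closed[OF ps_ord_mult[OF ps_ord_pow[OF p] ps_ord_pow[OF q]]] by (simp add: psa_simps(1))
 show ?thesis
  unfolding ps_at_def ps_subst2_def case_prod_beta ps_algebra_mult ps_algebra_pow using assms c
  by (intro add.finprod_cong') (auto simp: psa_simps(1))
qed

lemma ps_at_closed: "G \<in> carrier PSA \<Longrightarrow> ps_at p q G \<in> carrier PSA"
 using ps_subst2_closed[of "\<lambda>i j. G (mon i j)" p q] ps_ord_closed[OF p] ps_ord_closed[OF q]
 by (simp add: ps_at_def power_series_ring_simps psa_simps(1))

lemma ps_at_mod_hom: "ps_at p q \<in> mod_hom R PSA PSA"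
proof (rule mod_homI)
 have c: "(p [^]\<^bsub>PSA\<^esub> i \<otimes>\<^bsub>PSA\<^esub> q [^]\<^bsub>PSA\<^esub> j) m \<in> carrier R" for i j :: nat and m
  using ps_ord_closed[OF ps_ord_mult[OF ps_ord_pow[OF p] ps_ord_pow[OF q]]] by (simp add: psa_simps(1))
 fix G assume G: "G \<in> carrier PSA"
 then show "ps_at p q G \<in> carrier PSA" by (rule ps_at_closed)
 have Gc: "G m \<in> carrier R" for m using G by (simp add: psa_simps)
 show "ps_at p q (a \<odot>\<^bsub>PSA\<^esub> G) = a \<odot>\<^bsub>PSA\<^esub> ps_at p q G" if a: "a \<in> carrier R" for a
 proof
  fix m :: "nat multiset"
  show "ps_at p q (a \<odot>\<^bsub>PSA\<^esub> G) m = (a \<odot>\<^bsub>PSA\<^esub> ps_at p q G) m"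
   unfolding ps_at_def ps_subst2_def case_prod_beta ps_algebra_mult ps_algebra_pow psa_simps(6)
   using a c Gc by (subst finsum_rdistr) (auto simp: m_assoc intro!: add.finprod_cong')
 qed
 fix G' assume G': "G' \<in> carrier PSA"
 have Gc': "G' m \<in> carrier R" for m using G' by (simp add: psa_simps)
 show "ps_at p q (G \<oplus>\<^bsub>PSA\<^esub> G') = ps_at p q G \<oplus>\<^bsub>PSA\<^esub> ps_at p q G'"
 proof
  fix m :: "nat multiset"
  show "ps_at p q (G \<oplus>\<^bsub>PSA\<^esub> G') m = (ps_at p q G \<oplus>\<^bsub>PSA\<^esub> ps_at p q G') m"
   unfolding ps_at_def ps_subst2_def case_prod_beta ps_algebra_mult ps_algebra_pow psa_simps(5)
   using c Gc Gc' by (subst finsum_addf[symmetric]) (auto simp: l_distr intro!: add.finprod_cong')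
 qed
qed

definition mon_eval :: "nat multiset \<Rightarrow> nat multiset \<Rightarrow> 'a" where
 "mon_eval m = p [^]\<^bsub>PSA\<^esub> count m 0 \<otimes>\<^bsub>PSA\<^esub> q [^]\<^bsub>PSA\<^esub> count m 1"

lemma mon_eval_hom: "mon_eval \<in> hom (mset_monoid {0, 1}) PSA"
proof -
 interpret P: cring PSA by (rule PSA_cring)
 note c = ps_ord_closed[OF p] ps_ord_closed[OF q]
 show ?thesis
  by (rule homI) (use c in \<open>simp_all add: mon_eval_def mset_monoid_simps P.nat_pow_mult[symmetric] P.m_ac\<close>)
qed

lemma mon_eval_one: "mon_eval {#} = \<one>\<^bsub>PSA\<^esub>"
proof -
 interpret P: cring PSA by (rule PSA_cring)
 show ?thesis by (simp add: mon_eval_def)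
qed

text \<open>On polynomials in two variables, substitution is the evaluation homomorphism of a monoid
  algebra, whose multiplicativity is known.\<close>

lemma ps_at_poly:
 assumes G: "G \<in> carrier (poly_algebra R {0, 1::nat})"
 shows "lin_ext PSA mon_eval G = ps_at p q G"
proof
 fix m :: "nat multiset"
 have Gm: "G k \<in> carrier R" "G k \<noteq> \<zero> \<Longrightarrow> set_mset k \<subseteq> {0, 1}" for k
  using G by (auto simp: poly_algebra_def monoid_algebra_simps carrier_free_module mset_monoid_simps)
 have fin: "finite {k. G k \<noteq> \<zero>}"
  using G by (simp add: poly_algebra_def monoid_algebra_simps carrier_free_module)
 have ec: "mon_eval k \<in> carrier PSA" for k
  unfolding mon_eval_def using ps_ord_closed[OF ps_ord_mult[OF ps_ord_pow[OF p] ps_ord_pow[OF q]]] .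
 \<comment> \<open>A bound for the monomial m and for all monomials of G at once, so that both sides
   become sums over the same square of exponents.\<close>
 define N where "N = Max (insert (size m) (size ` {k. G k \<noteq> \<zero>}))"
 have N: "size m \<le> N" "\<And>k. G k \<noteq> \<zero> \<Longrightarrow> size k \<le> N"
  unfolding N_def using fin by (auto intro!: Max_ge)
 have ec': "mon_eval k m \<in> carrier R" for k using ec[of k] by (simp add: psa_simps(1))
 have "lin_ext PSA mon_eval G m = (\<Oplus>k\<in>{k. G k \<noteq> \<zero>}. G k \<otimes> mon_eval k m)"
  unfolding lin_ext_def using ec Gm by (subst PSA_finsum) (auto simp: psa_simps(1,6) intro!: add.finprod_cong')
 also have "\<dots> = (\<Oplus>k\<in>(\<lambda>(i, j). mon i j) ` ({..N} \<times> {..N}). G k \<otimes> mon_eval k m)"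
 proof (rule add.finprod_mono_neutral_cong_left)
  show "{k. G k \<noteq> \<zero>} \<subseteq> (\<lambda>(i, j). mon i j) ` ({..N} \<times> {..N})"
  proof
   fix k assume "k \<in> {k. G k \<noteq> \<zero>}"
   then have k: "G k \<noteq> \<zero>" by simp
   then have e: "k = mon (count k 0) (count k 1)" using Gm(2) by (intro mon_count)
   have "count k v \<le> N" for v using N(2)[OF k] count_le_size[of k v] by linarith
   then show "k \<in> (\<lambda>(i, j). mon i j) ` ({..N} \<times> {..N})" using e by (auto simp: image_iff intro!: bexI[of _ "(count k 0, count k 1)"])
  qed
 qed (use Gm ec' in auto)
 also have "\<dots> = (\<Oplus>z\<in>{..N} \<times> {..N}. G (mon (fst z) (snd z)) \<otimes> mon_eval (mon (fst z) (snd z)) m)"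
  using Gm ec' by (subst finsum_reindex) (auto simp: inj_on_def mon_eq_iff case_prod_beta)
 also have "\<dots> = ps_at p q G m"
  unfolding ps_at_def using Gm N by (subst ps_subst2_bound[OF _ p q N(1)]) (auto simp: mon_eval_def count_mon)
 finally show "lin_ext PSA mon_eval G m = ps_at p q G m" .
qed

text \<open>Multiplicativity reduces to polynomials, where it is the universal property.\<close>

lemma ps_at_hom: "ps_at p q \<in> alg_hom R PSA PSA"
proof (rule alg_homI[OF ps_at_mod_hom])
 let ?P = "poly_algebra R {0, 1::nat}"
 interpret PO: cring ?P by (rule algebra.M_cring[OF poly_algebra_algebra])
 have ev: "lin_ext PSA mon_eval \<in> alg_hom R ?P PSA"
  unfolding poly_algebra_def
  by (rule mon_alg.MA_eval(1)[OF mon_alg_mset PSA_algebra mon_eval_hom])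
   (simp add: mset_monoid_simps mon_eval_one)
 have one: "\<one>\<^bsub>?P\<^esub> = \<one>\<^bsub>PSA\<^esub>"
  by (auto simp: poly_algebra_def monoid_algebra_simps mset_monoid_simps psa_simps basis_elt_def)
 show "ps_at p q \<one>\<^bsub>PSA\<^esub> = \<one>\<^bsub>PSA\<^esub>"
  using alg_homD(5)[OF ev] ps_at_poly[OF PO.one_closed] unfolding one by simp
 fix G G' assume G: "G \<in> carrier PSA" "G' \<in> carrier PSA"
 show "ps_at p q (G \<otimes>\<^bsub>PSA\<^esub> G') = ps_at p q G \<otimes>\<^bsub>PSA\<^esub> ps_at p q G'"
 proof
  fix m :: "nat multiset"
  \<comment> \<open>Exactly the monomials that substitution reads when its coefficient at m is
    computed: both exponents run separately up to the size of m.\<close>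
  let ?K = "(\<lambda>(i, j). mon i j) ` ({..size m} \<times> {..size m})"
  let ?t = "ps_trunc ?K"
  have t: "?t H \<in> carrier ?P" if "H \<in> carrier PSA" for H
   using that by (intro ps_trunc_closed) (auto simp: mon_def split: if_splits)
  note tG = t[OF G(1)] t[OF G(2)]
  have tm: "H (mon i j) = ?t H (mon i j)" if "i \<le> size m" "j \<le> size m" for H i j
   using that by (auto simp: ps_trunc_def)
  have sub: "H k = ?t H k" if "k \<subseteq># mon i j" "i \<le> size m" "j \<le> size m" for H i j k
  proof -
   have "set_mset k \<subseteq> {0, 1}" using set_mset_mono[OF that(1)] by (auto simp: mon_def split: if_splits)
   then have e: "k = mon (count k 0) (count k 1)" by (rule mon_count)
   have "count k 0 \<le> i" "count k 1 \<le> j"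
    using mset_subset_eq_count[OF that(1), of 0] mset_subset_eq_count[OF that(1), of 1] by (simp_all add: count_mon)
   then show ?thesis using tm[of "count k 0" "count k 1" H] that e by simp
  qed
  have loc: "ps_at p q H k = ps_at p q (?t H) k" if "H \<in> carrier PSA" "k \<subseteq># m" for H k
   using that tm poly_sub_PSA[OF t] size_mset_mono[OF that(2)] by (intro ps_at_cong) auto
  have "ps_at p q (G \<otimes>\<^bsub>PSA\<^esub> G') m = ps_at p q (?t G \<otimes>\<^bsub>PSA\<^esub> ?t G') m"
   using G sub poly_sub_PSA[OF tG(1)] poly_sub_PSA[OF tG(2)]
   by (intro ps_at_cong PSA_mult_closed PSA_mult_cong) auto
  also have "\<dots> = lin_ext PSA mon_eval (?t G \<otimes>\<^bsub>?P\<^esub> ?t G') m"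
   by (simp only: poly_mult_PSA[OF tG] ps_at_poly[OF PO.m_closed[OF tG]])
  also have "\<dots> = (ps_at p q (?t G) \<otimes>\<^bsub>PSA\<^esub> ps_at p q (?t G')) m"
   by (simp only: alg_homD(4)[OF ev tG] ps_at_poly[OF tG(1)] ps_at_poly[OF tG(2)])
  also have "\<dots> = (ps_at p q G \<otimes>\<^bsub>PSA\<^esub> ps_at p q G') m"
   using G loc ps_at_closed by (intro PSA_mult_cong) auto
  finally show "ps_at p q (G \<otimes>\<^bsub>PSA\<^esub> G') m = (ps_at p q G \<otimes>\<^bsub>PSA\<^esub> ps_at p q G') m" .
 qed
qed

lemma ps_at_pow:
 "G \<in> carrier PSA \<Longrightarrow> ps_at p q (G [^]\<^bsub>PSA\<^esub> (k::nat)) = ps_at p q G [^]\<^bsub>PSA\<^esub> k"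
proof (induction k)
 case (Suc k)
 interpret P: cring PSA by (rule PSA_cring)
 show ?case using Suc by (simp add: alg_homD(4)[OF ps_at_hom])
qed (simp add: alg_homD(5)[OF ps_at_hom])

lemma ps_at_var: "ps_at p q (ps_var R 0) = p" "ps_at p q (ps_var R 1) = q"
proof -
 interpret P: cring PSA by (rule PSA_cring)
 note c = ps_ord_closed[OF p] ps_ord_closed[OF q]
 have f: "mon_eval \<in> carrier (mset_monoid {0, 1}) \<rightarrow> carrier PSA" using mon_eval_hom by (simp add: hom_def)
 interpret PA: algebra R PSA by (rule PSA_algebra)
 have v: "ps_var R v = basis_elt R {#v#}" for v by (auto simp: ps_var_def basis_elt_def)
 have "ps_at p q (ps_var R v) = mon_eval {#v#}" if "v \<in> {0, 1}" for v
 proof -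
  have "basis_elt R {#v#} \<in> carrier (poly_algebra R {0, 1})"
   using that poly_var_closed[of v "{0, 1}"] by (simp add: poly_var_def)
  from ps_at_poly[OF this] PA.lin_ext_basis[OF f, of "{#v#}"] show ?thesis
   using that by (simp add: v mset_monoid_simps)
 qed
 then show "ps_at p q (ps_var R 0) = p" "ps_at p q (ps_var R 1) = q"
  using c by (simp_all add: mon_eval_def)
qed

lemma ps_at_ord:
 assumes "G \<in> ps_ord 1"
 shows "ps_at p q G \<in> ps_ord 1"
proof -
 interpret P: cring PSA by (rule PSA_cring)
 have "ps_at p q G {#} = (\<Oplus>z\<in>{..0} \<times> {..0}. G (mon (fst z) (snd z)) \<otimes> (p [^]\<^bsub>PSA\<^esub> fst z \<otimes>\<^bsub>PSA\<^esub> q [^]\<^bsub>PSA\<^esub> snd z) {#})"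
  unfolding ps_at_def using assms by (intro ps_subst2_bound p q) (auto simp: ps_ord_def psa_simps(1))
 also have "\<dots> = \<zero>"
  using assms by (simp add: ps_ord_def mon_def) (simp add: psa_simps)
 finally show ?thesis using ps_at_closed[OF ps_ord_closed[OF assms]] by (auto simp: ps_ord_def)
qed

end

lemma ps_subst1_closed': "(\<And>i. f i \<in> carrier R) \<Longrightarrow> p \<in> carrier PSA \<Longrightarrow> ps_subst1 R f p \<in> carrier PSA"
 using ps_subst1_closed[of f p] by (simp add: power_series_ring_simps psa_simps(1))

lemma ps_subst1_ord:
 assumes "\<And>i. f i \<in> carrier R" "f 0 = \<zero>" "p \<in> ps_ord 1"
 shows "ps_subst1 R f p \<in> ps_ord 1"
proof -
 have "ps_subst1 R f p {#} = (\<Oplus>i\<in>{..0}. f i \<otimes> (p [^]\<^bsub>PSA\<^esub> i) {#})"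
  using assms by (intro ps_subst1_bound) auto
 then have "ps_subst1 R f p {#} = \<zero>" using assms ps_ord_closed[OF ps_ord_pow[OF assms(3), of 0]]
  by (simp add: psa_simps(1))
 then show ?thesis using ps_subst1_closed'[OF assms(1) ps_ord_closed[OF assms(3)]] by (auto simp: ps_ord_def)
qed

lemma ps_subst1_finsum:
 assumes f: "\<And>i. f i \<in> carrier R" and p: "p \<in> ps_ord 1" and N: "size m \<le> N"
 shows "ps_subst1 R f p m = (\<Oplus>\<^bsub>PSA\<^esub>i\<in>{..N}. f i \<odot>\<^bsub>PSA\<^esub> p [^]\<^bsub>PSA\<^esub> i) m"
proof -
 interpret PA: algebra R PSA by (rule PSA_algebra)
 have "p [^]\<^bsub>PSA\<^esub> i \<in> carrier PSA" for i :: nat using ps_ord_closed[OF ps_ord_pow[OF p]] .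
 then have "(\<lambda>i. f i \<odot>\<^bsub>PSA\<^esub> p [^]\<^bsub>PSA\<^esub> i) \<in> {..N} \<rightarrow> carrier PSA" using f by auto
 then show ?thesis by (simp add: PSA_finsum ps_subst1_bound[OF f p N]) (simp add: psa_simps(6))
qed

text \<open>Associativity of substitution, f(G)(p, q) = f(G(p, q)). Up to any given degree, f(G) is
  a finite combination of powers of G, and the homomorphism \<open>ps_at p q\<close> can be applied
  term by term.\<close>

lemma ps_at_subst1:
 assumes p: "p \<in> ps_ord 1" and q: "q \<in> ps_ord 1" and f: "\<And>i. f i \<in> carrier R" and G: "G \<in> ps_ord 1"
 shows "ps_at p q (ps_subst1 R f G) = ps_subst1 R f (ps_at p q G)"
proof
 fix m :: "nat multiset"
 interpret PC: cring PSA by (rule PSA_cring)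
 interpret PA: algebra R PSA by (rule PSA_algebra)
 \<comment> \<open>The coefficient at m involves G at x^i y^j with i and j separately bounded by
   \<open>size m\<close>, hence monomials of total degree up to twice that size.\<close>
 let ?N = "2 * size m"
 have Gk: "G [^]\<^bsub>PSA\<^esub> k \<in> carrier PSA" for k :: nat using ps_ord_closed[OF ps_ord_pow[OF G]] .
 have s: "(\<Oplus>\<^bsub>PSA\<^esub>k\<in>{..?N}. f k \<odot>\<^bsub>PSA\<^esub> G [^]\<^bsub>PSA\<^esub> k) \<in> carrier PSA"
  using f Gk by (intro PC.finsum_closed) auto
 have "ps_at p q (ps_subst1 R f G) m = ps_at p q (\<Oplus>\<^bsub>PSA\<^esub>k\<in>{..?N}. f k \<odot>\<^bsub>PSA\<^esub> G [^]\<^bsub>PSA\<^esub> k) m"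
  using ps_subst1_closed'[OF f ps_ord_closed[OF G]] s
  by (intro ps_at_cong[OF p q] ps_subst1_finsum f G) auto
 also have "ps_at p q (\<Oplus>\<^bsub>PSA\<^esub>k\<in>{..?N}. f k \<odot>\<^bsub>PSA\<^esub> G [^]\<^bsub>PSA\<^esub> k) =
   (\<Oplus>\<^bsub>PSA\<^esub>k\<in>{..?N}. ps_at p q (f k \<odot>\<^bsub>PSA\<^esub> G [^]\<^bsub>PSA\<^esub> k))"
  using f Gk by (intro mod_hom_finsum[OF PA.module_axioms PA.module_axioms ps_at_mod_hom[OF p q]]) auto
 also have "\<dots> = (\<Oplus>\<^bsub>PSA\<^esub>k\<in>{..?N}. f k \<odot>\<^bsub>PSA\<^esub> ps_at p q G [^]\<^bsub>PSA\<^esub> k)"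
  using f Gk ps_ord_closed[OF ps_at_ord[OF p q G]]
  by (intro PC.add.finprod_cong') (auto simp: mod_homD(3)[OF ps_at_mod_hom[OF p q]] ps_at_pow[OF p q ps_ord_closed[OF G]])
 also have "\<dots> m = ps_subst1 R f (ps_at p q G) m"
  using ps_subst1_finsum[OF f ps_at_ord[OF p q G], of m ?N] by simp
 finally show "ps_at p q (ps_subst1 R f G) m = ps_subst1 R f (ps_at p q G) m" .
qed

text \<open>Putting zero for the second variable reduces substitution into a series of one variable
  to \<open>ps_at\<close>, so that its homomorphism property can be used there too.\<close>

lemma ps_at_zero:
 assumes p: "p \<in> ps_ord 1" and G: "G \<in> carrier PSA"
 shows "ps_at p \<zero>\<^bsub>PSA\<^esub> G = ps_subst1 R (\<lambda>i. G (mon i 0)) p"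
proof
 fix m :: "nat multiset"
 interpret P: cring PSA by (rule PSA_cring)
 let ?N = "size m"
 have Gc: "G k \<in> carrier R" for k using G by (simp add: psa_simps)
 have pc: "p [^]\<^bsub>PSA\<^esub> i \<in> carrier PSA" for i :: nat using ps_ord_closed[OF ps_ord_pow[OF p]] .
 then have pm: "(p [^]\<^bsub>PSA\<^esub> i) m \<in> carrier R" for i :: nat by (simp add: psa_simps(1))
 have z: "\<zero>\<^bsub>PSA\<^esub> [^]\<^bsub>PSA\<^esub> j = \<zero>\<^bsub>PSA\<^esub>" if "j \<noteq> 0" for j :: nat
  using that by (cases j) auto
 have t: "(p [^]\<^bsub>PSA\<^esub> i \<otimes>\<^bsub>PSA\<^esub> \<zero>\<^bsub>PSA\<^esub> [^]\<^bsub>PSA\<^esub> j) m = (if j = 0 then (p [^]\<^bsub>PSA\<^esub> i) m else \<zero>)" for i j :: nat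
 proof (cases "j = 0")
  case False
  have "(p [^]\<^bsub>PSA\<^esub> i \<otimes>\<^bsub>PSA\<^esub> \<zero>\<^bsub>PSA\<^esub> [^]\<^bsub>PSA\<^esub> j) = \<zero>\<^bsub>PSA\<^esub>" using pc[of i] z[OF False] by simp
  then show ?thesis using False by (simp add: psa_simps(4))
 qed (use pc[of i] in simp)
 have "ps_at p \<zero>\<^bsub>PSA\<^esub> G m = (\<Oplus>z\<in>(\<lambda>i. (i, 0)) ` {..?N}. G (mon (fst z) (snd z)) \<otimes> (p [^]\<^bsub>PSA\<^esub> fst z) m)"
  unfolding ps_at_def using Gc
  apply (subst ps_subst2_bound[OF _ p zero_ord order_refl], simp)
  unfolding t
  by (rule add.finprod_mono_neutral_cong_right) (use Gc pm in auto)
 also have "\<dots> = ps_subst1 R (\<lambda>i. G (mon i 0)) p m"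
  using Gc pm by (subst finsum_reindex) (auto simp: inj_on_def ps_subst1_bound[OF _ p order_refl])
 finally show "ps_at p \<zero>\<^bsub>PSA\<^esub> G m = ps_subst1 R (\<lambda>i. G (mon i 0)) p m" .
qed

lemma ps_subst1_id:
 assumes p: "p \<in> ps_ord 1"
 shows "ps_subst1 R (\<lambda>i. if i = 1 then \<one> else \<zero>) p = p"
proof
 fix m :: "nat multiset"
 interpret P: cring PSA by (rule PSA_cring)
 have pc: "p [^]\<^bsub>PSA\<^esub> i \<in> carrier PSA" for i :: nat using ps_ord_closed[OF ps_ord_pow[OF p]] .
 then have pm: "(p [^]\<^bsub>PSA\<^esub> i) m \<in> carrier R" for i :: nat by (simp add: psa_simps(1))
 \<comment> \<open>The range goes up to \<open>Suc (size m)\<close> so that it contains the index 1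
   even at the empty monomial.\<close>
 have "ps_subst1 R (\<lambda>i. if i = 1 then \<one> else \<zero>) p m = (\<Oplus>i\<in>{..Suc (size m)}. (if i = 1 then \<one> else \<zero>) \<otimes> (p [^]\<^bsub>PSA\<^esub> i) m)"
  by (rule ps_subst1_bound[OF _ p]) auto
 also have "\<dots> = (p [^]\<^bsub>PSA\<^esub> (1::nat)) m"
 proof -
  have "(\<Oplus>i\<in>{..Suc (size m)}. (if i = 1 then \<one> else \<zero>) \<otimes> c i) = c 1" if "\<And>i. c i \<in> carrier R" for c :: "nat \<Rightarrow> 'a"
  proof -
   have "(\<Oplus>i\<in>{..Suc (size m)}. (if i = 1 then \<one> else \<zero>) \<otimes> c i) = (\<Oplus>i\<in>{1}. c i)"
    using that by (intro add.finprod_mono_neutral_cong_right) auto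
   then show ?thesis using that by simp
  qed
  from this[of "\<lambda>i. (p [^]\<^bsub>PSA\<^esub> i) m", OF pm] show ?thesis .
 qed
 also have "p [^]\<^bsub>PSA\<^esub> (1::nat) = p" using ps_ord_closed[OF p] by (rule P.nat_pow_eone)
 finally show "ps_subst1 R (\<lambda>i. if i = 1 then \<one> else \<zero>) p m = p m" .
qed

end

section \<open>Formal modules with a logarithm\<close>

text \<open>Course-of-values recursion: \<open>G n\<close> tabulates the first n values, and
  \<open>H\<close> at n depends on these only.\<close>

lemma nat_recursion_exists:
 fixes H :: "nat \<Rightarrow> (nat \<Rightarrow> 'b) \<Rightarrow> 'b"
 assumes "\<And>n g g'. (\<And>i. i < n \<Longrightarrow> g i = g' i) \<Longrightarrow> H n g = H n g'"
 shows "\<exists>g. \<forall>n. g n = H n g"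
proof -
 define G where "G = rec_nat (\<lambda>_. undefined) (\<lambda>n h. h(n := H n h))"
 have G: "G (Suc n) = (G n)(n := H n (G n))" for n by (simp add: G_def)
 define g where "g n = G (Suc n) n" for n
 have agree: "G n i = g i" if "i < n" for n i
  using that by (induction n) (auto simp: G g_def less_Suc_eq)
 have "g n = H n g" for n
 proof -
  have "g n = H n (G n)" by (simp add: g_def G)
  also have "\<dots> = H n g" by (rule assms) (simp add: agree)
  finally show ?thesis .
 qed
 then show ?thesis by blast
qed

section \<open>Compositional inverses\<close>

context cring
begin

lemma ps_subst2_vars:
 assumes "u \<noteq> v" and F: "\<And>i j. F i j \<in> carrier R"
 shows "ps_subst2 R F (ps_var R u) (ps_var R v) (replicate_mset i u + replicate_mset j v) = F i j"
proof -
 let ?m = "replicate_mset i u + replicate_mset j v"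
 have inj: "?m = replicate_mset i' u + replicate_mset j' v \<longleftrightarrow> i' = i \<and> j' = j" for i' j'
  using assms(1) by (auto dest: arg_cong[of _ _ "\<lambda>m. count m u"] arg_cong[of _ _ "\<lambda>m. count m v"])
 have "ps_subst2 R F (ps_var R u) (ps_var R v) ?m =
   (\<Oplus>z\<in>{..size ?m} \<times> {..size ?m}. F (fst z) (snd z) \<otimes> (if fst z = i \<and> snd z = j then \<one> else \<zero>))"
  using F by (subst ps_subst2_bound[OF _ ps_var_ord ps_var_ord order_refl]) (simp_all add: ps_var_pow2[OF assms(1)] inj)
 also have "\<dots> = (\<Oplus>z\<in>{(i, j)}. F (fst z) (snd z))"
  using F by (intro add.finprod_mono_neutral_cong_right) auto
 finally show ?thesis using F by simp
qed

lemma ps_subst1_var: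
 assumes f: "\<And>i. f i \<in> carrier R"
 shows "ps_subst1 R f (ps_var R 0) (mon i 0) = f i"
proof -
 interpret P: cring PSA by (rule PSA_cring)
 have v: "(ps_var R 0 [^]\<^bsub>PSA\<^esub> k) (mon i 0) = (if k = i then \<one> else \<zero>)" for k :: nat
  using ps_var_pow2[of 0 1 k 0 "mon i 0"] ps_ord_closed[OF ps_var_ord] mon_eq_iff[of i 0 k 0]
  by (auto simp: mon_def)
 have "ps_subst1 R f (ps_var R 0) (mon i 0) = (\<Oplus>k\<in>{..i}. f k \<otimes> (if k = i then \<one> else \<zero>))"
  using f by (subst ps_subst1_bound[OF _ ps_var_ord, where N = i]) (simp_all add: v)
 also have "\<dots> = (\<Oplus>k\<in>{i}. f k)" using f by (intro add.finprod_mono_neutral_cong_right) auto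
 finally show ?thesis using f by simp
qed

text \<open>Let c n i be the coefficient of X^n in f(X)^i. Since f = X + ..., this matrix is
  unitriangular, and the condition that the sum of the g_i c n i be 1 for n = 1 and 0 otherwise can
  be solved recursively for g.\<close>

lemma ps_left_inverse:
 assumes f: "\<And>i. f i \<in> carrier R" and f0: "f 0 = \<zero>" and f1: "f 1 = \<one>"
 shows "\<exists>g. (\<forall>i. g i \<in> carrier R) \<and> g 0 = \<zero> \<and> g 1 = \<one> \<and>
   (\<forall>p\<in>ps_ord 1. ps_subst1 R g (ps_subst1 R f p) = p)"
proof -
 interpret P: cring PSA by (rule PSA_cring)
 define u where "u = ps_subst1 R f (ps_var R 0)"
 have u: "u \<in> ps_ord 1" unfolding u_def by (rule ps_subst1_ord[of f, OF f f0 ps_var_ord])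
 define c where "c n i = (u [^]\<^bsub>PSA\<^esub> (i::nat)) (mon n 0)" for n i
 have cc: "c n i \<in> carrier R" for n i
  using ps_ord_closed[OF ps_ord_pow[OF u, of i]] by (simp add: c_def psa_simps(1))
 have um: "u (mon n 0) = f n" for n unfolding u_def by (rule ps_subst1_var[OF f])
 \<comment> \<open>The series u^n starts with X^n, so at X^(n+1) the product of u^n and u receives
   only the contribution X^n times X.\<close>
 have cnn: "c n n = \<one>" for n
 proof (induction n)
  case 0
  show ?case by (simp add: c_def mon_def) (simp add: psa_simps)
 next
  case (Suc n)
  have pn: "u [^]\<^bsub>PSA\<^esub> n \<in> ps_ord n" by (rule ps_ord_pow[OF u])
  have car: "(u [^]\<^bsub>PSA\<^esub> n) k \<in> carrier R" "u k \<in> carrier R" for k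
   using ps_ord_closed[OF pn] ps_ord_closed[OF u] by (simp_all add: psa_simps(1))
  have "c (Suc n) (Suc n) = (u [^]\<^bsub>PSA\<^esub> n \<otimes>\<^bsub>PSA\<^esub> u) (mon (Suc n) 0)" by (simp add: c_def)
  also have "\<dots> = (\<Oplus>k\<in>{k. k \<subseteq># mon (Suc n) 0}. (u [^]\<^bsub>PSA\<^esub> n) k \<otimes> u (mon (Suc n) 0 - k))"
   by (simp only: psa_simps)
  also have "\<dots> = (\<Oplus>k\<in>{mon n 0}. (u [^]\<^bsub>PSA\<^esub> n) k \<otimes> u (mon (Suc n) 0 - k))"
  proof (rule add.finprod_mono_neutral_cong_right)
   show "{mon n 0} \<subseteq> {k. k \<subseteq># mon (Suc n) 0}" by (auto simp: mon_def)
   fix k assume k: "k \<in> {k. k \<subseteq># mon (Suc n) 0} - {mon n 0}"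
   then have ks: "k \<subseteq># mon (Suc n) 0" "k \<noteq> mon n 0" by auto
   then have "k \<subseteq># replicate_mset (Suc n) 0" by (simp add: mon_def)
   then obtain j where j: "j \<le> Suc n" "k = replicate_mset j 0"
    by (rule msubseteq_replicate_msetE)
   then have "j \<noteq> n" using ks by (auto simp: mon_def)
   then consider "j < n" | "j = Suc n" using j by linarith
   then show "(u [^]\<^bsub>PSA\<^esub> n) k \<otimes> u (mon (Suc n) 0 - k) = \<zero>"
   proof cases
    case 1
    then show ?thesis using pn j car by (simp add: ps_ord_def)
   next
    case 2
    then have "mon (Suc n) 0 - k = {#}" using j by (simp add: mon_def)
    then show ?thesis using u car by (simp add: ps_ord_def)
   qed
  qed (use car finite_submultisets in auto)
  also have "\<dots> = \<one>"
  proof -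
   have "mon (Suc n) 0 - mon n 0 = mon 1 0" by (rule multiset_eqI) (simp add: count_mon)
   then show ?thesis using Suc um[of 1] f1 by (simp add: c_def[of n n, symmetric])
  qed
  finally show ?case .
 qed
 \<comment> \<open>The membership test keeps the sum inside the carrier for arbitrary
   \<open>g\<close>, so that the recursion can be set up before \<open>g\<close> is known to have
   coefficients in the ring.\<close>
 let ?H = "\<lambda>n g. if n = 0 then \<zero> else if n = 1 then \<one> else \<ominus> (\<Oplus>i\<in>{..<n}. (if g i \<in> carrier R then g i else \<zero>) \<otimes> c n i)"
 have "\<exists>g. \<forall>n. g n = ?H n g"
  by (rule nat_recursion_exists) (auto intro!: arg_cong[of _ _ "a_inv R"] add.finprod_cong' simp: cc)
 then obtain g where g: "\<And>n. g n = ?H n g" by blast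
 have gc: "g n \<in> carrier R" for n
  by (subst g) (auto simp: cc intro!: finsum_closed)
 have g': "g n = \<ominus> (\<Oplus>i\<in>{..<n}. g i \<otimes> c n i)" if "n \<ge> 2" for n
  using g[of n] that gc by simp
 have g0: "g 0 = \<zero>" and g1: "g 1 = \<one>" using g[of 0] g[of 1] by simp_all
 have coeff: "ps_subst1 R g u (mon n 0) = (if n = 1 then \<one> else \<zero>)" for n
 proof -
  have "ps_subst1 R g u (mon n 0) = (\<Oplus>i\<in>{..n}. g i \<otimes> c n i)"
   using gc u by (subst ps_subst1_bound[where N = n]) (auto simp: c_def)
  also have "{..n} = insert n {..<n}" by auto
  also have "(\<Oplus>i\<in>insert n {..<n}. g i \<otimes> c n i) = g n \<otimes> c n n \<oplus> (\<Oplus>i\<in>{..<n}. g i \<otimes> c n i)"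
   using gc cc by (subst finsum_insert) auto
  also have "\<dots> = g n \<oplus> (\<Oplus>i\<in>{..<n}. g i \<otimes> c n i)" using gc by (simp add: cnn)
  also have "\<dots> = (if n = 1 then \<one> else \<zero>)"
  proof (cases "n \<ge> 2")
   case True
   then show ?thesis using g'[OF True] gc cc by (simp add: l_neg)
  next
   case False
   then consider "n = 0" | "n = 1" by linarith
   then show ?thesis using g0 g1 cc by cases (auto simp: lessThan_Suc)
  qed
  finally show ?thesis .
 qed
 \<comment> \<open>The identity g(f(X)) = X is transported to p by the substitution that sends X to
   p and the second variable to zero.\<close>
 have "ps_subst1 R g (ps_subst1 R f p) = p" if p: "p \<in> ps_ord 1" for p
 proof -
  note at = ps_at_subst1[OF p zero_ord]
  have "ps_subst1 R f p = ps_at p \<zero>\<^bsub>PSA\<^esub> u"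
   unfolding u_def using at[OF f ps_var_ord] ps_at_var(1)[OF p zero_ord] by simp
  then have "ps_subst1 R g (ps_subst1 R f p) = ps_at p \<zero>\<^bsub>PSA\<^esub> (ps_subst1 R g u)"
   using at[OF gc u] by simp
  also have "\<dots> = ps_subst1 R (\<lambda>i. ps_subst1 R g u (mon i 0)) p"
   using gc ps_ord_closed[OF u] by (intro ps_at_zero[OF p] ps_subst1_closed')
  also have "\<dots> = p" unfolding coeff by (rule ps_subst1_id[OF p])
  finally show ?thesis .
 qed
 then show ?thesis using gc g0 g1 by blast
qed

text \<open>The left inverse g has a left inverse h in turn, and h = h g f = f under composition.
  Hence g inverts f on both sides.\<close>

lemma ps_inverse:
 assumes f: "\<And>i. f i \<in> carrier R" and f0: "f 0 = \<zero>" and f1: "f 1 = \<one>"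
 obtains g where "\<And>i. g i \<in> carrier R" "g 0 = \<zero>"
  "\<And>p. p \<in> ps_ord 1 \<Longrightarrow> ps_subst1 R g (ps_subst1 R f p) = p"
  "\<And>p. p \<in> ps_ord 1 \<Longrightarrow> ps_subst1 R f (ps_subst1 R g p) = p"
proof -
 obtain g where g: "\<And>i. g i \<in> carrier R" "g 0 = \<zero>" "g 1 = \<one>"
   "\<And>p. p \<in> ps_ord 1 \<Longrightarrow> ps_subst1 R g (ps_subst1 R f p) = p"
  using ps_left_inverse[OF f f0 f1] by blast
 obtain h where h: "\<And>i. h i \<in> carrier R" "h 0 = \<zero>"
   "\<And>p. p \<in> ps_ord 1 \<Longrightarrow> ps_subst1 R h (ps_subst1 R g p) = p"
  using ps_left_inverse[OF g(1-3)] by blast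
 have "ps_subst1 R f (ps_subst1 R g p) = p" if p: "p \<in> ps_ord 1" for p
 proof -
  have gp: "ps_subst1 R g p \<in> ps_ord 1" by (rule ps_subst1_ord[of g, OF g(1,2) p])
  have fgp: "ps_subst1 R f (ps_subst1 R g p) \<in> ps_ord 1" by (rule ps_subst1_ord[of f, OF f f0 gp])
  have "ps_subst1 R f (ps_subst1 R g p) = ps_subst1 R h (ps_subst1 R g (ps_subst1 R f (ps_subst1 R g p)))"
   using h(3)[OF fgp] by simp
  also have "\<dots> = p" using g(4)[OF gp] h(3)[OF p] by simp
  finally show ?thesis .
 qed
 then show ?thesis using g that by blast
qed

end

text \<open>With l the logarithm and e its inverse, F(p, q) = e(l(p) + l(q)) and rho(a)(p) = e(a
  l(p)). As l is injective on series without constant term, the power series equations may be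
  checked after applying l, where they are laws of addition and scalar multiplication.\<close>

lemma formal_module_of_logarithm:
 assumes B: "algebra A B" and f: "\<And>i. f i \<in> carrier B" and f0: "f 0 = \<zero>\<^bsub>B\<^esub>" and f1: "f 1 = \<one>\<^bsub>B\<^esub>"
 obtains F \<rho> where "formal_module A B F \<rho>"
  "ps_subst1 B f (ps_subst2 B F (ps_var B 0) (ps_var B 1)) =
    ps_subst1 B f (ps_var B 0) \<oplus>\<^bsub>psa B\<^esub> ps_subst1 B f (ps_var B 1)"
  "\<And>a. a \<in> carrier A \<Longrightarrow> ps_subst1 B f (ps_subst1 B (\<rho> a) (ps_var B 0)) =
    (a \<odot>\<^bsub>B\<^esub> \<one>\<^bsub>B\<^esub>) \<odot>\<^bsub>psa B\<^esub> ps_subst1 B f (ps_var B 0)"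
proof -
 interpret AC: cring A by (rule algebra.R_cring[OF B])
 interpret BC: cring B by (rule algebra.M_cring[OF B])
 interpret BA: algebra A B by (rule B)
 interpret P: cring "psa B" by (rule BC.PSA_cring)
 interpret PA: algebra B "psa B" by (rule BC.PSA_algebra)
 obtain g where g: "\<And>i. g i \<in> carrier B" "g 0 = \<zero>\<^bsub>B\<^esub>"
  "\<And>p. p \<in> BC.ps_ord 1 \<Longrightarrow> ps_subst1 B g (ps_subst1 B f p) = p"
  "\<And>p. p \<in> BC.ps_ord 1 \<Longrightarrow> ps_subst1 B f (ps_subst1 B g p) = p"
  using BC.ps_inverse[OF f f0 f1] by blast
 let ?l = "ps_subst1 B f" and ?e = "ps_subst1 B g" and ?O = "BC.ps_ord 1"
 let ?x = "ps_var B 0" and ?y = "ps_var B 1" and ?z = "ps_var B 2"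
 let ?s = "\<lambda>a. a \<odot>\<^bsub>B\<^esub> \<one>\<^bsub>B\<^esub>"
 have lO: "?l p \<in> ?O" if "p \<in> ?O" for p by (rule BC.ps_subst1_ord[of f, OF f f0 that])
 have eO: "?e p \<in> ?O" if "p \<in> ?O" for p by (rule BC.ps_subst1_ord[of g, OF g(1,2) that])
 have sc: "?s a \<in> carrier B" if "a \<in> carrier A" for a using that by simp
 note vO = BC.ps_var_ord and addO = BC.ps_ord_add and smO = BC.ps_ord_smult and cl = BC.ps_ord_closed
 have lc: "?l p \<in> carrier (psa B)" if "p \<in> ?O" for p using BC.ps_ord_closed[OF lO[OF that]] .
 \<comment> \<open>\<open>U\<close> is F(X, Y) and \<open>W a\<close> is rho(a)(X) as a series; the
   families of coefficients are read off from them.\<close>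
 define U where "U = ?e (?l ?x \<oplus>\<^bsub>psa B\<^esub> ?l ?y)"
 define W where "W a = ?e (?s a \<odot>\<^bsub>psa B\<^esub> ?l ?x)" for a
 define F where "F i j = U (BC.mon i j)" for i j
 define \<rho> where "\<rho> a i = W a (BC.mon i 0)" for a i
 have UO: "U \<in> ?O" unfolding U_def by (intro eO addO lO vO)
 have WO: "W a \<in> ?O" if "a \<in> carrier A" for a unfolding W_def using that by (intro eO smO lO vO sc)
 have Fc: "F i j \<in> carrier B" for i j using cl[OF UO] by (simp add: F_def psa_simps)
 have \<rho>c: "\<rho> a i \<in> carrier B" if "a \<in> carrier A" for a i using cl[OF WO[OF that]] by (simp add: \<rho>_def psa_simps)
 have F: "ps_subst2 B F p q = ?e (?l p \<oplus>\<^bsub>psa B\<^esub> ?l q)" if p: "p \<in> ?O" and q: "q \<in> ?O" for p q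
 proof -
  have "ps_subst2 B F p q = BC.ps_at p q U" by (simp add: BC.ps_at_def F_def[abs_def])
  also have "\<dots> = ?e (BC.ps_at p q (?l ?x \<oplus>\<^bsub>psa B\<^esub> ?l ?y))"
   unfolding U_def by (intro BC.ps_at_subst1[OF p q g(1)] addO lO vO)
  also have "BC.ps_at p q (?l ?x \<oplus>\<^bsub>psa B\<^esub> ?l ?y) = BC.ps_at p q (?l ?x) \<oplus>\<^bsub>psa B\<^esub> BC.ps_at p q (?l ?y)"
   by (intro mod_homD(2)[OF BC.ps_at_mod_hom[OF p q]] lc vO)
  also have "\<dots> = ?l p \<oplus>\<^bsub>psa B\<^esub> ?l q"
   by (simp only: BC.ps_at_subst1[OF p q f vO] BC.ps_at_var[OF p q])
  finally show ?thesis .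
 qed
 have \<rho>: "ps_subst1 B (\<rho> a) p = ?e (?s a \<odot>\<^bsub>psa B\<^esub> ?l p)" if p: "p \<in> ?O" and a: "a \<in> carrier A" for a p
 proof -
  note q = BC.zero_ord[of 1]
  have "ps_subst1 B (\<rho> a) p = BC.ps_at p \<zero>\<^bsub>psa B\<^esub> (W a)"
   using BC.ps_at_zero[OF p cl[OF WO[OF a]]] by (simp add: \<rho>_def[abs_def])
  also have "\<dots> = ?e (BC.ps_at p \<zero>\<^bsub>psa B\<^esub> (?s a \<odot>\<^bsub>psa B\<^esub> ?l ?x))"
   unfolding W_def by (intro BC.ps_at_subst1[OF p q g(1)] smO lO vO sc a)
  also have "BC.ps_at p \<zero>\<^bsub>psa B\<^esub> (?s a \<odot>\<^bsub>psa B\<^esub> ?l ?x) = ?s a \<odot>\<^bsub>psa B\<^esub> BC.ps_at p \<zero>\<^bsub>psa B\<^esub> (?l ?x)"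
   by (intro mod_homD(3)[OF BC.ps_at_mod_hom[OF p q]] lc vO sc a)
  also have "\<dots> = ?s a \<odot>\<^bsub>psa B\<^esub> ?l p"
   by (simp only: BC.ps_at_subst1[OF p q f vO] BC.ps_at_var[OF p q])
  finally show ?thesis .
 qed
 have FO: "ps_subst2 B F p q \<in> ?O" if "p \<in> ?O" "q \<in> ?O" for p q
  unfolding F[OF that] using that by (intro eO addO lO)
 have \<rho>O: "ps_subst1 B (\<rho> a) p \<in> ?O" if "p \<in> ?O" "a \<in> carrier A" for a p
  unfolding \<rho>[OF that] using that by (intro eO smO lO sc)
 have lF: "?l (ps_subst2 B F p q) = ?l p \<oplus>\<^bsub>psa B\<^esub> ?l q" if "p \<in> ?O" "q \<in> ?O" for p q
  unfolding F[OF that] using that by (intro g(4) addO lO)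
 have l\<rho>: "?l (ps_subst1 B (\<rho> a) p) = ?s a \<odot>\<^bsub>psa B\<^esub> ?l p" if "p \<in> ?O" "a \<in> carrier A" for a p
  unfolding \<rho>[OF that] using that by (intro g(4) smO lO sc)
 \<comment> \<open>The inverse series makes the logarithm injective; each axiom below is proved
   through this.\<close>
 have inj: "p = q" if "?l p = ?l q" "p \<in> ?O" "q \<in> ?O" for p q
  using arg_cong[OF that(1), of ?e] by (simp only: g(3)[OF that(2)] g(3)[OF that(3)])
 note rules = lF l\<rho> FO \<rho>O vO lc sc
 have sadd: "?s (a \<oplus>\<^bsub>A\<^esub> b) = ?s a \<oplus>\<^bsub>B\<^esub> ?s b" if "a \<in> carrier A" "b \<in> carrier A" for a b
  using that by (simp add: BA.smult_l_distr)
 have smul: "?s (a \<otimes>\<^bsub>A\<^esub> b) = ?s a \<otimes>\<^bsub>B\<^esub> ?s b" if "a \<in> carrier A" "b \<in> carrier A" for a b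
  using that by (simp add: BA.smult_assoc1 BA.smult_assoc2)
 have eqs: "p = q" if "(p, q) \<in> formal_module_equations A B F \<rho>" for p q
  using that unfolding formal_module_equations_def Let_def
 proof (elim UnE insertE emptyE CollectE exE conjE)
  assume "(p, q) = (ps_subst2 B F ?x ?y, ps_subst2 B F ?y ?x)"
  then have e: "p = ps_subst2 B F ?x ?y" "q = ps_subst2 B F ?y ?x" by simp_all
  show "p = q" unfolding e by (rule inj) (simp_all only: rules P.a_comm)
 next
  assume "(p, q) = (ps_subst2 B F (ps_subst2 B F ?x ?y) ?z, ps_subst2 B F ?x (ps_subst2 B F ?y ?z))"
  then have e: "p = ps_subst2 B F (ps_subst2 B F ?x ?y) ?z" "q = ps_subst2 B F ?x (ps_subst2 B F ?y ?z)" by simp_all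
  show "p = q" unfolding e by (rule inj) (simp_all only: rules P.a_assoc)
 next
  fix a assume "(p, q) = (ps_subst1 B (\<rho> a) (ps_subst2 B F ?x ?y),
    ps_subst2 B F (ps_subst1 B (\<rho> a) ?x) (ps_subst1 B (\<rho> a) ?y))" and a: "a \<in> carrier A"
  then have e: "p = ps_subst1 B (\<rho> a) (ps_subst2 B F ?x ?y)"
    "q = ps_subst2 B F (ps_subst1 B (\<rho> a) ?x) (ps_subst1 B (\<rho> a) ?y)" by simp_all
  show "p = q" unfolding e by (rule inj) (simp_all only: rules a PA.smult_r_distr)
 next
  fix a b assume "(p, q) = (ps_subst1 B (\<rho> (a \<oplus>\<^bsub>A\<^esub> b)) ?x,
    ps_subst2 B F (ps_subst1 B (\<rho> a) ?x) (ps_subst1 B (\<rho> b) ?x))" and ab: "a \<in> carrier A" "b \<in> carrier A"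
  then have e: "p = ps_subst1 B (\<rho> (a \<oplus>\<^bsub>A\<^esub> b)) ?x"
    "q = ps_subst2 B F (ps_subst1 B (\<rho> a) ?x) (ps_subst1 B (\<rho> b) ?x)" by simp_all
  show "p = q" unfolding e by (rule inj) (simp_all only: rules ab AC.a_closed sadd PA.smult_l_distr)
 next
  fix a b assume "(p, q) = (ps_subst1 B (\<rho> (a \<otimes>\<^bsub>A\<^esub> b)) ?x,
    ps_subst1 B (\<rho> a) (ps_subst1 B (\<rho> b) ?x))" and ab: "a \<in> carrier A" "b \<in> carrier A"
  then have e: "p = ps_subst1 B (\<rho> (a \<otimes>\<^bsub>A\<^esub> b)) ?x"
    "q = ps_subst1 B (\<rho> a) (ps_subst1 B (\<rho> b) ?x)" by simp_all
  show "p = q" unfolding e by (rule inj) (simp_all only: rules ab AC.m_closed smul PA.smult_assoc1)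
 next
  assume "(p, q) = (ps_subst1 B (\<rho> \<one>\<^bsub>A\<^esub>) ?x, ?x)"
  then have e: "p = ps_subst1 B (\<rho> \<one>\<^bsub>A\<^esub>) ?x" "q = ?x" by simp_all
  have s1: "?s \<one>\<^bsub>A\<^esub> = \<one>\<^bsub>B\<^esub>" by simp
  show "p = q" unfolding e by (rule inj) (simp_all only: rules AC.one_closed s1 PA.smult_one)
 qed
 have Fx0: "ps_subst2 B F ?x \<zero>\<^bsub>psa B\<^esub> = ?x" and F0x: "ps_subst2 B F \<zero>\<^bsub>psa B\<^esub> ?x = ?x"
 proof -
  have l0: "?l \<zero>\<^bsub>psa B\<^esub> = \<zero>\<^bsub>psa B\<^esub>"
  proof -
   have "BC.ps_at \<zero>\<^bsub>psa B\<^esub> \<zero>\<^bsub>psa B\<^esub> (?l ?x) = ?l \<zero>\<^bsub>psa B\<^esub>"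
    by (simp only: BC.ps_at_subst1[OF BC.zero_ord BC.zero_ord f vO] BC.ps_at_var[OF BC.zero_ord BC.zero_ord])
   moreover have "ps_subst1 B f \<zero>\<^bsub>psa B\<^esub> m = \<zero>\<^bsub>B\<^esub>" for m
   proof -
    have z: "\<zero>\<^bsub>psa B\<^esub> [^]\<^bsub>psa B\<^esub> i = \<zero>\<^bsub>psa B\<^esub>" if "i \<noteq> 0" for i :: nat
     using that by (cases i) auto
    have t: "f i \<otimes>\<^bsub>B\<^esub> (\<zero>\<^bsub>psa B\<^esub> [^]\<^bsub>psa B\<^esub> i) m = \<zero>\<^bsub>B\<^esub>" for i
    proof (cases "i = 0")
     case True
     have "\<one>\<^bsub>psa B\<^esub> m \<in> carrier B" using P.one_closed by (simp add: psa_simps(1) del: P.one_closed)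
     then show ?thesis using True f0 by simp
    next
     case False
     then show ?thesis using z[OF False] f by (simp add: psa_simps(4))
    qed
    show ?thesis unfolding BC.ps_subst1_bound[OF f BC.zero_ord order_refl] t by simp
   qed
   ultimately show ?thesis by (simp add: fun_eq_iff psa_simps(4))
  qed
  show "ps_subst2 B F ?x \<zero>\<^bsub>psa B\<^esub> = ?x" "ps_subst2 B F \<zero>\<^bsub>psa B\<^esub> ?x = ?x"
   unfolding F[OF vO BC.zero_ord] F[OF BC.zero_ord vO] l0
   using lc[OF vO] g(3)[OF vO] by simp_all
 qed
 have Fi0: "F i 0 = (if i = 1 then \<one>\<^bsub>B\<^esub> else \<zero>\<^bsub>B\<^esub>)" for i
 proof -
  have "?x = BC.ps_at ?x \<zero>\<^bsub>psa B\<^esub> U" using Fx0 by (simp add: BC.ps_at_def F_def[abs_def])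
  also have "\<dots> = ps_subst1 B (\<lambda>i. F i 0) ?x" using BC.ps_at_zero[OF vO cl[OF UO]] by (simp add: F_def)
  finally have "?x (BC.mon i 0) = F i 0" using BC.ps_subst1_var[of "\<lambda>i. F i 0" i] Fc by metis
  then show ?thesis using BC.mon_eq_iff[of i 0 1 0] by (simp add: ps_var_def) (auto simp: BC.mon_def)
 qed
 \<comment> \<open>Transfers the unit law from F(X, 0) to F(0, Y).\<close>
 have comm: "F i j = F j i" for i j
 proof -
  have "ps_subst2 B F ?x ?y = ps_subst2 B F ?y ?x"
   by (rule eqs) (simp add: formal_module_equations_def Let_def)
  then have "ps_subst2 B F ?x ?y (replicate_mset i 0 + replicate_mset j 1) =
    ps_subst2 B F ?y ?x (replicate_mset j 1 + replicate_mset i 0)" by (simp add: add.commute)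
  then show ?thesis using BC.ps_subst2_vars[of 0 1 F i j] BC.ps_subst2_vars[of 1 0 F j i] Fc by simp
 qed
 have \<rho>01: "\<rho> a 0 = \<zero>\<^bsub>B\<^esub>" "\<rho> a 1 = ?s a" if a: "a \<in> carrier A" for a
 proof -
  show "\<rho> a 0 = \<zero>\<^bsub>B\<^esub>" using WO[OF a] by (simp add: \<rho>_def BC.ps_ord_def BC.mon_def)
  have "?l (W a) (BC.mon 1 0) = (?s a \<odot>\<^bsub>psa B\<^esub> ?l ?x) (BC.mon 1 0)"
   unfolding W_def by (rule fun_cong[OF g(4)[OF smO[OF sc[OF a] lO[OF vO]]]])
  also have "\<dots> = ?s a" using BC.ps_subst1_var[of f 1, OF f] f1 sc[OF a] by (simp add: psa_simps)
  finally have 1: "?l (W a) (BC.mon 1 0) = ?s a" .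
  have Wm: "W a m \<in> carrier B" for m using cl[OF WO[OF a]] by (simp add: psa_simps)
  have o1: "\<one>\<^bsub>psa B\<^esub> m \<in> carrier B" for m using P.one_closed by (simp add: psa_simps(1) del: P.one_closed)
  have e: "{..Suc 0} = {0, 1}" by auto
  have "?l (W a) (BC.mon 1 0) = (\<Oplus>\<^bsub>B\<^esub>i\<in>{..1}. f i \<otimes>\<^bsub>B\<^esub> (W a [^]\<^bsub>psa B\<^esub> i) (BC.mon 1 0))"
   using WO[OF a] f by (intro BC.ps_subst1_bound) auto
  also have "\<dots> = W a (BC.mon 1 0)"
   using f0 f1 Wm o1 cl[OF WO[OF a]] f by (simp add: e)
  finally show "\<rho> a 1 = ?s a" using 1 by (simp add: \<rho>_def)
 qed
 have fm: "formal_module A B F \<rho>"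
  unfolding formal_module_def
  using Fc \<rho>c Fi0 comm[of 0] \<rho>01 eqs by (auto simp del: One_nat_def)
 show ?thesis
  by (rule that[OF fm]) (use lF[OF vO vO] l\<rho>[OF vO] in simp_all)
qed

section \<open>Formal modules over square-zero extensions\<close>

text \<open>The square-zero extension of A by M, which for M = A is the ring of dual numbers. A
  deformation of the additive formal group law along M has its non-trivial coefficients in M, and
  the axioms become linear equations between them.\<close>

definition sqz :: "('a, 'm) ring_scheme \<Rightarrow> ('a, 'b, 'p) module_scheme \<Rightarrow> ('a, 'a \<times> 'b) module" where
 "sqz A M = \<lparr>carrier = carrier A \<times> carrier M,
   monoid.mult = (\<lambda>x y. (fst x \<otimes>\<^bsub>A\<^esub> fst y, fst x \<odot>\<^bsub>M\<^esub> snd y \<oplus>\<^bsub>M\<^esub> fst y \<odot>\<^bsub>M\<^esub> snd x)),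
   one = (\<one>\<^bsub>A\<^esub>, \<zero>\<^bsub>M\<^esub>), ring.zero = (\<zero>\<^bsub>A\<^esub>, \<zero>\<^bsub>M\<^esub>),
   add = (\<lambda>x y. (fst x \<oplus>\<^bsub>A\<^esub> fst y, snd x \<oplus>\<^bsub>M\<^esub> snd y)),
   smult = (\<lambda>a x. (a \<otimes>\<^bsub>A\<^esub> fst x, a \<odot>\<^bsub>M\<^esub> snd x))\<rparr>"

lemma sqz_simps:
 "carrier (sqz A M) = carrier A \<times> carrier M"
 "x \<otimes>\<^bsub>sqz A M\<^esub> y = (fst x \<otimes>\<^bsub>A\<^esub> fst y, fst x \<odot>\<^bsub>M\<^esub> snd y \<oplus>\<^bsub>M\<^esub> fst y \<odot>\<^bsub>M\<^esub> snd x)"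
 "\<one>\<^bsub>sqz A M\<^esub> = (\<one>\<^bsub>A\<^esub>, \<zero>\<^bsub>M\<^esub>)" "\<zero>\<^bsub>sqz A M\<^esub> = (\<zero>\<^bsub>A\<^esub>, \<zero>\<^bsub>M\<^esub>)"
 "x \<oplus>\<^bsub>sqz A M\<^esub> y = (fst x \<oplus>\<^bsub>A\<^esub> fst y, snd x \<oplus>\<^bsub>M\<^esub> snd y)"
 "a \<odot>\<^bsub>sqz A M\<^esub> x = (a \<otimes>\<^bsub>A\<^esub> fst x, a \<odot>\<^bsub>M\<^esub> snd x)"
 by (simp_all add: sqz_def)

lemma (in cring) ps_binomial:
 assumes uv: "u \<noteq> v"
 shows "((ps_var R u \<oplus>\<^bsub>PSA\<^esub> ps_var R v) [^]\<^bsub>PSA\<^esub> (n::nat)) m =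
  (if set_mset m \<subseteq> {u, v} \<and> size m = n then add_pow R (n choose count m u) \<one> else \<zero>)"
proof (induction n arbitrary: m)
 case 0
 show ?case by (auto simp: psa_simps)
next
 case (Suc n)
 interpret P: cring PSA by (rule PSA_cring)
 let ?w = "ps_var R u \<oplus>\<^bsub>PSA\<^esub> ps_var R v"
 have vc: "ps_var R i \<in> carrier PSA" for i by (rule ps_ord_closed[OF ps_var_ord])
 have wn: "?w [^]\<^bsub>PSA\<^esub> n \<in> carrier PSA" using vc by simp
 have "?w [^]\<^bsub>PSA\<^esub> Suc n = ?w [^]\<^bsub>PSA\<^esub> n \<otimes>\<^bsub>PSA\<^esub> ps_var R u \<oplus>\<^bsub>PSA\<^esub> ?w [^]\<^bsub>PSA\<^esub> n \<otimes>\<^bsub>PSA\<^esub> ps_var R v"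
  using wn vc by (simp add: P.r_distr)
 then have "(?w [^]\<^bsub>PSA\<^esub> Suc n) m = (?w [^]\<^bsub>PSA\<^esub> n \<otimes>\<^bsub>PSA\<^esub> ps_var R u \<oplus>\<^bsub>PSA\<^esub> ?w [^]\<^bsub>PSA\<^esub> n \<otimes>\<^bsub>PSA\<^esub> ps_var R v) m"
  by (rule arg_cong)
 also have "\<dots> = (?w [^]\<^bsub>PSA\<^esub> n \<otimes>\<^bsub>PSA\<^esub> ps_var R u) m \<oplus> (?w [^]\<^bsub>PSA\<^esub> n \<otimes>\<^bsub>PSA\<^esub> ps_var R v) m"
  by (rule fun_cong[OF psa_simps(5)])
 finally have e: "(?w [^]\<^bsub>PSA\<^esub> Suc n) m =
   (if u \<in># m then (?w [^]\<^bsub>PSA\<^esub> n) (m - {#u#}) else \<zero>) \<oplus> (if v \<in># m then (?w [^]\<^bsub>PSA\<^esub> n) (m - {#v#}) else \<zero>)"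
  by (simp only: ps_var_mult[OF wn])
 show ?case
 proof (cases "set_mset m \<subseteq> {u, v} \<and> size m = Suc n")
  case False
  have "\<not> (set_mset (m - {#i#}) \<subseteq> {u, v} \<and> size (m - {#i#}) = n)" if "i \<in># m" "i \<in> {u, v}" for i
   using that False by (metis One_nat_def Suc_pred diff_single_trivial insert_DiffM insert_absorb insert_subset
     set_mset_add_mset_insert size_add_mset)
  then show ?thesis unfolding e Suc using False by auto
 next
  case True
  have s: "size m = count m u + count m v"
  proof -
   have "m = replicate_mset (count m u) u + replicate_mset (count m v) v"
    using True uv by (intro multiset_eqI) (auto simp: not_in_iff subset_iff)
   then show ?thesis by (metis size_replicate_mset size_union)
  qed
  have sub: "set_mset (m - {#i#}) \<subseteq> {u, v}" "size (m - {#i#}) = n" if "i \<in># m" for i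
   using that True by (auto simp: size_Diff_singleton dest: in_diffD)
  have one: "add_pow R k \<one> \<in> carrier R" for k :: nat by simp
  consider "u \<in># m" "v \<in># m" | "u \<in># m" "v \<notin># m" | "u \<notin># m" "v \<in># m"
   using True by (cases m) auto
  then show ?thesis
  proof cases
   case 1
   then obtain a b where ab: "count m u = Suc a" "count m v = Suc b"
    by (metis count_greater_zero_iff gr0_implies_Suc)
   then have "a + Suc b = n" using s True by simp
   then show ?thesis unfolding e Suc using 1 True sub uv ab
    by (simp add: add.nat_pow_mult add.commute)
  next
   case 2
   then have "count m u = Suc n" using s True by (simp add: not_in_iff)
   then show ?thesis unfolding e Suc using 2 True sub uv by simp
  next
   case 3
   then have "count m u = 0" by (simp add: not_in_iff)
   then show ?thesis unfolding e Suc using 3 True sub uv by simp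
  qed
 qed
qed

lemma (in cring) ps_smult_pow:
 assumes a: "a \<in> carrier R" and p: "p \<in> carrier PSA"
 shows "(a \<odot>\<^bsub>PSA\<^esub> p) [^]\<^bsub>PSA\<^esub> (n::nat) = (a [^] n) \<odot>\<^bsub>PSA\<^esub> p [^]\<^bsub>PSA\<^esub> n"
proof (induction n)
 case 0
 interpret P: cring PSA by (rule PSA_cring)
 interpret PA: algebra R PSA by (rule PSA_algebra)
 show ?case by simp
next
 case (Suc n)
 interpret P: cring PSA by (rule PSA_cring)
 interpret PA: algebra R PSA by (rule PSA_algebra)
 have c: "p [^]\<^bsub>PSA\<^esub> n \<otimes>\<^bsub>PSA\<^esub> (a \<odot>\<^bsub>PSA\<^esub> p) = a \<odot>\<^bsub>PSA\<^esub> (p [^]\<^bsub>PSA\<^esub> n \<otimes>\<^bsub>PSA\<^esub> p)"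
  using PA.smult_assoc2[of a p "p [^]\<^bsub>PSA\<^esub> n"] P.m_comm[of "p [^]\<^bsub>PSA\<^esub> n" "a \<odot>\<^bsub>PSA\<^esub> p"]
   P.m_comm[of "p [^]\<^bsub>PSA\<^esub> n" p] a p by simp
 show ?case using Suc a p by (simp add: PA.smult_assoc1 PA.smult_assoc2 c)
qed

context module
begin

abbreviation "SZ \<equiv> sqz R M"

lemma sqz_algebra: "algebra R SZ"
proof (rule algebraI[OF R.is_cring])
 have ag: "abelian_group SZ"
 proof (rule abelian_groupI)
  fix x assume "x \<in> carrier SZ"
  then show "\<exists>y\<in>carrier SZ. y \<oplus>\<^bsub>SZ\<^esub> x = \<zero>\<^bsub>SZ\<^esub>"
   by (intro bexI[of _ "(\<ominus> fst x, \<ominus>\<^bsub>M\<^esub> snd x)"]) (auto simp: sqz_simps R.l_neg M.l_neg)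
 qed (auto simp: sqz_simps R.a_ac M.a_ac)
 show "cring SZ"
 proof (rule cringI[OF ag])
  show "Group.comm_monoid SZ"
   by (rule comm_monoidI)
    (auto simp: sqz_simps R.m_ac M.a_ac smult_r_distr smult_assoc1[symmetric])
 qed (auto simp: sqz_simps R.l_distr smult_r_distr smult_l_distr M.a_ac)
qed (auto simp: sqz_simps R.l_distr R.r_distr R.m_assoc smult_l_distr smult_r_distr smult_assoc1
  smult_assoc1[symmetric] R.m_ac simp del: smult_assoc1)

lemma sqz_fst_hom: "fst \<in> ring_hom SZ R"
 by (auto simp: ring_hom_def sqz_simps)

lemma sqz_fst_hom_cring: "ring_hom_cring SZ R fst"
proof -
 interpret S: cring SZ by (rule algebra.M_cring[OF sqz_algebra])
 show ?thesis by (intro ring_hom_cringI ring_hom_ringI2 S.ring_axioms R.ring_axioms S.is_cring R.is_cring sqz_fst_hom)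
qed

lemma sqz_finsum:
 assumes "f \<in> S \<rightarrow> carrier SZ"
 shows "(\<Oplus>\<^bsub>SZ\<^esub>i\<in>S. f i) = ((\<Oplus>i\<in>S. fst (f i)), (\<Oplus>\<^bsub>M\<^esub>i\<in>S. snd (f i)))"
proof -
 interpret S: cring SZ by (rule algebra.M_cring[OF sqz_algebra])
 show ?thesis
 proof (cases "finite S")
  case True
  then show ?thesis using assms
  proof (induction S)
   case (insert i S)
   then have "\<forall>j\<in>insert i S. fst (f j) \<in> carrier R \<and> snd (f j) \<in> carrier M" by (auto simp: Pi_iff sqz_simps)
   then show ?case using insert by (simp add: Pi_iff) (simp add: sqz_simps(5))
  qed (simp add: sqz_simps)
 qed (simp add: S.add.finprod_infinite R.add.finprod_infinite M.add.finprod_infinite sqz_simps)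
qed

lemma sqz_ps:
 assumes p: "p \<in> cring.ps_ord SZ 1" and q: "q \<in> cring.ps_ord SZ 1"
 shows "fst \<circ> p \<in> R.ps_ord 1"
  "fst ((p [^]\<^bsub>psa SZ\<^esub> i \<otimes>\<^bsub>psa SZ\<^esub> q [^]\<^bsub>psa SZ\<^esub> j) m) =
   ((fst \<circ> p) [^]\<^bsub>psa R\<^esub> (i::nat) \<otimes>\<^bsub>psa R\<^esub> (fst \<circ> q) [^]\<^bsub>psa R\<^esub> (j::nat)) m"
  "fst ((p [^]\<^bsub>psa SZ\<^esub> i) m) = ((fst \<circ> p) [^]\<^bsub>psa R\<^esub> i) m"
proof -
 interpret S: cring SZ by (rule algebra.M_cring[OF sqz_algebra])
 interpret h: ring_hom_cring SZ R fst by (rule sqz_fst_hom_cring)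
 show "fst \<circ> p \<in> R.ps_ord 1" using p unfolding S.ps_ord_def R.ps_ord_def by (auto simp: psa_simps(1) sqz_simps)
 have c: "p \<in> carrier (power_series_ring SZ)" "q \<in> carrier (power_series_ring SZ)"
  using p q by (auto simp: S.ps_ord_def psa_simps(1) power_series_ring_simps(1))
 show "fst ((p [^]\<^bsub>psa SZ\<^esub> i) m) = ((fst \<circ> p) [^]\<^bsub>psa R\<^esub> i) m"
  using fun_cong[OF h.ps_pow_nat[OF c(1), of i], of m] by (simp add: ps_algebra_pow)
 show "fst ((p [^]\<^bsub>psa SZ\<^esub> i \<otimes>\<^bsub>psa SZ\<^esub> q [^]\<^bsub>psa SZ\<^esub> j) m) =
   ((fst \<circ> p) [^]\<^bsub>psa R\<^esub> i \<otimes>\<^bsub>psa R\<^esub> (fst \<circ> q) [^]\<^bsub>psa R\<^esub> j) m"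
  using fun_cong[OF h.ps_mult_nat[OF S.ps_pow_closed[OF c(1), of i] S.ps_pow_closed[OF c(2), of j]], of m]
  unfolding h.ps_pow_nat[OF c(1)] h.ps_pow_nat[OF c(2)] by (simp add: ps_algebra_pow ps_algebra_mult)
qed

text \<open>Since \<open>E i j\<close> is infinitesimal, only \<open>fst \<circ> p\<close> and \<open>fst \<circ> q\<close> enter its multiples.\<close>

lemma sqz_subst2:
 assumes p: "p \<in> cring.ps_ord SZ 1" and q: "q \<in> cring.ps_ord SZ 1" and N: "size m \<le> N"
  and E: "\<And>i j. E i j \<in> carrier M"
  and F: "\<And>i. F i 0 = (if i = 1 then \<one>\<^bsub>SZ\<^esub> else \<zero>\<^bsub>SZ\<^esub>)" "\<And>i. F 0 i = (if i = 1 then \<one>\<^bsub>SZ\<^esub> else \<zero>\<^bsub>SZ\<^esub>)"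
   "\<And>i j. 1 \<le> i \<Longrightarrow> 1 \<le> j \<Longrightarrow> F i j = (\<zero>, E i j)"
 shows "ps_subst2 SZ F p q m = (fst (p m) \<oplus> fst (q m), (snd (p m) \<oplus>\<^bsub>M\<^esub> snd (q m)) \<oplus>\<^bsub>M\<^esub>
   (\<Oplus>\<^bsub>M\<^esub>z\<in>{1..N} \<times> {1..N}. ((fst \<circ> p) [^]\<^bsub>psa R\<^esub> fst z \<otimes>\<^bsub>psa R\<^esub> (fst \<circ> q) [^]\<^bsub>psa R\<^esub> snd z) m \<odot>\<^bsub>M\<^esub> E (fst z) (snd z)))"
proof -
 interpret S: cring SZ by (rule algebra.M_cring[OF sqz_algebra])
 interpret PS: cring "psa SZ" by (rule S.PSA_cring)
 let ?t = "\<lambda>z :: nat \<times> nat. (p [^]\<^bsub>psa SZ\<^esub> fst z \<otimes>\<^bsub>psa SZ\<^esub> q [^]\<^bsub>psa SZ\<^esub> snd z) m"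
 \<comment> \<open>One more than N, so that the linear indices (1, 0) and (0, 1) are in range even
   for N = 0.\<close>
 let ?N = "Suc N"
 have pc: "p \<in> carrier (psa SZ)" "q \<in> carrier (psa SZ)" using p q S.ps_ord_closed by auto
 have tc: "?t z \<in> carrier SZ" for z :: "nat \<times> nat"
  using PS.m_closed[OF PS.nat_pow_closed[OF pc(1)] PS.nat_pow_closed[OF pc(2)]] by (simp add: psa_simps(1))
 have Fc: "F i j \<in> carrier SZ" for i j
  using F(1)[of i] F(2)[of j] F(3)[of i j] E[of i j] by (cases "i = 0"; cases "j = 0") (auto simp: sqz_simps)
 let ?I = "{1..N} \<times> {1..N}"
 have t1: "?t (1, 0) = p m" "?t (0, 1) = q m" using pc by simp_all
 have Ez: "F (fst z) (snd z) \<otimes>\<^bsub>SZ\<^esub> ?t z = (\<zero>, fst (?t z) \<odot>\<^bsub>M\<^esub> E (fst z) (snd z))" if "z \<in> ?I" for z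
  using that tc[of z] E F(3) by (auto simp: sqz_simps)
 have big: "?t z = \<zero>\<^bsub>SZ\<^esub>" if "N < fst z + snd z" for z
  using S.ps_ord_mult[OF S.ps_ord_pow[OF p, of "fst z"] S.ps_ord_pow[OF q, of "snd z"]] that N by (simp add: S.ps_ord_def)
 have "ps_subst2 SZ F p q m = (\<Oplus>\<^bsub>SZ\<^esub>z\<in>{..?N} \<times> {..?N}. F (fst z) (snd z) \<otimes>\<^bsub>SZ\<^esub> ?t z)"
  using Fc N by (intro S.ps_subst2_bound p q) auto
 also have "\<dots> = (\<Oplus>\<^bsub>SZ\<^esub>z\<in>insert (1, 0) (insert (0, 1) ?I). F (fst z) (snd z) \<otimes>\<^bsub>SZ\<^esub> ?t z)"
 proof (rule S.add.finprod_mono_neutral_cong_right)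
  show "insert (1, 0) (insert (0, 1) ?I) \<subseteq> {..?N} \<times> {..?N}" by auto
  fix z assume z: "z \<in> {..?N} \<times> {..?N} - insert (1, 0) (insert (0, 1) ?I)"
  obtain i j where ij: "z = (i, j)" by (cases z)
  show "F (fst z) (snd z) \<otimes>\<^bsub>SZ\<^esub> ?t z = \<zero>\<^bsub>SZ\<^esub>"
  proof (cases "i = 0 \<or> j = 0")
   case True
   then have "F i j = \<zero>\<^bsub>SZ\<^esub>" using z F(1)[of i] F(2)[of j] ij by auto
   then show ?thesis using tc[of z] ij by (simp add: S.l_null)
  next
   case False
   then have "N < fst z + snd z" using z ij by auto
   then show ?thesis using big Fc by (simp add: S.r_null)
  qed
 qed (use Fc tc in auto)
 also have "\<dots> = F 1 0 \<otimes>\<^bsub>SZ\<^esub> ?t (1, 0) \<oplus>\<^bsub>SZ\<^esub> (F 0 1 \<otimes>\<^bsub>SZ\<^esub> ?t (0, 1) \<oplus>\<^bsub>SZ\<^esub> (\<Oplus>\<^bsub>SZ\<^esub>z\<in>?I. F (fst z) (snd z) \<otimes>\<^bsub>SZ\<^esub> ?t z))"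
 proof -
  define h where "h z = F (fst z) (snd z) \<otimes>\<^bsub>SZ\<^esub> ?t z" for z
  have gen: "(\<Oplus>\<^bsub>SZ\<^esub>z\<in>insert a (insert b I). h z) = h a \<oplus>\<^bsub>SZ\<^esub> (h b \<oplus>\<^bsub>SZ\<^esub> (\<Oplus>\<^bsub>SZ\<^esub>z\<in>I. h z))"
   if "finite I" "a \<noteq> b" "a \<notin> I" "b \<notin> I" "\<And>z. h z \<in> carrier SZ" for h a b and I :: "(nat \<times> nat) set"
   using that by simp
  have "(\<Oplus>\<^bsub>SZ\<^esub>z\<in>insert (1, 0) (insert (0, 1) ?I). h z) = h (1, 0) \<oplus>\<^bsub>SZ\<^esub> (h (0, 1) \<oplus>\<^bsub>SZ\<^esub> (\<Oplus>\<^bsub>SZ\<^esub>z\<in>?I. h z))"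
   by (rule gen) (auto simp: h_def Fc tc simp del: nat_pow_0)
  then show ?thesis by (simp only: h_def fst_conv snd_conv)
 qed
 also have "(\<Oplus>\<^bsub>SZ\<^esub>z\<in>?I. F (fst z) (snd z) \<otimes>\<^bsub>SZ\<^esub> ?t z) = (\<Oplus>\<^bsub>SZ\<^esub>z\<in>?I. (\<zero>, fst (?t z) \<odot>\<^bsub>M\<^esub> E (fst z) (snd z)))"
  using tc E by (intro S.add.finprod_cong') (auto simp: Ez sqz_simps(1) mem_Times_iff)
 also have "\<dots> = (\<zero>, (\<Oplus>\<^bsub>M\<^esub>z\<in>?I. fst (?t z) \<odot>\<^bsub>M\<^esub> E (fst z) (snd z)))"
  using tc E by (subst sqz_finsum) (auto simp: sqz_simps(1) mem_Times_iff)
 finally have *: "ps_subst2 SZ F p q m = F 1 0 \<otimes>\<^bsub>SZ\<^esub> ?t (1, 0) \<oplus>\<^bsub>SZ\<^esub> (F 0 1 \<otimes>\<^bsub>SZ\<^esub> ?t (0, 1) \<oplus>\<^bsub>SZ\<^esub>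
   (\<zero>, (\<Oplus>\<^bsub>M\<^esub>z\<in>?I. fst (?t z) \<odot>\<^bsub>M\<^esub> E (fst z) (snd z))))" .
 have pm: "p m \<in> carrier SZ" "q m \<in> carrier SZ" using pc by (auto simp: psa_simps(1))
 have s: "(\<Oplus>\<^bsub>M\<^esub>z\<in>?I. fst (?t z) \<odot>\<^bsub>M\<^esub> E (fst z) (snd z)) \<in> carrier M"
  using tc E by (intro M.finsum_closed) (auto simp: sqz_simps(1) mem_Times_iff)
 have "ps_subst2 SZ F p q m = (fst (p m) \<oplus> fst (q m), (snd (p m) \<oplus>\<^bsub>M\<^esub> snd (q m)) \<oplus>\<^bsub>M\<^esub>
   (\<Oplus>\<^bsub>M\<^esub>z\<in>?I. fst (?t z) \<odot>\<^bsub>M\<^esub> E (fst z) (snd z)))"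
  unfolding * t1 F using pm s by (auto simp: sqz_simps M.a_assoc)
 then show ?thesis by (simp add: sqz_ps(2)[OF p q])
qed

text \<open>The series is X + e X^n, the shape of a logarithm with a single infinitesimal
  term.\<close>

lemma sqz_subst1:
 assumes p: "p \<in> cring.ps_ord SZ 1" and n: "2 \<le> n" and e: "e \<in> carrier M"
 shows "ps_subst1 SZ (\<lambda>k. if k = 1 then \<one>\<^bsub>SZ\<^esub> else if k = n then (\<zero>, e) else \<zero>\<^bsub>SZ\<^esub>) p m =
   (fst (p m), snd (p m) \<oplus>\<^bsub>M\<^esub> ((fst \<circ> p) [^]\<^bsub>psa R\<^esub> n) m \<odot>\<^bsub>M\<^esub> e)"
proof -
 interpret S: cring SZ by (rule algebra.M_cring[OF sqz_algebra])
 interpret PS: cring "psa SZ" by (rule S.PSA_cring)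
 let ?f = "\<lambda>k. if k = 1 then \<one>\<^bsub>SZ\<^esub> else if k = n then (\<zero>, e) else \<zero>\<^bsub>SZ\<^esub>"
 let ?t = "\<lambda>k :: nat. (p [^]\<^bsub>psa SZ\<^esub> k) m"
 have pc: "p \<in> carrier (psa SZ)" using p S.ps_ord_closed by auto
 have tc: "?t k \<in> carrier SZ" for k :: nat
  using PS.nat_pow_closed[OF pc] by (simp add: psa_simps(1))
 have t1: "?t 1 = p m" using PS.nat_pow_eone[OF pc] by simp
 have fc: "?f k \<in> carrier SZ" for k using e by (auto simp: sqz_simps)
 have gen: "(\<Oplus>\<^bsub>SZ\<^esub>k\<in>{..N}. ?f k \<otimes>\<^bsub>SZ\<^esub> t k) = ?f 1 \<otimes>\<^bsub>SZ\<^esub> t 1 \<oplus>\<^bsub>SZ\<^esub> ?f n \<otimes>\<^bsub>SZ\<^esub> t n"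
  if "n \<le> N" "\<And>k. t k \<in> carrier SZ" for t N
 proof -
  have "(\<Oplus>\<^bsub>SZ\<^esub>k\<in>{..N}. ?f k \<otimes>\<^bsub>SZ\<^esub> t k) = (\<Oplus>\<^bsub>SZ\<^esub>k\<in>{1, n}. ?f k \<otimes>\<^bsub>SZ\<^esub> t k)"
  proof (rule S.add.finprod_mono_neutral_cong_right)
   show "?f k \<otimes>\<^bsub>SZ\<^esub> t k = \<zero>\<^bsub>SZ\<^esub>" if "k \<in> {..N} - {1, n}" for k
    using that \<open>\<And>k. t k \<in> carrier SZ\<close>[of k] by (simp add: S.l_null)
  qed (use that n fc in auto)
  also have "\<dots> = ?f 1 \<otimes>\<^bsub>SZ\<^esub> t 1 \<oplus>\<^bsub>SZ\<^esub> ?f n \<otimes>\<^bsub>SZ\<^esub> t n"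
  proof -
   have "(\<Oplus>\<^bsub>SZ\<^esub>k\<in>{a, b}. h k) = h a \<oplus>\<^bsub>SZ\<^esub> h b" if "a \<noteq> b" "\<And>k. h k \<in> carrier SZ" for h and a b :: nat
    using that by simp
   from this[of 1 n "\<lambda>k. ?f k \<otimes>\<^bsub>SZ\<^esub> t k"] show ?thesis
    using n S.m_closed[OF fc \<open>\<And>k. t k \<in> carrier SZ\<close>] by simp
  qed
  finally show ?thesis .
 qed
 \<comment> \<open>Adding n to the size of m puts both relevant indices, 1 and n, into the
   range.\<close>
 have "ps_subst1 SZ ?f p m = (\<Oplus>\<^bsub>SZ\<^esub>k\<in>{..size m + n}. ?f k \<otimes>\<^bsub>SZ\<^esub> ?t k)"
  by (rule S.ps_subst1_bound[OF fc p]) simp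
 also have "\<dots> = ?f 1 \<otimes>\<^bsub>SZ\<^esub> ?t 1 \<oplus>\<^bsub>SZ\<^esub> ?f n \<otimes>\<^bsub>SZ\<^esub> ?t n" by (rule gen) (use tc in auto)
 also have "\<dots> = (fst (p m), snd (p m) \<oplus>\<^bsub>M\<^esub> fst (?t n) \<odot>\<^bsub>M\<^esub> e)"
 proof -
  have "p m \<in> carrier SZ" using tc[of 1] t1 by simp
  then show ?thesis unfolding t1 using n e tc[of n] by (auto simp: sqz_simps)
 qed
 finally show ?thesis by (simp add: sqz_ps(3)[OF p p])
qed

end

declare One_nat_def [simp del]

lemma self_module_simps:
 "carrier (self_module A) = carrier A" "\<zero>\<^bsub>self_module A\<^esub> = \<zero>\<^bsub>A\<^esub>" "\<one>\<^bsub>self_module A\<^esub> = \<one>\<^bsub>A\<^esub>"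
 "x \<oplus>\<^bsub>self_module A\<^esub> y = x \<oplus>\<^bsub>A\<^esub> y" "x \<otimes>\<^bsub>self_module A\<^esub> y = x \<otimes>\<^bsub>A\<^esub> y"
 "x \<odot>\<^bsub>self_module A\<^esub> y = x \<otimes>\<^bsub>A\<^esub> y"
 by (simp_all add: self_module_def)

lemma (in cring) self_module_module: "module R (self_module R)"
proof (rule moduleI[OF is_cring])
 show "abelian_group (self_module R)"
 proof (rule abelian_groupI)
  fix x assume "x \<in> carrier (self_module R)"
  then show "\<exists>y\<in>carrier (self_module R). y \<oplus>\<^bsub>self_module R\<^esub> x = \<zero>\<^bsub>self_module R\<^esub>"
   by (intro bexI[of _ "\<ominus> x"]) (auto simp: self_module_simps l_neg)
 qed (auto simp: self_module_simps a_ac)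
qed (auto simp: self_module_simps l_distr r_distr m_assoc)

section \<open>The universal formal module mapped to polynomials\<close>

context cring
begin

abbreviation "PX \<equiv> poly_algebra R {1::nat..}"
abbreviation "SR \<equiv> sqz R (self_module R)"

text \<open>The quotient map of A[x_1, x_2, ...] that sets all variables except x_k, and the square
  of x_k, to zero. Its target is the ring of dual numbers.\<close>

definition lin_part :: "nat \<Rightarrow> (nat multiset \<Rightarrow> 'a) \<Rightarrow> 'a \<times> 'a" where
 "lin_part k p = (p {#}, p {#k#})"

lemma lin_part_hom:
 shows "lin_part k \<in> alg_hom R PX SR"
proof (intro alg_homI mod_homI)
 have s0: "{m. m \<subseteq># {#}} = {{#}}" by auto
 have s1: "{m. m \<subseteq># {#k#}} = {{#}, {#k#}}"
  by (auto simp: mset_subset_eq_exists_conv single_is_union)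
 fix p assume p: "p \<in> carrier PX"
 then have pc: "p m \<in> carrier R" for m by (simp add: poly_algebra_def monoid_algebra_simps carrier_free_module)
 show "lin_part k p \<in> carrier SR" using pc by (simp add: lin_part_def sqz_simps self_module_simps)
 show "lin_part k (a \<odot>\<^bsub>PX\<^esub> p) = a \<odot>\<^bsub>SR\<^esub> lin_part k p" if "a \<in> carrier R" for a
  by (simp add: lin_part_def sqz_simps self_module_simps poly_algebra_def monoid_algebra_simps)
 fix q assume q: "q \<in> carrier PX"
 then have qc: "q m \<in> carrier R" for m by (simp add: poly_algebra_def monoid_algebra_simps carrier_free_module)
 show "lin_part k (p \<oplus>\<^bsub>PX\<^esub> q) = lin_part k p \<oplus>\<^bsub>SR\<^esub> lin_part k q"
  by (simp add: lin_part_def sqz_simps self_module_simps poly_algebra_def monoid_algebra_simps)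
 show "lin_part k (p \<otimes>\<^bsub>PX\<^esub> q) = lin_part k p \<otimes>\<^bsub>SR\<^esub> lin_part k q"
  using pc qc by (simp add: lin_part_def sqz_simps self_module_simps poly_mult_formula[OF p q] s0 s1 m_comm)
next
 show "lin_part k \<one>\<^bsub>PX\<^esub> = \<one>\<^bsub>SR\<^esub>"
  by (simp add: lin_part_def sqz_simps self_module_simps poly_algebra_def monoid_algebra_simps mset_monoid_simps basis_elt_def)
qed

text \<open>The classifying map of the formal module with logarithm X + x_1 X^2 + x_2 X^3 + ... is
  reduced to dual numbers, where the logarithm is l = X + eps X^n. Writing the reduced law as X + Y
  + eps g gives l(F) = X + Y + eps (g + (X + Y)^n), and comparison with l(X) + l(Y) yields g. The
  equation l(rho(a)(X)) = a l(X) is used in the same way. Thus the inverse of l never has to be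
  expanded.\<close>

lemma lazard_hom_to_poly:
 obtains \<Phi> where "\<Phi> \<in> alg_hom R (lazard R) PX"
  "\<And>i j n. \<lbrakk>1 \<le> i; 1 \<le> j; 2 \<le> n\<rbrakk> \<Longrightarrow> lin_part (n - 1) (\<Phi> (universal_F R i j)) =
    (\<zero>, if i + j = n then \<ominus> (add_pow R (n choose i) \<one>) else \<zero>)"
  "\<And>a k n. \<lbrakk>a \<in> carrier R; 2 \<le> k; 2 \<le> n\<rbrakk> \<Longrightarrow> lin_part (n - 1) (\<Phi> (universal_rho R a k)) =
    (\<zero>, if k = n then a \<ominus> a [^] n else \<zero>)"
proof -
 interpret PC: cring PX by (rule algebra.M_cring[OF poly_algebra_algebra])
 interpret PXA: algebra R PX by (rule poly_algebra_algebra)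
 interpret SM: module R "self_module R" by (rule self_module_module)
 interpret SC: cring SR by (rule algebra.M_cring[OF SM.sqz_algebra])
 interpret PSS: cring "psa SR" by (rule SC.PSA_cring)
 interpret PSR: cring "psa R" by (rule PSA_cring)
 \<comment> \<open>The coefficient of X^k is the variable of index k - 1, in accordance with the
   degree 2 (k - 1) of the coefficients of X^k.\<close>
 define f where "f k = (if k = 0 then \<zero>\<^bsub>PX\<^esub> else if k = 1 then \<one>\<^bsub>PX\<^esub> else poly_var R (k - 1))" for k :: nat
 have fc: "f k \<in> carrier PX" for k
  using PC.one_closed PC.zero_closed poly_var_closed[of "k - 1" "{1..}"] by (auto simp: f_def simp del: One_nat_def)
 obtain F \<rho> where fm: "formal_module R PX F \<rho>"
  and lF: "ps_subst1 PX f (ps_subst2 PX F (ps_var PX 0) (ps_var PX 1)) =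
    ps_subst1 PX f (ps_var PX 0) \<oplus>\<^bsub>psa PX\<^esub> ps_subst1 PX f (ps_var PX 1)"
  and l\<rho>: "\<And>a. a \<in> carrier R \<Longrightarrow> ps_subst1 PX f (ps_subst1 PX (\<rho> a) (ps_var PX 0)) =
    (a \<odot>\<^bsub>PX\<^esub> \<one>\<^bsub>PX\<^esub>) \<odot>\<^bsub>psa PX\<^esub> ps_subst1 PX f (ps_var PX 0)"
  using formal_module_of_logarithm[OF poly_algebra_algebra, of f] fc by (auto simp: f_def)
 obtain \<Phi> where \<Phi>: "\<Phi> \<in> alg_hom R (lazard R) PX" "\<And>i j. \<Phi> (universal_F R i j) = F i j"
   "\<And>a i. a \<in> carrier R \<Longrightarrow> \<Phi> (universal_rho R a i) = \<rho> a i"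
  using lazard_classifies[OF poly_algebra_algebra fm] by blast
 have Fc: "F i j \<in> carrier PX" for i j using fm by (simp add: formal_module_def)
 have \<rho>c: "\<rho> a i \<in> carrier PX" if "a \<in> carrier R" for a i using fm that by (simp add: formal_module_def)
 have main: "(1 \<le> i \<longrightarrow> 1 \<le> j \<longrightarrow> lin_part (n - 1) (F i j) = (\<zero>, if i + j = n then \<ominus> (add_pow R (n choose i) \<one>) else \<zero>)) \<and>
   (a \<in> carrier R \<longrightarrow> 2 \<le> k \<longrightarrow> lin_part (n - 1) (\<rho> a k) = (\<zero>, if k = n then a \<ominus> a [^] n else \<zero>))"
   if n: "2 \<le> n" for n i j a k
 proof -
  let ?D = "lin_part (n - 1)"
  have D: "?D \<in> alg_hom R PX SR" by (rule lin_part_hom)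
  interpret D: ring_hom_cring PX SR ?D
   by (rule alg_hom_ring_hom_cring[OF poly_algebra_algebra SM.sqz_algebra D])
  define f' where "f' k = (if k = 1 then \<one>\<^bsub>SR\<^esub> else if k = n then (\<zero>, \<one>) else \<zero>\<^bsub>SR\<^esub>)" for k :: nat
  \<comment> \<open>Only the variable n - 1 survives the reduction, so the logarithm becomes X + eps
    X^n.\<close>
  have Df: "?D \<circ> f = f'"
   using n alg_homD(5)[OF D] D.hom_zero
   by (auto simp: f_def f'_def fun_eq_iff) (auto simp: lin_part_def poly_var_def basis_elt_def sqz_simps self_module_simps)
  have f'c: "f' k \<in> carrier SR" for k using D.hom_closed[OF fc[of k]] Df by (auto simp: fun_eq_iff)
  let ?x = "ps_var SR 0" and ?y = "ps_var SR 1"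
  note vO = SC.ps_var_ord
  have sub1: "ps_subst1 SR f' p m = (fst (p m), snd (p m) \<oplus> ((fst \<circ> p) [^]\<^bsub>psa R\<^esub> n) m)"
   if "p \<in> SC.ps_ord 1" for p m
  proof -
   have "fst \<circ> p \<in> ps_ord 1" using SM.sqz_ps(1)[OF that that] .
   then have "((fst \<circ> p) [^]\<^bsub>psa R\<^esub> n) m \<in> carrier R"
    using ps_ord_closed[OF ps_ord_pow] by (simp add: psa_simps(1))
   then show ?thesis using SM.sqz_subst1[OF that n, of \<one> m] by (simp add: f'_def[abs_def] self_module_simps)
  qed
  have vc: "ps_var PX v \<in> carrier (power_series_ring PX)" for v by (rule PC.ps_var_closed)
  have Dadd: "?D \<circ> (p \<oplus>\<^bsub>psa PX\<^esub> q) = (?D \<circ> p) \<oplus>\<^bsub>psa SR\<^esub> (?D \<circ> q)"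
   if "p \<in> carrier (power_series_ring PX)" "q \<in> carrier (power_series_ring PX)" for p q
   using that by (auto simp: fun_eq_iff psa_simps power_series_ring_simps)
  have Dsm: "?D \<circ> (b \<odot>\<^bsub>psa PX\<^esub> p) = ?D b \<odot>\<^bsub>psa SR\<^esub> (?D \<circ> p)"
   if "p \<in> carrier (power_series_ring PX)" "b \<in> carrier PX" for p b
   using that by (auto simp: fun_eq_iff psa_simps power_series_ring_simps)
  have fstx: "fst \<circ> ps_var SR v = ps_var R v" for v by (auto simp: ps_var_def sqz_simps fun_eq_iff)
  have fv: "fst (ps_var SR v m) = ps_var R v m" for v m using fun_cong[OF fstx, of v m] by simp
  have sndx: "snd (ps_var SR v m) = \<zero>" for v m by (auto simp: ps_var_def sqz_simps self_module_simps)
  have l1c: "ps_subst1 PX f (ps_var PX v) \<in> carrier (power_series_ring PX)" for v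
   by (rule PC.ps_subst1_closed[OF fc vc])
  have vpow: "(ps_var R v [^]\<^bsub>psa R\<^esub> n) m = (if m = replicate_mset n v then \<one> else \<zero>)" for v m
   using ps_var_pow2[of v "Suc v" n 0 m] PSR.nat_pow_closed[OF ps_ord_closed[OF ps_var_ord], of v n] by simp
  have \<open>?D (F i j) = (\<zero>, if i + j = n then \<ominus> (add_pow R (n choose i) \<one>) else \<zero>)\<close> if ij: "1 \<le> i" "1 \<le> j"
  proof -
   define F' where "F' i j = ?D (F i j)" for i j
   have F'c: "F' i j \<in> carrier SR" for i j unfolding F'_def by (rule D.hom_closed[OF Fc])
   define p where "p = ps_subst2 SR F' ?x ?y"
   have F'0: "F' 0 0 = \<zero>\<^bsub>SR\<^esub>" using fm D.hom_zero by (simp add: F'_def formal_module_def)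
   have pp: "p (mon i j) = F' i j" for i j
    unfolding p_def mon_def by (rule SC.ps_subst2_vars) (simp_all add: F'c)
   have pc: "p \<in> carrier (psa SR)"
   proof -
    have "p \<in> carrier (power_series_ring SR)"
     unfolding p_def by (rule SC.ps_subst2_closed[OF F'c SC.ps_var_closed SC.ps_var_closed])
    then show ?thesis by (simp add: psa_simps(1) power_series_ring_simps(1))
   qed
   have p: "p \<in> SC.ps_ord 1" using pc pp[of 0 0] F'0 by (auto simp: SC.ps_ord_def mon_def)
   have "?D \<circ> ps_subst2 PX F (ps_var PX 0) (ps_var PX 1) = p"
    using D.ps_subst2_nat[OF Fc vc vc] by (simp only: D.ps_var_nat F'_def[symmetric] p_def)
   then have "ps_subst1 SR f' p = ?D \<circ> ps_subst1 PX f (ps_subst2 PX F (ps_var PX 0) (ps_var PX 1))"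
    using D.ps_subst1_nat[OF fc PC.ps_subst2_closed[OF Fc vc vc]] by (simp only: Df)
   also have "\<dots> = ps_subst1 SR f' ?x \<oplus>\<^bsub>psa SR\<^esub> ps_subst1 SR f' ?y"
    unfolding lF Dadd[OF l1c l1c] D.ps_subst1_nat[OF fc vc] Df D.ps_var_nat ..
   finally have eq: "ps_subst1 SR f' p m = ps_subst1 SR f' ?x m \<oplus>\<^bsub>SR\<^esub> ps_subst1 SR f' ?y m" for m
    by (simp add: psa_simps(5))
   have fp: "fst (p m) = ps_var R 0 m \<oplus> ps_var R 1 m" for m
    using eq[of m] fun_cong[OF fstx, of 0 m] fun_cong[OF fstx, of 1 m] by (simp add: sub1[OF p] sub1[OF vO] sqz_simps)
   then have fp': "fst \<circ> p = ps_var R 0 \<oplus>\<^bsub>PSA\<^esub> ps_var R 1" by (auto simp: fun_eq_iff psa_simps)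
   let ?m = "mon i j"
   have ne: "?m \<noteq> replicate_mset n 0" "?m \<noteq> replicate_mset n 1" "?m \<noteq> {#0#}" "?m \<noteq> {#1#}"
    using ij mon_eq_iff[of i j n 0] mon_eq_iff[of i j 0 n] mon_eq_iff[of i j 1 0] mon_eq_iff[of i j 0 1]
    by (auto simp: mon_def One_nat_def)
   \<comment> \<open>The right side l(X) + l(Y) has no mixed monomials, so the infinitesimal part of
     F there is minus the coefficient of (X + Y)^n.\<close>
   have "snd (p ?m) \<oplus> ((ps_var R 0 \<oplus>\<^bsub>PSA\<^esub> ps_var R 1) [^]\<^bsub>PSA\<^esub> n) ?m = \<zero>"
    using eq[of ?m] ne unfolding sub1[OF p] sub1[OF vO] fp' fstx vpow sndx by (simp add: sqz_simps self_module_simps)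
   moreover have "snd (p ?m) \<in> carrier R"
    using pc by (auto simp: psa_simps(1) sqz_simps self_module_simps mem_Times_iff)
   moreover have "((ps_var R 0 \<oplus>\<^bsub>PSA\<^esub> ps_var R 1) [^]\<^bsub>PSA\<^esub> n) ?m = (if i + j = n then add_pow R (n choose i) \<one> else \<zero>)"
   proof -
    have "set_mset ?m \<subseteq> {0, 1}" by (auto simp: mon_def split: if_splits)
    then show ?thesis using ps_binomial[of 0 1 n ?m] by (simp add: count_mon)
   qed
   ultimately have "snd (p ?m) = (if i + j = n then \<ominus> (add_pow R (n choose i) \<one>) else \<zero>)"
    by (auto intro: minus_equality[symmetric] split: if_splits)
   moreover have "fst (p ?m) = \<zero>" unfolding fp using ne by (simp add: ps_var_def)
   ultimately show ?thesis using pp[of i j] unfolding F'_def by (metis prod.collapse)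
  qed
  moreover have "?D (\<rho> a k) = (\<zero>, if k = n then a \<ominus> a [^] n else \<zero>)" if a: "a \<in> carrier R" and k: "2 \<le> k"
  proof -
   define r where "r i = ?D (\<rho> a i)" for i
   have rc: "r i \<in> carrier SR" for i unfolding r_def by (rule D.hom_closed[OF \<rho>c[OF a]])
   define p where "p = ps_subst1 SR r ?x"
   have pp: "p (mon i 0) = r i" for i unfolding p_def by (rule SC.ps_subst1_var[OF rc])
   have r0: "r 0 = \<zero>\<^bsub>SR\<^esub>" using fm a D.hom_zero by (simp add: r_def formal_module_def)
   have p: "p \<in> SC.ps_ord 1" unfolding p_def by (rule SC.ps_subst1_ord[of r, OF rc r0 vO])
   have "?D \<circ> ps_subst1 PX (\<rho> a) (ps_var PX 0) = p"
   proof -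
    have "?D \<circ> \<rho> a = r" by (auto simp: r_def)
    then show ?thesis unfolding D.ps_subst1_nat[OF \<rho>c[OF a] vc] D.ps_var_nat p_def by (simp only:)
   qed
   then have "ps_subst1 SR f' p = ?D \<circ> ps_subst1 PX f (ps_subst1 PX (\<rho> a) (ps_var PX 0))"
    using D.ps_subst1_nat[OF fc PC.ps_subst1_closed[OF \<rho>c[OF a] vc]] by (simp only: Df)
   also have "\<dots> = ?D (a \<odot>\<^bsub>PX\<^esub> \<one>\<^bsub>PX\<^esub>) \<odot>\<^bsub>psa SR\<^esub> ps_subst1 SR f' ?x"
    unfolding l\<rho>[OF a] using a by (simp add: Dsm[OF l1c] D.ps_subst1_nat[OF fc vc] Df D.ps_var_nat)
   also have "?D (a \<odot>\<^bsub>PX\<^esub> \<one>\<^bsub>PX\<^esub>) = (a, \<zero>)"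
    using a by (simp add: alg_homD(3)[OF D] alg_homD(5)[OF D] sqz_simps self_module_simps)
   finally have eq: "ps_subst1 SR f' p m = (a, \<zero>) \<otimes>\<^bsub>SR\<^esub> ps_subst1 SR f' ?x m" for m
    by (simp add: psa_simps(6))
   have vR: "ps_var R 0 m \<in> carrier R" for m by (simp add: ps_var_def)
   have fp: "fst (p m) = a \<otimes> ps_var R 0 m" for m
    using eq[of m] fun_cong[OF fstx, of 0 m] by (simp add: sub1[OF p] sub1[OF vO] sqz_simps)
   then have fp': "fst \<circ> p = a \<odot>\<^bsub>PSA\<^esub> ps_var R 0" by (auto simp: fun_eq_iff psa_simps)
   let ?m = "mon k 0"
   have ne: "?m \<noteq> {#0#}" "?m = replicate_mset n 0 \<longleftrightarrow> k = n"
    using k mon_eq_iff[of k 0 1 0] mon_eq_iff[of k 0 n 0] by (auto simp: mon_def One_nat_def)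
   have c: "snd (p ?m) \<in> carrier R"
    using SC.ps_ord_closed[OF p] by (auto simp: psa_simps(1) sqz_simps self_module_simps mem_Times_iff)
   have e1: "((a \<odot>\<^bsub>PSA\<^esub> ps_var R 0) [^]\<^bsub>PSA\<^esub> n) ?m = (if k = n then a [^] n else \<zero>)"
    unfolding ps_smult_pow[OF a ps_ord_closed[OF ps_var_ord]] using ne a by (simp add: psa_simps(6) vpow)
   have e2: "snd (p ?m) \<oplus> ((a \<odot>\<^bsub>PSA\<^esub> ps_var R 0) [^]\<^bsub>PSA\<^esub> n) ?m = (if k = n then a else \<zero>)"
    using eq[of ?m] ne a vR unfolding sub1[OF p] sub1[OF vO] fp' fstx vpow sndx
    by (auto simp: fv sqz_simps self_module_simps split: if_splits)
   have "snd (p ?m) = (if k = n then a \<ominus> a [^] n else \<zero>)"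
   proof (cases "k = n")
    case True
    have "(snd (p ?m) \<oplus> a [^] n) \<ominus> a [^] n = snd (p ?m)"
     using c a by (simp add: a_minus_def a_assoc r_neg)
    then show ?thesis using e2 unfolding e1 using True by simp
   next
    case False
    then show ?thesis using e2 c unfolding e1 by simp
   qed
   moreover have "fst (p ?m) = \<zero>" unfolding fp using ne a by (simp add: ps_var_def)
   ultimately show ?thesis using pp[of k] unfolding r_def by (metis prod.collapse)
  qed
  ultimately show ?thesis by blast
 qed
 show ?thesis
  by (rule that[OF \<Phi>(1)]) (use main \<Phi> in auto)
qed

end

section \<open>Gradings\<close>

text \<open>Only what is needed of a grading: independence of the summands is not required.\<close>

definition graded_by :: "('a, 'm) ring_scheme \<Rightarrow> ('a, 'b, 'p) module_scheme \<Rightarrow> (nat \<Rightarrow> 'b set) \<Rightarrow> bool" where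
 "graded_by A B K \<longleftrightarrow> (\<forall>d. submodule (K d) A B) \<and> \<one>\<^bsub>B\<^esub> \<in> K 0 \<and>
   (\<forall>d e. \<forall>x\<in>K d. \<forall>y\<in>K e. x \<otimes>\<^bsub>B\<^esub> y \<in> K (d + e))"

lemma graded_byD:
 assumes "graded_by A B K"
 shows "submodule (K d) A B" "\<one>\<^bsub>B\<^esub> \<in> K 0" "x \<in> K d \<Longrightarrow> y \<in> K e \<Longrightarrow> x \<otimes>\<^bsub>B\<^esub> y \<in> K (d + e)"
 using assms by (auto simp: graded_by_def)

context cring
begin

definition homog :: "'v set \<Rightarrow> ('v \<Rightarrow> nat) \<Rightarrow> nat \<Rightarrow> ('v multiset \<Rightarrow> 'a) set" where
 "homog V dg d = {p \<in> carrier (poly_algebra R V). \<forall>m. p m \<noteq> \<zero> \<longrightarrow> (\<Sum>v\<in>#m. dg v) = d}"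

lemma carrier_poly: "p \<in> carrier (poly_algebra R V) \<longleftrightarrow>
  (\<forall>s. p s \<in> carrier R) \<and> (\<forall>s. \<not> set_mset s \<subseteq> V \<longrightarrow> p s = \<zero>) \<and> finite {s. p s \<noteq> \<zero>}"
 by (simp add: poly_algebra_def monoid_algebra_simps carrier_free_module mset_monoid_simps)

lemma poly_simps:
 "\<zero>\<^bsub>poly_algebra R V\<^esub> = (\<lambda>s. \<zero>)" "\<one>\<^bsub>poly_algebra R V\<^esub> = basis_elt R {#}"
 "p \<oplus>\<^bsub>poly_algebra R V\<^esub> q = (\<lambda>s. p s \<oplus> q s)" "a \<odot>\<^bsub>poly_algebra R V\<^esub> p = (\<lambda>s. a \<otimes> p s)"
 by (simp_all add: poly_algebra_def monoid_algebra_simps mset_monoid_simps)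

lemma homog_closed: "p \<in> homog V dg d \<Longrightarrow> p \<in> carrier (poly_algebra R V)"
 by (simp add: homog_def)

lemma homog_basis:
 "set_mset m \<subseteq> V \<Longrightarrow> (\<Sum>v\<in>#m. dg v) = d \<Longrightarrow> basis_elt R m \<in> homog V dg d"
 by (auto simp: homog_def carrier_poly basis_elt_def)

lemma basis_poly_closed: "set_mset m \<subseteq> V \<Longrightarrow> basis_elt R m \<in> carrier (poly_algebra R V)"
 by (auto simp: carrier_poly basis_elt_def)

lemma basis_poly_mult: "set_mset m \<subseteq> V \<Longrightarrow> set_mset m' \<subseteq> V \<Longrightarrow>
  basis_elt R m \<otimes>\<^bsub>poly_algebra R V\<^esub> basis_elt R m' = basis_elt R (m + m')"
 using mon_alg.mult_basis[OF mon_alg_mset[of V], of m m'] by (simp add: poly_algebra_def mset_monoid_simps)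

lemma homog_submodule: "submodule (homog V dg d) R (poly_algebra R V)"
proof -
 interpret PA: algebra R "poly_algebra R V" by (rule poly_algebra_algebra)
 show ?thesis
 proof (rule PA.submoduleI')
  show "homog V dg d \<subseteq> carrier (poly_algebra R V)" by (auto simp: homog_def)
  show "\<zero>\<^bsub>poly_algebra R V\<^esub> \<in> homog V dg d" by (simp add: homog_def) (simp add: poly_simps)
  fix x y assume "x \<in> homog V dg d" "y \<in> homog V dg d"
  then have c: "x \<in> carrier (poly_algebra R V)" "y \<in> carrier (poly_algebra R V)"
   and z: "\<And>m. (\<Sum>v\<in>#m. dg v) \<noteq> d \<Longrightarrow> x m = \<zero>" "\<And>m. (\<Sum>v\<in>#m. dg v) \<noteq> d \<Longrightarrow> y m = \<zero>" by (auto simp: homog_def)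
  have "(x \<oplus>\<^bsub>poly_algebra R V\<^esub> y) m = \<zero>" if "(\<Sum>v\<in>#m. dg v) \<noteq> d" for m using z[OF that] by (simp add: poly_simps)
  then show "x \<oplus>\<^bsub>poly_algebra R V\<^esub> y \<in> homog V dg d" using c PA.M.a_closed by (auto simp: homog_def)
 next
  fix a x assume a: "a \<in> carrier R" and "x \<in> homog V dg d"
  then have c: "x \<in> carrier (poly_algebra R V)"
   and z: "\<And>m. (\<Sum>v\<in>#m. dg v) \<noteq> d \<Longrightarrow> x m = \<zero>" by (auto simp: homog_def)
  have "(a \<odot>\<^bsub>poly_algebra R V\<^esub> x) m = \<zero>" if "(\<Sum>v\<in>#m. dg v) \<noteq> d" for m using z[OF that] a by (simp add: poly_simps)
  then show "a \<odot>\<^bsub>poly_algebra R V\<^esub> x \<in> homog V dg d" using c a PA.smult_closed by (auto simp: homog_def)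
 qed
qed

lemma homog_mult:
 assumes p: "p \<in> homog V dg d" and q: "q \<in> homog V dg e"
 shows "p \<otimes>\<^bsub>poly_algebra R V\<^esub> q \<in> homog V dg (d + e)"
proof -
 interpret PC: cring "poly_algebra R V" by (rule algebra.M_cring[OF poly_algebra_algebra])
 note c = homog_closed[OF p] homog_closed[OF q]
 have "(p \<otimes>\<^bsub>poly_algebra R V\<^esub> q) m = \<zero>" if m: "(\<Sum>v\<in>#m. dg v) \<noteq> d + e" for m
 proof -
  have z: "p k \<otimes> q (m - k) = \<zero>" if k: "k \<subseteq># m" for k
  proof -
   have "(\<Sum>v\<in>#m. dg v) = (\<Sum>v\<in>#k. dg v) + (\<Sum>v\<in>#m - k. dg v)"
    by (metis image_mset_union k subset_mset.add_diff_inverse sum_mset.union)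
   then have "(\<Sum>v\<in>#k. dg v) \<noteq> d \<or> (\<Sum>v\<in>#m - k. dg v) \<noteq> e" using m by auto
   then have "p k = \<zero> \<or> q (m - k) = \<zero>" using p q by (auto simp: homog_def)
   then show ?thesis using c by (auto simp: carrier_poly)
  qed
  have "(p \<otimes>\<^bsub>poly_algebra R V\<^esub> q) m = (\<Oplus>k\<in>{k. k \<subseteq># m}. \<zero>)"
   unfolding poly_mult_formula[OF c] using z by (intro add.finprod_cong') auto
  then show ?thesis by simp
 qed
 then show ?thesis using c PC.m_closed by (auto simp: homog_def)
qed

lemma homog_graded: "graded_by R (poly_algebra R V) (homog V dg)"
 unfolding graded_by_def using homog_submodule homog_mult homog_basis[of "{#}" V dg 0] by (auto simp: poly_simps)

lemma homog_induct [consumes 1, case_names zero basis]: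
 assumes p: "p \<in> homog V dg d" and "Q \<zero>\<^bsub>poly_algebra R V\<^esub>"
  and "\<And>a m p. \<lbrakk>a \<in> carrier R; set_mset m \<subseteq> V; (\<Sum>v\<in>#m. dg v) = d; p \<in> homog V dg d; Q p\<rbrakk> \<Longrightarrow>
    Q (a \<odot>\<^bsub>poly_algebra R V\<^esub> basis_elt R m \<oplus>\<^bsub>poly_algebra R V\<^esub> p)"
 shows "Q p"
proof -
 have e: "x \<in> carrier (free_module R {m. set_mset m \<subseteq> V \<and> (\<Sum>v\<in>#m. dg v) = d}) \<longleftrightarrow> x \<in> homog V dg d" for x
  by (auto simp: carrier_free_module homog_def carrier_poly)
 have "p \<in> carrier (free_module R {m. set_mset m \<subseteq> V \<and> (\<Sum>v\<in>#m. dg v) = d})" using p by (simp only: e)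
 then show ?thesis
  by (induction rule: free_module_induct) (use assms(2,3) in \<open>auto simp: poly_simps e\<close>)
qed

lemma poly_homog_span:
 assumes "submodule H R (poly_algebra R V)" "\<And>d. homog V dg d \<subseteq> H"
 shows "carrier (poly_algebra R V) \<subseteq> H"
proof
 interpret PA: algebra R "poly_algebra R V" by (rule poly_algebra_algebra)
 note H = PA.submoduleD[OF assms(1)]
 fix p assume "p \<in> carrier (poly_algebra R V)"
 then have "p \<in> carrier (free_module R {m. set_mset m \<subseteq> V})"
  by (auto simp: carrier_free_module carrier_poly)
 then show "p \<in> H"
 proof (induction rule: free_module_induct)
  case zero
  then show ?case using H(2) by (simp add: poly_simps)
 next
  case (basis a m p)
  have "basis_elt R m \<in> H" using basis assms(2)[of "\<Sum>v\<in>#m. dg v"] homog_basis[of m V dg] by auto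
  then show ?case using basis H(3)[OF H(6)] by (simp add: poly_simps)
 qed
qed

text \<open>Two infinitesimal factors multiply to zero. A homomorphism that makes all generators
  infinitesimal therefore kills every monomial of length at least two; below, this is how
  decomposables are made to vanish.\<close>

lemma sqz_hom_monomial:
 assumes M: "module R M" and h: "h \<in> alg_hom R (poly_algebra R V) (sqz R M)"
  and v: "\<And>v. v \<in> V \<Longrightarrow> fst (h (poly_var R v)) = \<zero>" and m: "set_mset m \<subseteq> V"
 shows "1 \<le> size m \<Longrightarrow> fst (h (basis_elt R m)) = \<zero>"
  and "2 \<le> size m \<Longrightarrow> h (basis_elt R m) = (\<zero>, \<zero>\<^bsub>M\<^esub>)"
proof -
 interpret M: module R M by (rule M)
 have hc: "h x \<in> carrier R \<times> carrier M" if "x \<in> carrier (poly_algebra R V)" for x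
  using alg_homD(1)[OF h that] by (simp add: sqz_simps)
 have add: "h (basis_elt R (add_mset v m)) = h (poly_var R v) \<otimes>\<^bsub>sqz R M\<^esub> h (basis_elt R m)"
  if "v \<in> V" "set_mset m \<subseteq> V" for v m
  using that basis_poly_mult[of "{#v#}" V m] alg_homD(4)[OF h, of "basis_elt R {#v#}" "basis_elt R m"]
  by (simp add: poly_var_def basis_poly_closed)
 have 1: "fst (h (basis_elt R m)) = \<zero>" if m: "1 \<le> size m" "set_mset m \<subseteq> V" for m
 proof -
  obtain w m' where "m = add_mset w m'" using m by (cases m) (auto simp: One_nat_def)
  then show ?thesis using m v[of w] hc[OF basis_poly_closed, of m'] by (auto simp: add sqz_simps)
 qed
 then show "1 \<le> size m \<Longrightarrow> fst (h (basis_elt R m)) = \<zero>" using m by blast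
 assume s: "2 \<le> size m"
 then obtain w m' where mm: "m = add_mset w m'" by (cases m) auto
 then have m': "1 \<le> size m'" "set_mset m' \<subseteq> V" "w \<in> V" using s m by (auto simp: One_nat_def)
 have "snd (h (poly_var R w)) \<in> carrier M" "snd (h (basis_elt R m')) \<in> carrier M"
  using hc[OF poly_var_closed[OF m'(3)]] hc[OF basis_poly_closed[OF m'(2)]] by auto
 then show "h (basis_elt R m) = (\<zero>, \<zero>\<^bsub>M\<^esub>)"
  using 1[OF m'(1,2)] v[OF m'(3)] unfolding mm by (simp add: add m' sqz_simps)
qed

section \<open>The grading of the classifying algebra\<close>

abbreviation "LZ \<equiv> lazard R"
abbreviation "LH \<equiv> homog (lazard_gens R) lazard_gen_degree"

lemma lazard_degree_eq: "lazard_degree R d = lazard_class R ` LH d"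
 by (auto simp: lazard_degree_def homog_def lazard_poly_algebra_def)

lemma lazard_graded: "graded_by R LZ (lazard_degree R)"
proof -
 interpret LPA: algebra R LP by (rule LP_algebra)
 interpret LA: algebra R LZ by (rule lazard_algebra)
 note h = alg_homD[OF lazard_class_hom]
 note g = graded_byD[OF homog_graded[of "lazard_gens R" lazard_gen_degree], folded lazard_poly_algebra_def]
 have c: "p \<in> LH d \<Longrightarrow> p \<in> carrier LP" for p d by (simp add: homog_def lazard_poly_algebra_def)
 show ?thesis
  unfolding graded_by_def lazard_degree_eq
 proof (intro conjI allI ballI)
  show "submodule (lazard_class R ` LH d) R LZ" for d
   by (rule LA.submodule_image[OF LPA.module_axioms alg_mod_hom[OF lazard_class_hom] g(1)])
  show "\<one>\<^bsub>LZ\<^esub> \<in> lazard_class R ` LH 0" using g(2) h(5) by (metis imageI)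
  fix d e x y assume "x \<in> lazard_class R ` LH d" "y \<in> lazard_class R ` LH e"
  then obtain p q where "p \<in> LH d" "q \<in> LH e" "x = lazard_class R p" "y = lazard_class R q" by blast
  then show "x \<otimes>\<^bsub>LZ\<^esub> y \<in> lazard_class R ` LH (d + e)"
   using h(4)[of p q] c g(3)[of p d q e] by (metis imageI)
 qed
qed

lemma lazard_degree_closed: "x \<in> lazard_degree R d \<Longrightarrow> x \<in> carrier LZ"
 using graded_byD(1)[OF lazard_graded, of d] module.submoduleD(1)[OF algebra.module[OF lazard_algebra]] by blast

lemma lazard_cases:
 assumes "x \<in> carrier LZ"
 obtains p where "p \<in> carrier LP" "x = lazard_class R p"
proof -
 interpret LPA: algebra R LP by (rule LP_algebra)
 have "submodule (lazard_ideal R) R LP"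
 proof (rule LPA.submoduleI')
  interpret I: ideal "lazard_ideal R" LP by (rule lazard_ideal_ideal)
  show "lazard_ideal R \<subseteq> carrier LP" "\<zero>\<^bsub>LP\<^esub> \<in> lazard_ideal R" using I.a_subset by auto
  show "x \<oplus>\<^bsub>LP\<^esub> y \<in> lazard_ideal R" if "x \<in> lazard_ideal R" "y \<in> lazard_ideal R" for x y using that by simp
  show "a \<odot>\<^bsub>LP\<^esub> x \<in> lazard_ideal R" if "a \<in> carrier R" "x \<in> lazard_ideal R" for a x
  proof -
   have c: "x \<in> carrier LP" using that I.a_subset by blast
   interpret LPC: cring LP by (rule algebra.M_cring[OF LP_algebra])
   have o: "\<one>\<^bsub>LP\<^esub> \<in> carrier LP" by (rule cring.cring_simprules(6)[OF algebra.M_cring[OF LP_algebra]])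
   have "a \<odot>\<^bsub>LP\<^esub> x = (a \<odot>\<^bsub>LP\<^esub> \<one>\<^bsub>LP\<^esub>) \<otimes>\<^bsub>LP\<^esub> x"
    using LPA.smult_assoc2[OF that(1) o c] cring.cring_simprules(12)[OF algebra.M_cring[OF LP_algebra] c] by simp
   then show ?thesis using I.I_l_closed[OF that(2), of "a \<odot>\<^bsub>LP\<^esub> \<one>\<^bsub>LP\<^esub>"] that(1) o by simp
  qed
 qed
 then interpret Q: module_quotient R LP "lazard_ideal R"
  by (intro module_quotient.intro LPA.module_axioms module_quotient_axioms.intro)
 show ?thesis using Q.proj_cases[of x] assms that unfolding lazard_def lazard_class_def by metis
qed

lemma lazard_homog_span:
 assumes H: "submodule H R LZ" and "\<And>d. lazard_degree R d \<subseteq> H" and x: "x \<in> carrier LZ"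
 shows "x \<in> H"
proof -
 interpret LPA: algebra R LP by (rule LP_algebra)
 obtain p where p: "p \<in> carrier LP" "x = lazard_class R p" using x by (rule lazard_cases)
 have "carrier LP \<subseteq> {p \<in> carrier LP. lazard_class R p \<in> H}"
  unfolding lazard_poly_algebra_def
 proof (rule poly_homog_span[of _ _ lazard_gen_degree], fold lazard_poly_algebra_def)
  show "submodule {p \<in> carrier LP. lazard_class R p \<in> H} R LP"
   by (rule LPA.submodule_vimage[OF algebra.module[OF lazard_algebra] alg_mod_hom[OF lazard_class_hom] H])
  show "LH d \<subseteq> {p \<in> carrier LP. lazard_class R p \<in> H}" for d
   using assms(2)[of d] homog_closed[of _ "lazard_gens R" lazard_gen_degree d]
   by (auto simp: lazard_degree_eq lazard_poly_algebra_def)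
 qed
 then show ?thesis using p by blast
qed

lemma lazard_gen_degree_pos:
 "v \<in> lazard_gens R \<Longrightarrow> 2 \<le> lazard_gen_degree v" "even (lazard_gen_degree v)"
 by (auto simp: lazard_gens_def) (cases v; simp)

lemma monomial_degree:
 assumes "set_mset m \<subseteq> lazard_gens R"
 shows "even (\<Sum>v\<in>#m. lazard_gen_degree v)" "2 * size m \<le> (\<Sum>v\<in>#m. lazard_gen_degree v)"
 using assms
proof (induction m)
 case (add v m)
 { case 1 then show ?case using add lazard_gen_degree_pos[of v] by auto }
 { case 2 then show ?case using add lazard_gen_degree_pos[of v] by auto }
qed auto

text \<open>All generators have positive even degree, so the only monomial that can occur is the
  empty one. This is the start of inductions on the degree.\<close>

lemma lazard_degree_0_odd:
 assumes H: "submodule H R LZ" "d = 0 \<Longrightarrow> \<one>\<^bsub>LZ\<^esub> \<in> H" and d: "d = 0 \<or> odd d"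
 shows "lazard_degree R d \<subseteq> H"
proof -
 interpret LPA: algebra R LP by (rule LP_algebra)
 interpret LA: algebra R LZ by (rule lazard_algebra)
 note h = alg_homD[OF lazard_class_hom]
 note H' = LA.submoduleD[OF H(1)]
 have "lazard_class R p \<in> H" if "p \<in> LH d" for p
  using that
 proof (induction rule: homog_induct)
  case zero
  then show ?case using mod_hom_zero[OF LPA.module_axioms LA.module_axioms alg_mod_hom[OF lazard_class_hom]] H'
   by (simp add: lazard_poly_algebra_def)
 next
  case (basis a m p)
  have "m = {#}" using d monomial_degree[OF basis(2)] basis(3) by auto
  then have "d = 0" "basis_elt R m = \<one>\<^bsub>LP\<^esub>" using basis(3) by (simp_all add: lazard_poly_algebra_def poly_simps)
  moreover have "p \<in> carrier LP" "\<one>\<^bsub>LP\<^esub> \<in> carrier LP"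
   using homog_closed[OF basis(4)] cring.cring_simprules(6)[OF algebra.M_cring[OF LP_algebra]]
   by (simp_all add: lazard_poly_algebra_def)
  ultimately show ?case unfolding lazard_poly_algebra_def[symmetric] using basis H' H(2) by (simp add: h)
 qed
 then show ?thesis by (auto simp: lazard_degree_eq)
qed

section \<open>Homogeneity of the relations\<close>

text \<open>Homogeneity of degree -2 w when the variables of the series have degree -2: the
  coefficient at a monomial of size s has degree 2 (s - w). The case distinction replaces negative
  degrees by vanishing. Single variables have weight 1.\<close>

definition ps_weight :: "nat \<Rightarrow> (nat multiset \<Rightarrow> 'a lazard_poly) set" where
 "ps_weight w = {p. \<forall>m. if size m < w then p m = \<zero>\<^bsub>LP\<^esub> else p m \<in> LH (2 * (size m - w))}"

lemma LH_LP: "submodule (LH d) R LP" "p \<in> LH d \<Longrightarrow> q \<in> LH e \<Longrightarrow> p \<otimes>\<^bsub>LP\<^esub> q \<in> LH (d + e)"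
 using homog_submodule homog_mult by (auto simp: lazard_poly_algebra_def)

lemma LH_closed: "p \<in> LH d \<Longrightarrow> p \<in> carrier LP"
 by (simp add: homog_def lazard_poly_algebra_def)

lemma ps_weight_closed:
 assumes "p \<in> ps_weight w"
 shows "p m \<in> carrier LP"
proof -
 interpret LPA: algebra R LP by (rule LP_algebra)
 have "if size m < w then p m = \<zero>\<^bsub>LP\<^esub> else p m \<in> LH (2 * (size m - w))"
  using assms unfolding ps_weight_def by blast
 then show ?thesis using LH_closed LPA.M.zero_closed by (auto split: if_splits)
qed

lemma ps_weight_mult:
 assumes p: "p \<in> ps_weight i" and q: "q \<in> ps_weight j"
 shows "p \<otimes>\<^bsub>power_series_ring LP\<^esub> q \<in> ps_weight (i + j)"
proof -
 interpret LPC: cring LP by (rule algebra.M_cring[OF LP_algebra])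
 interpret LPA: algebra R LP by (rule LP_algebra)
 note cl = ps_weight_closed[OF p] ps_weight_closed[OF q]
 have t: "(if size m < i + j then p k \<otimes>\<^bsub>LP\<^esub> q (m - k) = \<zero>\<^bsub>LP\<^esub> else p k \<otimes>\<^bsub>LP\<^esub> q (m - k) \<in> LH (2 * (size m - (i + j))))"
  if k: "k \<subseteq># m" for k m
 proof (cases "size k < i \<or> size (m - k) < j")
  case True
  then have "p k \<otimes>\<^bsub>LP\<^esub> q (m - k) = \<zero>\<^bsub>LP\<^esub>"
   using p q cl by (auto simp: ps_weight_def)
  then show ?thesis using LPA.submoduleD(2)[OF LH_LP(1)] by simp
 next
  case False
  have s: "size m = size k + size (m - k)" using k by (metis size_union subset_mset.add_diff_inverse)
  have "p k \<in> LH (2 * (size k - i))" "q (m - k) \<in> LH (2 * (size (m - k) - j))"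
   using p q False by (auto simp: ps_weight_def)
  from LH_LP(2)[OF this] have "p k \<otimes>\<^bsub>LP\<^esub> q (m - k) \<in> LH (2 * (size m - (i + j)))"
   using False s by (simp add: algebra_simps)
  then show ?thesis using False s by auto
 qed
 have "if size m < i + j then (p \<otimes>\<^bsub>power_series_ring LP\<^esub> q) m = \<zero>\<^bsub>LP\<^esub>
   else (p \<otimes>\<^bsub>power_series_ring LP\<^esub> q) m \<in> LH (2 * (size m - (i + j)))" for m
 proof (cases "size m < i + j")
  case True
  have "(p \<otimes>\<^bsub>power_series_ring LP\<^esub> q) m = (\<Oplus>\<^bsub>LP\<^esub>k\<in>{k. k \<subseteq># m}. \<zero>\<^bsub>LP\<^esub>)"
   unfolding power_series_ring_simps using t[of _ m] True by (intro LPC.add.finprod_cong') auto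
  then show ?thesis using True by simp
 next
  case False
  then show ?thesis unfolding power_series_ring_simps
   using t[of _ m] by (auto intro!: LPA.submodule_finsum[OF LH_LP(1)])
 qed
 then show ?thesis by (simp add: ps_weight_def)
qed

lemma ps_weight_pow:
 assumes "p \<in> ps_weight 1"
 shows "p [^]\<^bsub>power_series_ring LP\<^esub> (k::nat) \<in> ps_weight k"
proof (induction k)
 case 0
 have "\<one>\<^bsub>LP\<^esub> \<in> LH 0" using graded_byD(2)[OF homog_graded] by (simp add: lazard_poly_algebra_def)
 then show ?case using module.submoduleD(2)[OF algebra.module[OF LP_algebra] LH_LP(1)]
  by (auto simp: pow_power_series power_series_ring_simps ps_weight_def)
next
 case (Suc k)
 then show ?case unfolding pow_power_series(2) using ps_weight_mult[OF Suc assms] by (simp add: One_nat_def)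
qed

lemma ps_weight_var: "ps_var LP v \<in> ps_weight 1"
proof -
 have "\<one>\<^bsub>LP\<^esub> \<in> LH 0" using graded_byD(2)[OF homog_graded] by (simp add: lazard_poly_algebra_def)
 then show ?thesis using module.submoduleD(2)[OF algebra.module[OF LP_algebra] LH_LP(1)]
  by (auto simp: ps_weight_def ps_var_def)
qed

lemma generic_F_homog: "1 \<le> i + j \<Longrightarrow> generic_F R i j \<in> LH (2 * (i + j - 1))" "generic_F R 0 0 = \<zero>\<^bsub>LP\<^esub>"
proof -
 have o: "\<one>\<^bsub>LP\<^esub> \<in> LH 0" using graded_byD(2)[OF homog_graded] by (simp add: lazard_poly_algebra_def)
 note z = module.submoduleD(2)[OF algebra.module[OF LP_algebra] LH_LP(1)]
 show "generic_F R 0 0 = \<zero>\<^bsub>LP\<^esub>" by (simp add: generic_F_def)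
 assume ij: "1 \<le> i + j"
 show "generic_F R i j \<in> LH (2 * (i + j - 1))"
 proof (cases "i \<ge> 1 \<and> j \<ge> 1")
  case True
  then have "basis_elt R {#FCoeff i j#} \<in> LH (2 * (i + j - 1))"
   by (intro homog_basis) (auto simp: lazard_gens_def)
  then show ?thesis using True by (simp add: generic_F_def poly_var_def)
 next
  case False
  then show ?thesis using o z by (auto simp: generic_F_def)
 qed
qed

text \<open>The coefficient at X^i Y^j has degree 2 (i + j - 1), and p^i q^j has weight i + j. At a
  monomial of size s this gives 2 (i + j - 1) + 2 (s - (i + j)) = 2 (s - 1), independently of i and
  j. By iteration both sides of commutativity and of associativity are homogeneous.\<close>

lemma ps_weight_subst2:
 assumes p: "p \<in> ps_weight 1" and q: "q \<in> ps_weight 1"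
 shows "ps_subst2 LP (generic_F R) p q \<in> ps_weight 1"
proof -
 interpret LPC: cring LP by (rule algebra.M_cring[OF LP_algebra])
 interpret LPA: algebra R LP by (rule LP_algebra)
 let ?t = "\<lambda>z m. generic_F R (fst z) (snd z) \<otimes>\<^bsub>LP\<^esub>
    (p [^]\<^bsub>power_series_ring LP\<^esub> fst z \<otimes>\<^bsub>power_series_ring LP\<^esub> q [^]\<^bsub>power_series_ring LP\<^esub> snd z) m"
 have w: "p [^]\<^bsub>power_series_ring LP\<^esub> i \<otimes>\<^bsub>power_series_ring LP\<^esub> q [^]\<^bsub>power_series_ring LP\<^esub> j \<in> ps_weight (i + j)" for i j :: nat
  by (intro ps_weight_mult ps_weight_pow p q)
 have t: "if size m < 1 then ?t z m = \<zero>\<^bsub>LP\<^esub> else ?t z m \<in> LH (2 * (size m - 1))" for z m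
 proof -
  obtain i j where z: "z = (i, j)" by (cases z)
  let ?u = "(p [^]\<^bsub>power_series_ring LP\<^esub> i \<otimes>\<^bsub>power_series_ring LP\<^esub> q [^]\<^bsub>power_series_ring LP\<^esub> j) m"
  have uc: "?u \<in> carrier LP" by (rule ps_weight_closed[OF w])
  consider "i = 0 \<and> j = 0" | "size m < i + j" | "1 \<le> i + j" "i + j \<le> size m" by linarith
  then show ?thesis
  proof cases
   case 1
   then have e: "?t z m = \<zero>\<^bsub>LP\<^esub>" using z uc generic_F_homog(2) by simp
   show ?thesis unfolding e using LPA.submoduleD(2)[OF LH_LP(1)] by auto
  next
   case 2
   then have "?u = \<zero>\<^bsub>LP\<^esub>" using w[of i j] by (auto simp: ps_weight_def)
   then have e: "?t z m = \<zero>\<^bsub>LP\<^esub>" using z generic_closed(1) by simp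
   show ?thesis unfolding e using LPA.submoduleD(2)[OF LH_LP(1)] by auto
  next
   case 3
   then have "?u \<in> LH (2 * (size m - (i + j)))" using w[of i j] unfolding ps_weight_def by (auto simp: not_less split: if_splits)
   from LH_LP(2)[OF generic_F_homog(1)[OF 3(1)] this] have "?t z m \<in> LH (2 * (i + j - 1) + 2 * (size m - (i + j)))"
    using z by simp
   also have "2 * (i + j - 1) + 2 * (size m - (i + j)) = 2 * (size m - 1)" using 3 by linarith
   finally have H: "?t z m \<in> LH (2 * (size m - 1))" .
   have "\<not> size m < 1" using 3 by linarith
   then show ?thesis using H by (simp only: if_False)
  qed
 qed
 have "if size m < 1 then ps_subst2 LP (generic_F R) p q m = \<zero>\<^bsub>LP\<^esub>
   else ps_subst2 LP (generic_F R) p q m \<in> LH (2 * (size m - 1))" for m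
 proof (cases "size m < 1")
  case True
  have tz: "?t z m = \<zero>\<^bsub>LP\<^esub>" for z using t[of m z] True by (simp only: if_True)
  have "ps_subst2 LP (generic_F R) p q m = \<zero>\<^bsub>LP\<^esub>"
   unfolding ps_subst2_def case_prod_beta tz by simp
  then show ?thesis using True by simp
 next
  case False
  then show ?thesis unfolding ps_subst2_def case_prod_beta
   using t[of m] by (auto intro!: LPA.submodule_finsum[OF LH_LP(1)])
 qed
 then show ?thesis by (simp add: ps_weight_def)
qed

end

section \<open>Indecomposables\<close>

lemma (in abelian_group) finsum_single:
 assumes "finite S" "a \<in> S" "f a \<in> carrier G" "\<And>x. x \<in> S \<Longrightarrow> x \<noteq> a \<Longrightarrow> f x = \<zero>"
 shows "(\<Oplus>x\<in>S. f x) = f a"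
proof -
 have "(\<Oplus>x\<in>S. f x) = (\<Oplus>x\<in>{a}. f x)"
  using assms by (intro add.finprod_mono_neutral_cong_right) (auto, metis zero_closed)
 then show ?thesis using assms by simp
qed

lemma (in module) add_pow_one_smult:
 "x \<in> carrier M \<Longrightarrow> add_pow R (k::nat) \<one> \<odot>\<^bsub>M\<^esub> x = add_pow M k x"
 by (induction k) (auto simp: smult_l_distr)

lemma (in abelian_group) add_pow_int_nat: "add_pow G (int k) x = add_pow G k x"
 by (simp add: add_pow_int_ge)

context cring
begin

lemma lazard_part_simps:
 "carrier (lazard_part R k) = lazard_degree R (2 * k)" "\<zero>\<^bsub>lazard_part R k\<^esub> = \<zero>\<^bsub>LZ\<^esub>"
 "x \<oplus>\<^bsub>lazard_part R k\<^esub> y = x \<oplus>\<^bsub>LZ\<^esub> y" "a \<odot>\<^bsub>lazard_part R k\<^esub> x = a \<odot>\<^bsub>LZ\<^esub> x"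
 by (simp_all add: lazard_part_def)

lemma lazard_part_module: "module R (lazard_part R k)"
 unfolding lazard_part_def
 by (rule submodule.submodule_is_module[OF graded_byD(1)[OF lazard_graded] algebra.module[OF lazard_algebra]])

definition "decomposable_products k = {x \<otimes>\<^bsub>LZ\<^esub> y | x y d e. d < 2 * k \<and> e < 2 * k \<and> d + e = 2 * k \<and>
    x \<in> lazard_degree R d \<and> y \<in> lazard_degree R e}"

lemma decomposables_eq: "decomposables R k = mod_span R (lazard_part R k) (decomposable_products k)"
 by (simp add: decomposables_def decomposable_products_def)

lemma decomposable_products_closed: "decomposable_products k \<subseteq> carrier (lazard_part R k)"
proof -
 have "x \<otimes>\<^bsub>LZ\<^esub> y \<in> lazard_degree R (2 * k)" if "x \<in> lazard_degree R d" "y \<in> lazard_degree R e" "d + e = 2 * k" for x y d e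
  using graded_byD(3)[OF lazard_graded that(1,2)] that(3) by simp
 then show ?thesis by (auto simp: decomposable_products_def lazard_part_simps)
qed

lemma indec_quotient: "module_quotient R (lazard_part R k) (decomposables R k)"
 unfolding decomposables_eq
 by (intro module_quotient.intro lazard_part_module module_quotient_axioms.intro
   module.mod_span_submodule[OF lazard_part_module decomposable_products_closed])

lemma indec_module: "module R (indec R n)"
 unfolding indec_def by (rule module_quotient.Q_module[OF indec_quotient])

lemma indec_proj_hom: "indec_proj R n \<in> mod_hom R (lazard_part R (n - 1)) (indec R n)"
 using module_quotient.proj_hom[OF indec_quotient, of "n - 1"] by (simp add: indec_def indec_proj_def[abs_def])

lemma indec_cases:
 assumes "u \<in> carrier (indec R n)"
 obtains x where "x \<in> lazard_degree R (2 * (n - 1))" "u = indec_proj R n x"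
 using module_quotient.proj_cases[OF indec_quotient, of u "n - 1"] assms
 unfolding indec_def indec_proj_def lazard_part_simps by metis

lemma indec_proj_eq_zero_iff:
 "x \<in> lazard_degree R (2 * (n - 1)) \<Longrightarrow> indec_proj R n x = \<zero>\<^bsub>indec R n\<^esub> \<longleftrightarrow> x \<in> decomposables R (n - 1)"
 using module_quotient.proj_eq_zero_iff[OF indec_quotient, of x "n - 1"]
 by (simp add: indec_def indec_proj_def lazard_part_simps)

lemma indec_proj_product:
 assumes "x \<in> lazard_degree R d" "y \<in> lazard_degree R e" "0 < d" "0 < e" "d + e = 2 * (n - 1)"
 shows "indec_proj R n (x \<otimes>\<^bsub>LZ\<^esub> y) = \<zero>\<^bsub>indec R n\<^esub>"
proof -
 have "x \<otimes>\<^bsub>LZ\<^esub> y \<in> decomposable_products (n - 1)"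
  unfolding decomposable_products_def
  by (rule CollectI, rule exI[of _ x], rule exI[of _ y], rule exI[of _ d], rule exI[of _ e]) (use assms in auto)
 then have "x \<otimes>\<^bsub>LZ\<^esub> y \<in> decomposables R (n - 1)"
  unfolding decomposables_eq using module.mod_span_superset[OF lazard_part_module] by blast
 moreover have "x \<otimes>\<^bsub>LZ\<^esub> y \<in> lazard_degree R (2 * (n - 1))"
  using graded_byD(3)[OF lazard_graded assms(1,2)] assms(5) by simp
 ultimately show ?thesis by (simp add: indec_proj_eq_zero_iff)
qed

text \<open>Splitting off one generator leaves two factors of positive, hence strictly smaller,
  degree.\<close>

lemma indec_proj_monomial:
 assumes m: "set_mset m \<subseteq> lazard_gens R" and d: "(\<Sum>v\<in>#m. lazard_gen_degree v) = 2 * (n - 1)" and s: "2 \<le> size m"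
 shows "indec_proj R n (lazard_class R (basis_elt R m)) = \<zero>\<^bsub>indec R n\<^esub>"
proof -
 obtain v m' where mm: "m = add_mset v m'" using s by (cases m) auto
 have v: "v \<in> lazard_gens R" "set_mset m' \<subseteq> lazard_gens R" "1 \<le> size m'" using m s mm by (auto simp: One_nat_def)
 let ?v = "basis_elt R {#v#}" and ?m = "basis_elt R m'"
 have "basis_elt R m = ?v \<otimes>\<^bsub>LP\<^esub> ?m"
  using basis_poly_mult[of "{#v#}" "lazard_gens R" m'] v mm by (simp add: lazard_poly_algebra_def)
 moreover have h: "?v \<in> LH (lazard_gen_degree v)" "?m \<in> LH (\<Sum>v\<in>#m'. lazard_gen_degree v)"
  using v by (auto intro!: homog_basis)
 ultimately have "lazard_class R (basis_elt R m) = lazard_class R ?v \<otimes>\<^bsub>LZ\<^esub> lazard_class R ?m"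
  using alg_homD(4)[OF lazard_class_hom] LH_closed by simp
 moreover have "0 < lazard_gen_degree v" "0 < (\<Sum>v\<in>#m'. lazard_gen_degree v)"
  using lazard_gen_degree_pos(1)[OF v(1)] monomial_degree(2)[OF v(2)] v(3) by linarith+
 ultimately show ?thesis
  using h d mm indec_proj_product[of "lazard_class R ?v" "lazard_gen_degree v" "lazard_class R ?m" "\<Sum>v\<in>#m'. lazard_gen_degree v" n]
  by (auto simp: lazard_degree_eq)
qed

text \<open>Generators of degree 2 (n - 1) go to their classes and all others to zero. Longer
  monomials vanish under this map and under the projection to the indecomposables, so the two agree
  in degree 2 (n - 1). Unlike the projection, the map is multiplicative and can be applied to
  identities of power series.\<close>

lemma indec_hom:
 assumes n: "1 < n"
 obtains h where "h \<in> alg_hom R LP (sqz R (indec R n))"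
  "\<And>v. v \<in> lazard_gens R \<Longrightarrow> h (poly_var R v) =
    (\<zero>, if lazard_gen_degree v = 2 * (n - 1) then indec_proj R n (lazard_class R (poly_var R v)) else \<zero>\<^bsub>indec R n\<^esub>)"
  "\<And>p. p \<in> LH (2 * (n - 1)) \<Longrightarrow> h p = (\<zero>, indec_proj R n (lazard_class R p))"
proof -
 interpret E: module R "indec R n" by (rule indec_module)
 interpret LPA: algebra R LP by (rule LP_algebra)
 interpret LA: algebra R LZ by (rule lazard_algebra)
 interpret SA: algebra R E.SZ by (rule E.sqz_algebra)
 interpret LPt: module R "lazard_part R (n - 1)" by (rule lazard_part_module)
 note pr = mod_homD[OF indec_proj_hom, unfolded lazard_part_simps]
 have vh: "lazard_class R (poly_var R v) \<in> lazard_degree R (lazard_gen_degree v)" if "v \<in> lazard_gens R" for v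
  using homog_basis[of "{#v#}" "lazard_gens R" lazard_gen_degree] that by (auto simp: lazard_degree_eq poly_var_def)
 let ?g = "\<lambda>v. (\<zero>, if lazard_gen_degree v = 2 * (n - 1) then indec_proj R n (lazard_class R (poly_var R v)) else \<zero>\<^bsub>indec R n\<^esub>)"
 have g: "?g \<in> lazard_gens R \<rightarrow> carrier E.SZ" using pr(1)[of _ n] vh by (fastforce simp: sqz_simps)
 obtain h where h': "h \<in> alg_hom R (poly_algebra R (lazard_gens R)) E.SZ"
  and hg: "\<And>v. v \<in> lazard_gens R \<Longrightarrow> h (poly_var R v) = ?g v"
  using poly_algebra_lift[OF E.sqz_algebra g] by blast
 note h = h'[folded lazard_poly_algebra_def] hg
 have mono: "h (basis_elt R m) = (\<zero>, indec_proj R n (lazard_class R (basis_elt R m)))"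
  if m: "set_mset m \<subseteq> lazard_gens R" "(\<Sum>v\<in>#m. lazard_gen_degree v) = 2 * (n - 1)" for m
 proof (cases "2 \<le> size m")
  case True
  then show ?thesis using h m
   by (simp add: indec_proj_monomial sqz_hom_monomial(2)[OF E.module_axioms h(1)[unfolded lazard_poly_algebra_def]])
 next
  case False
  have "m \<noteq> {#}" using m n by auto
  then obtain v where "m = {#v#}" using False by (metis One_nat_def less_2_cases not_le size_1_singleton_mset size_eq_0_iff_empty)
  then show ?thesis using h(2)[of v] m by (simp add: poly_var_def)
 qed
 have "h p = (\<zero>, indec_proj R n (lazard_class R p))" if "p \<in> LH (2 * (n - 1))" for p
  using that
 proof (induction rule: homog_induct)
  case zero
  have "lazard_class R \<zero>\<^bsub>LP\<^esub> = \<zero>\<^bsub>LZ\<^esub>"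
   by (rule mod_hom_zero[OF LPA.module_axioms LA.module_axioms alg_mod_hom[OF lazard_class_hom]])
  moreover have "h \<zero>\<^bsub>LP\<^esub> = \<zero>\<^bsub>E.SZ\<^esub>" by (rule mod_hom_zero[OF LPA.module_axioms SA.module_axioms alg_mod_hom[OF h(1)]])
  moreover have "indec_proj R n \<zero>\<^bsub>LZ\<^esub> = \<zero>\<^bsub>indec R n\<^esub>"
   using mod_hom_zero[OF lazard_part_module indec_module indec_proj_hom, of n] by (simp add: lazard_part_simps)
  ultimately show ?case by (simp add: lazard_poly_algebra_def[symmetric] sqz_simps)
 next
  case (basis a m p)
  have c: "basis_elt R m \<in> LH (2 * (n - 1))" using basis by (intro homog_basis)
  note c' = LH_closed[OF c] LH_closed[OF basis(4)]
  have l: "lazard_class R (basis_elt R m) \<in> lazard_degree R (2 * (n - 1))" "lazard_class R p \<in> lazard_degree R (2 * (n - 1))"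
   using c basis by (auto simp: lazard_degree_eq)
  note s = module.submoduleD(6)[OF LA.module_axioms graded_byD(1)[OF lazard_graded], OF basis(1) l(1)]
  have "lazard_class R (a \<odot>\<^bsub>LP\<^esub> basis_elt R m \<oplus>\<^bsub>LP\<^esub> p) = a \<odot>\<^bsub>LZ\<^esub> lazard_class R (basis_elt R m) \<oplus>\<^bsub>LZ\<^esub> lazard_class R p"
   using basis(1) c' by (simp add: alg_homD[OF lazard_class_hom])
  then have "indec_proj R n (lazard_class R (a \<odot>\<^bsub>LP\<^esub> basis_elt R m \<oplus>\<^bsub>LP\<^esub> p)) =
    a \<odot>\<^bsub>indec R n\<^esub> indec_proj R n (lazard_class R (basis_elt R m)) \<oplus>\<^bsub>indec R n\<^esub> indec_proj R n (lazard_class R p)"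
   using pr(2)[OF s l(2)] pr(3)[OF basis(1) l(1)] by simp
  moreover have "h (a \<odot>\<^bsub>LP\<^esub> basis_elt R m \<oplus>\<^bsub>LP\<^esub> p) = a \<odot>\<^bsub>E.SZ\<^esub> h (basis_elt R m) \<oplus>\<^bsub>E.SZ\<^esub> h p"
   using basis(1) c' by (simp add: alg_homD[OF h(1)])
  ultimately show ?case
   using basis(1,5) mono[OF basis(2,3)] unfolding lazard_poly_algebra_def[symmetric] by (simp add: sqz_simps)
 qed
 then show ?thesis using that[OF h] by blast
qed

text \<open>Over the square-zero extension the universal law becomes X + Y plus the sum of e i j X^i
  Y^j. Commutativity gives the symmetry of e. Associativity is read at X^i Y^j Z^k with positive
  exponents, where the left side contributes through (X + Y)^a Z^b and the right side through X^a (Y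
  + Z)^b.\<close>

lemma indec_cocycle:
 assumes n: "1 < n"
 shows "abelian_group.symm_cocycle (indec R n) n (\<lambda>i. indec_proj R n (universal_F R i (n - i)))"
proof -
 interpret E: module R "indec R n" by (rule indec_module)
 obtain h where h: "h \<in> alg_hom R LP E.SZ"
  and hv: "\<And>v. v \<in> lazard_gens R \<Longrightarrow> h (poly_var R v) =
    (\<zero>, if lazard_gen_degree v = 2 * (n - 1) then indec_proj R n (lazard_class R (poly_var R v)) else \<zero>\<^bsub>indec R n\<^esub>)"
  and hh: "\<And>p. p \<in> LH (2 * (n - 1)) \<Longrightarrow> h p = (\<zero>, indec_proj R n (lazard_class R p))"
  using indec_hom[OF n] by blast
 interpret LPC: cring LP by (rule algebra.M_cring[OF LP_algebra])
 interpret SC: cring E.SZ by (rule algebra.M_cring[OF E.sqz_algebra])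
 interpret h: ring_hom_cring LP E.SZ h
  by (rule alg_hom_ring_hom_cring[OF LP_algebra E.sqz_algebra h])
 interpret cl: ring_hom_cring LP LZ "lazard_class R"
  by (rule alg_hom_ring_hom_cring[OF LP_algebra lazard_algebra lazard_class_hom])
 let ?F = "generic_F R" and ?x = "ps_var LP 0" and ?y = "ps_var LP 1" and ?z = "ps_var LP 2"
 define G where "G i j = h (?F i j)" for i j
 \<comment> \<open>Coefficients with i + j different from n have another degree and are sent to
   zero, so \<open>e\<close> is the whole infinitesimal part of the reduced law.\<close>
 define e where "e i j = (if i + j = n \<and> 1 \<le> i \<and> 1 \<le> j then indec_proj R n (universal_F R i j) else \<zero>\<^bsub>indec R n\<^esub>)" for i j
 have Fdeg: "universal_F R i j \<in> lazard_degree R (2 * (n - 1))" if "i + j = n" for i j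
  using generic_F_homog(1)[of i j] that n by (auto simp: universal_F_def lazard_degree_eq)
 have ec: "e i j \<in> carrier (indec R n)" for i j
  using mod_homD(1)[OF indec_proj_hom, of "universal_F R i j" n] Fdeg by (auto simp: e_def lazard_part_simps)
 have G1: "G i 0 = (if i = 1 then \<one>\<^bsub>E.SZ\<^esub> else \<zero>\<^bsub>E.SZ\<^esub>)" "G 0 i = (if i = 1 then \<one>\<^bsub>E.SZ\<^esub> else \<zero>\<^bsub>E.SZ\<^esub>)" for i
  unfolding G_def generic_normalized by simp_all
 have G2: "G i j = (\<zero>, e i j)" if "1 \<le> i" "1 \<le> j" for i j
 proof -
  have "FCoeff i j \<in> lazard_gens R" using that by (auto simp: lazard_gens_def)
  moreover have "lazard_gen_degree (FCoeff i j) = 2 * (n - 1) \<longleftrightarrow> i + j = n" using that n by auto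
  ultimately show ?thesis using hv[of "FCoeff i j"] that
   by (simp add: G_def generic_F_def e_def universal_F_def)
 qed
 have Gc: "G i j \<in> carrier E.SZ" for i j unfolding G_def by (rule h.hom_closed[OF generic_closed(1)])
 note nat2 = h.ps_subst2_nat[where F = ?F, OF generic_closed(1), folded G_def]
 note vc = LPC.ps_var_closed
 \<comment> \<open>\<open>h\<close> is defined on the polynomial algebra, not on \<open>LZ\<close>.
   The coefficients at monomials of size n are homogeneous of degree 2 (n - 1), and in that degree
   \<open>h\<close> depends on the class in \<open>LZ\<close> only, where the equations
   hold.\<close>
 have eq: "h (p m) = h (q m)" if pq: "(p, q) \<in> formal_module_equations R LP ?F (generic_rho R)"
   and w: "p \<in> ps_weight 1" "q \<in> ps_weight 1" and m: "size m = n" for p q m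
 proof -
  have pm: "p m \<in> LH (2 * (n - 1))" "q m \<in> LH (2 * (n - 1))"
  proof -
   have "p' m \<in> LH (2 * (n - 1))" if "p' \<in> ps_weight 1" for p'
   proof -
    have "if size m < 1 then p' m = \<zero>\<^bsub>LP\<^esub> else p' m \<in> LH (2 * (size m - 1))"
     using that unfolding ps_weight_def by blast
    moreover have "\<not> size m < 1" using m n by linarith
    ultimately show ?thesis using m by (simp only: if_False)
   qed
   then show "p m \<in> LH (2 * (n - 1))" "q m \<in> LH (2 * (n - 1))" using w by blast+
  qed
  have "(lazard_class R \<circ> p, lazard_class R \<circ> q) \<in> formal_module_equations R LZ (universal_F R) (universal_rho R)"
   using cl.formal_module_equations_nat(1)[where F = ?F and \<rho> = "generic_rho R", OF is_cring generic_closed] pq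
   unfolding universal_F_def[abs_def] universal_rho_def[abs_def] by force
  then have "lazard_class R \<circ> p = lazard_class R \<circ> q" using lazard_formal_module unfolding formal_module_def by auto
  then show ?thesis using hh pm by (metis comp_apply)
 qed
 let ?X = "ps_var E.SZ 0" and ?Y = "ps_var E.SZ 1" and ?Z = "ps_var E.SZ 2"
 let ?S = "ps_subst2 E.SZ G"
 have comm: "e i j = e j i" if ij: "1 \<le> i" "1 \<le> j" "i + j = n" for i j
 proof -
  let ?m = "replicate_mset i 0 + replicate_mset j (1::nat)"
  have "h (ps_subst2 LP ?F ?x ?y ?m) = h (ps_subst2 LP ?F ?y ?x ?m)"
   by (rule eq) (use ij in \<open>auto simp: formal_module_equations_def Let_def intro!: ps_weight_subst2 ps_weight_var\<close>)
  then have "?S ?X ?Y ?m = ?S ?Y ?X ?m"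
   using fun_cong[OF nat2[OF vc[of 0] vc[of 1]], of ?m] fun_cong[OF nat2[OF vc[of 1] vc[of 0]], of ?m]
   by (simp add: h.ps_var_nat)
  moreover have "?S ?X ?Y ?m = G i j" by (rule SC.ps_subst2_vars[OF _ Gc]) simp
  moreover have "?S ?Y ?X (replicate_mset j (1::nat) + replicate_mset i 0) = G j i" by (rule SC.ps_subst2_vars[OF _ Gc]) simp
  ultimately show ?thesis using G2 ij by (simp add: add.commute)
 qed
 have assoc: "add_pow (indec R n) (i + j choose i) (e (i + j) k) = add_pow (indec R n) (j + k choose j) (e i (j + k))"
  if ijk: "1 \<le> i" "1 \<le> j" "1 \<le> k" "i + j + k = n" for i j k
 proof -
  let ?m = "replicate_mset i 0 + replicate_mset j (1::nat) + replicate_mset k 2"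
  have fstv: "fst \<circ> ps_var E.SZ v = ps_var R v" for v by (auto simp: ps_var_def sqz_simps fun_eq_iff)
  have sndv: "snd (ps_var E.SZ v m) = \<zero>\<^bsub>indec R n\<^esub>" for v m by (auto simp: ps_var_def sqz_simps)
  have vO: "ps_var E.SZ v \<in> SC.ps_ord 1" for v by (rule SC.ps_var_ord)
  have S: "?S p q m = (fst (p m) \<oplus> fst (q m), (snd (p m) \<oplus>\<^bsub>indec R n\<^esub> snd (q m)) \<oplus>\<^bsub>indec R n\<^esub>
    (\<Oplus>\<^bsub>indec R n\<^esub>z\<in>{1..n} \<times> {1..n}. ((fst \<circ> p) [^]\<^bsub>PSA\<^esub> fst z \<otimes>\<^bsub>PSA\<^esub> (fst \<circ> q) [^]\<^bsub>PSA\<^esub> snd z) m \<odot>\<^bsub>indec R n\<^esub> e (fst z) (snd z)))"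
   if "p \<in> SC.ps_ord 1" "q \<in> SC.ps_ord 1" "size m \<le> n" for p q m
   using that by (rule E.sqz_subst2[where E = e and F = G]) (use ec G1 G2 in auto)
  have Sfst: "fst \<circ> ?S p q = (fst \<circ> p) \<oplus>\<^bsub>PSA\<^esub> (fst \<circ> q)" if "p \<in> SC.ps_ord 1" "q \<in> SC.ps_ord 1" for p q
  proof
   fix m :: "nat multiset"
   show "(fst \<circ> ?S p q) m = ((fst \<circ> p) \<oplus>\<^bsub>PSA\<^esub> (fst \<circ> q)) m"
    using E.sqz_subst2[where E = e and F = G and m = m, OF that order_refl ec] G1 G2 by (simp add: psa_simps)
  qed
  have SO: "?S p q \<in> SC.ps_ord 1" if p: "p \<in> SC.ps_ord 1" and q: "q \<in> SC.ps_ord 1" for p q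
  proof -
   have "?S p q = SC.ps_at p q (\<lambda>m. G (count m 0) (count m 1))"
    by (simp add: SC.ps_at_def SC.count_mon)
   moreover have "(\<lambda>m. G (count m 0) (count m 1)) \<in> SC.ps_ord 1"
    using Gc G1(1)[of 0] by (auto simp: SC.ps_ord_def psa_simps(1) One_nat_def)
   ultimately show ?thesis using SC.ps_at_ord[OF p q] by simp
  qed
  \<comment> \<open>The inner law involves only two of the three variables, so it has no
    infinitesimal term at X^i Y^j Z^k.\<close>
  have zero: "snd (?S (ps_var E.SZ u) (ps_var E.SZ v) ?m) = \<zero>\<^bsub>indec R n\<^esub>"
   if uv: "u \<noteq> v" "\<And>a b. ?m \<noteq> replicate_mset a u + replicate_mset b v" for u v
  proof -
   have "(\<Oplus>\<^bsub>indec R n\<^esub>z\<in>{1..n} \<times> {1..n}. ((fst \<circ> ps_var E.SZ u) [^]\<^bsub>PSA\<^esub> fst z \<otimes>\<^bsub>PSA\<^esub> (fst \<circ> ps_var E.SZ v) [^]\<^bsub>PSA\<^esub> snd z) ?m \<odot>\<^bsub>indec R n\<^esub> e (fst z) (snd z))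
    = (\<Oplus>\<^bsub>indec R n\<^esub>z\<in>{1..n} \<times> {1..n}. \<zero>\<^bsub>indec R n\<^esub>)"
    unfolding fstv ps_var_pow2[OF uv(1)] using uv(2) ec by (intro E.M.add.finprod_cong') auto
   then show ?thesis using S[OF vO vO, of ?m u v] ijk by (simp add: sndv)
  qed
  have smO: "size ?m \<le> n" "size ?m = n" using ijk by simp_all
  have cm: "count ?m 0 = i" "count ?m 1 = j" "count ?m 2 = k" by simp_all
  have vR: "ps_var R v \<in> carrier PSA" for v using ps_ord_closed[OF ps_var_ord] .
  interpret P: cring PSA by (rule PSA_cring)
  \<comment> \<open>Dividing X^i Y^j Z^k by Z^b must leave a monomial in X and Y, which forces b =
    k; then the binomial theorem applies. \<open>Rr\<close> is the mirror image.\<close>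
  have L: "((ps_var R 0 \<oplus>\<^bsub>PSA\<^esub> ps_var R 1) [^]\<^bsub>PSA\<^esub> a \<otimes>\<^bsub>PSA\<^esub> ps_var R 2 [^]\<^bsub>PSA\<^esub> b) ?m =
    (if (a, b) = (i + j, k) then add_pow R (i + j choose i) \<one> else \<zero>)" for a b :: nat
  proof -
   have p: "(ps_var R 0 \<oplus>\<^bsub>PSA\<^esub> ps_var R 1) [^]\<^bsub>PSA\<^esub> a \<in> carrier PSA" using vR by simp
   show ?thesis
   proof (cases "b \<le> k")
    case False
    then show ?thesis using ps_var_pow_mult[OF p, of 2 b ?m] by simp
   next
    case True
    have r: "?m - replicate_mset b 2 = replicate_mset i 0 + replicate_mset j (1::nat) + replicate_mset (k - b) 2"
     using True by (intro multiset_eqI) auto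
    have "set_mset (replicate_mset i 0 + replicate_mset j (1::nat) + replicate_mset (k - b) 2) \<subseteq> {0, 1} \<longleftrightarrow> b = k"
     using True by auto
    then show ?thesis using ps_var_pow_mult[OF p, of 2 b ?m] True ps_binomial[of 0 1 a]
     unfolding r by auto
   qed
  qed
  have Rr: "(ps_var R 0 [^]\<^bsub>PSA\<^esub> a \<otimes>\<^bsub>PSA\<^esub> (ps_var R 1 \<oplus>\<^bsub>PSA\<^esub> ps_var R 2) [^]\<^bsub>PSA\<^esub> b) ?m =
    (if (a, b) = (i, j + k) then add_pow R (j + k choose j) \<one> else \<zero>)" for a b :: nat
  proof -
   have p: "(ps_var R 1 \<oplus>\<^bsub>PSA\<^esub> ps_var R 2) [^]\<^bsub>PSA\<^esub> b \<in> carrier PSA" using vR by simp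
   have c: "ps_var R 0 [^]\<^bsub>PSA\<^esub> a \<otimes>\<^bsub>PSA\<^esub> (ps_var R 1 \<oplus>\<^bsub>PSA\<^esub> ps_var R 2) [^]\<^bsub>PSA\<^esub> b =
     (ps_var R 1 \<oplus>\<^bsub>PSA\<^esub> ps_var R 2) [^]\<^bsub>PSA\<^esub> b \<otimes>\<^bsub>PSA\<^esub> ps_var R 0 [^]\<^bsub>PSA\<^esub> a"
    using p vR by (intro P.m_comm) auto
   show ?thesis unfolding c
   proof (cases "a \<le> i")
    case False
    then show "((ps_var R 1 \<oplus>\<^bsub>PSA\<^esub> ps_var R 2) [^]\<^bsub>PSA\<^esub> b \<otimes>\<^bsub>PSA\<^esub> ps_var R 0 [^]\<^bsub>PSA\<^esub> a) ?m = (if (a, b) = (i, j + k) then add_pow R (j + k choose j) \<one> else \<zero>)"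
     using ps_var_pow_mult[OF p, of 0 a ?m] by simp
   next
    case True
    have r: "?m - replicate_mset a 0 = replicate_mset (i - a) 0 + replicate_mset j (1::nat) + replicate_mset k 2"
     using True by (intro multiset_eqI) auto
    have "set_mset (replicate_mset (i - a) 0 + replicate_mset j (1::nat) + replicate_mset k 2) \<subseteq> {1, 2} \<longleftrightarrow> a = i"
     using True by auto
    then show "((ps_var R 1 \<oplus>\<^bsub>PSA\<^esub> ps_var R 2) [^]\<^bsub>PSA\<^esub> b \<otimes>\<^bsub>PSA\<^esub> ps_var R 0 [^]\<^bsub>PSA\<^esub> a) ?m = (if (a, b) = (i, j + k) then add_pow R (j + k choose j) \<one> else \<zero>)"
     using ps_var_pow_mult[OF p, of 0 a ?m] True ps_binomial[of 1 2 b]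
     unfolding r by auto
   qed
  qed
  have one: "(\<Oplus>\<^bsub>indec R n\<^esub>z\<in>{1..n} \<times> {1..n}. (if (fst z, snd z) = (a, b) then add_pow R (c::nat) \<one> else \<zero>) \<odot>\<^bsub>indec R n\<^esub> e (fst z) (snd z)) =
    add_pow (indec R n) c (e a b)" if "1 \<le> a" "a \<le> n" "1 \<le> b" "b \<le> n" for a b c
   using that ec by (subst E.M.finsum_single[of _ "(a, b)"]) (auto simp: E.add_pow_one_smult)
  have ne: "?m \<noteq> replicate_mset a 0 + replicate_mset b 1" "?m \<noteq> replicate_mset a 1 + replicate_mset b 2" for a b
   using ijk by (auto dest: arg_cong[of _ _ "\<lambda>m. count m 2"] arg_cong[of _ _ "\<lambda>m. count m 0"])
  have "snd (?S (?S ?X ?Y) ?Z ?m) = add_pow (indec R n) (i + j choose i) (e (i + j) k)"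
   unfolding S[OF SO[OF vO vO] vO smO(1)] Sfst[OF vO vO] fstv L snd_conv zero[OF zero_neq_one ne(1)] sndv
   using ijk one[of "i + j" k] ec by (simp add: E.M.add.int_pow_closed)
  moreover have "snd (?S ?X (?S ?Y ?Z) ?m) = add_pow (indec R n) (j + k choose j) (e i (j + k))"
   unfolding S[OF vO SO[OF vO vO] smO(1)] Sfst[OF vO vO] fstv Rr snd_conv
   using zero[OF _ ne(2)] ijk one[of i "j + k"] ec by (simp add: sndv)
  moreover have "?S (?S ?X ?Y) ?Z ?m = ?S ?X (?S ?Y ?Z) ?m"
  proof -
   have "h (ps_subst2 LP ?F (ps_subst2 LP ?F ?x ?y) ?z ?m) = h (ps_subst2 LP ?F ?x (ps_subst2 LP ?F ?y ?z) ?m)"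
    by (rule eq) (use smO in \<open>auto simp: formal_module_equations_def Let_def intro!: ps_weight_subst2 ps_weight_var\<close>)
   moreover have "h \<circ> ps_subst2 LP ?F (ps_subst2 LP ?F ?x ?y) ?z = ?S (?S ?X ?Y) ?Z"
    unfolding nat2[OF LPC.ps_subst2_closed[where F = ?F, OF generic_closed(1) vc vc] vc] nat2[OF vc vc] h.ps_var_nat ..
   moreover have "h \<circ> ps_subst2 LP ?F ?x (ps_subst2 LP ?F ?y ?z) = ?S ?X (?S ?Y ?Z)"
    unfolding nat2[OF vc LPC.ps_subst2_closed[where F = ?F, OF generic_closed(1) vc vc]] nat2[OF vc vc] h.ps_var_nat ..
   ultimately show ?thesis by (metis comp_apply)
  qed
  ultimately show ?thesis by simp
 qed
 have e1: "indec_proj R n (universal_F R i (n - i)) = e i (n - i)" if "0 < i" "i < n" for i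
  using that by (simp add: e_def One_nat_def Suc_le_eq)
 show ?thesis
  unfolding E.M.symm_cocycle_def
 proof (intro conjI allI impI)
  fix i assume i: "0 < i \<and> i < n"
  show "indec_proj R n (universal_F R i (n - i)) \<in> carrier (indec R n)" using i ec by (simp add: e1)
  show "indec_proj R n (universal_F R (n - i) (n - (n - i))) = indec_proj R n (universal_F R i (n - i))"
   using i comm[of i "n - i"] e1[of i] e1[of "n - i"] by (simp add: One_nat_def)
 next
  fix i j assume ij: "0 < i \<and> 0 < j \<and> i + j < n"
  show "add_pow (indec R n) (int (i + j choose i)) (indec_proj R n (universal_F R (i + j) (n - (i + j)))) =
    add_pow (indec R n) (int (n - i choose j)) (indec_proj R n (universal_F R i (n - i)))"
   using ij assoc[of i j "n - (i + j)"] e1[of i] e1[of "i + j"] by (simp add: E.M.add_pow_int_nat One_nat_def)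
 qed
qed

end

section \<open>The fundamental functional\<close>

text \<open>Adjusts the sign: \<open>indec_d\<close> is specified by negated multiples, while the
  cocycle lemma produces multiples.\<close>

lemma (in abelian_group) ex1_minus:
 assumes "\<exists>!d. d \<in> carrier G \<and> Q d"
 shows "\<exists>!d. d \<in> carrier G \<and> Q (\<ominus> d)"
proof -
 obtain d where d: "d \<in> carrier G" "Q d" "\<And>d'. d' \<in> carrier G \<Longrightarrow> Q d' \<Longrightarrow> d' = d" using assms by blast
 show ?thesis
 proof (rule ex1I[of _ "\<ominus> d"])
  fix d' assume d': "d' \<in> carrier G \<and> Q (\<ominus> d')"
  then have "\<ominus> d' = d" using d(3)[of "\<ominus> d'"] by simp
  then show "d' = \<ominus> d" using d' by (metis minus_minus)
 qed (use d(1,2) in simp)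
qed

context cring
begin

text \<open>Lazard's lemma, applied to the coefficients of the universal law modulo decomposables,
  shows that the definite description \<open>indec_d\<close> denotes.\<close>

lemma indec_d_props:
 assumes n: "1 < n"
 shows "indec_d R n \<in> carrier (indec R n)"
  "\<lbrakk>0 < i; i < n\<rbrakk> \<Longrightarrow> indec_proj R n (universal_F R i (n - i)) =
    \<ominus>\<^bsub>indec R n\<^esub> add_pow (indec R n) ((n choose i) div nu n) (indec_d R n)"
proof -
 interpret E: module R "indec R n" by (rule indec_module)
 have "\<exists>!d. d \<in> carrier (indec R n) \<and> (\<forall>i. 0 < i \<and> i < n \<longrightarrow>
   indec_proj R n (universal_F R i (n - i)) = add_pow (indec R n) (int (cocycle_coeff n i)) d)"
  by (rule E.M.symm_cocycle_unique_multiple[OF indec_cocycle[OF n] n])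
 from E.M.ex1_minus[OF this]
 have "\<exists>!d. d \<in> carrier (indec R n) \<and> (\<forall>i. 0 < i \<and> i < n \<longrightarrow> indec_proj R n (universal_F R i (n - i)) =
    add_pow (indec R n) (int (cocycle_coeff n i)) (\<ominus>\<^bsub>indec R n\<^esub> d))" .
 moreover have "add_pow (indec R n) (int (cocycle_coeff n i)) (\<ominus>\<^bsub>indec R n\<^esub> d) =
   \<ominus>\<^bsub>indec R n\<^esub> add_pow (indec R n) ((n choose i) div nu n) d" if "d \<in> carrier (indec R n)" for d i
  using that by (simp add: E.M.add_pow_int_nat cocycle_coeff_def E.M.add.nat_pow_inv)
 ultimately have "\<exists>!d. d \<in> carrier (indec R n) \<and> (\<forall>i. 0 < i \<and> i < n \<longrightarrow> indec_proj R n (universal_F R i (n - i)) =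
    \<ominus>\<^bsub>indec R n\<^esub> add_pow (indec R n) ((n choose i) div nu n) d)"
  by (simp cong: conj_cong)
 from theI'[OF this] show "indec_d R n \<in> carrier (indec R n)"
  "\<lbrakk>0 < i; i < n\<rbrakk> \<Longrightarrow> indec_proj R n (universal_F R i (n - i)) =
    \<ominus>\<^bsub>indec R n\<^esub> add_pow (indec R n) ((n choose i) div nu n) (indec_d R n)"
  unfolding indec_d_def by auto
qed

lemma universal_degree:
 "1 \<le> i + j \<Longrightarrow> universal_F R i j \<in> lazard_degree R (2 * (i + j - 1))"
 "a \<in> carrier R \<Longrightarrow> 2 \<le> k \<Longrightarrow> universal_rho R a k \<in> lazard_degree R (2 * (k - 1))"
proof -
 show "1 \<le> i + j \<Longrightarrow> universal_F R i j \<in> lazard_degree R (2 * (i + j - 1))"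
  using generic_F_homog(1) by (auto simp: universal_F_def lazard_degree_eq)
 assume a: "a \<in> carrier R" "2 \<le> k"
 then have "basis_elt R {#RCoeff a k#} \<in> LH (2 * (k - 1))"
  by (intro homog_basis) (auto simp: lazard_gens_def)
 then show "universal_rho R a k \<in> lazard_degree R (2 * (k - 1))"
  using a by (auto simp: universal_rho_def generic_rho_def poly_var_def lazard_degree_eq)
qed

lemma indec_c_closed: "1 < n \<Longrightarrow> a \<in> carrier R \<Longrightarrow> indec_c R n a \<in> carrier (indec R n)"
 using mod_homD(1)[OF indec_proj_hom, of "universal_rho R a n" n] universal_degree(2)[of a n]
 by (simp add: indec_c_def lazard_part_simps)

text \<open>The monomials of length one in degree 2 (n - 1) are \<open>FCoeff i (n - i)\<close> and
  \<open>RCoeff a n\<close>, so a linear map that kills the longer ones is controlled by its values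
  there. This is used both for the projection to the indecomposables and for linear parts of the
  logarithm.\<close>

lemma lazard_degree_linear:
 assumes N: "module R N" and h: "h \<in> mod_hom R (lazard_part R (n - 1)) N" and n: "1 < n"
  and mono: "\<And>m. \<lbrakk>set_mset m \<subseteq> lazard_gens R; (\<Sum>v\<in>#m. lazard_gen_degree v) = 2 * (n - 1); 2 \<le> size m\<rbrakk> \<Longrightarrow>
    h (lazard_class R (basis_elt R m)) = \<zero>\<^bsub>N\<^esub>"
  and H: "submodule H R N"
  and F: "\<And>i. 0 < i \<Longrightarrow> i < n \<Longrightarrow> h (universal_F R i (n - i)) \<in> H"
  and \<rho>: "\<And>a. a \<in> carrier R \<Longrightarrow> h (universal_rho R a n) \<in> H"
  and x: "x \<in> lazard_degree R (2 * (n - 1))"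
 shows "h x \<in> H"
proof -
 interpret N: module R N by (rule N)
 interpret LPA: algebra R LP by (rule LP_algebra)
 interpret LA: algebra R LZ by (rule lazard_algebra)
 note H' = N.submoduleD[OF H]
 note h' = mod_homD[OF h, unfolded lazard_part_simps]
 obtain p where p: "p \<in> LH (2 * (n - 1))" "x = lazard_class R p" using x by (auto simp: lazard_degree_eq)
 have m: "h (lazard_class R (basis_elt R m)) \<in> H"
  if m: "set_mset m \<subseteq> lazard_gens R" "(\<Sum>v\<in>#m. lazard_gen_degree v) = 2 * (n - 1)" for m
 proof (cases "2 \<le> size m")
  case True
  then show ?thesis using mono[OF m True] H'(2) by simp
 next
  case False
  have "m \<noteq> {#}" using m n by auto
  then obtain v where v: "m = {#v#}" using False by (metis One_nat_def less_2_cases not_le size_1_singleton_mset size_eq_0_iff_empty)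
  show ?thesis
  proof (cases v)
   case (FCoeff i j)
   then have "1 \<le> i" "1 \<le> j" "j = n - i" "i < n" "0 < i" using m v n by (auto simp: lazard_gens_def)
   then show ?thesis using F[of i] v FCoeff by (simp add: universal_F_def generic_F_def poly_var_def)
  next
   case (RCoeff a k)
   then have "a \<in> carrier R" "k = n" using m v n by (auto simp: lazard_gens_def)
   then show ?thesis using \<rho>[of a] v RCoeff n by (simp add: universal_rho_def generic_rho_def poly_var_def)
  qed
 qed
 have "h (lazard_class R p) \<in> H" using p(1)
 proof (induction rule: homog_induct)
  case zero
  have "lazard_class R \<zero>\<^bsub>LP\<^esub> = \<zero>\<^bsub>LZ\<^esub>"
   by (rule mod_hom_zero[OF LPA.module_axioms LA.module_axioms alg_mod_hom[OF lazard_class_hom]])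
  moreover have "h \<zero>\<^bsub>LZ\<^esub> = \<zero>\<^bsub>N\<^esub>"
   using mod_hom_zero[OF lazard_part_module N h] by (simp add: lazard_part_simps)
  ultimately show ?case using H'(2) by (simp add: lazard_poly_algebra_def[symmetric])
 next
  case (basis a m p)
  have c: "basis_elt R m \<in> LH (2 * (n - 1))" using basis by (intro homog_basis)
  note c' = LH_closed[OF c] LH_closed[OF basis(4)]
  have l: "lazard_class R (basis_elt R m) \<in> lazard_degree R (2 * (n - 1))" "lazard_class R p \<in> lazard_degree R (2 * (n - 1))"
   using c basis by (auto simp: lazard_degree_eq)
  note s = module.submoduleD(6)[OF LA.module_axioms graded_byD(1)[OF lazard_graded], OF basis(1) l(1)]
  have "lazard_class R (a \<odot>\<^bsub>LP\<^esub> basis_elt R m \<oplus>\<^bsub>LP\<^esub> p) = a \<odot>\<^bsub>LZ\<^esub> lazard_class R (basis_elt R m) \<oplus>\<^bsub>LZ\<^esub> lazard_class R p"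
   using basis(1) c' by (simp add: alg_homD[OF lazard_class_hom])
  then have "h (lazard_class R (a \<odot>\<^bsub>LP\<^esub> basis_elt R m \<oplus>\<^bsub>LP\<^esub> p)) =
    a \<odot>\<^bsub>N\<^esub> h (lazard_class R (basis_elt R m)) \<oplus>\<^bsub>N\<^esub> h (lazard_class R p)"
   using h'(2)[OF s l(2)] h'(3)[OF basis(1) l(1)] by simp
  then show ?case using m[OF basis(2,3)] basis(1,5) H' unfolding lazard_poly_algebra_def[symmetric] by simp
 qed
 then show ?thesis using p by simp
qed

text \<open>Modulo decomposables every coefficient of F in this degree is an integer multiple of d,
  so that d and the c_a generate.\<close>

lemma indec_span:
 assumes n: "1 < n" and H: "submodule H R (indec R n)" and d: "indec_d R n \<in> H"
  and c: "\<And>a. a \<in> carrier R \<Longrightarrow> indec_c R n a \<in> H" and u: "u \<in> carrier (indec R n)"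
 shows "u \<in> H"
proof -
 interpret E: module R "indec R n" by (rule indec_module)
 obtain x where x: "x \<in> lazard_degree R (2 * (n - 1))" "u = indec_proj R n x" using u by (rule indec_cases)
 note H' = E.submoduleD[OF H]
 have "add_pow (indec R n) (k::nat) (indec_d R n) \<in> H" for k
  using H'(6)[OF _ d, of "add_pow R k \<one>"] d H'(1) by (auto simp: E.add_pow_one_smult)
 then have F: "indec_proj R n (universal_F R i (n - i)) \<in> H" if "0 < i" "i < n" for i
  using that indec_d_props(2)[OF n] H'(4) by simp
 show ?thesis unfolding x(2)
  by (rule lazard_degree_linear[OF indec_module indec_proj_hom n indec_proj_monomial H F _ x(1)])
   (use c in \<open>auto simp: indec_c_def\<close>)
qed

text \<open>A fixed choice, so that the construction of the functional and the later analysis of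
  \<open>i_sharp\<close> refer to the same homomorphism.\<close>

definition lazard_log where
 "lazard_log = (SOME \<Phi>. \<Phi> \<in> alg_hom R LZ PX \<and>
  (\<forall>i j n. 1 \<le> i \<longrightarrow> 1 \<le> j \<longrightarrow> 2 \<le> n \<longrightarrow> lin_part (n - 1) (\<Phi> (universal_F R i j)) =
    (\<zero>, if i + j = n then \<ominus> (add_pow R (n choose i) \<one>) else \<zero>)) \<and>
  (\<forall>a\<in>carrier R. \<forall>k n. 2 \<le> k \<longrightarrow> 2 \<le> n \<longrightarrow> lin_part (n - 1) (\<Phi> (universal_rho R a k)) =
    (\<zero>, if k = n then a \<ominus> a [^] n else \<zero>)))"

lemma lazard_log_props:
 "lazard_log \<in> alg_hom R LZ PX"
 "\<lbrakk>1 \<le> i; 1 \<le> j; 2 \<le> n\<rbrakk> \<Longrightarrow> lin_part (n - 1) (lazard_log (universal_F R i j)) =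
    (\<zero>, if i + j = n then \<ominus> (add_pow R (n choose i) \<one>) else \<zero>)"
 "\<lbrakk>a \<in> carrier R; 2 \<le> k; 2 \<le> n\<rbrakk> \<Longrightarrow> lin_part (n - 1) (lazard_log (universal_rho R a k)) =
    (\<zero>, if k = n then a \<ominus> a [^] n else \<zero>)"
proof -
 have "\<exists>\<Phi>. \<Phi> \<in> alg_hom R LZ PX \<and>
  (\<forall>i j n. 1 \<le> i \<longrightarrow> 1 \<le> j \<longrightarrow> 2 \<le> n \<longrightarrow> lin_part (n - 1) (\<Phi> (universal_F R i j)) =
    (\<zero>, if i + j = n then \<ominus> (add_pow R (n choose i) \<one>) else \<zero>)) \<and>
  (\<forall>a\<in>carrier R. \<forall>k n. 2 \<le> k \<longrightarrow> 2 \<le> n \<longrightarrow> lin_part (n - 1) (\<Phi> (universal_rho R a k)) =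
    (\<zero>, if k = n then a \<ominus> a [^] n else \<zero>))"
  by (rule lazard_hom_to_poly) blast
 from someI_ex[OF this, folded lazard_log_def]
 show "lazard_log \<in> alg_hom R LZ PX"
  "\<lbrakk>1 \<le> i; 1 \<le> j; 2 \<le> n\<rbrakk> \<Longrightarrow> lin_part (n - 1) (lazard_log (universal_F R i j)) =
    (\<zero>, if i + j = n then \<ominus> (add_pow R (n choose i) \<one>) else \<zero>)"
  "\<lbrakk>a \<in> carrier R; 2 \<le> k; 2 \<le> n\<rbrakk> \<Longrightarrow> lin_part (n - 1) (lazard_log (universal_rho R a k)) =
    (\<zero>, if k = n then a \<ominus> a [^] n else \<zero>)"
  by blast+
qed

definition log_lin :: "nat \<Rightarrow> 'a lazard_poly set \<Rightarrow> 'a \<times> 'a" where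
 "log_lin n x = lin_part (n - 1) (lazard_log x)"

lemma log_lin_hom: "log_lin n \<in> alg_hom R LZ SR"
 using alg_hom_comp[OF lazard_log_props(1) lin_part_hom] by (simp add: log_lin_def[abs_def] comp_def)

lemma log_lin_gen:
 assumes "v \<in> lazard_gens R" "2 \<le> n"
 shows "fst (log_lin n (lazard_class R (poly_var R v))) = \<zero>"
proof (cases v)
 case (FCoeff i j)
 then have "1 \<le> i" "1 \<le> j" using assms by (auto simp: lazard_gens_def)
 then show ?thesis using lazard_log_props(2)[of i j n] assms(2) FCoeff
  by (simp add: log_lin_def universal_F_def generic_F_def)
next
 case (RCoeff a k)
 then have "a \<in> carrier R" "2 \<le> k" using assms by (auto simp: lazard_gens_def)
 then show ?thesis using lazard_log_props(3)[of a k n] assms(2) RCoeff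
  by (simp add: log_lin_def universal_rho_def generic_rho_def)
qed

lemma log_lin_monomial:
 assumes n: "2 \<le> n" and m: "set_mset m \<subseteq> lazard_gens R"
 shows "1 \<le> size m \<Longrightarrow> fst (log_lin n (lazard_class R (basis_elt R m))) = \<zero>"
  "2 \<le> size m \<Longrightarrow> log_lin n (lazard_class R (basis_elt R m)) = (\<zero>, \<zero>)"
 using sqz_hom_monomial[OF self_module_module alg_hom_comp[OF lazard_class_hom log_lin_hom[of n], unfolded lazard_poly_algebra_def] _ m]
  log_lin_gen[OF _ n] by (simp_all add: self_module_simps)

text \<open>Monomials of positive degree contain a generator, and generators have no constant term
  in the logarithm. Consequently a product of two elements of positive degree has no linear term,
  which lets the linear coefficient descend to the indecomposables.\<close>

lemma log_lin_positive:
 assumes n: "2 \<le> n" and x: "x \<in> lazard_degree R d" and d: "0 < d"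
 shows "fst (log_lin n x) = \<zero>"
proof -
 interpret LPA: algebra R LP by (rule LP_algebra)
 interpret SM: module R "self_module R" by (rule self_module_module)
 interpret SA: algebra R SR by (rule SM.sqz_algebra)
 have h: "log_lin n \<circ> lazard_class R \<in> alg_hom R LP SR" by (rule alg_hom_comp[OF lazard_class_hom log_lin_hom])
 obtain p where p: "p \<in> LH d" "x = lazard_class R p" using x by (auto simp: lazard_degree_eq)
 have "fst ((log_lin n \<circ> lazard_class R) p) = \<zero>" using p(1)
 proof (induction rule: homog_induct)
  case zero
  then show ?case using mod_hom_zero[OF LPA.module_axioms SA.module_axioms alg_mod_hom[OF h]]
   by (simp add: lazard_poly_algebra_def[symmetric] sqz_simps)
 next
  case (basis a m p)
  have c: "basis_elt R m \<in> LH d" using basis by (intro homog_basis)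
  have "m \<noteq> {#}" using basis(3) d by auto
  then have "1 \<le> size m" by (simp add: One_nat_def Suc_le_eq nonempty_has_size)
  then have "fst ((log_lin n \<circ> lazard_class R) (basis_elt R m)) = \<zero>" using log_lin_monomial(1)[OF n basis(2)] by simp
  then show ?case using basis(1,5) alg_homD(2)[OF h, of "a \<odot>\<^bsub>LP\<^esub> basis_elt R m" p] alg_homD(3)[OF h basis(1) LH_closed[OF c]]
    LH_closed[OF c] LH_closed[OF basis(4)] unfolding lazard_poly_algebra_def[symmetric] by (simp add: sqz_simps)
 qed
 then show ?thesis using p by simp
qed

text \<open>The part of the homogeneity of the logarithm that concerns linear terms: x_{k-1} belongs
  to degree 2 (k - 1). It is checked on the generators of degree 2 (n - 1).\<close>

lemma log_lin_other_degree:
 assumes n: "2 \<le> n" and k: "2 \<le> k" "k \<noteq> n" and x: "x \<in> lazard_degree R (2 * (n - 1))"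
 shows "log_lin k x = (\<zero>, \<zero>)"
proof -
 interpret SM: module R "self_module R" by (rule self_module_module)
 interpret SA: algebra R SR by (rule SM.sqz_algebra)
 have h: "log_lin k \<in> mod_hom R (lazard_part R (n - 1)) SR"
  using alg_mod_hom[OF log_lin_hom[of k]] lazard_degree_closed
  unfolding mod_hom_def lazard_part_simps by (simp add: Pi_iff)
 have "log_lin k x \<in> {\<zero>\<^bsub>SR\<^esub>}"
 proof (rule lazard_degree_linear[OF SA.module_axioms h _ _ _ _ _ x])
  show "submodule {\<zero>\<^bsub>SR\<^esub>} R SR" by (rule SA.submoduleI') auto
  show "log_lin k (universal_F R i (n - i)) \<in> {\<zero>\<^bsub>SR\<^esub>}" if "0 < i" "i < n" for i
   using that lazard_log_props(2)[of i "n - i" k] k by (simp add: log_lin_def sqz_simps self_module_simps One_nat_def Suc_le_eq)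
  show "log_lin k (universal_rho R a n) \<in> {\<zero>\<^bsub>SR\<^esub>}" if "a \<in> carrier R" for a
   using that lazard_log_props(3)[of a n k] k n by (simp add: log_lin_def sqz_simps self_module_simps)
 qed (use n log_lin_monomial(2)[OF k(1)] in \<open>auto simp: sqz_simps self_module_simps\<close>)
 then show ?thesis by (simp add: sqz_simps self_module_simps)
qed

section \<open>Existence of the fundamental functional and its image\<close>

lemma torsion_free_natD:
 assumes "additively_torsion_free R" "add_pow R (k::nat) a = \<zero>" "a \<in> carrier R" "k \<noteq> 0"
 shows "a = \<zero>"
proof -
 have "add_pow R (int k) a = \<zero>" using assms(2) by (simp add: add_pow_int_nat)
 then show ?thesis using assms(1,3,4) unfolding additively_torsion_free_def by fastforce
qed

text \<open>Existence: the coefficient of the logarithm at x_{n-1} is linear and kills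
  decomposables, hence descends to the indecomposables with the prescribed values. Uniqueness: d and
  the c_a generate. The last property, the identification with the logarithm, is what the comparison
  with \<open>i_sharp\<close> rests on.\<close>

lemma fundamental_functional_props:
 assumes TF: "additively_torsion_free R" and n: "1 < n"
 shows "fundamental_functional R n \<in> mod_hom R (indec R n) (self_module R)"
  "fundamental_functional R n (indec_d R n) = add_pow R (nu n) \<one>"
  "a \<in> carrier R \<Longrightarrow> fundamental_functional R n (indec_c R n a) = a \<ominus> a [^] n"
  "x \<in> lazard_degree R (2 * (n - 1)) \<Longrightarrow> fundamental_functional R n (indec_proj R n x) = snd (log_lin n x)"
proof -
 interpret E: module R "indec R n" by (rule indec_module)
 interpret SM: module R "self_module R" by (rule self_module_module)
 interpret Q: module_quotient R "lazard_part R (n - 1)" "decomposables R (n - 1)" by (rule indec_quotient)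
 have n2: "2 \<le> n" using n by simp
 let ?h = "\<lambda>x. snd (log_lin n x)"
 have h: "?h \<in> mod_hom R (lazard_part R (n - 1)) (self_module R)"
 proof (rule mod_homI)
  note l = alg_homD[OF log_lin_hom]
  fix x assume x: "x \<in> carrier (lazard_part R (n - 1))"
  then have xc: "x \<in> carrier LZ" using lazard_degree_closed by (simp add: lazard_part_simps)
  show "?h x \<in> carrier (self_module R)" using l(1)[OF xc, of n] by (auto simp: sqz_simps)
  show "?h (a \<odot>\<^bsub>lazard_part R (n - 1)\<^esub> x) = a \<odot>\<^bsub>self_module R\<^esub> ?h x" if "a \<in> carrier R" for a
   using l(3)[OF that xc] by (simp add: lazard_part_simps sqz_simps)
  fix y assume "y \<in> carrier (lazard_part R (n - 1))"
  then have yc: "y \<in> carrier LZ" using lazard_degree_closed by (simp add: lazard_part_simps)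
  show "?h (x \<oplus>\<^bsub>lazard_part R (n - 1)\<^esub> y) = ?h x \<oplus>\<^bsub>self_module R\<^esub> ?h y"
   using l(2)[OF xc yc] by (simp add: lazard_part_simps sqz_simps)
 qed
 have ker: "?h x = \<zero>\<^bsub>self_module R\<^esub>" if "x \<in> decomposables R (n - 1)" for x
 proof -
  have "decomposables R (n - 1) \<subseteq> {x \<in> carrier (lazard_part R (n - 1)). ?h x \<in> {\<zero>\<^bsub>self_module R\<^esub>}}"
   unfolding decomposables_eq
  proof (rule Q.mod_span_minimal[OF Q.submodule_vimage[OF SM.module_axioms h]])
   show "submodule {\<zero>\<^bsub>self_module R\<^esub>} R (self_module R)" by (rule SM.submoduleI') auto
   show "decomposable_products (n - 1) \<subseteq> {x \<in> carrier (lazard_part R (n - 1)). ?h x \<in> {\<zero>\<^bsub>self_module R\<^esub>}}"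
   proof
    fix z assume z: "z \<in> decomposable_products (n - 1)"
    then obtain x y d e where xy: "z = x \<otimes>\<^bsub>LZ\<^esub> y" "d < 2 * (n - 1)" "e < 2 * (n - 1)" "d + e = 2 * (n - 1)"
     "x \<in> lazard_degree R d" "y \<in> lazard_degree R e" unfolding decomposable_products_def by blast
    have c: "x \<in> carrier LZ" "y \<in> carrier LZ" using xy lazard_degree_closed by auto
    have "fst (log_lin n x) = \<zero>" "fst (log_lin n y) = \<zero>"
     using log_lin_positive[OF n2 xy(5)] log_lin_positive[OF n2 xy(6)] xy by auto
    then have "?h z = \<zero>\<^bsub>self_module R\<^esub>" using alg_homD(1)[OF log_lin_hom c(1), of n] alg_homD(1)[OF log_lin_hom c(2), of n]
     unfolding xy(1) alg_homD(4)[OF log_lin_hom c] by (auto simp: sqz_simps self_module_simps)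
    then show "z \<in> {x \<in> carrier (lazard_part R (n - 1)). ?h x \<in> {\<zero>\<^bsub>self_module R\<^esub>}}"
     using z decomposable_products_closed by auto
   qed
  qed
  then show ?thesis using that by blast
 qed
 \<comment> \<open>The restriction meets the extensionality demanded by the definite
   description.\<close>
 define \<sigma> where "\<sigma> = restrict (quot_lift ?h) (carrier (indec R n))"
 have \<sigma>0: "quot_lift ?h \<in> mod_hom R (indec R n) (self_module R)"
  using Q.quot_lift_mod_hom[OF SM.module_axioms h ker] by (simp add: indec_def)
 then have \<sigma>h: "\<sigma> \<in> mod_hom R (indec R n) (self_module R)"
  by (auto simp: mod_hom_def \<sigma>_def E.smult_closed)
 have \<sigma>p: "\<sigma> (indec_proj R n x) = ?h x" if "x \<in> lazard_degree R (2 * (n - 1))" for x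
  using Q.quot_lift_proj[OF SM.module_axioms h ker, of x] that mod_homD(1)[OF indec_proj_hom, of x n]
  by (simp add: \<sigma>_def lazard_part_simps indec_proj_def)
 have \<sigma>c: "\<sigma> (indec_c R n a) = a \<ominus> a [^] n" if "a \<in> carrier R" for a
  unfolding indec_c_def using \<sigma>p[OF universal_degree(2)[OF that n2]] lazard_log_props(3)[OF that n2 n2]
  by (simp add: log_lin_def)
 note sc = mod_homD(1)[OF \<sigma>h, unfolded self_module_simps]
 have \<sigma>d: "\<sigma> (indec_d R n) = add_pow R (nu n) \<one>"
 proof -
  \<comment> \<open>The coefficient at X Y^(n-1) is compared. With c = n / nu(n) it gives c sigma(d)
    = n = c nu(n), and c is cancelled because A is torsion-free.\<close>
  let ?c = "(n choose 1) div nu n" and ?d = "indec_d R n"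
  note d = indec_d_props(1)[OF n]
  have c: "nu n * ?c = (n choose 1)" using nu_dvd_choose[of 1 n] n by simp
  have Fd: "universal_F R 1 (n - 1) \<in> lazard_degree R (2 * (n - 1))" using universal_degree(1)[of 1 "n - 1"] n by simp
  have 1: "\<sigma> (indec_proj R n (universal_F R 1 (n - 1))) = \<ominus> (add_pow R (n choose 1) \<one>)"
   using \<sigma>p[OF Fd] lazard_log_props(2)[of 1 "n - 1" n] n by (simp add: log_lin_def One_nat_def)
  have "\<sigma> (\<ominus>\<^bsub>indec R n\<^esub> add_pow (indec R n) ?c ?d) = \<ominus> (add_pow R ?c (\<sigma> ?d))"
  proof -
   have "\<ominus>\<^bsub>indec R n\<^esub> add_pow (indec R n) ?c ?d = (\<ominus> (add_pow R ?c \<one>)) \<odot>\<^bsub>indec R n\<^esub> ?d"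
    using d by (simp add: E.smult_l_minus E.add_pow_one_smult)
   then have "\<sigma> (\<ominus>\<^bsub>indec R n\<^esub> add_pow (indec R n) ?c ?d) = (\<ominus> (add_pow R ?c \<one>)) \<otimes> \<sigma> ?d"
    using d mod_homD(3)[OF \<sigma>h] by (simp add: self_module_simps)
   also have "\<dots> = \<ominus> (add_pow R ?c (\<sigma> ?d))" using sc[OF d] by (simp add: l_minus add_pow_ldistr)
   finally show ?thesis .
  qed
  then have "\<ominus> (add_pow R ?c (\<sigma> ?d)) = \<ominus> (add_pow R (n choose 1) \<one>)"
   using 1 indec_d_props(2)[OF n, of 1] n by simp
  then have "add_pow R ?c (\<sigma> ?d) = add_pow R (nu n * ?c) \<one>"
   unfolding c using sc[OF d] by (metis add.nat_pow_closed minus_minus one_closed)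
  then have "add_pow R ?c (\<sigma> ?d) = add_pow R ?c (add_pow R (nu n) \<one>)" by (simp add: add.nat_pow_pow)
  then have "add_pow R ?c (\<sigma> ?d \<ominus> add_pow R (nu n) \<one>) = \<zero>"
   using sc[OF d] by (simp add: a_minus_def add.nat_pow_distrib add.nat_pow_inv r_neg)
  moreover have "?c \<noteq> 0" using c n by (cases "?c = 0") auto
  ultimately have "\<sigma> ?d \<ominus> add_pow R (nu n) \<one> = \<zero>" using torsion_free_natD[OF TF] sc[OF d] by blast
  then show ?thesis using sc[OF d] by (simp add: minus_zero_iff)
 qed
 have uniq: "\<tau> = \<sigma>" if \<tau>: "\<tau> \<in> mod_hom R (indec R n) (self_module R) \<and> \<tau> \<in> extensional (carrier (indec R n)) \<and>
   \<tau> (indec_d R n) = add_pow R (nu n) \<one> \<and> (\<forall>a\<in>carrier R. \<tau> (indec_c R n a) = a \<ominus> a [^] n)" for \<tau>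
 proof
  fix u
  show "\<tau> u = \<sigma> u"
  proof (cases "u \<in> carrier (indec R n)")
   case True
   have "u \<in> {u \<in> carrier (indec R n). \<tau> u = \<sigma> u}"
   proof (rule indec_span[OF n _ _ _ True])
    note t = mod_homD[of \<tau>, OF conjunct1[OF \<tau>]]
    show "submodule {u \<in> carrier (indec R n). \<tau> u = \<sigma> u} R (indec R n)"
     using mod_hom_zero[OF E.module_axioms SM.module_axioms \<sigma>h] mod_hom_zero[OF E.module_axioms SM.module_axioms conjunct1[OF \<tau>]]
     by (intro E.submoduleI') (auto simp: t mod_homD[OF \<sigma>h])
   qed (use \<tau> \<sigma>d \<sigma>c indec_d_props(1)[OF n] indec_c_closed[OF n] in auto)
   then show ?thesis by simp
  next
   case False
   then show ?thesis using \<tau> by (simp add: \<sigma>_def extensional_def)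
  qed
 qed
 have eq: "fundamental_functional R n = \<sigma>"
  unfolding fundamental_functional_def
  by (rule the_equality) (use \<sigma>h \<sigma>d \<sigma>c uniq in \<open>auto simp: \<sigma>_def\<close>)
 show "fundamental_functional R n \<in> mod_hom R (indec R n) (self_module R)"
  "fundamental_functional R n (indec_d R n) = add_pow R (nu n) \<one>"
  "a \<in> carrier R \<Longrightarrow> fundamental_functional R n (indec_c R n a) = a \<ominus> a [^] n"
  "x \<in> lazard_degree R (2 * (n - 1)) \<Longrightarrow> fundamental_functional R n (indec_proj R n x) = snd (log_lin n x)"
  unfolding eq using \<sigma>h \<sigma>d \<sigma>c \<sigma>p by auto
qed

lemma submodule_self_iff: "submodule I R (self_module R) \<longleftrightarrow> ideal I R"
proof
 interpret SM: module R "self_module R" by (rule self_module_module)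
 assume "submodule I R (self_module R)"
 then interpret S: submodule I R "self_module R" .
 note D = SM.submoduleD[OF S.submodule_axioms]
 have "\<ominus> x \<in> I" if "x \<in> I" for x
  using D(6)[of "\<ominus> \<one>" x] subsetD[OF D(1) that] that by (simp add: self_module_simps l_minus)
 then have "subgroup I (add_monoid R)" using D(1,2,3) by (intro add.subgroupI) (auto simp: self_module_simps)
 moreover have "x \<otimes> a \<in> I" "a \<otimes> x \<in> I" if "a \<in> I" "x \<in> carrier R" for a x
  using D(6)[OF that(2,1)] m_comm[of x a] subsetD[OF D(1) that(1)] that(2)
  by (simp_all add: self_module_simps)
 ultimately show "ideal I R" by (intro idealI ring_axioms) auto
next
 assume "ideal I R"
 then interpret I: ideal I R .
 interpret SM: module R "self_module R" by (rule self_module_module)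
 show "submodule I R (self_module R)"
  by (rule SM.submoduleI') (auto simp: self_module_simps I.I_l_closed)
qed

text \<open>The functional takes the generators d and c_a to the listed generators of the ideal, and
  the preimage of an ideal under it is a submodule, to which \<open>indec_span\<close>
  applies.\<close>

lemma fundamental_ideal_eq:
 assumes TF: "additively_torsion_free R" and n: "1 < n"
 shows "fundamental_ideal R n = Idl (insert (add_pow R (nu n) \<one>) {a \<ominus> a [^] n | a. a \<in> carrier R})" (is "_ = Idl ?G")
  and "ideal (fundamental_ideal R n) R"
proof -
 interpret E: module R "indec R n" by (rule indec_module)
 interpret SM: module R "self_module R" by (rule self_module_module)
 note \<sigma> = fundamental_functional_props[OF TF n]
 have G: "?G \<subseteq> carrier R" by auto
 show I: "ideal (fundamental_ideal R n) R"
  unfolding fundamental_ideal_def submodule_self_iff[symmetric]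
  by (rule SM.submodule_image[OF E.module_axioms \<sigma>(1) E.submodule_carrier])
 have "u \<in> {u \<in> carrier (indec R n). fundamental_functional R n u \<in> Idl ?G}" if "u \<in> carrier (indec R n)" for u
 proof (rule indec_span[OF n _ _ _ that])
  show "submodule {u \<in> carrier (indec R n). fundamental_functional R n u \<in> Idl ?G} R (indec R n)"
   by (rule E.submodule_vimage[OF SM.module_axioms \<sigma>(1)]) (use genideal_ideal[OF G] submodule_self_iff in blast)
 qed (use genideal_self[OF G] \<sigma> indec_d_props(1)[OF n] indec_c_closed[OF n] in \<open>auto simp: subset_iff\<close>)
 then have "fundamental_ideal R n \<subseteq> Idl ?G" by (auto simp: fundamental_ideal_def)
 moreover have "Idl ?G \<subseteq> fundamental_ideal R n"
 proof (rule genideal_minimal[OF I])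
  have "add_pow R (nu n) \<one> \<in> fundamental_ideal R n"
   unfolding fundamental_ideal_def using \<sigma>(2) indec_d_props(1)[OF n] by (metis imageI)
  moreover have "a \<ominus> a [^] n \<in> fundamental_ideal R n" if "a \<in> carrier R" for a
   unfolding fundamental_ideal_def using \<sigma>(3)[OF that] indec_c_closed[OF n that] by (metis imageI)
  ultimately show "?G \<subseteq> fundamental_ideal R n" by auto
 qed
 ultimately show "fundamental_ideal R n = Idl ?G" by blast
qed

end

section \<open>Direct sums and projective modules\<close>

locale module_family = cring R for R :: "('a, 'm) ring_scheme" (structure) +
 fixes N :: "'i set" and M :: "'i \<Rightarrow> ('a, 'b, 'p) module_scheme"
 assumes M_module: "n \<in> N \<Longrightarrow> module R (M n)"
begin

abbreviation "DS \<equiv> direct_sum N M"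

lemma component_simps:
 assumes "n \<in> N"
 shows "\<zero>\<^bsub>M n\<^esub> \<in> carrier (M n)" "x \<in> carrier (M n) \<Longrightarrow> y \<in> carrier (M n) \<Longrightarrow> x \<oplus>\<^bsub>M n\<^esub> y \<in> carrier (M n)"
  "a \<in> carrier R \<Longrightarrow> x \<in> carrier (M n) \<Longrightarrow> a \<odot>\<^bsub>M n\<^esub> x \<in> carrier (M n)"
  "x \<in> carrier (M n) \<Longrightarrow> \<zero>\<^bsub>M n\<^esub> \<oplus>\<^bsub>M n\<^esub> x = x" "x \<in> carrier (M n) \<Longrightarrow> x \<oplus>\<^bsub>M n\<^esub> \<zero>\<^bsub>M n\<^esub> = x"
  "a \<in> carrier R \<Longrightarrow> a \<odot>\<^bsub>M n\<^esub> \<zero>\<^bsub>M n\<^esub> = \<zero>\<^bsub>M n\<^esub>"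
  "x \<in> carrier (M n) \<Longrightarrow> (\<ominus> \<one>) \<odot>\<^bsub>M n\<^esub> x \<oplus>\<^bsub>M n\<^esub> x = \<zero>\<^bsub>M n\<^esub>"
proof -
 interpret module R "M n" by (rule M_module[OF assms])
 show "x \<in> carrier (M n) \<Longrightarrow> (\<ominus> \<one>) \<odot>\<^bsub>M n\<^esub> x \<oplus>\<^bsub>M n\<^esub> x = \<zero>\<^bsub>M n\<^esub>"
  by (simp add: smult_l_minus M.l_neg)
qed (use M_module[OF assms] in \<open>simp_all add: module.smult_closed module.smult_r_null
  abelian_monoid.zero_closed abelian_monoid.a_closed abelian_monoid.l_zero abelian_monoid.r_zero
  abelian_group.axioms(1) module.axioms(2)\<close>)

lemma carrier_DS: "f \<in> carrier DS \<longleftrightarrow>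
  f \<in> extensional N \<and> (\<forall>n\<in>N. f n \<in> carrier (M n)) \<and> finite {n \<in> N. f n \<noteq> \<zero>\<^bsub>M n\<^esub>}"
 by (auto simp: direct_sum_def PiE_def)

lemma DS_simps: "\<zero>\<^bsub>DS\<^esub> = (\<lambda>n\<in>N. \<zero>\<^bsub>M n\<^esub>)" "f \<oplus>\<^bsub>DS\<^esub> g = (\<lambda>n\<in>N. f n \<oplus>\<^bsub>M n\<^esub> g n)"
  "a \<odot>\<^bsub>DS\<^esub> f = (\<lambda>n\<in>N. a \<odot>\<^bsub>M n\<^esub> f n)"
 by (simp_all add: direct_sum_def)

lemma DS_smult_closed: assumes "a \<in> carrier R" "f \<in> carrier DS" shows "a \<odot>\<^bsub>DS\<^esub> f \<in> carrier DS"
proof -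
 have "{n \<in> N. (a \<odot>\<^bsub>DS\<^esub> f) n \<noteq> \<zero>\<^bsub>M n\<^esub>} \<subseteq> {n \<in> N. f n \<noteq> \<zero>\<^bsub>M n\<^esub>}"
  using assms by (auto simp: DS_simps component_simps)
 then have "finite {n \<in> N. (a \<odot>\<^bsub>DS\<^esub> f) n \<noteq> \<zero>\<^bsub>M n\<^esub>}" using assms(2) by (auto simp: carrier_DS intro: finite_subset)
 then show ?thesis using assms by (simp add: carrier_DS DS_simps component_simps)
qed

lemma DS_add_closed: assumes "f \<in> carrier DS" "g \<in> carrier DS" shows "f \<oplus>\<^bsub>DS\<^esub> g \<in> carrier DS"
proof -
 have "{n \<in> N. (f \<oplus>\<^bsub>DS\<^esub> g) n \<noteq> \<zero>\<^bsub>M n\<^esub>} \<subseteq> {n \<in> N. f n \<noteq> \<zero>\<^bsub>M n\<^esub>} \<union> {n \<in> N. g n \<noteq> \<zero>\<^bsub>M n\<^esub>}"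
  by (auto simp: DS_simps component_simps)
 moreover have "finite ({n \<in> N. f n \<noteq> \<zero>\<^bsub>M n\<^esub>} \<union> {n \<in> N. g n \<noteq> \<zero>\<^bsub>M n\<^esub>})"
  using assms by (simp add: carrier_DS)
 ultimately have "finite {n \<in> N. (f \<oplus>\<^bsub>DS\<^esub> g) n \<noteq> \<zero>\<^bsub>M n\<^esub>}" by (rule finite_subset)
 then show ?thesis using assms by (simp add: carrier_DS DS_simps component_simps)
qed

lemma DS_module: "module R DS"
proof -
 have pt: "restrict f N = restrict g N" if "\<And>n. n \<in> N \<Longrightarrow> f n = g n" for f g :: "'i \<Rightarrow> 'b"
  using that by (auto simp: restrict_def)
 have ext: "restrict f N = f" if "f \<in> carrier DS" for f
  using that by (simp add: carrier_DS extensional_restrict)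
 have c: "n \<in> N \<Longrightarrow> f n \<in> carrier (M n)" if "f \<in> carrier DS" for f n using that by (simp add: carrier_DS)
 show ?thesis
 proof (rule moduleI)
  show "cring R" by (rule is_cring)
  show "abelian_group DS"
  proof (rule abelian_groupI)
   show "\<zero>\<^bsub>DS\<^esub> \<in> carrier DS" by (simp add: carrier_DS DS_simps component_simps)
   fix f assume f: "f \<in> carrier DS"
   show "\<zero>\<^bsub>DS\<^esub> \<oplus>\<^bsub>DS\<^esub> f = f"
    by (subst (2) ext[OF f, symmetric]) (auto simp: DS_simps component_simps c[OF f] intro!: pt)
   show "\<exists>g\<in>carrier DS. g \<oplus>\<^bsub>DS\<^esub> f = \<zero>\<^bsub>DS\<^esub>"
    by (rule bexI[OF _ DS_smult_closed[of "\<ominus> \<one>", OF _ f]])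
     (auto simp: DS_simps component_simps c[OF f] intro!: pt)
   fix g assume g: "g \<in> carrier DS"
   show "f \<oplus>\<^bsub>DS\<^esub> g = g \<oplus>\<^bsub>DS\<^esub> f"
    unfolding DS_simps by (rule pt) (use f g c abelian_monoid.a_comm[OF abelian_group.axioms(1)[OF module.axioms(2)[OF M_module]]] in blast)
   fix h assume h: "h \<in> carrier DS"
   show "f \<oplus>\<^bsub>DS\<^esub> g \<oplus>\<^bsub>DS\<^esub> h = f \<oplus>\<^bsub>DS\<^esub> (g \<oplus>\<^bsub>DS\<^esub> h)"
    unfolding DS_simps
    by (rule pt) (simp add: f g h c abelian_monoid.a_assoc[OF abelian_group.axioms(1)[OF module.axioms(2)[OF M_module]]])
  qed (rule DS_add_closed)
 next
  fix a f assume af: "a \<in> carrier R" "f \<in> carrier DS"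
  show "a \<odot>\<^bsub>DS\<^esub> f \<in> carrier DS" using af by (rule DS_smult_closed)
  show "(a \<oplus> b) \<odot>\<^bsub>DS\<^esub> f = a \<odot>\<^bsub>DS\<^esub> f \<oplus>\<^bsub>DS\<^esub> b \<odot>\<^bsub>DS\<^esub> f" if "b \<in> carrier R" for b
   unfolding DS_simps by (rule pt) (simp add: af that c module.smult_l_distr[OF M_module])
  show "(a \<otimes> b) \<odot>\<^bsub>DS\<^esub> f = a \<odot>\<^bsub>DS\<^esub> (b \<odot>\<^bsub>DS\<^esub> f)" if "b \<in> carrier R" for b
   unfolding DS_simps by (rule pt) (simp add: af that c module.smult_assoc1[OF M_module])
  show "a \<odot>\<^bsub>DS\<^esub> (f \<oplus>\<^bsub>DS\<^esub> g) = a \<odot>\<^bsub>DS\<^esub> f \<oplus>\<^bsub>DS\<^esub> a \<odot>\<^bsub>DS\<^esub> g" if "g \<in> carrier DS" for g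
   unfolding DS_simps by (rule pt) (simp add: af that c module.smult_r_distr[OF M_module])
 next
  fix f assume f: "f \<in> carrier DS"
  show "\<one> \<odot>\<^bsub>DS\<^esub> f = f"
   by (subst (2) ext[OF f, symmetric]) (auto simp: DS_simps c[OF f] module.smult_one[OF M_module] intro!: pt)
 qed
qed

definition summand :: "'i \<Rightarrow> 'b \<Rightarrow> 'i \<Rightarrow> 'b" where
 "summand n u = (\<lambda>m\<in>N. if m = n then u else \<zero>\<^bsub>M m\<^esub>)"

lemma summand_hom: "n \<in> N \<Longrightarrow> summand n \<in> mod_hom R (M n) DS"
 by (rule mod_homI)
  (auto simp: carrier_DS summand_def component_simps DS_simps fun_eq_iff
   intro: finite_subset[of _ "{n}"])

lemma DS_span:
 assumes H: "submodule H R DS" and s: "\<And>n u. n \<in> N \<Longrightarrow> u \<in> carrier (M n) \<Longrightarrow> summand n u \<in> H"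
  and f: "f \<in> carrier DS"
 shows "f \<in> H"
proof -
 note H' = module.submoduleD[OF DS_module H]
 have "finite F \<Longrightarrow> f \<in> carrier DS \<Longrightarrow> {n \<in> N. f n \<noteq> \<zero>\<^bsub>M n\<^esub>} \<subseteq> F \<Longrightarrow> f \<in> H" for F f
 proof (induction F arbitrary: f rule: finite_induct)
  case empty
  then have "f = \<zero>\<^bsub>DS\<^esub>" by (fastforce simp: DS_simps carrier_DS extensional_def fun_eq_iff)
  then show ?case using H'(2) by simp
 next
  case (insert n F)
  show ?case
  proof (cases "n \<in> N")
   case True
   define f' where "f' = f(n := \<zero>\<^bsub>M n\<^esub>)"
   have fin: "finite {m \<in> N. f m \<noteq> \<zero>\<^bsub>M m\<^esub>}" using insert.prems by (simp add: carrier_DS)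
   then have "f' \<in> carrier DS"
    using insert.prems True unfolding carrier_DS f'_def
    by (auto simp: component_simps extensional_def intro: finite_subset[OF _ fin])
   moreover from this have "f' \<in> H" by (rule insert.IH) (use insert.prems(2) in \<open>auto simp: f'_def split: if_splits\<close>)
   moreover have fn: "f n \<in> carrier (M n)" using insert.prems(1) True by (simp add: carrier_DS)
   moreover have "f = summand n (f n) \<oplus>\<^bsub>DS\<^esub> f'"
    using insert.prems(1) True
    by (auto simp: fun_eq_iff DS_simps summand_def f'_def component_simps carrier_DS extensional_def)
   ultimately show ?thesis using H'(3)[OF s[OF True fn]] by metis
  next
   case False
   then show ?thesis using insert by auto
  qed
 qed
 then show ?thesis using f by (auto simp: carrier_DS)
qed

lemma DS_hom_unique:
 assumes B: "module R B" and h: "h \<in> mod_hom R DS B" "h' \<in> mod_hom R DS B"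
  and eq: "\<And>n u. n \<in> N \<Longrightarrow> u \<in> carrier (M n) \<Longrightarrow> h (summand n u) = h' (summand n u)"
  and f: "f \<in> carrier DS"
 shows "h f = h' f"
proof -
 interpret D: module R DS by (rule DS_module)
 have "f \<in> {f \<in> carrier DS. h f = h' f}"
 proof (rule DS_span[OF _ _ f])
  show "submodule {f \<in> carrier DS. h f = h' f} R DS"
   using mod_hom_zero[OF DS_module B h(1)] mod_hom_zero[OF DS_module B h(2)]
   by (intro D.submoduleI') (auto simp: mod_homD[OF h(1)] mod_homD[OF h(2)])
 qed (use eq mod_homD(1)[OF summand_hom] in auto)
 then show ?thesis by simp
qed

lemma sym_DS_hom_unique:
 assumes B: "algebra R B" and h: "h \<in> alg_hom R (sym_algebra R DS) B" "h' \<in> alg_hom R (sym_algebra R DS) B"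
  and eq: "\<And>n u. n \<in> N \<Longrightarrow> u \<in> carrier (M n) \<Longrightarrow>
   h (sym_incl R DS (summand n u)) = h' (sym_incl R DS (summand n u))"
  and x: "x \<in> carrier (sym_algebra R DS)"
 shows "h x = h' x"
proof (rule alg_generates_hom_unique[OF module.sym_algebra_algebra[OF DS_module] B module.sym_generated[OF DS_module] h _ x])
 note i = module.sym_incl_hom[OF DS_module]
 fix s assume "s \<in> sym_incl R DS ` carrier DS"
 then obtain f where f: "f \<in> carrier DS" "s = sym_incl R DS f" by blast
 have "(h \<circ> sym_incl R DS) f = (h' \<circ> sym_incl R DS) f"
  by (rule DS_hom_unique[OF algebra.module[OF B] mod_hom_comp[OF i alg_mod_hom[OF h(1)]]
    mod_hom_comp[OF i alg_mod_hom[OF h(2)]] _ f(1)]) (simp add: eq)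
 then show "h s = h' s" using f by simp
qed

lemma
 assumes B: "module R B" and h: "\<And>n. n \<in> N \<Longrightarrow> h n \<in> mod_hom R (M n) B"
 shows direct_sum_lift_hom: "direct_sum_lift N M B h \<in> mod_hom R DS B"
  and direct_sum_lift_summand: "n \<in> N \<Longrightarrow> u \<in> carrier (M n) \<Longrightarrow> direct_sum_lift N M B h (summand n u) = h n u"
proof -
 interpret B: module R B by (rule B)
 note hD = mod_homD[OF h]
 have h0: "h n \<zero>\<^bsub>M n\<^esub> = \<zero>\<^bsub>B\<^esub>" if "n \<in> N" for n by (rule mod_hom_zero[OF M_module[OF that] B h[OF that]])
 have sup: "direct_sum_lift N M B h f = (\<Oplus>\<^bsub>B\<^esub>n\<in>F. h n (f n))"
  if "f \<in> carrier DS" "finite F" "{n \<in> N. f n \<noteq> \<zero>\<^bsub>M n\<^esub>} \<subseteq> F" "F \<subseteq> N" for f F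
  unfolding direct_sum_lift_def using that h0
  by (intro B.M.add.finprod_mono_neutral_cong_left) (auto simp: carrier_DS Pi_iff hD(1) subset_iff)
 have fc: "(\<lambda>n. h n (f n)) \<in> F \<rightarrow> carrier B" if "f \<in> carrier DS" "F \<subseteq> N" for f F
  using that by (auto simp: carrier_DS hD(1))
 show "direct_sum_lift N M B h \<in> mod_hom R DS B"
 proof (rule mod_homI)
  fix f assume f: "f \<in> carrier DS"
  let ?F = "{n \<in> N. f n \<noteq> \<zero>\<^bsub>M n\<^esub>}"
  have F: "finite ?F" "?F \<subseteq> N" using f by (auto simp: carrier_DS)
  show "direct_sum_lift N M B h f \<in> carrier B"
   unfolding direct_sum_lift_def by (rule B.M.finsum_closed[OF fc[OF f F(2)]])
  show "direct_sum_lift N M B h (a \<odot>\<^bsub>DS\<^esub> f) = a \<odot>\<^bsub>B\<^esub> direct_sum_lift N M B h f" if a: "a \<in> carrier R" for a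
  proof -
   have "direct_sum_lift N M B h (a \<odot>\<^bsub>DS\<^esub> f) = (\<Oplus>\<^bsub>B\<^esub>n\<in>?F. h n ((a \<odot>\<^bsub>DS\<^esub> f) n))"
    using a by (intro sup[OF DS_smult_closed[OF a f] F(1) _ F(2)]) (auto simp: DS_simps component_simps)
   also have "\<dots> = (\<Oplus>\<^bsub>B\<^esub>n\<in>?F. a \<odot>\<^bsub>B\<^esub> h n (f n))"
    using f a by (intro B.M.add.finprod_cong') (auto simp: DS_simps hD carrier_DS)
   also have "\<dots> = a \<odot>\<^bsub>B\<^esub> (\<Oplus>\<^bsub>B\<^esub>n\<in>?F. h n (f n))"
    by (rule B.finsum_smult_ldistr[OF F(1) a fc[OF f F(2)], symmetric])
   finally show ?thesis by (simp add: direct_sum_lift_def)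
  qed
  fix g assume g: "g \<in> carrier DS"
  let ?G = "?F \<union> {n \<in> N. g n \<noteq> \<zero>\<^bsub>M n\<^esub>}"
  have G: "finite ?G" "?G \<subseteq> N" using f g by (auto simp: carrier_DS)
  have "direct_sum_lift N M B h (f \<oplus>\<^bsub>DS\<^esub> g) = (\<Oplus>\<^bsub>B\<^esub>n\<in>?G. h n ((f \<oplus>\<^bsub>DS\<^esub> g) n))"
   by (intro sup[OF DS_add_closed[OF f g] G(1) _ G(2)]) (auto simp: DS_simps component_simps)
  also have "\<dots> = (\<Oplus>\<^bsub>B\<^esub>n\<in>?G. h n (f n) \<oplus>\<^bsub>B\<^esub> h n (g n))"
   using f g by (intro B.M.add.finprod_cong') (auto simp: DS_simps hD carrier_DS)
  also have "\<dots> = (\<Oplus>\<^bsub>B\<^esub>n\<in>?G. h n (f n)) \<oplus>\<^bsub>B\<^esub> (\<Oplus>\<^bsub>B\<^esub>n\<in>?G. h n (g n))"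
   by (rule B.M.finsum_addf[OF fc[OF f G(2)] fc[OF g G(2)]])
  also have "\<dots> = direct_sum_lift N M B h f \<oplus>\<^bsub>B\<^esub> direct_sum_lift N M B h g"
   using sup[OF f G(1) _ G(2)] sup[OF g G(1) _ G(2)] by simp
  finally show "direct_sum_lift N M B h (f \<oplus>\<^bsub>DS\<^esub> g) = direct_sum_lift N M B h f \<oplus>\<^bsub>B\<^esub> direct_sum_lift N M B h g" .
 qed
 show "direct_sum_lift N M B h (summand n u) = h n u" if n: "n \<in> N" and u: "u \<in> carrier (M n)"
 proof -
  have "direct_sum_lift N M B h (summand n u) = (\<Oplus>\<^bsub>B\<^esub>m\<in>{n}. h m (summand n u m))"
   using n by (intro sup mod_homD(1)[OF summand_hom[OF n] u]) (auto simp: summand_def split: if_splits)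
  also have "\<dots> = h n u" using n u by (simp add: hD(1) summand_def)
  finally show ?thesis .
 qed
qed

lemma direct_sum_map_hom:
 assumes M': "module_family R N M'" and h: "\<And>n. n \<in> N \<Longrightarrow> h n \<in> mod_hom R (M n) (M' n)"
 shows "direct_sum_map N h \<in> mod_hom R DS (direct_sum N M')"
  and "n \<in> N \<Longrightarrow> direct_sum_map N h (summand n u) = module_family.summand N M' n (h n u)"
proof -
 interpret M': module_family R N M' by (rule M')
 note hD = mod_homD[OF h]
 have h0: "h n \<zero>\<^bsub>M n\<^esub> = \<zero>\<^bsub>M' n\<^esub>" if "n \<in> N" for n
  by (rule mod_hom_zero[OF M_module[OF that] M'.M_module[OF that] h[OF that]])
 show "direct_sum_map N h \<in> mod_hom R DS (direct_sum N M')"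
 proof (rule mod_homI)
  fix f assume f: "f \<in> carrier DS"
  have "{n \<in> N. direct_sum_map N h f n \<noteq> \<zero>\<^bsub>M' n\<^esub>} \<subseteq> {n \<in> N. f n \<noteq> \<zero>\<^bsub>M n\<^esub>}"
   using h0 by (auto simp: direct_sum_map_def)
  then have "finite {n \<in> N. direct_sum_map N h f n \<noteq> \<zero>\<^bsub>M' n\<^esub>}" using f by (auto simp: carrier_DS intro: finite_subset)
  then show "direct_sum_map N h f \<in> carrier (direct_sum N M')"
   using f by (simp add: carrier_DS M'.carrier_DS direct_sum_map_def hD(1))
 qed (auto simp: direct_sum_map_def DS_simps M'.DS_simps hD carrier_DS fun_eq_iff)
 show "n \<in> N \<Longrightarrow> direct_sum_map N h (summand n u) = M'.summand n (h n u)"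
  by (auto simp: direct_sum_map_def summand_def M'.summand_def h0 fun_eq_iff)
qed

end

section \<open>Projective modules and rescaling of polynomial variables\<close>

context cring
begin

lemma free_hom_unique:
 assumes M: "module R M" and h: "h \<in> mod_hom R (free_module R S) M" "h' \<in> mod_hom R (free_module R S) M"
  and eq: "\<And>s. s \<in> S \<Longrightarrow> h (basis_elt R s) = h' (basis_elt R s)" and p: "p \<in> carrier (free_module R S)"
 shows "h p = h' p"
 using p
proof (induction rule: free_module_induct)
 case zero
 show ?case using mod_hom_zero[OF free_module_module M h(1)] mod_hom_zero[OF free_module_module M h(2)]
  by (simp add: free_module_simps)
next
 case (basis a s p)
 have "(\<lambda>t. a \<otimes> basis_elt R s t \<oplus> p t) = a \<odot>\<^bsub>free_module R S\<^esub> basis_elt R s \<oplus>\<^bsub>free_module R S\<^esub> p"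
  by (simp add: free_module_simps)
 moreover have "a \<odot>\<^bsub>free_module R S\<^esub> basis_elt R s \<in> carrier (free_module R S)"
  using module.smult_closed[OF free_module_module basis(1) free_module_closed(2)[OF basis(2)]] .
 ultimately show ?case using basis free_module_closed(2)[OF basis(2)] eq
  by (simp add: mod_homD[OF h(1)] mod_homD[OF h(2)])
qed

text \<open>The basis can be replaced by the elements of \<open>P\<close>, since the retraction factors through their
 free module.\<close>

lemma projective_transport:
 fixes P :: "('a, 'c, 'p) module_scheme" and Q :: "('a, 'd, 'q) module_scheme"
 assumes P: "module R P" and Q: "projective_module R Q" and f: "f \<in> mod_hom R P Q"
  and bij: "bij_betw f (carrier P) (carrier Q)"
 shows "projective_module R P"
proof -
 obtain S :: "'d set" and i r where ir: "i \<in> mod_hom R Q (free_module R S)" "r \<in> mod_hom R (free_module R S) Q"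
  "\<And>x. x \<in> carrier Q \<Longrightarrow> r (i x) = x" using Q unfolding projective_module_def by blast
 interpret P: module R P by (rule P)
 interpret FP: module R "free_module R (carrier P)" by (rule free_module_module)
 define g where "g = the_inv_into (carrier P) f"
 have inj: "inj_on f (carrier P)" and im: "f ` carrier P = carrier Q" using bij by (auto simp: bij_betw_def)
 have gf: "g (f x) = x" if "x \<in> carrier P" for x using the_inv_into_f_f[OF inj that] by (simp add: g_def)
 have gc: "g y \<in> carrier P" if "y \<in> carrier Q" for y
  using that gf unfolding im[symmetric] by auto
 have gh: "g \<in> mod_hom R Q P"
 proof (rule mod_homI)
  fix y assume "y \<in> carrier Q"
  then obtain x where x: "x \<in> carrier P" "y = f x" using im by blast
  show "g y \<in> carrier P" using x gf by simp
  show "g (a \<odot>\<^bsub>Q\<^esub> y) = a \<odot>\<^bsub>P\<^esub> g y" if "a \<in> carrier R" for a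
   using that x gf[of "a \<odot>\<^bsub>P\<^esub> x"] by (simp add: gf mod_homD[OF f])
  fix y' assume "y' \<in> carrier Q"
  then obtain x' where x': "x' \<in> carrier P" "y' = f x'" using im by blast
  show "g (y \<oplus>\<^bsub>Q\<^esub> y') = g y \<oplus>\<^bsub>P\<^esub> g y'"
   using x x' gf[of "x \<oplus>\<^bsub>P\<^esub> x'"] by (simp add: gf mod_homD[OF f])
 qed
 define b where "b s = basis_elt R (g (r (basis_elt R s)))" for s
 have sc: "g (r (basis_elt R s)) \<in> carrier P" if "s \<in> S" for s
  using gc mod_homD(1)[OF ir(2) free_module_closed(2)[OF that]] by simp
 have b: "b \<in> S \<rightarrow> carrier (free_module R (carrier P))" using free_module_closed(2)[OF sc] by (simp add: b_def)
 have id: "(\<lambda>x. x) \<in> carrier P \<rightarrow> carrier P" by simp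
 note L = FP.lin_ext_hom[OF b] and L' = P.lin_ext_hom[OF id]
 have eq: "(lin_ext P (\<lambda>x. x) \<circ> lin_ext (free_module R (carrier P)) b) p = (g \<circ> r) p" if "p \<in> carrier (free_module R S)" for p
  by (rule free_hom_unique[OF P mod_hom_comp[OF L L'] mod_hom_comp[OF ir(2) gh] _ that])
   (simp add: FP.lin_ext_basis[OF b], simp add: b_def P.lin_ext_basis[OF id] sc)
 show ?thesis unfolding projective_module_def
 proof (intro conjI exI bexI ballI)
  show "lin_ext (free_module R (carrier P)) b \<circ> (i \<circ> f) \<in> mod_hom R P (free_module R (carrier P))"
   by (rule mod_hom_comp[OF mod_hom_comp[OF f ir(1)] L])
  fix x assume x: "x \<in> carrier P"
  have fx: "f x \<in> carrier Q" by (rule mod_homD(1)[OF f x])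
  show "lin_ext P (\<lambda>x. x) ((lin_ext (free_module R (carrier P)) b \<circ> (i \<circ> f)) x) = x"
   using eq[OF mod_homD(1)[OF ir(1) fx]] by (simp add: ir(3)[OF fx] gf x)
 qed (rule P L')+
qed

text \<open>Preimages are chosen for the images of the basis and extended linearly; precomposition
  with the embedding into the free module gives the section. It will supply the splittings.\<close>

lemma projective_section:
 fixes P :: "('a, 'c, 'p) module_scheme"
 assumes P: "projective_module R P" and M: "module R M" and \<pi>: "\<pi> \<in> mod_hom R M P" "\<pi> ` carrier M = carrier P"
 shows "\<exists>i\<in>mod_hom R P M. \<forall>x\<in>carrier P. \<pi> (i x) = x"
proof -
 obtain S :: "'c set" and i r where ir: "i \<in> mod_hom R P (free_module R S)" "r \<in> mod_hom R (free_module R S) P"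
  "\<And>x. x \<in> carrier P \<Longrightarrow> r (i x) = x" using P unfolding projective_module_def by blast
 have Pm: "module R P" using P unfolding projective_module_def by (rule conjunct1)
 interpret M: module R M by (rule M)
 define b where "b s = (SOME x. x \<in> carrier M \<and> \<pi> x = r (basis_elt R s))" for s
 have b': "b s \<in> carrier M \<and> \<pi> (b s) = r (basis_elt R s)" if "s \<in> S" for s
 proof -
  have "r (basis_elt R s) \<in> \<pi> ` carrier M" unfolding \<pi>(2) by (rule mod_homD(1)[OF ir(2) free_module_closed(2)[OF that]])
  then have "\<exists>x. x \<in> carrier M \<and> \<pi> x = r (basis_elt R s)" by auto
  then show ?thesis unfolding b_def by (rule someI_ex)
 qed
 then have b: "b \<in> S \<rightarrow> carrier M" by blast
 have eq: "(\<pi> \<circ> lin_ext M b) p = r p" if "p \<in> carrier (free_module R S)" for p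
  by (rule free_hom_unique[OF Pm mod_hom_comp[OF M.lin_ext_hom[OF b] \<pi>(1)] ir(2) _ that])
   (simp add: M.lin_ext_basis[OF b] b')
 show ?thesis
 proof (rule bexI[OF _ mod_hom_comp[OF ir(1) M.lin_ext_hom[OF b]]], rule ballI)
  fix x assume x: "x \<in> carrier P"
  show "\<pi> ((lin_ext M b \<circ> i) x) = x" using eq[OF mod_homD(1)[OF ir(1) x]] ir(3)[OF x] by simp
 qed
qed

text \<open>The coefficient at a monomial is multiplied by the product of the weights of its
  variables, a non-zero integer, and A is torsion-free.\<close>

lemma poly_scaling_inj:
 assumes TF: "additively_torsion_free R" and w: "\<And>v. v \<in> V \<Longrightarrow> w v \<noteq> (0::nat)"
  and D: "D \<in> alg_hom R (poly_algebra R V) (poly_algebra R V)"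
  and Dv: "\<And>v. v \<in> V \<Longrightarrow> D (poly_var R v) = add_pow R (w v) \<one> \<odot>\<^bsub>poly_algebra R V\<^esub> poly_var R v"
 shows "inj_on D (carrier (poly_algebra R V))"
proof -
 let ?A = "poly_algebra R V"
 interpret PC: cring ?A by (rule algebra.M_cring[OF poly_algebra_algebra])
 interpret PA: algebra R ?A by (rule poly_algebra_algebra)
 note D' = alg_homD[OF D]
 let ?W = "\<lambda>m. \<Prod>v\<in>#m. w v"
 have Db: "D (basis_elt R m) = add_pow R (?W m) \<one> \<odot>\<^bsub>?A\<^esub> basis_elt R m" if "set_mset m \<subseteq> V" for m
  using that
 proof (induction m)
  case empty
  have "D \<one>\<^bsub>?A\<^esub> = \<one>\<^bsub>?A\<^esub>" by (rule D'(5))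
  then show ?case using PA.smult_one[OF PC.one_closed] by (simp add: poly_simps(2) One_nat_def)
 next
  case (add v m)
  have c: "poly_var R v \<in> carrier ?A" "basis_elt R m \<in> carrier ?A"
   using add.prems by (auto intro: poly_var_closed basis_poly_closed)
  have e: "basis_elt R (add_mset v m) = poly_var R v \<otimes>\<^bsub>?A\<^esub> basis_elt R m"
   using basis_poly_mult[of "{#v#}" V m] add.prems by (simp add: poly_var_def)
  have "D (basis_elt R (add_mset v m)) = (add_pow R (w v) \<one> \<odot>\<^bsub>?A\<^esub> poly_var R v) \<otimes>\<^bsub>?A\<^esub> (add_pow R (?W m) \<one> \<odot>\<^bsub>?A\<^esub> basis_elt R m)"
   unfolding e D'(4)[OF c] using add Dv by simp
  also have "\<dots> = (add_pow R (w v) \<one> \<otimes> add_pow R (?W m) \<one>) \<odot>\<^bsub>?A\<^esub> (poly_var R v \<otimes>\<^bsub>?A\<^esub> basis_elt R m)"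
   using c by (simp add: PA.smult_assoc2 PA.smult_assoc1 PC.m_comm[of "poly_var R v"])
  also have "add_pow R (w v) \<one> \<otimes> add_pow R (?W m) \<one> = add_pow R (?W (add_mset v m)) \<one>"
   by (simp add: add_pow_ldistr add.nat_pow_pow mult.commute)
  finally show ?case unfolding e .
 qed
 have coeff: "D p m = add_pow R (?W m) \<one> \<otimes> p m" if "p \<in> carrier ?A" for p m
 proof -
  have "p \<in> carrier (free_module R {m. set_mset m \<subseteq> V})" using that by (auto simp: carrier_free_module carrier_poly)
  then show ?thesis
  proof (induction rule: free_module_induct)
   case zero
   then show ?case using mod_hom_zero[OF PA.module_axioms PA.module_axioms alg_mod_hom[OF D]] by (simp add: poly_simps)
  next
   case (basis a s p)
   have c: "basis_elt R s \<in> carrier ?A" "p \<in> carrier ?A"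
    using basis(2,3) basis_poly_closed[of s V] by (auto simp: carrier_free_module carrier_poly)
   have "(\<lambda>t. a \<otimes> basis_elt R s t \<oplus> p t) = a \<odot>\<^bsub>?A\<^esub> basis_elt R s \<oplus>\<^bsub>?A\<^esub> p" by (simp add: poly_simps)
   moreover have "D (a \<odot>\<^bsub>?A\<^esub> basis_elt R s \<oplus>\<^bsub>?A\<^esub> p) = a \<odot>\<^bsub>?A\<^esub> D (basis_elt R s) \<oplus>\<^bsub>?A\<^esub> D p"
    using basis(1) c by (simp add: D')
   moreover have "p m \<in> carrier R" using c by (simp add: carrier_poly)
   ultimately show ?case using basis Db[of s]
    by (auto simp: poly_simps(3,4) basis_elt_def r_distr m_comm)
  qed
 qed
 show ?thesis
 proof (rule mod_hom_inj_onI[OF PA.module_axioms PA.module_axioms alg_mod_hom[OF D]])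
  fix p assume p: "p \<in> carrier ?A" "D p = \<zero>\<^bsub>?A\<^esub>"
  have "p m = \<zero>" for m
  proof (cases "set_mset m \<subseteq> V")
   case True
   have pm: "p m \<in> carrier R" using p by (simp add: carrier_poly)
   have W: "?W m \<noteq> 0" using True w by (induction m) auto
   have "add_pow R (?W m) (p m) = \<zero>"
    using coeff[OF p(1), of m] p(2) pm by (simp add: poly_simps add_pow_ldistr)
   then show ?thesis by (rule torsion_free_natD[OF TF _ pm W])
  qed (use p in \<open>simp add: carrier_poly\<close>)
  then show "p = \<zero>\<^bsub>?A\<^esub>" by (simp add: poly_simps fun_eq_iff)
 qed
qed

end

section \<open>Symmetric algebras of the indecomposables\<close>

lemma (in module) mod_hom_smult:
 assumes "h \<in> mod_hom R N M" "c \<in> carrier R"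
 shows "(\<lambda>x. c \<odot>\<^bsub>M\<^esub> h x) \<in> mod_hom R N M"
proof (rule mod_homI)
 note h = mod_homD[OF assms(1)]
 show "c \<odot>\<^bsub>M\<^esub> h (a \<odot>\<^bsub>N\<^esub> x) = a \<odot>\<^bsub>M\<^esub> (c \<odot>\<^bsub>M\<^esub> h x)" if "a \<in> carrier R" "x \<in> carrier N" for a x
  using that assms(2) by (simp add: h smult_assoc1[symmetric] R.m_comm)
qed (use assms(2) mod_homD[OF assms(1)] in \<open>simp_all add: smult_r_distr\<close>)

lemma (in algebra) mod_hom_scalar:
 assumes "h \<in> mod_hom R N (self_module R)" "x \<in> carrier M"
 shows "(\<lambda>u. h u \<odot>\<^bsub>M\<^esub> x) \<in> mod_hom R N M"
 using mod_homD[OF assms(1), unfolded self_module_simps] assms(2)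
 by (intro mod_homI) (simp_all add: smult_l_distr smult_assoc1)

context cring
begin

lemma self_module_family: "module_family R N (\<lambda>n. self_module R)"
 by (intro module_family.intro module_family_axioms.intro is_cring self_module_module)

lemma ideal_module_simps:
 "carrier (ideal_module R I) = I" "\<zero>\<^bsub>ideal_module R I\<^esub> = \<zero>" "x \<oplus>\<^bsub>ideal_module R I\<^esub> y = x \<oplus> y"
 "a \<odot>\<^bsub>ideal_module R I\<^esub> x = a \<otimes> x"
 by (simp_all add: ideal_module_def self_module_def)

lemma ideal_module_module: "ideal I R \<Longrightarrow> module R (ideal_module R I)"
 unfolding ideal_module_def
 by (rule submodule.submodule_is_module[OF _ self_module_module]) (simp add: submodule_self_iff)

text \<open>Induction on the degree. The difference of x and a lift y of its indecomposable class is
  decomposable, hence a combination of products of elements of lower degree, which are known to lie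
  in the family. Indexing \<open>K\<close> by the degree serves two purposes: a constant family
  gives the surjectivity of \<open>i_sharp\<close>, and a graded family gives the compatibility of
  an isomorphism with gradings.\<close>

lemma lazard_degree_into:
 assumes K: "\<And>d. submodule (K d) R LZ" "\<one>\<^bsub>LZ\<^esub> \<in> K 0" "\<And>d e x y. x \<in> K d \<Longrightarrow> y \<in> K e \<Longrightarrow> x \<otimes>\<^bsub>LZ\<^esub> y \<in> K (d + e)"
  and sec: "\<And>n u. 1 < n \<Longrightarrow> u \<in> carrier (indec R n) \<Longrightarrow>
    \<exists>x. x \<in> K (2 * (n - 1)) \<and> x \<in> lazard_degree R (2 * (n - 1)) \<and> indec_proj R n x = u"
 shows "lazard_degree R d \<subseteq> K d"
proof (induction d rule: less_induct)
 case (less d)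
 show ?case
 proof (cases "d = 0 \<or> odd d")
  case True
  then show ?thesis using K by (intro lazard_degree_0_odd) auto
 next
  case False
  \<comment> \<open>The index for which d = 2 (n - 1).\<close>
  define n where "n = d div 2 + 1"
  have d: "d = 2 * (n - 1)" and n: "1 < n" using False by (auto simp: n_def elim!: evenE)
  let ?P = "lazard_part R (n - 1)"
  interpret P: module R ?P by (rule lazard_part_module)
  interpret E: module R "indec R n" by (rule indec_module)
  note KD = module.submoduleD[OF algebra.module[OF lazard_algebra] K(1)]
  show ?thesis
  proof
   fix x assume x: "x \<in> lazard_degree R d"
   then have xP: "x \<in> carrier ?P" using d by (simp add: lazard_part_simps)
   obtain y where y: "y \<in> K d" "y \<in> lazard_degree R d" "indec_proj R n y = indec_proj R n x"
    using sec[OF n mod_homD(1)[OF indec_proj_hom xP]] d by auto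
   have yP: "y \<in> carrier ?P" using y d by (simp add: lazard_part_simps)
   have xy: "x \<ominus>\<^bsub>?P\<^esub> y \<in> carrier ?P" using xP yP by simp
   have "indec_proj R n (x \<ominus>\<^bsub>?P\<^esub> y) = \<zero>\<^bsub>indec R n\<^esub>"
    using mod_hom_minus[OF P.module_axioms E.module_axioms indec_proj_hom xP yP] y(3) mod_homD(1)[OF indec_proj_hom xP]
    by (simp add: E.M.minus_zero_iff)
   then have "x \<ominus>\<^bsub>?P\<^esub> y \<in> mod_span R ?P (decomposable_products (n - 1))"
    using indec_proj_eq_zero_iff[of "x \<ominus>\<^bsub>?P\<^esub> y" n] xy unfolding decomposables_eq lazard_part_simps by simp
   moreover have "mod_span R ?P (decomposable_products (n - 1)) \<subseteq> {z \<in> carrier ?P. z \<in> K d}"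
   proof (rule P.mod_span_minimal)
    show "submodule {z \<in> carrier ?P. z \<in> K d} R ?P"
     using KD P.M.zero_closed P.M.a_closed P.smult_closed
     by (intro P.submoduleI') (auto simp: lazard_part_simps)
    show "decomposable_products (n - 1) \<subseteq> {z \<in> carrier ?P. z \<in> K d}"
    proof
     fix z assume z: "z \<in> decomposable_products (n - 1)"
     then obtain v w a b where "z = v \<otimes>\<^bsub>LZ\<^esub> w" "a < d" "b < d" "a + b = d"
       "v \<in> lazard_degree R a" "w \<in> lazard_degree R b"
      unfolding decomposable_products_def d by blast
     then have "z \<in> K d" using less[of a] less[of b] K(3)[of v a w b] by auto
     then show "z \<in> {z \<in> carrier ?P. z \<in> K d}" using z decomposable_products_closed by blast
    qed
   qed
   ultimately have "x \<ominus>\<^bsub>?P\<^esub> y \<in> K d" by blast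
   then have "(x \<ominus>\<^bsub>?P\<^esub> y) \<oplus>\<^bsub>LZ\<^esub> y \<in> K d" using y(1) by (rule KD(3))
   moreover have "(x \<ominus>\<^bsub>?P\<^esub> y) \<oplus>\<^bsub>?P\<^esub> y = x" using xP yP by (simp add: P.M.minus_eq P.M.a_assoc P.M.l_neg)
   ultimately show "x \<in> K d" by (simp add: lazard_part_simps)
  qed
 qed
qed

end

section \<open>The hypotheses of the theorem and the map Symm(sigma)\<close>

locale injective_fundamental = cring R for R :: "('a, 'm) ring_scheme" (structure) +
 assumes torsion_free: "additively_torsion_free R"
  and functional_inj: "1 < n \<Longrightarrow> inj_on (fundamental_functional R n) (carrier (indec R n))"
  and ideal_projective: "1 < n \<Longrightarrow> projective_module R (ideal_module R (fundamental_ideal R n))"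
begin

abbreviation "sg \<equiv> fundamental_functional R"
abbreviation "In \<equiv> fundamental_ideal R"

lemmas sg_hom = fundamental_functional_props(1)[OF torsion_free]
lemmas sg_d = fundamental_functional_props(2)[OF torsion_free]
lemmas sg_proj = fundamental_functional_props(4)[OF torsion_free]
lemmas In_ideal = fundamental_ideal_eq(2)[OF torsion_free]

lemma sg_ideal_hom: "1 < n \<Longrightarrow> sg n \<in> mod_hom R (indec R n) (ideal_module R (In n))"
 using sg_hom[of n] by (auto simp: mod_hom_def ideal_module_simps self_module_simps fundamental_ideal_def)

lemma sg_bij: "1 < n \<Longrightarrow> bij_betw (sg n) (carrier (indec R n)) (carrier (ideal_module R (In n)))"
 using functional_inj by (simp add: bij_betw_def ideal_module_simps fundamental_ideal_def)

text \<open>By injectivity the functional is an isomorphism onto the ideal, and projectivity is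
  transported back along it. This is the fundamental comparison condition.\<close>

lemma indec_projective: "1 < n \<Longrightarrow> projective_module R (indec R n)"
 by (rule projective_transport[OF indec_module ideal_projective sg_ideal_hom sg_bij])

sublocale E: module_family R "{1::nat<..}" "indec R"
 by (intro module_family.intro module_family_axioms.intro is_cring indec_module)

abbreviation "MS \<equiv> indec_sum R"
abbreviation "SY \<equiv> sym_algebra R MS"

lemma MS_module: "module R MS"
 unfolding indec_sum_def by (rule E.DS_module)

lemmas SY_algebra = module.sym_algebra_algebra[OF MS_module]

definition gen :: "nat \<Rightarrow> 'a lazard_poly set set \<Rightarrow> ((nat \<Rightarrow> 'a lazard_poly set set) list \<Rightarrow> 'a) set" where
 "gen n u = sym_incl R MS (E.summand n u)"

lemma gen_hom: "1 < n \<Longrightarrow> gen n \<in> mod_hom R (indec R n) SY"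
 using mod_hom_comp[OF E.summand_hom[of n] module.sym_incl_hom[OF MS_module, unfolded indec_sum_def]]
 by (simp add: gen_def[abs_def] indec_sum_def comp_def)

lemma SY_hom_unique:
 assumes "algebra R B" "h \<in> alg_hom R SY B" "h' \<in> alg_hom R SY B"
  and "\<And>n u. 1 < n \<Longrightarrow> u \<in> carrier (indec R n) \<Longrightarrow> h (gen n u) = h' (gen n u)" "x \<in> carrier SY"
 shows "h x = h' x"
 using E.sym_DS_hom_unique[of B h h' x] assms unfolding gen_def indec_sum_def by auto

definition sum_lift :: "('a, 'c, 'q) module_scheme \<Rightarrow> (nat \<Rightarrow> 'a lazard_poly set set \<Rightarrow> 'c) \<Rightarrow>
  (nat \<Rightarrow> 'a lazard_poly set set) \<Rightarrow> 'c" where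
 "sum_lift B h = direct_sum_lift {1<..} (indec R) B h"

lemma
 assumes B: "module R B" and h: "\<And>n. 1 < n \<Longrightarrow> h n \<in> mod_hom R (indec R n) B"
 shows sum_lift_hom: "sum_lift B h \<in> mod_hom R MS B"
  and sum_lift_summand: "1 < n \<Longrightarrow> u \<in> carrier (indec R n) \<Longrightarrow> sum_lift B h (E.summand n u) = h n u"
 unfolding sum_lift_def indec_sum_def
 using E.direct_sum_lift_hom[OF B, of h] E.direct_sum_lift_summand[OF B, of h] h by auto

lemma
 assumes B: "algebra R B" and h: "\<And>n. 1 < n \<Longrightarrow> h n \<in> mod_hom R (indec R n) B"
 shows family_lift_hom: "sym_lift R B (sum_lift B h) \<in> alg_hom R SY B"
  and family_lift_gen: "1 < n \<Longrightarrow> u \<in> carrier (indec R n) \<Longrightarrow> sym_lift R B (sum_lift B h) (gen n u) = h n u"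
proof -
 note l = sum_lift_hom[OF algebra.module[OF B], of h, OF h]
 show "sym_lift R B (sum_lift B h) \<in> alg_hom R SY B" by (rule module.sym_lift_hom[OF MS_module B l])
 assume n: "1 < n" and u: "u \<in> carrier (indec R n)"
 then have "E.summand n u \<in> carrier MS" unfolding indec_sum_def by (intro mod_homD(1)[OF E.summand_hom]) auto
 then show "sym_lift R B (sum_lift B h) (gen n u) = h n u"
  unfolding gen_def using module.sym_lift_incl[OF MS_module B l] sum_lift_summand[OF algebra.module[OF B], of h, OF h n u] by simp
qed

definition sigma_var :: "nat \<Rightarrow> 'a lazard_poly set set \<Rightarrow> nat multiset \<Rightarrow> 'a" where
 "sigma_var n u = sg n u \<odot>\<^bsub>PX\<^esub> poly_var R (n - 1)"

text \<open>The map s with its target passed to the polynomial ring. Polynomials have coefficients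
  that can be compared with those of \<open>lazard_log\<close>, unlike classes of words.\<close>

definition "sigma_hat = sym_lift R PX (sum_lift PX sigma_var)"

lemma sigma_var_hom: "1 < n \<Longrightarrow> sigma_var n \<in> mod_hom R (indec R n) PX"
 unfolding sigma_var_def[abs_def] by (rule algebra.mod_hom_scalar[OF poly_algebra_algebra sg_hom poly_var_closed]) auto

lemma sigma_hat_hom: "sigma_hat \<in> alg_hom R SY PX"
 unfolding sigma_hat_def by (rule family_lift_hom[OF poly_algebra_algebra sigma_var_hom])

lemma sigma_hat_gen: "1 < n \<Longrightarrow> u \<in> carrier (indec R n) \<Longrightarrow> sigma_hat (gen n u) = sigma_var n u"
 unfolding sigma_hat_def by (rule family_lift_gen[OF poly_algebra_algebra sigma_var_hom])

text \<open>Since \<open>\<sigma>(u) d = \<nu>(n) u\<close>, mapping the \<open>n\<close>-th variable to the class of \<open>d\<close> turns \<open>sigma_hat\<close> into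
 the embedding of the symmetric algebra into a polynomial algebra, followed by a rescaling of the
 variables.\<close>

lemma sigma_hat_inj: "inj_on sigma_hat (carrier SY)"
proof -
 have "\<forall>n. \<exists>S :: 'a lazard_poly set set set. \<exists>i r. 1 < n \<longrightarrow> i \<in> mod_hom R (indec R n) (free_module R S) \<and>
   r \<in> mod_hom R (free_module R S) (indec R n) \<and> (\<forall>x\<in>carrier (indec R n). r (i x) = x)"
  using indec_projective unfolding projective_module_def by blast
 then obtain S :: "nat \<Rightarrow> 'a lazard_poly set set set" and i r where
  ir: "\<forall>n. 1 < n \<longrightarrow> i n \<in> mod_hom R (indec R n) (free_module R (S n)) \<and>
   r n \<in> mod_hom R (free_module R (S n)) (indec R n) \<and> (\<forall>x\<in>carrier (indec R n). r n (i n x) = x)"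
  by metis
 then have i: "\<And>n. 1 < n \<Longrightarrow> i n \<in> mod_hom R (indec R n) (free_module R (S n))"
  and r: "\<And>n. 1 < n \<Longrightarrow> r n \<in> mod_hom R (free_module R (S n)) (indec R n)"
  and ri: "\<And>n x. 1 < n \<Longrightarrow> x \<in> carrier (indec R n) \<Longrightarrow> r n (i n x) = x" by auto
 define V where "V = {(n, s). 1 < n \<and> s \<in> S n}"
 let ?A = "poly_algebra R V"
 have Aa: "algebra R ?A" by (rule poly_algebra_algebra)
 interpret A: algebra R ?A by (rule Aa)
 interpret SYa: algebra R SY by (rule SY_algebra)
 define v where "v n s = poly_var R (n, s)" for n :: nat and s :: "'a lazard_poly set set"
 have v: "v n \<in> S n \<rightarrow> carrier ?A" if "1 < n" for n
  using that by (auto simp: v_def V_def intro: poly_var_closed)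
 \<comment> \<open>The coordinates of a class in its free module, written as a linear form in the
   variables (n, s).\<close>
 define \<iota> where "\<iota> n = lin_ext ?A (v n) \<circ> i n" for n
 have \<iota>: "\<iota> n \<in> mod_hom R (indec R n) ?A" if "1 < n" for n
  unfolding \<iota>_def by (rule mod_hom_comp[OF i[OF that] A.lin_ext_hom[OF v[OF that]]])
 define \<kappa> where "\<kappa> = sym_lift R ?A (sum_lift ?A \<iota>)"
 have \<kappa>: "\<kappa> \<in> alg_hom R SY ?A" and \<kappa>g: "\<And>n u. 1 < n \<Longrightarrow> u \<in> carrier (indec R n) \<Longrightarrow> \<kappa> (gen n u) = \<iota> n u"
  unfolding \<kappa>_def using family_lift_hom[OF Aa, of \<iota>] family_lift_gen[OF Aa, of \<iota>] \<iota> by auto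
 have rb: "r n (basis_elt R s) \<in> carrier (indec R n)" if "1 < n" "s \<in> S n" for n s
  by (rule mod_homD(1)[OF r[OF that(1)] free_module_closed(2)[OF that(2)]])
 \<comment> \<open>A retraction of \<open>\<kappa>\<close>, induced by the retractions
   \<open>r n\<close> of the free modules. So \<open>\<kappa>\<close> embeds the symmetric algebra
   into a polynomial algebra, although the indecomposables need not be free.\<close>
 obtain \<rho> where \<rho>: "\<rho> \<in> alg_hom R ?A SY" "\<And>w. w \<in> V \<Longrightarrow> \<rho> (poly_var R w) = (case w of (n, s) \<Rightarrow> gen n (r n (basis_elt R s)))"
  by (rule poly_algebra_lift[OF SY_algebra, of "\<lambda>w. case w of (n, s) \<Rightarrow> gen n (r n (basis_elt R s))" V])
   (auto simp: V_def rb mod_homD(1)[OF gen_hom])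
 have \<rho>v: "\<rho> (v n s) = gen n (r n (basis_elt R s))" if "1 < n" "s \<in> S n" for n s
  using \<rho>(2)[of "(n, s)"] that by (simp add: v_def V_def)
 have \<rho>\<iota>: "\<rho> (\<iota> n u) = gen n u" if n: "1 < n" and u: "u \<in> carrier (indec R n)" for n u
 proof -
  have "(\<rho> \<circ> lin_ext ?A (v n)) (i n u) = (gen n \<circ> r n) (i n u)"
   by (rule free_hom_unique[OF SYa.module_axioms mod_hom_comp[OF A.lin_ext_hom[OF v[OF n]] alg_mod_hom[OF \<rho>(1)]]
      mod_hom_comp[OF r[OF n] gen_hom[OF n]] _ mod_homD(1)[OF i[OF n] u]])
    (simp add: A.lin_ext_basis[OF v[OF n]] \<rho>v[OF n])
  then show ?thesis using ri[OF n u] by (simp add: \<iota>_def)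
 qed
 have ret: "\<rho> (\<kappa> x) = x" if "x \<in> carrier SY" for x
 proof -
  have "(\<rho> \<circ> \<kappa>) x = id x"
   by (rule SY_hom_unique[OF SY_algebra alg_hom_comp[OF \<kappa> \<rho>(1)] _ _ that])
    (simp_all add: \<kappa>g \<rho>\<iota> alg_hom_def mod_hom_def ring_hom_def)
  then show ?thesis by simp
 qed
 define c where "c n = add_pow R (nu n) \<one>" for n
 have cc: "c n \<in> carrier R" for n by (simp add: c_def)
 obtain \<delta> where \<delta>: "\<delta> \<in> alg_hom R ?A ?A" "\<And>w. w \<in> V \<Longrightarrow> \<delta> (poly_var R w) = c (fst w) \<odot>\<^bsub>?A\<^esub> poly_var R w"
  by (rule poly_algebra_lift[OF Aa, of "\<lambda>w. c (fst w) \<odot>\<^bsub>?A\<^esub> poly_var R w" V]) (auto simp: cc poly_var_closed)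
 have \<delta>v: "\<delta> (v n s) = c n \<odot>\<^bsub>?A\<^esub> v n s" if "1 < n" "s \<in> S n" for n s
  using \<delta>(2)[of "(n, s)"] that by (simp add: v_def V_def)
 have \<delta>inj: "inj_on \<delta> (carrier ?A)"
  by (rule poly_scaling_inj[OF torsion_free _ \<delta>(1), of "\<lambda>w. nu (fst w)"]) (use nu_pos \<delta>(2) in \<open>auto simp: c_def\<close>)
 have \<delta>\<iota>: "\<delta> (\<iota> n u) = c n \<odot>\<^bsub>?A\<^esub> \<iota> n u" if n: "1 < n" and u: "u \<in> carrier (indec R n)" for n u
 proof -
  have "(\<delta> \<circ> lin_ext ?A (v n)) (i n u) = (\<lambda>p. c n \<odot>\<^bsub>?A\<^esub> lin_ext ?A (v n) p) (i n u)"
   by (rule free_hom_unique[OF A.module_axioms mod_hom_comp[OF A.lin_ext_hom[OF v[OF n]] alg_mod_hom[OF \<delta>(1)]]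
      A.mod_hom_smult[OF A.lin_ext_hom[OF v[OF n]] cc] _ mod_homD(1)[OF i[OF n] u]])
    (simp add: A.lin_ext_basis[OF v[OF n]] \<delta>v[OF n])
  then show ?thesis by (simp add: \<iota>_def)
 qed
 \<comment> \<open>The variable of index k belongs to the indecomposables of index k + 1 and goes to
   the linear form of their class d.\<close>
 obtain \<chi> where \<chi>: "\<chi> \<in> alg_hom R PX ?A" "\<And>k. k \<in> {1::nat..} \<Longrightarrow> \<chi> (poly_var R k) = \<iota> (k + 1) (indec_d R (k + 1))"
  by (rule poly_algebra_lift[OF Aa, of "\<lambda>k. \<iota> (k + 1) (indec_d R (k + 1))" "{1::nat..}"])
   (auto intro!: mod_homD(1)[OF \<iota>] indec_d_props(1) simp: Suc_le_eq)
 have comm: "\<chi> (sigma_hat x) = \<delta> (\<kappa> x)" if "x \<in> carrier SY" for x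
 proof -
  have "(\<chi> \<circ> sigma_hat) x = (\<delta> \<circ> \<kappa>) x"
  proof (rule SY_hom_unique[OF Aa alg_hom_comp[OF sigma_hat_hom \<chi>(1)] alg_hom_comp[OF \<kappa> \<delta>(1)] _ that])
   fix n u assume n: "1 < n" and u: "u \<in> carrier (indec R n)"
   note d = indec_d_props(1)[OF n]
   interpret En: module R "indec R n" by (rule indec_module)
   have sgc: "sg n u \<in> carrier R" using mod_homD(1)[OF sg_hom[OF n] u] by (simp add: self_module_simps)
   \<comment> \<open>Both sides equal nu(n) sigma(u); injectivity of the functional then gives the
     relation sigma(u) d = nu(n) u between the classes themselves.\<close>
   have "sg n (sg n u \<odot>\<^bsub>indec R n\<^esub> indec_d R n) = sg n (c n \<odot>\<^bsub>indec R n\<^esub> u)"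
    using u d sgc cc by (simp add: mod_homD(3)[OF sg_hom[OF n]] self_module_simps sg_d[OF n] c_def m_comm)
   then have eq: "sg n u \<odot>\<^bsub>indec R n\<^esub> indec_d R n = c n \<odot>\<^bsub>indec R n\<^esub> u"
    using inj_onD[OF functional_inj[OF n]] u d sgc cc En.smult_closed by blast
   have k: "n - 1 \<in> {1..}" "n - 1 + 1 = n" using n by auto
   have "\<chi> (sigma_hat (gen n u)) = sg n u \<odot>\<^bsub>?A\<^esub> \<iota> n (indec_d R n)"
    using alg_homD(3)[OF \<chi>(1) sgc poly_var_closed[OF k(1)]] \<chi>(2)[OF k(1)] k(2)
    by (simp add: sigma_hat_gen[OF n u] sigma_var_def)
   also have "\<dots> = c n \<odot>\<^bsub>?A\<^esub> \<iota> n u" unfolding mod_homD(3)[OF \<iota>[OF n] sgc d, symmetric] eq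
    by (rule mod_homD(3)[OF \<iota>[OF n] cc u])
   also have "\<dots> = \<delta> (\<kappa> (gen n u))" using n u by (simp add: \<kappa>g \<delta>\<iota>)
   finally show "(\<chi> \<circ> sigma_hat) (gen n u) = (\<delta> \<circ> \<kappa>) (gen n u)" by simp
  qed
  then show ?thesis by simp
 qed
 show ?thesis
 proof (rule inj_onI)
  fix x y assume xy: "x \<in> carrier SY" "y \<in> carrier SY" "sigma_hat x = sigma_hat y"
  then have "\<delta> (\<kappa> x) = \<delta> (\<kappa> y)" using comm by metis
  then have "\<kappa> x = \<kappa> y" using inj_onD[OF \<delta>inj _ alg_homD(1)[OF \<kappa> xy(1)] alg_homD(1)[OF \<kappa> xy(2)]] by simp
  then show "x = y" using ret xy by metis
 qed
qed

text \<open>The natural map \<open>q\<close> from the symmetric algebra of the direct sum of copies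
  of A to the polynomial ring satisfies q s = \<open>sigma_hat\<close>, so s inherits
  injectivity.\<close>

lemma s_map_inj: "inj_on (s_map R) (carrier SY)"
proof -
 let ?S = "direct_sum {1::nat<..} (\<lambda>n. self_module R)"
 interpret F: module_family R "{1::nat<..}" "\<lambda>n. self_module R" by (rule self_module_family)
 interpret PX: algebra R PX by (rule poly_algebra_algebra)
 have mh: "direct_sum_map {1<..} sg \<in> mod_hom R MS ?S"
  unfolding indec_sum_def by (rule E.direct_sum_map_hom(1)[OF F.module_family_axioms]) (auto intro: sg_hom)
 have h: "(\<lambda>x. sym_incl R ?S (direct_sum_map {1<..} sg x)) \<in> mod_hom R MS (sym_algebra R ?S)"
  using mod_hom_comp[OF mh module.sym_incl_hom[OF F.DS_module]] by (simp add: comp_def)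
 note Sa = module.sym_algebra_algebra[OF F.DS_module]
 have s: "s_map R \<in> alg_hom R SY (sym_algebra R ?S)"
  unfolding s_map_def sym_map_def by (rule module.sym_lift_hom[OF MS_module Sa h])
 let ?x = "\<lambda>(n::nat) a. a \<odot>\<^bsub>PX\<^esub> poly_var R (n - 1)"
 have x: "?x n \<in> mod_hom R (self_module R) PX" if "n \<in> {1<..}" for n
  by (rule PX.mod_hom_scalar[OF _ poly_var_closed]) (use that in \<open>auto simp: mod_hom_def\<close>)
 define q where "q = sym_lift R PX (direct_sum_lift {1<..} (\<lambda>n. self_module R) PX ?x)"
 note l = F.direct_sum_lift_hom[OF PX.module_axioms, of ?x, OF x]
 have q: "q \<in> alg_hom R (sym_algebra R ?S) PX"
  unfolding q_def by (rule module.sym_lift_hom[OF F.DS_module poly_algebra_algebra l])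
 have qs: "q (s_map R z) = sigma_hat z" if "z \<in> carrier SY" for z
 proof -
  have "(q \<circ> s_map R) z = sigma_hat z"
  proof (rule SY_hom_unique[OF poly_algebra_algebra alg_hom_comp[OF s q] sigma_hat_hom _ that])
   fix n u assume n: "1 < n" and u: "u \<in> carrier (indec R n)"
   have n': "n \<in> {1<..}" using n by simp
   have sgc: "sg n u \<in> carrier (self_module R)" by (rule mod_homD(1)[OF sg_hom[OF n] u])
   have sc: "E.summand n u \<in> carrier MS" unfolding indec_sum_def by (rule mod_homD(1)[OF E.summand_hom[OF n'] u])
   have "s_map R (gen n u) = sym_incl R ?S (F.summand n (sg n u))"
    unfolding s_map_def sym_map_def gen_def
    using module.sym_lift_incl[OF MS_module Sa h sc]
     E.direct_sum_map_hom(2)[OF F.module_family_axioms, of sg n u] sg_hom n' by simp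
   moreover have "q (sym_incl R ?S (F.summand n (sg n u))) = sigma_var n u"
    unfolding q_def
    using module.sym_lift_incl[OF F.DS_module poly_algebra_algebra l mod_homD(1)[OF F.summand_hom[OF n'] sgc]]
     F.direct_sum_lift_summand[OF PX.module_axioms, of ?x, OF x n' sgc] by (simp add: sigma_var_def)
   ultimately show "(q \<circ> s_map R) (gen n u) = sigma_hat (gen n u)" by (simp add: sigma_hat_gen[OF n u])
  qed
  then show ?thesis by simp
 qed
 show ?thesis
  by (rule inj_onI, rule inj_onD[OF sigma_hat_inj]) (metis qs)+
qed

end

section \<open>The comparison map\<close>

context cring
begin

lemma lin_ext_cong:
 assumes "module R B" "p \<in> carrier (free_module R S)" "f \<in> S \<rightarrow> carrier B" "\<And>w. p w \<noteq> \<zero> \<Longrightarrow> f w = g w"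
 shows "lin_ext B f p = lin_ext B g p"
proof -
 interpret B: module R B by (rule assms(1))
 have "p w \<odot>\<^bsub>B\<^esub> g w \<in> carrier B" if "p w \<noteq> \<zero>" for w
  using assms(2,3) assms(4)[OF that, symmetric] that by (auto simp: carrier_free_module)
 then show ?thesis unfolding lin_ext_def using assms(4) by (intro B.M.add.finprod_cong') auto
qed

lemma lin_ext_null:
 assumes "module R B" "p \<in> carrier (free_module R S)" "\<And>w. p w \<noteq> \<zero> \<Longrightarrow> f w = \<zero>\<^bsub>B\<^esub>"
 shows "lin_ext B f p = \<zero>\<^bsub>B\<^esub>"
proof -
 interpret B: module R B by (rule assms(1))
 show ?thesis unfolding lin_ext_def using assms(2,3)
  by (intro B.M.add.finprod_one_eqI) (auto simp: carrier_free_module)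
qed

text \<open>Taking a coefficient is linear and so commutes with linear extension. This brings
  statements about polynomial values of words down to scalars.\<close>

lemma lin_ext_coeff:
 assumes f: "f \<in> S \<rightarrow> carrier (poly_algebra R V)" and p: "p \<in> carrier (free_module R S)"
 shows "lin_ext (poly_algebra R V) f p m = lin_ext (self_module R) (\<lambda>w. f w m) p"
proof -
 interpret PX: algebra R "poly_algebra R V" by (rule poly_algebra_algebra)
 interpret SM: module R "self_module R" by (rule self_module_module)
 note l = PX.lin_ext_hom[OF f]
 have "f w m \<in> carrier R" if "w \<in> S" for w using funcset_mem[OF f that] by (simp add: carrier_poly)
 then have c: "(\<lambda>w. f w m) \<in> S \<rightarrow> carrier (self_module R)" by (simp add: self_module_simps)
 have h: "(\<lambda>p. lin_ext (poly_algebra R V) f p m) \<in> mod_hom R (free_module R S) (self_module R)"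
  using mod_homD(1)[OF l] by (intro mod_homI) (simp_all add: mod_homD(2,3)[OF l] poly_simps self_module_simps carrier_poly)
 show ?thesis
  by (rule free_hom_unique[OF SM.module_axioms h SM.lin_ext_hom[OF c] _ p])
   (simp add: PX.lin_ext_basis[OF f] SM.lin_ext_basis[OF c])
qed

end

context injective_fundamental
begin

text \<open>Every variable has weight 1 here: it is the polynomial degree, not the grading of
  \<open>LZ\<close>, that orders the terms in the comparison below.\<close>

lemma sigma_sum_homog:
 assumes "f \<in> carrier MS"
 shows "sum_lift PX sigma_var f \<in> homog {1..} (\<lambda>_. 1) 1"
proof -
 interpret PX: algebra R PX by (rule poly_algebra_algebra)
 interpret MS: module R MS by (rule MS_module)
 note h = sum_lift_hom[OF PX.module_axioms sigma_var_hom]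
 have "f \<in> {f \<in> carrier MS. sum_lift PX sigma_var f \<in> homog {1..} (\<lambda>_. 1) 1}"
 proof (rule E.DS_span[folded indec_sum_def, OF _ _ assms])
  show "submodule {f \<in> carrier MS. sum_lift PX sigma_var f \<in> homog {1..} (\<lambda>_. 1) 1} R MS"
   by (rule MS.submodule_vimage[OF PX.module_axioms h homog_submodule])
  fix n u assume n: "n \<in> {1::nat<..}" and u: "u \<in> carrier (indec R n)"
  have "poly_var R (n - 1) \<in> homog {1..} (\<lambda>_. 1) 1"
   unfolding poly_var_def using n by (intro homog_basis) auto
  then have "sigma_var n u \<in> homog {1..} (\<lambda>_. 1) 1"
   unfolding sigma_var_def using mod_homD(1)[OF sg_hom u] n
   by (intro PX.submoduleD(6)[OF homog_submodule]) (auto simp: self_module_simps)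
  then show "E.summand n u \<in> {f \<in> carrier MS. sum_lift PX sigma_var f \<in> homog {1..} (\<lambda>_. 1) 1}"
   using sum_lift_summand[OF PX.module_axioms sigma_var_hom, of n u] n u
    mod_homD(1)[OF E.summand_hom[OF n] u] by (simp add: indec_sum_def)
 qed
 then show ?thesis by simp
qed

end

section \<open>The comparison map for a fixed choice of splittings\<close>

locale comparison = injective_fundamental +
 fixes i :: "nat \<Rightarrow> 'a lazard_poly set set \<Rightarrow> 'a lazard_poly set"
 assumes splitting: "is_splitting R i"
begin

lemma splitting_degree: "1 < n \<Longrightarrow> u \<in> carrier (indec R n) \<Longrightarrow> i n u \<in> lazard_degree R (2 * (n - 1))"
 and splitting_proj: "1 < n \<Longrightarrow> u \<in> carrier (indec R n) \<Longrightarrow> indec_proj R n (i n u) = u"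
 using splitting lazard_degree_closed unfolding is_splitting_def mod_hom_def lazard_part_simps
 by (auto simp: Pi_iff)

lemma splitting_hom: "1 < n \<Longrightarrow> i n \<in> mod_hom R (indec R n) LZ"
 using splitting lazard_degree_closed[OF splitting_degree]
 unfolding is_splitting_def mod_hom_def lazard_part_simps by (simp add: Pi_iff)

lemma i_sharp_eq: "i_sharp R i = sym_lift R LZ (sum_lift LZ i)"
 by (simp add: i_sharp_def sum_lift_def)

lemma i_sharp_hom: "i_sharp R i \<in> alg_hom R SY LZ"
 unfolding i_sharp_eq by (rule family_lift_hom[OF lazard_algebra splitting_hom])

lemma i_sharp_gen: "1 < n \<Longrightarrow> u \<in> carrier (indec R n) \<Longrightarrow> i_sharp R i (gen n u) = i n u"
 unfolding i_sharp_eq by (rule family_lift_gen[OF lazard_algebra splitting_hom])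

text \<open>The image contains the lifts \<open>i n u\<close> of all indecomposables, so
  \<open>lazard_degree_into\<close> applies with the image itself in every degree.\<close>

lemma i_sharp_surj: "i_sharp R i ` carrier SY = carrier LZ"
proof
 let ?K = "i_sharp R i ` carrier SY"
 interpret SYr: cring SY by (rule algebra.M_cring[OF SY_algebra])
 interpret SY: algebra R SY by (rule SY_algebra)
 interpret LZ: algebra R LZ by (rule lazard_algebra)
 note h = alg_homD[OF i_sharp_hom]
 show "?K \<subseteq> carrier LZ" using h(1) by auto
 have K: "submodule ?K R LZ"
  by (rule LZ.submodule_image[OF SY.module_axioms alg_mod_hom[OF i_sharp_hom] SY.submodule_carrier])
 have K1: "\<one>\<^bsub>LZ\<^esub> \<in> ?K" using h(5) SYr.one_closed by (metis imageI)
 have KM: "x \<otimes>\<^bsub>LZ\<^esub> y \<in> ?K" if "x \<in> ?K" "y \<in> ?K" for x y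
 proof -
  from that obtain x' y' where "x = i_sharp R i x'" "y = i_sharp R i y'" "x' \<in> carrier SY" "y' \<in> carrier SY" by blast
  then show ?thesis using h(4)[of x' y'] SYr.m_closed[of x' y'] by (metis imageI)
 qed
 have "lazard_degree R d \<subseteq> ?K" for d
 proof (rule lazard_degree_into[of "\<lambda>_. ?K", OF K K1 KM])
  fix n u assume n: "1 < n" and u: "u \<in> carrier (indec R n)"
  have "i n u \<in> ?K" using i_sharp_gen[OF n u] mod_homD(1)[OF gen_hom[OF n] u] by (metis imageI)
  then show "\<exists>x. x \<in> ?K \<and> x \<in> lazard_degree R (2 * (n - 1)) \<and> indec_proj R n x = u"
   using splitting_degree[OF n u] splitting_proj[OF n u] by blast
 qed
 then show "carrier LZ \<subseteq> ?K" using lazard_homog_span[OF K] by blast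
qed

text \<open>The linear map that induces the composite of \<open>i_sharp\<close> and the logarithm.
  It is to be compared with \<open>sum_lift PX sigma_var\<close>, which induces
  \<open>sigma_hat\<close>.\<close>

definition log_sum :: "(nat \<Rightarrow> 'a lazard_poly set set) \<Rightarrow> nat multiset \<Rightarrow> 'a" where
 "log_sum f = lazard_log (sum_lift LZ i f)"

lemma log_sum_hom: "log_sum \<in> mod_hom R MS PX"
 using mod_hom_comp[OF sum_lift_hom[OF algebra.module[OF lazard_algebra] splitting_hom] alg_mod_hom[OF lazard_log_props(1)]]
 by (simp add: log_sum_def[abs_def] comp_def)

lemma log_i_sharp: "z \<in> carrier SY \<Longrightarrow> lazard_log (i_sharp R i z) = sym_lift R PX log_sum z"
proof -
 assume z: "z \<in> carrier SY"
 have "(lazard_log \<circ> i_sharp R i) z = sym_lift R PX log_sum z"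
  by (rule module.sym_lift_unique[OF MS_module poly_algebra_algebra log_sum_hom alg_hom_comp[OF i_sharp_hom lazard_log_props(1)] _ z])
   (simp add: i_sharp_eq log_sum_def
     module.sym_lift_incl[OF MS_module lazard_algebra sum_lift_hom[OF algebra.module[OF lazard_algebra] splitting_hom]])
 then show ?thesis by simp
qed

text \<open>The logarithm of \<open>i n u\<close> has no constant term because the degree is
  positive. Its coefficient at x_{n-1} is sigma_n(u) by the construction of the functional, and its
  other linear coefficients vanish for reasons of degree. So the two linear maps differ only in
  polynomial degree at least two.\<close>

lemma log_sum_linear:
 assumes f: "f \<in> carrier MS" and m: "size m \<le> 1"
 shows "log_sum f m = sum_lift PX sigma_var f m"
proof -
 interpret PX: algebra R PX by (rule poly_algebra_algebra)
 interpret MS: module R MS by (rule MS_module)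
 note h = mod_homD[OF sum_lift_hom[OF PX.module_axioms sigma_var_hom]] and l = mod_homD[OF log_sum_hom]
 have "f \<in> {f \<in> carrier MS. \<forall>m. size m \<le> 1 \<longrightarrow> log_sum f m = sum_lift PX sigma_var f m}"
 proof (rule E.DS_span[folded indec_sum_def, OF _ _ f])
  show "submodule {f \<in> carrier MS. \<forall>m. size m \<le> 1 \<longrightarrow> log_sum f m = sum_lift PX sigma_var f m} R MS"
   using mod_hom_zero[OF MS.module_axioms PX.module_axioms log_sum_hom]
    mod_hom_zero[OF MS.module_axioms PX.module_axioms sum_lift_hom[OF PX.module_axioms sigma_var_hom]]
   by (intro MS.submoduleI') (auto simp: h l poly_simps)
  fix n u assume n': "n \<in> {1::nat<..}" and u: "u \<in> carrier (indec R n)"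
  then have n: "1 < n" "2 \<le> n" by auto
  have s: "E.summand n u \<in> carrier MS" unfolding indec_sum_def by (rule mod_homD(1)[OF E.summand_hom[OF n'] u])
  note iu = splitting_degree[OF n(1) u]
  have L: "log_sum (E.summand n u) = lazard_log (i n u)"
   using sum_lift_summand[OF algebra.module[OF lazard_algebra] splitting_hom, of n u] n u by (simp add: log_sum_def)
  have S: "sum_lift PX sigma_var (E.summand n u) = (\<lambda>m. sg n u \<otimes> basis_elt R {#n - 1#} m)"
   using sum_lift_summand[OF PX.module_axioms sigma_var_hom, of n u] n u
   by (simp add: sigma_var_def poly_simps poly_var_def)
  have sc: "sg n u \<in> carrier R" using mod_homD(1)[OF sg_hom[OF n(1)] u] by (simp add: self_module_simps)
  have "lazard_log (i n u) m = sg n u \<otimes> basis_elt R {#n - 1#} m" if m: "size m \<le> 1" for m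
  proof (cases "m = {#}")
   case True
   have "fst (log_lin n (i n u)) = \<zero>" by (rule log_lin_positive[OF n(2) iu]) (use n in simp)
   then show ?thesis using True sc by (simp add: log_lin_def lin_part_def basis_elt_def)
  next
   case False
   then obtain k where k: "m = {#k#}" using m
    by (metis One_nat_def le_antisym less_eq_Suc_le nonempty_has_size size_1_singleton_mset)
   \<comment> \<open>Index 0 is separate because the variables of \<open>PX\<close> start at 1, so
     no monomial containing it occurs.\<close>
   consider "k = 0" | "k + 1 = n" | "1 \<le> k" "k + 1 \<noteq> n" by linarith
   then show ?thesis
   proof cases
    case 1
    have "lazard_log (i n u) \<in> carrier PX"
     by (rule alg_homD(1)[OF lazard_log_props(1) lazard_degree_closed[OF iu]])
    then have "lazard_log (i n u) m = \<zero>" using 1 k by (auto simp: carrier_poly)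
    then show ?thesis using 1 k n sc by (simp add: basis_elt_def)
   next
    case 2
    have "snd (log_lin n (i n u)) = sg n u" using sg_proj[OF n(1) iu] splitting_proj[OF n(1) u] by simp
    moreover have "n - 1 = k" using 2 by simp
    ultimately show ?thesis using k sc by (simp add: log_lin_def lin_part_def basis_elt_def)
   next
    case 3
    have "log_lin (k + 1) (i n u) = (\<zero>, \<zero>)" by (rule log_lin_other_degree[OF n(2) _ _ iu]) (use 3 in auto)
    then show ?thesis using 3 k n sc by (auto simp: log_lin_def lin_part_def basis_elt_def)
   qed
  qed
  then show "E.summand n u \<in> {f \<in> carrier MS. \<forall>m. size m \<le> 1 \<longrightarrow> log_sum f m = sum_lift PX sigma_var f m}"
   using s by (simp add: L S)
 qed
 then show ?thesis using m by simp
qed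

abbreviation "log_word \<equiv> module.word_eval PX log_sum"
abbreviation "sig_word \<equiv> module.word_eval PX (sum_lift PX sigma_var)"

lemma sigma_sum_hom: "sum_lift PX sigma_var \<in> mod_hom R MS PX"
 by (rule sum_lift_hom[OF algebra.module[OF poly_algebra_algebra] sigma_var_hom])

lemma word_simps:
 "sig_word [] = \<one>\<^bsub>PX\<^esub>" "sig_word (f # w) = sum_lift PX sigma_var f \<otimes>\<^bsub>PX\<^esub> sig_word w"
 "log_word [] = \<one>\<^bsub>PX\<^esub>" "log_word (f # w) = log_sum f \<otimes>\<^bsub>PX\<^esub> log_word w"
 by (simp_all add: module.word_eval_def[OF MS_module poly_algebra_algebra sigma_sum_hom]
   module.word_eval_def[OF MS_module poly_algebra_algebra log_sum_hom])

lemmas sig_word_closed = module.word_eval_closed[OF MS_module poly_algebra_algebra sigma_sum_hom]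
lemmas log_word_closed = module.word_eval_closed[OF MS_module poly_algebra_algebra log_sum_hom]

lemma sig_word_homog: "w \<in> lists (carrier MS) \<Longrightarrow> sig_word w \<in> homog {1..} (\<lambda>_. 1) (length w)"
proof (induction w)
 case Nil
 then show ?case using homog_basis[of "{#}" "{1..}" "\<lambda>_. 1" 0] by (simp add: word_simps poly_simps)
next
 case (Cons f w)
 then show ?case using homog_mult[OF sigma_sum_homog Cons.IH, of f] by (simp add: word_simps plus_1_eq_Suc)
qed

lemma sig_word_zero: "w \<in> lists (carrier MS) \<Longrightarrow> size m \<noteq> length w \<Longrightarrow> sig_word w m = \<zero>"
 using sig_word_homog[of w] by (auto simp: homog_def size_multiset_overloaded_eq)

text \<open>A word of length k goes to a product of k series without constant term. Below degree k
  such a product vanishes, and in degree k it depends on the linear parts only, where the logarithm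
  agrees with sigma.\<close>

lemma log_word_leading:
 "w \<in> lists (carrier MS) \<Longrightarrow> size m \<le> length w \<Longrightarrow> log_word w m = sig_word w m"
proof (induction w arbitrary: m)
 case Nil
 then show ?case by (simp add: word_simps)
next
 case (Cons f w)
 have fw: "f \<in> carrier MS" "w \<in> lists (carrier MS)" using Cons.prems(1) by auto
 let ?s = "sum_lift PX sigma_var f"
 have c: "?s \<in> carrier PX" "log_sum f \<in> carrier PX" "sig_word w \<in> carrier PX" "log_word w \<in> carrier PX"
  using mod_homD(1)[OF sigma_sum_hom fw(1)] mod_homD(1)[OF log_sum_hom fw(1)] sig_word_closed[OF fw(2)] log_word_closed[OF fw(2)] by auto
 then have cc: "?s k \<in> carrier R" "log_sum f k \<in> carrier R" "sig_word w k \<in> carrier R" "log_word w k \<in> carrier R" for k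
  by (auto simp: carrier_poly)
 have "log_sum f k \<otimes> log_word w (m - k) = ?s k \<otimes> sig_word w (m - k)" if k: "k \<subseteq># m" for k
 proof -
  have sz: "size (m - k) = size m - size k" "size k \<le> size m"
   using k by (auto simp: size_Diff_submset size_mset_mono)
  have s0: "?s {#} = \<zero>" using sigma_sum_homog[OF fw(1)] by (auto simp: homog_def)
  have le: "size m \<le> length w + 1" using Cons.prems(2) by simp
  consider "k = {#}" | "size k = 1" | "2 \<le> size k"
   by (metis One_nat_def less_2_cases not_le size_eq_0_iff_empty)
  then show ?thesis
  proof cases
   case 1
   then show ?thesis using log_sum_linear[OF fw(1), of k] s0 cc by simp
  next
   case 2
   then have "log_word w (m - k) = sig_word w (m - k)" using sz le by (intro Cons.IH[OF fw(2)]) simp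
   then show ?thesis using log_sum_linear[OF fw(1), of k] 2 by simp
  next
   case 3
   then have "size (m - k) < length w" using sz le by linarith
   then have "log_word w (m - k) = \<zero>" "sig_word w (m - k) = \<zero>"
    using Cons.IH[OF fw(2), of "m - k"] sig_word_zero[OF fw(2), of "m - k"] by auto
   then show ?thesis using cc by simp
  qed
 qed
 then show ?case unfolding word_simps poly_mult_formula[OF c(1,3)] poly_mult_formula[OF c(2,4)]
  using cc by (intro add.finprod_cong') auto
qed

text \<open>The words of minimal length \<open>k\<close> alone determine the terms of degree \<open>k\<close> of the logarithm.\<close>

lemma i_sharp_inj: "inj_on (i_sharp R i) (carrier SY)"
proof -
 let ?W = "lists (carrier MS)"
 let ?L = "lin_ext PX log_word" and ?S = "lin_ext PX sig_word"
 let ?c = "\<lambda>p. sym_ideal R MS +>\<^bsub>word_algebra R MS\<^esub> p"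
 interpret PX: algebra R PX by (rule poly_algebra_algebra)
 interpret SY: algebra R SY by (rule SY_algebra)
 interpret SM: module R "self_module R" by (rule self_module_module)
 interpret MS: module R MS by (rule MS_module)
 have WA: "carrier (word_algebra R MS) = carrier (free_module R ?W)" by (rule MS.carrier_WA)
 have Lf: "log_word \<in> ?W \<rightarrow> carrier PX" and Sf: "sig_word \<in> ?W \<rightarrow> carrier PX"
  using log_word_closed sig_word_closed by auto
 note Lh = PX.lin_ext_hom[OF Lf] and Sh = PX.lin_ext_hom[OF Sf]
 have Lc: "sym_lift R PX log_sum (?c p) = ?L p" and Sc: "sigma_hat (?c p) = ?S p"
  if "p \<in> carrier (free_module R ?W)" for p
  using MS.sym_lift_class[OF poly_algebra_algebra log_sum_hom] MS.sym_lift_class[OF poly_algebra_algebra sigma_sum_hom] that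
  by (simp_all add: WA sigma_hat_def)
 have c0: "?c (\<lambda>_. \<zero>) = \<zero>\<^bsub>SY\<^esub>"
  using module_quotient.proj_zero[OF MS.SymQ]
  by (simp add: sym_algebra_def word_algebra_def monoid_algebra_simps)
 have ca: "?c (\<lambda>w. p w \<oplus> q w) = ?c p \<oplus>\<^bsub>SY\<^esub> ?c q"
  if "p \<in> carrier (free_module R ?W)" "q \<in> carrier (free_module R ?W)" for p q
  using MS.sym_class_add[of p q] that unfolding WA by (simp add: word_algebra_def monoid_algebra_simps)
 \<comment> \<open>The induction is over representatives in the word algebra, by the size of their
   support; a class in the symmetric algebra has no support of its own.\<close>
 have main: "?c p = \<zero>\<^bsub>SY\<^esub>" if "p \<in> carrier (free_module R ?W)" "?L p = \<zero>\<^bsub>PX\<^esub>" for p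
  using that
 proof (induction "card {w. p w \<noteq> \<zero>}" arbitrary: p rule: less_induct)
  case less
  note p = less.prems(1)
  have pD: "p w \<in> carrier R" "p w \<noteq> \<zero> \<Longrightarrow> w \<in> ?W" "finite {w. p w \<noteq> \<zero>}" for w
   using p unfolding carrier_free_module by auto
  show ?case
  proof (cases "\<exists>w. p w \<noteq> \<zero>")
   case False
   then have "p = (\<lambda>_. \<zero>)" by auto
   then show ?thesis using c0 by simp
  next
   case True
   define k where "k = (LEAST k. \<exists>w. p w \<noteq> \<zero> \<and> length w = k)"
   have "\<exists>w. p w \<noteq> \<zero> \<and> length w = k" unfolding k_def by (rule LeastI_ex) (use True in blast)
   then obtain w0 where w0: "p w0 \<noteq> \<zero>" "length w0 = k" by blast
   have kle: "k \<le> length w" if "p w \<noteq> \<zero>" for w unfolding k_def by (rule Least_le) (use that in blast)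
   \<comment> \<open>\<open>p1\<close> collects the words of minimal length k. Its class will vanish
     by the injectivity of \<open>sigma_hat\<close>, which leaves \<open>p2\<close> with a strictly
     smaller support.\<close>
   define p1 where "p1 = (\<lambda>w. if length w = k then p w else \<zero>)"
   define p2 where "p2 = (\<lambda>w. if length w = k then \<zero> else p w)"
   have sub: "{w. p1 w \<noteq> \<zero>} \<subseteq> {w. p w \<noteq> \<zero>}" "{w. p2 w \<noteq> \<zero>} \<subset> {w. p w \<noteq> \<zero>}"
    using w0 by (auto simp: p1_def p2_def)
   have p12: "p1 \<in> carrier (free_module R ?W)" "p2 \<in> carrier (free_module R ?W)"
    using pD finite_subset[OF sub(1)] finite_subset[OF psubset_imp_subset[OF sub(2)]]
    unfolding carrier_free_module by (auto simp: p1_def p2_def)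
   have pp: "p = (\<lambda>w. p1 w \<oplus> p2 w)" using pD(1) by (auto simp: p1_def p2_def)
   have LS: "h p = h p1 \<oplus>\<^bsub>PX\<^esub> h p2" if "h \<in> mod_hom R (free_module R ?W) PX" for h
    using mod_homD(2)[OF that p12] pp by (simp add: free_module_simps)
   \<comment> \<open>In degree k the longer words contribute nothing to \<open>?S\<close>, so the
     value equals that of the logarithm, which is zero. In any other degree the words of length k
     contribute nothing.\<close>
   have S1: "?S p1 = \<zero>\<^bsub>PX\<^esub>"
   proof -
    have "?S p1 m = \<zero>" for m
    proof (cases "size m = k")
     case True
     have "?S p2 m = \<zero>"
      unfolding lin_ext_coeff[OF Sf p12(2)]
      by (subst lin_ext_null[OF SM.module_axioms p12(2)])
       (use True pD(2) sig_word_zero in \<open>auto simp: p2_def self_module_simps split: if_splits\<close>)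
     moreover have "?S p1 m \<in> carrier R" using mod_homD(1)[OF Sh p12(1)] by (simp add: carrier_poly)
     ultimately have "?S p1 m = ?S p m" using LS[OF Sh] by (simp add: poly_simps)
     also have "\<dots> = ?L p m"
      unfolding lin_ext_coeff[OF Sf p] lin_ext_coeff[OF Lf p]
     proof (rule lin_ext_cong[OF SM.module_axioms p])
      show "(\<lambda>w. sig_word w m) \<in> ?W \<rightarrow> carrier (self_module R)"
       using funcset_mem[OF Sf] by (auto simp: carrier_poly self_module_simps)
      show "sig_word w m = log_word w m" if "p w \<noteq> \<zero>" for w
       using log_word_leading[OF pD(2)[OF that], of m] kle[OF that] True by simp
     qed
     also have "\<dots> = \<zero>" using less.prems(2) by (simp add: poly_simps)
     finally show ?thesis .
    next
     case False
     then show ?thesis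
      unfolding lin_ext_coeff[OF Sf p12(1)]
      by (subst lin_ext_null[OF SM.module_axioms p12(1)])
       (use pD(2) sig_word_zero in \<open>auto simp: p1_def self_module_simps split: if_splits\<close>)
    qed
    then show ?thesis by (auto simp: poly_simps)
   qed
   have cp1: "?c p1 \<in> carrier SY" using MS.sym_class_closed[of p1] p12 by (simp add: WA)
   have "sigma_hat (?c p1) = sigma_hat \<zero>\<^bsub>SY\<^esub>"
    using Sc[OF p12(1)] S1 mod_hom_zero[OF SY.module_axioms PX.module_axioms alg_mod_hom[OF sigma_hat_hom]] by simp
   then have c1: "?c p1 = \<zero>\<^bsub>SY\<^esub>" by (rule inj_onD[OF sigma_hat_inj _ cp1]) simp
   have "?L p1 = \<zero>\<^bsub>PX\<^esub>"
    using Lc[OF p12(1)] mod_hom_zero[OF SY.module_axioms PX.module_axioms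
      alg_mod_hom[OF MS.sym_lift_hom[OF poly_algebra_algebra log_sum_hom]]] by (simp add: c1)
   then have "?L p2 = \<zero>\<^bsub>PX\<^esub>"
    using LS[OF Lh] less.prems(2) mod_homD(1)[OF Lh p12(2)] by simp
   then have c2: "?c p2 = \<zero>\<^bsub>SY\<^esub>"
    by (rule less.hyps[OF psubset_card_mono[OF pD(3) sub(2)] p12(2)])
   have "?c p = ?c p1 \<oplus>\<^bsub>SY\<^esub> ?c p2" by (subst pp) (rule ca[OF p12])
   then show ?thesis using c1 c2 by simp
  qed
 qed
 show ?thesis
 proof (rule mod_hom_inj_onI[OF SY.module_axioms algebra.module[OF lazard_algebra] alg_mod_hom[OF i_sharp_hom]])
  fix z assume z: "z \<in> carrier SY" "i_sharp R i z = \<zero>\<^bsub>LZ\<^esub>"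
  obtain p where p: "p \<in> carrier (free_module R ?W)" "z = ?c p" using MS.sym_class_cases[OF z(1)] WA by metis
  have "sym_lift R PX log_sum z = \<zero>\<^bsub>PX\<^esub>"
   unfolding log_i_sharp[OF z(1), symmetric] z(2)
   by (rule mod_hom_zero[OF algebra.module[OF lazard_algebra] PX.module_axioms alg_mod_hom[OF lazard_log_props(1)]])
  then show "z = \<zero>\<^bsub>SY\<^esub>" using main[OF p(1)] Lc[OF p(1)] p(2) by simp
 qed
qed

lemma i_sharp_iso: "i_sharp R i \<in> alg_iso R SY LZ"
 using i_sharp_hom i_sharp_inj i_sharp_surj by (simp add: alg_iso_def bij_betw_def)

end

lemma (in injective_fundamental) splitting_exists: "\<exists>i. is_splitting R i"
proof -
 have "\<exists>i. 1 < n \<longrightarrow> i \<in> mod_hom R (indec R n) (lazard_part R (n - 1)) \<and>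
   (\<forall>x\<in>carrier (indec R n). indec_proj R n (i x) = x)" for n
 proof (cases "1 < n")
  case True
  have "indec_proj R n ` carrier (lazard_part R (n - 1)) = carrier (indec R n)"
  proof
   show "indec_proj R n ` carrier (lazard_part R (n - 1)) \<subseteq> carrier (indec R n)"
    using mod_homD(1)[OF indec_proj_hom] by blast
   show "carrier (indec R n) \<subseteq> indec_proj R n ` carrier (lazard_part R (n - 1))"
    by (auto simp: lazard_part_simps elim!: indec_cases)
  qed
  from projective_section[OF indec_projective[OF True] lazard_part_module indec_proj_hom this]
  show ?thesis by blast
 qed simp
 then show ?thesis unfolding is_splitting_def by metis
qed

section \<open>Tensor products\<close>

lemma alg_iso_comp: "h \<in> alg_iso A B C \<Longrightarrow> k \<in> alg_iso A C D \<Longrightarrow> k \<circ> h \<in> alg_iso A B D"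
 by (auto simp: alg_iso_def intro: alg_hom_comp bij_betw_trans)

lemma alg_iso_inv:
 assumes B: "algebra A B" and h: "h \<in> alg_iso A B C"
 shows "inv_into (carrier B) h \<in> alg_iso A C B"
proof -
 interpret Bc: cring B by (rule algebra.M_cring[OF B])
 interpret B: algebra A B by (rule B)
 have bij: "bij_betw h (carrier B) (carrier C)" and hh: "h \<in> alg_hom A B C" using h by (auto simp: alg_iso_def)
 let ?g = "inv_into (carrier B) h"
 note h' = alg_homD[OF hh]
 have gh: "?g (h x) = x" if "x \<in> carrier B" for x using bij that by (simp add: bij_betw_def inv_into_f_f)
 have surj: "\<exists>x\<in>carrier B. y = h x" if "y \<in> carrier C" for y using bij that by (auto simp: bij_betw_def)
 have "?g \<in> mod_hom A C B"
 proof (rule mod_homI)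
  fix y assume "y \<in> carrier C"
  then obtain x where x: "x \<in> carrier B" "y = h x" using surj by blast
  show "?g y \<in> carrier B" using x gh by simp
  show "?g (a \<odot>\<^bsub>C\<^esub> y) = a \<odot>\<^bsub>B\<^esub> ?g y" if "a \<in> carrier A" for a
   using x that gh[of "a \<odot>\<^bsub>B\<^esub> x"] by (simp add: h' gh)
  fix y' assume "y' \<in> carrier C"
  then obtain x' where x': "x' \<in> carrier B" "y' = h x'" using surj by blast
  show "?g (y \<oplus>\<^bsub>C\<^esub> y') = ?g y \<oplus>\<^bsub>B\<^esub> ?g y'"
   using x x' gh[of "x \<oplus>\<^bsub>B\<^esub> x'"] by (simp add: h' gh)
 qed
 moreover have "?g (y \<otimes>\<^bsub>C\<^esub> y') = ?g y \<otimes>\<^bsub>B\<^esub> ?g y'" if "y \<in> carrier C" "y' \<in> carrier C" for y y'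
 proof -
  from that surj obtain x x' where "x \<in> carrier B" "y = h x" "x' \<in> carrier B" "y' = h x'" by meson
  then show ?thesis using gh[of "x \<otimes>\<^bsub>B\<^esub> x'"] by (simp add: h' gh)
 qed
 moreover have "?g \<one>\<^bsub>C\<^esub> = \<one>\<^bsub>B\<^esub>" using gh[OF Bc.one_closed] by (simp add: h')
 ultimately show ?thesis using bij_betw_inv_into[OF bij] by (auto simp: alg_iso_def intro: alg_homI)
qed

lemma (in algebra) subalgebra_image:
 assumes B: "algebra R B" and h: "h \<in> alg_hom R B M"
 shows "subalgebra_of R (h ` carrier B) M"
proof -
 interpret Bc: cring B by (rule algebra.M_cring[OF B])
 interpret B: algebra R B by (rule B)
 note h' = alg_homD[OF h]
 have s: "submodule (h ` carrier B) R M"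
  by (rule submodule_image[OF B.module_axioms alg_mod_hom[OF h] B.submodule_carrier])
 have "subring (h ` carrier B) M"
 proof (rule ring.subringI[OF cring.axioms(1)[OF M_cring]])
  show "\<one>\<^bsub>M\<^esub> \<in> h ` carrier B" using h'(5) Bc.one_closed by (metis imageI)
  fix x y assume "x \<in> h ` carrier B" "y \<in> h ` carrier B"
  then obtain x' y' where "x = h x'" "y = h y'" "x' \<in> carrier B" "y' \<in> carrier B" by blast
  then show "x \<otimes>\<^bsub>M\<^esub> y \<in> h ` carrier B" using h'(4)[of x' y'] Bc.m_closed[of x' y'] by (metis imageI)
 qed (use submoduleD[OF s] in auto)
 then show ?thesis using s by (simp add: subalgebra_of_def)
qed

lemma (in algebra) subalgebra_algebra:
 assumes "subalgebra_of R H M"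
 shows "algebra R (M\<lparr>carrier := H\<rparr>)"
proof -
 have sr: "subring H M" and sm: "submodule H R M" using assms by (auto simp: subalgebra_of_def)
 have H: "H \<subseteq> carrier M" by (rule submoduleD(1)[OF sm])
 have "cring (M\<lparr>carrier := H\<rparr>)" using ring.subcring_iff[OF cring.axioms(1)[OF M_cring] H] cring.subcringI'[OF M_cring sr] by blast
 moreover have "module R (M\<lparr>carrier := H\<rparr>)" by (rule submodule.submodule_is_module[OF sm module_axioms])
 ultimately show ?thesis
  using H by (intro algebra.intro algebra_axioms.intro R.is_cring) (auto simp: smult_assoc2 subset_iff)
qed

context injective_fundamental
begin

text \<open>The embedding is \<open>sigma_hat\<close> after the inverse of
  \<open>i_sharp\<close>.\<close>

lemma lazard_subalgebra:
 "\<exists>H. subalgebra_of R H PX \<and> (\<exists>h. h \<in> alg_iso R LZ (PX\<lparr>carrier := H\<rparr>))"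
proof -
 obtain i where "is_splitting R i" using splitting_exists by blast
 then interpret comparison R i by unfold_locales
 interpret PX: algebra R PX by (rule poly_algebra_algebra)
 let ?g = "inv_into (carrier SY) (i_sharp R i)"
 have g: "?g \<in> alg_iso R LZ SY" by (rule alg_iso_inv[OF SY_algebra i_sharp_iso])
 have gh: "?g \<in> alg_hom R LZ SY" and gb: "bij_betw ?g (carrier LZ) (carrier SY)" using g by (auto simp: alg_iso_def)
 define \<theta> where "\<theta> = sigma_hat \<circ> ?g"
 have \<theta>: "\<theta> \<in> alg_hom R LZ PX" unfolding \<theta>_def by (rule alg_hom_comp[OF gh sigma_hat_hom])
 have "inj_on \<theta> (carrier LZ)" unfolding \<theta>_def
  using gb sigma_hat_inj by (intro comp_inj_on) (auto simp: bij_betw_def)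
 then have "\<theta> \<in> alg_iso R LZ (PX\<lparr>carrier := \<theta> ` carrier LZ\<rparr>)"
  using \<theta> by (auto simp: alg_iso_def alg_hom_def mod_hom_def ring_hom_def bij_betw_def)
 then show ?thesis using PX.subalgebra_image[OF lazard_algebra \<theta>] by blast
qed

text \<open>A common criterion for symmetric and Rees algebras. The maps \<open>j n\<close> induce
  \<psi> from the symmetric algebra of the indecomposables to the tensor product; it is onto because
  the images of the ideals generate. The maps \<open>g n\<close> induce k from the tensor product to
  the polynomial ring, and k \<psi> = \<open>sigma_hat\<close> is injective. So \<psi> is bijective
  and k is injective. With x_v of degree 2 v, the injectivity of k also serves to detect
  degrees.\<close>

lemma tensor_isomorphic:
 fixes B :: "nat \<Rightarrow> ('a, 'b, 'p) module_scheme"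
 assumes B: "\<And>n. 1 < n \<Longrightarrow> algebra R (B n)"
  and j: "\<And>n. 1 < n \<Longrightarrow> j n \<in> mod_hom R (ideal_module R (In n)) (B n)"
  and gen: "\<And>n. 1 < n \<Longrightarrow> alg_generates R (B n) (j n ` In n)"
  and g: "\<And>n. 1 < n \<Longrightarrow> g n \<in> alg_hom R (B n) PX"
  and gj: "\<And>n a. 1 < n \<Longrightarrow> a \<in> In n \<Longrightarrow> g n (j n a) = a \<odot>\<^bsub>PX\<^esub> poly_var R (n - 1)"
  and jd: "\<And>n a. 1 < n \<Longrightarrow> a \<in> In n \<Longrightarrow> j n a \<in> gr n (2 * (n - 1))"
  and gr1: "\<And>n. 1 < n \<Longrightarrow> \<one>\<^bsub>B n\<^esub> \<in> gr n 0"
  and grm: "\<And>n x y d e. 1 < n \<Longrightarrow> x \<in> gr n d \<Longrightarrow> y \<in> gr n e \<Longrightarrow> x \<otimes>\<^bsub>B n\<^esub> y \<in> gr n (d + e)"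
  and gK: "\<And>n x d. 1 < n \<Longrightarrow> x \<in> gr n d \<Longrightarrow> g n x \<in> homog {1..} (\<lambda>v. 2 * v) d"
 shows "graded_alg_isomorphic R LZ (lazard_degree R) (tensor_algebra R {1<..} B) (tensor_degree R {1<..} B gr)"
proof -
 interpret T: tensor_family R "{1::nat<..}" B
  by (intro tensor_family.intro tensor_family_axioms.intro is_cring B) simp
 obtain i where "is_splitting R i" using splitting_exists by blast
 then interpret comparison R i by unfold_locales
 interpret PX: algebra R PX by (rule poly_algebra_algebra)
 interpret TAc: cring T.T by (rule algebra.M_cring[OF T.T_algebra])
 interpret TA: algebra R T.T by (rule T.T_algebra)
 interpret LA: algebra R LZ by (rule lazard_algebra)
 define u where "u n x = T.tens n (j n (sg n x))" for n x
 have u: "u n \<in> mod_hom R (indec R n) T.T" if "1 < n" for n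
  using mod_hom_comp[OF sg_ideal_hom[OF that] mod_hom_comp[OF j[OF that] alg_mod_hom[OF T.tens_hom[of n]]]] that
  by (simp add: u_def[abs_def] comp_def)
 define \<psi> where "\<psi> = sym_lift R T.T (sum_lift T.T u)"
 have \<psi>: "\<psi> \<in> alg_hom R SY T.T" unfolding \<psi>_def by (rule family_lift_hom[OF T.T_algebra u])
 have \<psi>g: "\<psi> (local.gen n x) = u n x" if "1 < n" "x \<in> carrier (indec R n)" for n x
  unfolding \<psi>_def by (rule family_lift_gen[OF T.T_algebra u that])
 have jc: "j n a \<in> carrier (B n)" if "1 < n" "a \<in> In n" for n a
  using mod_homD(1)[OF j[OF that(1)]] that(2) by (simp add: ideal_module_simps)
 have g': "g n \<in> alg_hom R (B n) PX" if "n \<in> {1<..}" for n using g that by simp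
 obtain k where k: "k \<in> alg_hom R T.T PX"
  and kp: "\<And>f. f \<in> carrier T.P \<Longrightarrow> k (T.pure f) = (\<Otimes>\<^bsub>PX\<^esub>n\<in>{n \<in> {1<..}. f n \<noteq> \<one>\<^bsub>B n\<^esub>}. g n (f n))"
  and kt: "\<And>n x. n \<in> {1<..} \<Longrightarrow> x \<in> carrier (B n) \<Longrightarrow> k (T.tens n x) = g n x"
  using T.tensor_lift[OF poly_algebra_algebra, of g, OF g'] by blast
 have sI: "sg n x \<in> In n" if "x \<in> carrier (indec R n)" for n x using that by (simp add: fundamental_ideal_def)
 have k\<psi>: "k (\<psi> z) = sigma_hat z" if "z \<in> carrier SY" for z
 proof -
  have "(k \<circ> \<psi>) z = sigma_hat z"
  proof (rule SY_hom_unique[OF poly_algebra_algebra alg_hom_comp[OF \<psi> k] sigma_hat_hom _ that])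
   fix n x assume nx: "1 < n" "x \<in> carrier (indec R n)"
   show "(k \<circ> \<psi>) (local.gen n x) = sigma_hat (local.gen n x)"
    using nx kt[of n "j n (sg n x)"] jc[OF nx(1) sI[OF nx(2)]] gj[OF nx(1) sI[OF nx(2)]]
    by (simp add: \<psi>g sigma_hat_gen u_def sigma_var_def)
  qed
  then show ?thesis by simp
 qed
 have \<psi>im: "\<psi> ` carrier SY = carrier T.T"
 proof (rule alg_generates_image[OF SY_algebra T.T_algebra T.tensor_generated \<psi>])
  show "n \<in> {1<..} \<Longrightarrow> alg_generates R (B n) (j n ` In n)" for n by (simp add: gen)
  show "(\<Union>n\<in>{1<..}. T.tens n ` j n ` In n) \<subseteq> \<psi> ` carrier SY"
  proof
   fix t assume "t \<in> (\<Union>n\<in>{1<..}. T.tens n ` j n ` In n)"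
   then obtain n a where t: "1 < n" "a \<in> In n" "t = T.tens n (j n a)" by auto
   then obtain x where x: "x \<in> carrier (indec R n)" "a = sg n x" by (auto simp: fundamental_ideal_def)
   have "t = \<psi> (local.gen n x)" using t x by (simp add: \<psi>g u_def)
   then show "t \<in> \<psi> ` carrier SY" using mod_homD(1)[OF gen_hom[OF t(1)] x(1)] by blast
  qed
 qed
 have \<psi>inj: "inj_on \<psi> (carrier SY)"
  by (rule inj_onI, rule inj_onD[OF sigma_hat_inj]) (metis k\<psi>)+
 have kinj: "x = y" if "x \<in> carrier T.T" "y \<in> carrier T.T" "k x = k y" for x y
 proof -
  from that(1,2) obtain x' y' where "x' \<in> carrier SY" "x = \<psi> x'" "y' \<in> carrier SY" "y = \<psi> y'"
   unfolding \<psi>im[symmetric] by blast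
  then show ?thesis using that(3) inj_onD[OF sigma_hat_inj, of x' y'] by (simp add: k\<psi>)
 qed
 define h where "h = \<psi> \<circ> inv_into (carrier SY) (i_sharp R i)"
 have hi: "h \<in> alg_iso R LZ T.T" unfolding h_def
  by (rule alg_iso_comp[OF alg_iso_inv[OF SY_algebra i_sharp_iso]])
   (use \<psi> \<psi>inj \<psi>im in \<open>simp add: alg_iso_def bij_betw_def\<close>)
 then have h: "h \<in> alg_hom R LZ T.T" and hb: "bij_betw h (carrier LZ) (carrier T.T)" by (auto simp: alg_iso_def)
 note h' = alg_homD[OF h]
 let ?K = "\<lambda>d. homog {1::nat..} (\<lambda>v. 2 * v) d"
 let ?TD = "tensor_degree R {1<..} B gr"
 have tdeg: "T.tens n x \<in> ?TD d" if n: "1 < n" and x: "x \<in> gr n d" "x \<in> carrier (B n)" for n x d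
 proof -
  have "T.pure (T.single n x) \<in> T.homog_pure gr d"
   by (rule T.homog_pureI[where K = "{n}" and dg = "(\<lambda>_. 0)(n := d)"])
    (use n x gr1 T.single_closed[of n x] in \<open>auto simp: T.single_def T.P_simps\<close>)
  then show ?thesis using TA.mod_span_superset unfolding T.tensor_degree_eq T.tens_def by blast
 qed
 have hd: "lazard_degree R d \<subseteq> {x \<in> carrier LZ. h x \<in> ?TD d}" for d
 proof (rule lazard_degree_into)
  show "submodule {x \<in> carrier LZ. h x \<in> ?TD d} R LZ" for d
   by (rule LA.submodule_vimage[OF TA.module_axioms alg_mod_hom[OF h] T.tensor_degree_submodule])
  show "\<one>\<^bsub>LZ\<^esub> \<in> {x \<in> carrier LZ. h x \<in> ?TD 0}"
   using T.tensor_degree_one[of gr] gr1 cring.cring_simprules(6)[OF algebra.M_cring[OF lazard_algebra]] by (simp add: h'(5))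
  show "x \<otimes>\<^bsub>LZ\<^esub> y \<in> {x \<in> carrier LZ. h x \<in> ?TD (d + e)}"
   if "x \<in> {x \<in> carrier LZ. h x \<in> ?TD d}" "y \<in> {x \<in> carrier LZ. h x \<in> ?TD e}" for d e x y
   using that T.tensor_degree_mult[of gr "h x" d "h y" e] grm
    cring.cring_simprules(5)[OF algebra.M_cring[OF lazard_algebra]] by (simp add: h'(4))
  fix n x assume n: "1 < n" and x: "x \<in> carrier (indec R n)"
  have gc: "local.gen n x \<in> carrier SY" by (rule mod_homD(1)[OF gen_hom[OF n] x])
  have "h (i n x) = u n x"
   using inv_into_f_f[OF i_sharp_inj gc] by (simp add: h_def i_sharp_gen[OF n x] \<psi>g[OF n x])
  also have "\<dots> \<in> ?TD (2 * (n - 1))"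
   unfolding u_def by (rule tdeg[OF n jd[OF n sI[OF x]] jc[OF n sI[OF x]]])
  finally show "\<exists>y. y \<in> {x \<in> carrier LZ. h x \<in> ?TD (2 * (n - 1))} \<and> y \<in> lazard_degree R (2 * (n - 1)) \<and> indec_proj R n y = x"
   using splitting_degree[OF n x] splitting_proj[OF n x] lazard_degree_closed by blast
 qed
 have kd: "k z \<in> ?K d" if "z \<in> ?TD d" for z d
  by (rule T.tensor_degree_image[where K = ?K, OF poly_algebra_algebra k kp _ _ graded_byD[OF homog_graded] that]) (use g gK in auto)
 have kh: "(\<lambda>x. k (h x)) \<in> mod_hom R LZ PX"
  using alg_mod_hom[OF alg_hom_comp[OF h k]] by (simp add: comp_def)
 have "h ` lazard_degree R d = ?TD d" for d
 proof
  show "h ` lazard_degree R d \<subseteq> ?TD d" using hd[of d] by auto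
  show "?TD d \<subseteq> h ` lazard_degree R d"
  proof
   fix y assume y: "y \<in> ?TD d"
   have yT: "y \<in> carrier T.T" using TA.submoduleD(1)[OF T.tensor_degree_submodule] y by blast
   then obtain x where x: "x \<in> carrier LZ" "y = h x" using hb by (auto simp: bij_betw_def)
   note D = LA.submoduleD[OF graded_byD(1)[OF lazard_graded, of d]]
   \<comment> \<open>Replaces the projection to degree d: the image of an element of
     \<open>?H\<close> agrees, at the monomials of degree d, with that of an element of
     \<open>lazard_degree R d\<close>. A homogeneous element is compared with itself or with zero,
     and \<open>?H\<close> is a submodule, hence everything. Since the image of x is concentrated in
     degree d, the two images coincide.\<close>
   let ?H = "{x \<in> carrier LZ. \<exists>x'\<in>lazard_degree R d. \<forall>m. (\<Sum>v\<in>#m. 2 * v) = d \<longrightarrow> k (h x) m = k (h x') m}"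
   note kh' = mod_homD[OF kh]
   have kh0: "k (h \<zero>\<^bsub>LZ\<^esub>) = \<zero>\<^bsub>PX\<^esub>" by (rule mod_hom_zero[OF LA.module_axioms PX.module_axioms kh])
   have "x \<in> ?H"
   proof (rule lazard_homog_span[OF _ _ x(1)])
    show "submodule ?H R LZ"
    proof (rule LA.submoduleI')
     show "\<zero>\<^bsub>LZ\<^esub> \<in> ?H" using D(2) by auto
     show "v \<oplus>\<^bsub>LZ\<^esub> w \<in> ?H" if "v \<in> ?H" "w \<in> ?H" for v w
     proof -
      from that obtain v' w' where "v \<in> carrier LZ" "w \<in> carrier LZ" "v' \<in> lazard_degree R d" "w' \<in> lazard_degree R d"
       "\<forall>m. (\<Sum>v\<in>#m. 2 * v) = d \<longrightarrow> k (h v) m = k (h v') m" "\<forall>m. (\<Sum>v\<in>#m. 2 * v) = d \<longrightarrow> k (h w) m = k (h w') m" by blast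
      then show ?thesis using D(3)[of v' w'] lazard_degree_closed
       by (intro CollectI conjI bexI[of _ "v' \<oplus>\<^bsub>LZ\<^esub> w'"]) (simp_all add: kh' poly_simps)
     qed
     show "a \<odot>\<^bsub>LZ\<^esub> v \<in> ?H" if "a \<in> carrier R" "v \<in> ?H" for a v
     proof -
      from that obtain v' where "v \<in> carrier LZ" "v' \<in> lazard_degree R d"
       "\<forall>m. (\<Sum>v\<in>#m. 2 * v) = d \<longrightarrow> k (h v) m = k (h v') m" by blast
      then show ?thesis using D(6)[OF that(1), of v'] lazard_degree_closed that(1)
       by (intro CollectI conjI bexI[of _ "a \<odot>\<^bsub>LZ\<^esub> v'"]) (simp_all add: kh' poly_simps)
     qed
    qed blast
    show "lazard_degree R e \<subseteq> ?H" for e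
    proof
     fix v assume v: "v \<in> lazard_degree R e"
     have vc: "v \<in> carrier LZ" using v by (rule lazard_degree_closed)
     show "v \<in> ?H"
     proof (cases "e = d")
      case True
      then show ?thesis using v vc by blast
     next
      case False
      have "k (h v) \<in> ?K e" using kd hd[of e] v by blast
      then have "\<forall>m. (\<Sum>v\<in>#m. 2 * v) = d \<longrightarrow> k (h v) m = k (h \<zero>\<^bsub>LZ\<^esub>) m"
       using False unfolding kh0 homog_def by (auto simp: poly_simps)
      then show ?thesis using vc D(2) by blast
     qed
    qed
   qed
   then obtain x' where x': "x' \<in> lazard_degree R d" "\<forall>m. (\<Sum>v\<in>#m. 2 * v) = d \<longrightarrow> k (h x) m = k (h x') m" by blast
   have "k (h x') \<in> ?K d" "k y \<in> ?K d" using kd y hd[of d] x' by blast+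
   then have "k y = k (h x')" using x'(2) x(2) unfolding homog_def by (auto simp: fun_eq_iff) metis
   then have "y = h x'" using kinj[OF yT h'(1)[OF lazard_degree_closed[OF x'(1)]]] by simp
   then show "y \<in> h ` lazard_degree R d" using x' by blast
  qed
 qed
 then show ?thesis using hi unfolding graded_alg_isomorphic_def by blast
qed

end

section \<open>Graded symmetric algebras and Rees algebras\<close>

context module
begin

lemma sym_degree_eq: "sym_degree j R M d =
  sym_class ` {p \<in> carrier WA. \<forall>w. p w \<noteq> \<zero> \<longrightarrow> j * length w = d}"
 by (auto simp: sym_degree_def)

lemma sym_degree_incl: "x \<in> carrier M \<Longrightarrow> sym_incl R M x \<in> sym_degree j R M j"
 unfolding sym_degree_eq sym_incl_def
 by (rule imageI) (use word_closed[of "[x]"] in \<open>auto simp: basis_elt_def\<close>)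

lemma sym_degree_one: "\<one>\<^bsub>Sym\<^esub> \<in> sym_degree j R M 0"
 unfolding sym_degree_eq sym_class_one
 by (rule imageI) (use word_closed[of "[]"] in \<open>auto simp: basis_elt_def\<close>)

lemma sym_degree_mult:
 assumes "x \<in> sym_degree j R M d" "y \<in> sym_degree j R M e"
 shows "x \<otimes>\<^bsub>Sym\<^esub> y \<in> sym_degree j R M (d + e)"
proof -
 obtain p q where pq: "x = sym_class p" "p \<in> carrier WA" "\<And>w. p w \<noteq> \<zero> \<Longrightarrow> j * length w = d"
  "y = sym_class q" "q \<in> carrier WA" "\<And>w. q w \<noteq> \<zero> \<Longrightarrow> j * length w = e"
  using assms unfolding sym_degree_eq by blast
 have "j * length w = d + e" if w: "(p \<otimes>\<^bsub>WA\<^esub> q) w \<noteq> \<zero>" for w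
 proof -
  have "{(h, k). p h \<noteq> \<zero> \<and> q k \<noteq> \<zero> \<and> h @ k = w} \<noteq> {}"
  proof
   assume emp: "{(h, k). p h \<noteq> \<zero> \<and> q k \<noteq> \<zero> \<and> h @ k = w} = {}"
   have "(p \<otimes>\<^bsub>WA\<^esub> q) w = \<zero>"
    unfolding word_algebra_def monoid_algebra_mult list_monoid_simps emp by (rule R.finsum_empty)
   then show False using w by simp
  qed
  then obtain h k where "p h \<noteq> \<zero>" "q k \<noteq> \<zero>" "w = h @ k" by blast
  then show ?thesis using pq(3)[of h] pq(6)[of k] by (simp add: distrib_left)
 qed
 then show ?thesis using pq ring.ring_simprules(5)[OF WA_ring pq(2,5)]
  unfolding sym_degree_eq pq(1,4) sym_class_mult[OF pq(2,5)] by (intro imageI) simp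
qed

lemma sym_degree_lift:
 assumes B: "algebra R B" and h: "h \<in> mod_hom R M B" and K: "graded_by R B K"
  and hK: "\<And>x. x \<in> carrier M \<Longrightarrow> h x \<in> K j" and z: "z \<in> sym_degree j R M d"
 shows "sym_lift R B h z \<in> K d"
proof -
 interpret B: algebra R B by (rule B)
 note K' = graded_byD[OF K]
 obtain p where p: "z = sym_class p" "p \<in> carrier WA" "\<And>w. p w \<noteq> \<zero> \<Longrightarrow> j * length w = d"
  using z unfolding sym_degree_eq by blast
 let ?e = "\<lambda>w. foldr (\<lambda>x y. h x \<otimes>\<^bsub>B\<^esub> y) w \<one>\<^bsub>B\<^esub>"
 have w: "?e w \<in> K (j * length w)" if "w \<in> lists (carrier M)" for w
  using that
 proof (induction w)
  case Nil
  then show ?case using K'(2) by simp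
 next
  case (Cons x w)
  then show ?case using K'(3)[OF hK Cons.IH, of x] by simp
 qed
 have pw: "w \<in> lists (carrier M)" "p w \<in> carrier R" if "p w \<noteq> \<zero>" for w
  using p(2) that unfolding carrier_WA carrier_free_module by auto
 show ?thesis
  unfolding p(1) sym_lift_class[OF B h p(2)] R.lin_ext_def word_eval_def[OF B h]
 proof (rule B.submodule_finsum[OF K'(1)])
  fix v assume "v \<in> {s. p s \<noteq> \<zero>}"
  then show "p v \<odot>\<^bsub>B\<^esub> ?e v \<in> K d"
   using w[of v] pw[of v] p(3)[of v] B.submoduleD(6)[OF K'(1)] by simp
 qed
qed

end

section \<open>Powers of ideals, Rees algebras and their evaluation in the polynomial ring\<close>

context cring
begin

abbreviation "ideal_pow I m \<equiv> I [^]\<^bsub>ideals_set R\<^esub> (m::nat)"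

lemma ideal_pow_simps:
 assumes "ideal I R"
 shows "ideal_pow I 0 = carrier R" "ideal_pow I (Suc m) = ideal_prod R (ideal_pow I m) I"
  "ideal (ideal_pow I m) R" "ideal_pow I 1 = I"
  "a \<in> ideal_pow I m \<Longrightarrow> b \<in> ideal_pow I k \<Longrightarrow> a \<otimes> b \<in> ideal_pow I (m + k)"
proof -
 interpret S: Group.monoid "ideals_set R" by (rule comm_monoid.axioms(1)[OF ideals_set_is_comm_monoid])
 have Ic: "I \<in> carrier (ideals_set R)" using assms by (simp add: ideals_set_def)
 show "ideal_pow I 0 = carrier R" by (simp add: ideals_set_def)
 show "ideal_pow I (Suc m) = ideal_prod R (ideal_pow I m) I" by (simp add: ideals_set_def)
 show "ideal (ideal_pow I m) R" using S.nat_pow_closed[OF Ic] by (simp add: ideals_set_def)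
 show "ideal_pow I 1 = I" using S.nat_pow_eone[OF Ic] by (simp add: One_nat_def)
 assume "a \<in> ideal_pow I m" "b \<in> ideal_pow I k"
 then have "a \<otimes> b \<in> ideal_prod R (ideal_pow I m) (ideal_pow I k)" by (rule ideal_prod.prod)
 then show "a \<otimes> b \<in> ideal_pow I (m + k)" using S.nat_pow_mult[OF Ic, of m k] by (simp add: ideals_set_def)
qed

lemma ideal_finsum:
 assumes "ideal I R" "finite S" "\<And>i. i \<in> S \<Longrightarrow> f i \<in> I"
 shows "finsum R f S \<in> I"
proof -
 interpret I: ideal I R by (rule assms(1))
 show ?thesis using assms(2,3)
 proof (induction S rule: finite_induct)
  case (insert x F)
  then show ?case using I.Icarr by (subst finsum_insert) (auto simp: I.a_closed)
 qed simp
qed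

abbreviation "U \<equiv> UP R"

lemma U_algebra: "algebra R U"
 by (rule UP_cring.UP_algebra) (simp add: UP_cring_def is_cring)

lemma U_simps:
 "carrier U = up R" "\<zero>\<^bsub>U\<^esub> = (\<lambda>i. \<zero>)" "\<one>\<^bsub>U\<^esub> = (\<lambda>i. if i = 0 then \<one> else \<zero>)"
 "p \<in> up R \<Longrightarrow> q \<in> up R \<Longrightarrow> p \<oplus>\<^bsub>U\<^esub> q = (\<lambda>i. p i \<oplus> q i)"
 "a \<in> carrier R \<Longrightarrow> p \<in> up R \<Longrightarrow> a \<odot>\<^bsub>U\<^esub> p = (\<lambda>i. a \<otimes> p i)"
 "p \<in> up R \<Longrightarrow> q \<in> up R \<Longrightarrow> p \<otimes>\<^bsub>U\<^esub> q = (\<lambda>n. \<Oplus>i\<in>{..n}. p i \<otimes> q (n - i))"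
 "a \<in> carrier R \<Longrightarrow> up_ring.monom U a n = (\<lambda>i. if i = n then a else \<zero>)"
 by (simp_all add: UP_def)

lemma up_closed: "p \<in> up R \<Longrightarrow> p i \<in> carrier R"
 by (rule mem_upD)

lemma rees_carrier: "p \<in> carrier (rees_algebra R I) \<longleftrightarrow> p \<in> up R \<and> (\<forall>m. p m \<in> ideal_pow I m)"
 by (simp add: rees_algebra_def U_simps)

lemma rees_simps:
 "\<zero>\<^bsub>rees_algebra R I\<^esub> = \<zero>\<^bsub>U\<^esub>" "\<one>\<^bsub>rees_algebra R I\<^esub> = \<one>\<^bsub>U\<^esub>" "p \<oplus>\<^bsub>rees_algebra R I\<^esub> q = p \<oplus>\<^bsub>U\<^esub> q"
 "p \<otimes>\<^bsub>rees_algebra R I\<^esub> q = p \<otimes>\<^bsub>U\<^esub> q" "a \<odot>\<^bsub>rees_algebra R I\<^esub> p = a \<odot>\<^bsub>U\<^esub> p"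
 by (simp_all add: rees_algebra_def)

text \<open>A subalgebra of A[t]: the terms of a coefficient of a product lie in I^i I^(n-i), which
  is contained in I^n, and the constant terms are unrestricted since I^0 is the whole ring.\<close>

lemma rees_algebra_algebra:
 assumes I: "ideal I R"
 shows "algebra R (rees_algebra R I)"
proof -
 interpret U: algebra R U by (rule U_algebra)
 let ?H = "carrier (rees_algebra R I)"
 note P = ideal_pow_simps[OF I]
 have pc: "ideal_pow I m \<subseteq> carrier R" for m using additive_subgroup.a_subset[OF ideal.axioms(1)[OF P(3)]] .
 have z: "\<zero> \<in> ideal_pow I m" for m using additive_subgroup.zero_closed[OF ideal.axioms(1)[OF P(3)]] .
 have H: "?H \<subseteq> up R" by (auto simp: rees_carrier)
 have sm: "submodule ?H R U"
 proof (rule U.submoduleI')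
  show "?H \<subseteq> carrier U" using H by (simp add: U_simps)
  show "\<zero>\<^bsub>U\<^esub> \<in> ?H" using U.M.zero_closed z by (simp add: rees_carrier U_simps)
  show "p \<oplus>\<^bsub>U\<^esub> q \<in> ?H" if "p \<in> ?H" "q \<in> ?H" for p q
   using that U.M.a_closed[of p q] additive_subgroup.a_closed[OF ideal.axioms(1)[OF P(3)]]
   by (simp add: rees_carrier U_simps)
  show "a \<odot>\<^bsub>U\<^esub> p \<in> ?H" if "a \<in> carrier R" "p \<in> ?H" for a p
   using that U.smult_closed[of a p] ideal.I_l_closed[OF P(3)] by (simp add: rees_carrier U_simps)
 qed
 have "subring ?H U"
 proof (rule ring.subringI[OF cring.axioms(1)[OF U.M_cring]])
  show "\<one>\<^bsub>U\<^esub> \<in> ?H" using cring.cring_simprules(6)[OF U.M_cring] z P(1) by (auto simp: rees_carrier U_simps)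
  fix p q assume pq: "p \<in> ?H" "q \<in> ?H"
  have "(\<Oplus>i\<in>{..n}. p i \<otimes> q (n - i)) \<in> ideal_pow I n" for n
  proof (rule ideal_finsum[OF P(3)])
   fix i assume "i \<in> {..n}"
   then show "p i \<otimes> q (n - i) \<in> ideal_pow I n" using P(5)[of "p i" i "q (n - i)" "n - i"] pq by (simp add: rees_carrier)
  qed simp
  then show "p \<otimes>\<^bsub>U\<^esub> q \<in> ?H"
   using pq cring.cring_simprules(5)[OF U.M_cring, of p q] by (simp add: rees_carrier U_simps)
 qed (use U.submoduleD[OF sm] in auto)
 then have "subalgebra_of R ?H U" using sm by (simp add: subalgebra_of_def)
 from U.subalgebra_algebra[OF this] show ?thesis by (simp add: rees_algebra_def)
qed

lemma rees_monom:
 assumes I: "ideal I R" and c: "c \<in> ideal_pow I m"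
 shows "up_ring.monom U c m \<in> carrier (rees_algebra R I)"
proof -
 note P = ideal_pow_simps[OF I]
 have cR: "c \<in> carrier R" using c additive_subgroup.a_subset[OF ideal.axioms(1)[OF P(3)]] by blast
 have z: "\<zero> \<in> ideal_pow I m" for m using additive_subgroup.zero_closed[OF ideal.axioms(1)[OF P(3)]] .
 have "up_ring.monom U c m \<in> up R"
  using UP_ring.monom_closed[of R c m] cR by (simp add: UP_ring_def ring_axioms U_simps(1))
 then show ?thesis using c z by (simp add: rees_carrier U_simps(7)[OF cR])
qed

text \<open>The elements of I^(m+1) are sums of products of an element of I^m and one of I, so every
  c t^m with c in I^m is reached by repeated multiplication with elements a t, a in I. Finite sums
  of such terms are all of the Rees algebra.\<close>

lemma rees_generated:
 assumes I: "ideal I R"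
 shows "alg_generates R (rees_algebra R I) ((\<lambda>a. up_ring.monom U a 1) ` I)"
 unfolding alg_generates_def
proof (intro conjI allI impI)
 interpret UC: UP_cring R U by (simp add: UP_cring_def is_cring)
 let ?A = "rees_algebra R I"
 interpret A: algebra R ?A by (rule rees_algebra_algebra[OF I])
 note P = ideal_pow_simps[OF I]
 have pc: "c \<in> carrier R" if "c \<in> ideal_pow I m" for c m
  using additive_subgroup.a_subset[OF ideal.axioms(1)[OF P(3)]] that by blast
 have Ic: "a \<in> carrier R" if "a \<in> I" for a using pc[of a 1] that P(4) by simp
 show "(\<lambda>a. up_ring.monom U a 1) ` I \<subseteq> carrier ?A" using rees_monom[OF I, of _ 1] P(4) by auto
 fix H assume H: "submodule H R ?A" and H1: "\<one>\<^bsub>?A\<^esub> \<in> H" and HM: "\<forall>s\<in>(\<lambda>a. up_ring.monom U a 1) ` I. \<forall>x\<in>H. s \<otimes>\<^bsub>?A\<^esub> x \<in> H"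
 note D = A.submoduleD[OF H]
 have mon: "up_ring.monom U c m \<in> H" if "c \<in> ideal_pow I m" for c m
  using that
 proof (induction m arbitrary: c)
  case 0
  then have c: "c \<in> carrier R" using P(1) by simp
  have "up_ring.monom U c 0 = c \<odot>\<^bsub>?A\<^esub> \<one>\<^bsub>?A\<^esub>"
   using c up_one_closed by (auto simp: rees_simps U_simps fun_eq_iff)
  then show ?case using D(6)[OF c H1] by simp
 next
  case (Suc m)
  have "c \<in> ideal_prod R (ideal_pow I m) I" using Suc.prems P(2) by simp
  then show ?case
  proof (induction rule: ideal_prod.induct)
   case (prod a b)
   have "up_ring.monom U (b \<otimes> a) (1 + m) = up_ring.monom U b 1 \<otimes>\<^bsub>U\<^esub> up_ring.monom U a m"
    by (rule UC.monom_mult[OF Ic[OF prod(2)] pc[OF prod(1)]])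
   moreover have "a \<otimes> b = b \<otimes> a" using m_comm pc[OF prod(1)] Ic[OF prod(2)] by blast
   ultimately show ?case using HM prod(2) Suc.IH[OF prod(1)] by (simp add: rees_simps plus_1_eq_Suc)
  next
   case (sum a b)
   have "a \<in> carrier R" "b \<in> carrier R" using sum(1,2) pc[of _ "Suc m"] P(2) by auto
   then show ?case using D(3)[OF sum(3,4)] UC.monom_add[of a b "Suc m"] by (simp add: rees_simps)
  qed
 qed
 \<comment> \<open>Induction on a bound N for the coefficients that may be non-zero: the top term is
   split off, and the remainder stays in the Rees algebra.\<close>
 have "p \<in> H" if "p \<in> carrier ?A" "\<forall>m\<ge>N. p m = \<zero>" for N p
  using that
 proof (induction N arbitrary: p)
  case 0
  then have "p = \<zero>\<^bsub>?A\<^esub>" by (auto simp: rees_simps U_simps)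
  then show ?case using D(2) by simp
 next
  case (Suc N)
  have pN: "p N \<in> ideal_pow I N" and pu: "p \<in> up R" using Suc.prems(1) by (auto simp: rees_carrier)
  define p' where "p' = p(N := \<zero>)"
  have z: "\<zero> \<in> ideal_pow I N" using additive_subgroup.zero_closed[OF ideal.axioms(1)[OF P(3)]] .
  have "p' \<in> up R"
  proof (rule mem_upI)
   show "p' n \<in> carrier R" for n using up_closed[OF pu] by (simp add: p'_def)
   show "\<exists>n. bound \<zero> n p'" using Suc.prems(2) by (intro exI[of _ "Suc N"] bound.intro) (simp add: p'_def)
  qed
  then have p'A: "p' \<in> carrier ?A" using Suc.prems(1) z by (simp add: rees_carrier p'_def)
  have "p' \<in> H"
  proof (rule Suc.IH[OF p'A], intro allI impI)
   fix m assume "N \<le> m"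
   then show "p' m = \<zero>" using Suc.prems(2) by (cases "m = N") (auto simp: p'_def)
  qed
  moreover have "p = up_ring.monom U (p N) N \<oplus>\<^bsub>?A\<^esub> p'"
  proof -
   have "up_ring.monom U (p N) N \<in> up R" using rees_monom[OF I pN] by (simp add: rees_carrier)
   then show ?thesis using \<open>p' \<in> up R\<close> up_closed[OF pu]
    by (auto simp: rees_simps U_simps p'_def fun_eq_iff)
  qed
  ultimately show ?case using D(3)[OF mon[OF pN]] by metis
 qed
 moreover have "\<exists>N. \<forall>m\<ge>N. p m = \<zero>" if p: "p \<in> carrier ?A" for p
 proof -
  obtain n where "bound \<zero> n p" using p bound_upD[of p] by (auto simp: rees_carrier)
  then show ?thesis by (intro exI[of _ "Suc n"]) (auto simp: bound_def)
 qed
 ultimately show "carrier ?A \<subseteq> H" by blast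
qed

text \<open>The homomorphism of \<open>R[t]\<close> to the polynomial ring in several variables that maps \<open>t\<close> to the
 variable \<open>k\<close>.\<close>

definition up_eval :: "nat \<Rightarrow> (nat \<Rightarrow> 'a) \<Rightarrow> nat multiset \<Rightarrow> 'a" where
 "up_eval k p s = (if set_mset s \<subseteq> {k} then p (size s) else \<zero>)"

lemma up_eval_hom:
 assumes k: "1 \<le> k"
 shows "up_eval k \<in> alg_hom R U PX"
proof (rule alg_homI)
 have rep: "s = replicate_mset (size s) k" if "set_mset s \<subseteq> {k}" for s
  using that by (rule set_mset_subset_singletonD)
 have cl: "up_eval k p \<in> carrier PX" if p: "p \<in> up R" for p
 proof -
  obtain n where n: "bound \<zero> n p" using bound_upD[OF p] by blast
  have "{s. up_eval k p s \<noteq> \<zero>} \<subseteq> (\<lambda>i. replicate_mset i k) ` {..n}"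
  proof
   fix s assume "s \<in> {s. up_eval k p s \<noteq> \<zero>}"
   then have "set_mset s \<subseteq> {k}" "p (size s) \<noteq> \<zero>" by (auto simp: up_eval_def split: if_splits)
   then show "s \<in> (\<lambda>i. replicate_mset i k) ` {..n}" using rep[of s] bound_below[OF n] by blast
  qed
  then have "finite {s. up_eval k p s \<noteq> \<zero>}" by (rule finite_subset) simp
  then show ?thesis using k up_closed[OF p] unfolding carrier_poly by (auto simp: up_eval_def)
 qed
 show "up_eval k \<in> mod_hom R U PX"
  by (rule mod_homI) (use cl in \<open>auto simp: U_simps poly_simps up_eval_def fun_eq_iff\<close>)
 show "up_eval k \<one>\<^bsub>U\<^esub> = \<one>\<^bsub>PX\<^esub>"
  by (auto simp: U_simps poly_simps up_eval_def basis_elt_def fun_eq_iff)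
 fix p q assume "p \<in> carrier U" "q \<in> carrier U"
 then have pq: "p \<in> up R" "q \<in> up R" by (simp_all add: U_simps)
 note c = up_closed[OF pq(1)] up_closed[OF pq(2)]
 have "up_eval k (p \<otimes>\<^bsub>U\<^esub> q) s = (\<Oplus>t\<in>{t. t \<subseteq># s}. up_eval k p t \<otimes> up_eval k q (s - t))" for s
 proof (cases "set_mset s \<subseteq> {k}")
  case True
  let ?r = "\<lambda>i. replicate_mset i k"
  have s: "s = ?r (size s)" by (rule rep[OF True])
  \<comment> \<open>The divisors of a power of a single variable are its lower powers, so that the
    product formula in \<open>PX\<close> turns into the Cauchy product.\<close>
  have "{t. t \<subseteq># s} = ?r ` {..size s}"
  proof (intro equalityI subsetI)
   fix t assume "t \<in> {t. t \<subseteq># s}"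
   then have t: "t \<subseteq># s" by simp
   then have "set_mset t \<subseteq> {k}" using set_mset_mono[OF t] True by blast
   then show "t \<in> ?r ` {..size s}" using rep[of t] size_mset_mono[OF t] by blast
  next
   fix t assume "t \<in> ?r ` {..size s}"
   then obtain i where i: "i \<le> size s" "t = ?r i" by auto
   have "?r i \<subseteq># ?r (size s)" using i by (simp add: subseteq_mset_def)
   then show "t \<in> {t. t \<subseteq># s}" using i s by simp
  qed
  moreover have "inj_on ?r {..size s}" by (rule inj_onI) (metis size_replicate_mset)
  ultimately have "(\<Oplus>t\<in>{t. t \<subseteq># s}. up_eval k p t \<otimes> up_eval k q (s - t)) =
    (\<Oplus>i\<in>{..size s}. up_eval k p (?r i) \<otimes> up_eval k q (s - ?r i))"
   using c by (simp add: add.finprod_reindex up_eval_def Pi_iff)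
  also have "\<dots> = (\<Oplus>i\<in>{..size s}. p i \<otimes> q (size s - i))"
  proof (rule add.finprod_cong')
   fix i assume i: "i \<in> {..size s}"
   have "?r i \<subseteq># ?r (size s)" using i by (simp add: subseteq_mset_def)
   then have "size (s - ?r i) = size s - i" using s by (simp add: size_Diff_submset)
   moreover have "set_mset (s - ?r i) \<subseteq> {k}" using True by (meson in_diffD subset_eq)
   moreover have "set_mset (?r i) \<subseteq> {k}" by auto
   ultimately show "up_eval k p (?r i) \<otimes> up_eval k q (s - ?r i) = p i \<otimes> q (size s - i)"
    by (simp add: up_eval_def)
  qed (use c in auto)
  finally show ?thesis using True pq by (simp add: up_eval_def U_simps)
 next
  case False
  have "up_eval k p t \<otimes> up_eval k q (s - t) = \<zero>" if "t \<subseteq># s" for t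
  proof -
   have "set_mset s = set_mset t \<union> set_mset (s - t)" using that by (metis set_mset_union subset_mset.add_diff_inverse)
   then have "\<not> set_mset t \<subseteq> {k} \<or> \<not> set_mset (s - t) \<subseteq> {k}" using False by blast
   then show ?thesis using c by (auto simp: up_eval_def)
  qed
  then have "(\<Oplus>t\<in>{t. t \<subseteq># s}. up_eval k p t \<otimes> up_eval k q (s - t)) = \<zero>"
   by (intro add.finprod_one_eqI) auto
  then show ?thesis using False by (simp add: up_eval_def)
 qed
 then show "up_eval k (p \<otimes>\<^bsub>U\<^esub> q) = up_eval k p \<otimes>\<^bsub>PX\<^esub> up_eval k q"
  using poly_mult_formula[OF cl[OF pq(1)] cl[OF pq(2)]] by (auto simp: fun_eq_iff)
qed

lemma up_eval_monom: "a \<in> carrier R \<Longrightarrow> up_eval k (up_ring.monom U a 1) = a \<odot>\<^bsub>PX\<^esub> poly_var R k"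
proof -
 assume a: "a \<in> carrier R"
 have "set_mset s \<subseteq> {k} \<and> size s = 1 \<longleftrightarrow> s = {#k#}" for s
  by (auto simp: size_1_singleton_mset dest: size_1_singleton_mset simp flip: One_nat_def)
 then show ?thesis using a by (auto simp: up_eval_def U_simps poly_simps poly_var_def basis_elt_def fun_eq_iff)
qed

lemma up_eval_homog:
 assumes k: "1 \<le> k" and p: "p \<in> up R" "\<And>m. p m \<noteq> \<zero> \<Longrightarrow> 2 * k * m = d"
 shows "up_eval k p \<in> homog {1..} (\<lambda>v. 2 * v) d"
proof -
 have "(\<Sum>v\<in>#s. 2 * v) = d" if "up_eval k p s \<noteq> \<zero>" for s
 proof -
  have s: "set_mset s \<subseteq> {k}" "p (size s) \<noteq> \<zero>" using that by (auto simp: up_eval_def split: if_splits)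
  have "(\<Sum>v\<in>#replicate_mset (size s) k. 2 * v) = 2 * k * size s" by simp
  then show ?thesis using set_mset_subset_singletonD[OF s(1)] p(2)[OF s(2)] by simp
 qed
 then show ?thesis using alg_homD(1)[OF up_eval_hom[OF k], of p] p(1) by (simp add: homog_def U_simps)
qed

end

section \<open>Comparison with symmetric and Rees algebras\<close>

context injective_fundamental
begin

lemma sym_tensor_isomorphic:
 "graded_alg_isomorphic R LZ (lazard_degree R)
   (tensor_algebra R {1<..} (\<lambda>n. sym_algebra R (ideal_module R (In n))))
   (tensor_degree R {1<..} (\<lambda>n. sym_algebra R (ideal_module R (In n)))
    (\<lambda>n. sym_degree (2 * (n - 1)) R (ideal_module R (In n))))"
proof -
 let ?J = "\<lambda>n. ideal_module R (In n)"
 let ?x = "\<lambda>n a. a \<odot>\<^bsub>PX\<^esub> poly_var R (n - 1)"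
 interpret PX: algebra R PX by (rule poly_algebra_algebra)
 have J: "module R (?J n)" if "1 < n" for n by (rule ideal_module_module[OF In_ideal[OF that]])
 have x: "?x n \<in> mod_hom R (?J n) PX" if "1 < n" for n
  using that ideal.Icarr[OF In_ideal[OF that]]
  by (intro PX.mod_hom_scalar poly_var_closed) (auto simp: mod_hom_def ideal_module_simps self_module_simps)
 show ?thesis
 proof (rule tensor_isomorphic[where j = "\<lambda>n. sym_incl R (?J n)" and g = "\<lambda>n. sym_lift R PX (?x n)"])
  fix n :: nat assume n: "1 < n"
  interpret J: module R "?J n" by (rule J[OF n])
  show "algebra R (sym_algebra R (?J n))" by (rule J.sym_algebra_algebra)
  show "sym_incl R (?J n) \<in> mod_hom R (?J n) (sym_algebra R (?J n))" by (rule J.sym_incl_hom)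
  show "alg_generates R (sym_algebra R (?J n)) (sym_incl R (?J n) ` In n)"
   using J.sym_generated by (simp add: ideal_module_simps)
  show "sym_lift R PX (?x n) \<in> alg_hom R (sym_algebra R (?J n)) PX"
   by (rule J.sym_lift_hom[OF poly_algebra_algebra x[OF n]])
  show "\<one>\<^bsub>sym_algebra R (?J n)\<^esub> \<in> sym_degree (2 * (n - 1)) R (?J n) 0" by (rule J.sym_degree_one)
  show "sym_lift R PX (?x n) (sym_incl R (?J n) a) = ?x n a" if "a \<in> In n" for a
   by (rule J.sym_lift_incl[OF poly_algebra_algebra x[OF n]]) (use that in \<open>simp add: ideal_module_simps\<close>)
  show "sym_incl R (?J n) a \<in> sym_degree (2 * (n - 1)) R (?J n) (2 * (n - 1))" if "a \<in> In n" for a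
   by (rule J.sym_degree_incl) (use that in \<open>simp add: ideal_module_simps\<close>)
  show "y \<otimes>\<^bsub>sym_algebra R (?J n)\<^esub> z \<in> sym_degree (2 * (n - 1)) R (?J n) (d + e)"
   if "y \<in> sym_degree (2 * (n - 1)) R (?J n) d" "z \<in> sym_degree (2 * (n - 1)) R (?J n) e" for y z d e
   by (rule J.sym_degree_mult[OF that])
  have "?x n a \<in> homog {1..} (\<lambda>v. 2 * v) (2 * (n - 1))" if "a \<in> carrier (?J n)" for a
  proof (rule PX.submoduleD(6)[OF homog_submodule])
   show "a \<in> carrier R" using that ideal.Icarr[OF In_ideal[OF n]] by (simp add: ideal_module_simps)
   show "poly_var R (n - 1) \<in> homog {1..} (\<lambda>v. 2 * v) (2 * (n - 1))"
    unfolding poly_var_def using n by (intro homog_basis) auto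
  qed
  then show "sym_lift R PX (?x n) z \<in> homog {1..} (\<lambda>v. 2 * v) d"
   if "z \<in> sym_degree (2 * (n - 1)) R (?J n) d" for z d
   by (rule J.sym_degree_lift[OF poly_algebra_algebra x[OF n] homog_graded _ that])
 qed
qed

text \<open>In the criterion, a in the ideal corresponds to a t, and evaluation sends t to
  x_{n-1}.\<close>

lemma rees_tensor_isomorphic:
 "graded_alg_isomorphic R LZ (lazard_degree R)
   (tensor_algebra R {1<..} (\<lambda>n. rees_algebra R (In n)))
   (tensor_degree R {1<..} (\<lambda>n. rees_algebra R (In n)) (\<lambda>n. rees_degree (2 * (n - 1)) R (In n)))"
proof (rule tensor_isomorphic[where j = "\<lambda>n a. up_ring.monom U a 1" and g = "\<lambda>n. up_eval (n - 1)"])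
 fix n :: nat assume n: "1 < n"
 note I = In_ideal[OF n]
 note P = ideal_pow_simps[OF I]
 let ?A = "rees_algebra R (In n)"
 have k: "1 \<le> n - 1" using n by simp
 have Ic: "a \<in> carrier R" if "a \<in> In n" for a using ideal.Icarr[OF I that] .
 interpret UC: UP_cring R U by (simp add: UP_cring_def is_cring)
 interpret A: algebra R ?A by (rule rees_algebra_algebra[OF I])
 show "algebra R ?A" by (rule rees_algebra_algebra[OF I])
 have m: "up_ring.monom U a 1 \<in> carrier ?A" if "a \<in> In n" for a using rees_monom[OF I, of a 1] that P(4) by simp
 show "(\<lambda>a. up_ring.monom U a 1) \<in> mod_hom R (ideal_module R (In n)) ?A"
  using m Ic by (intro mod_homI) (simp_all add: ideal_module_simps rees_simps UC.monom_mult_smult)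
 show "alg_generates R ?A ((\<lambda>a. up_ring.monom U a 1) ` In n)" by (rule rees_generated[OF I])
 have sub: "p \<in> carrier U" if "p \<in> carrier ?A" for p using that by (simp add: rees_carrier U_simps)
 show "up_eval (n - 1) \<in> alg_hom R ?A PX"
  using alg_homD[OF up_eval_hom[OF k]] sub by (intro alg_homI mod_homI) (simp_all add: rees_simps)
 show "up_eval (n - 1) (up_ring.monom U a 1) = a \<odot>\<^bsub>PX\<^esub> poly_var R (n - 1)" if "a \<in> In n" for a
  by (rule up_eval_monom[OF Ic[OF that]])
 show "up_ring.monom U a 1 \<in> rees_degree (2 * (n - 1)) R (In n) (2 * (n - 1))" if "a \<in> In n" for a
  using m[OF that] Ic[OF that] by (simp add: rees_degree_def U_simps)
 show "\<one>\<^bsub>?A\<^esub> \<in> rees_degree (2 * (n - 1)) R (In n) 0"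
  using cring.cring_simprules(6)[OF A.M_cring] by (simp add: rees_degree_def rees_simps U_simps)
 show "up_eval (n - 1) x \<in> homog {1..} (\<lambda>v. 2 * v) d" if "x \<in> rees_degree (2 * (n - 1)) R (In n) d" for x d
  by (rule up_eval_homog[OF k]) (use that in \<open>auto simp: rees_degree_def rees_carrier\<close>)
 fix p q d e assume pq: "p \<in> rees_degree (2 * (n - 1)) R (In n) d" "q \<in> rees_degree (2 * (n - 1)) R (In n) e"
 then have c: "p \<in> carrier ?A" "q \<in> carrier ?A" by (auto simp: rees_degree_def)
 then have u: "p \<in> up R" "q \<in> up R" by (auto simp: rees_carrier)
 have "2 * (n - 1) * m = d + e" if "(p \<otimes>\<^bsub>U\<^esub> q) m \<noteq> \<zero>" for m
 proof -
  have "\<exists>i\<le>m. p i \<otimes> q (m - i) \<noteq> \<zero>"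
  proof (rule ccontr)
   assume "\<not> (\<exists>i\<le>m. p i \<otimes> q (m - i) \<noteq> \<zero>)"
   then have "(\<Oplus>i\<in>{..m}. p i \<otimes> q (m - i)) = \<zero>" by (intro add.finprod_one_eqI) auto
   then show False using that u by (simp add: U_simps)
  qed
  then obtain i where i: "i \<le> m" "p i \<otimes> q (m - i) \<noteq> \<zero>" by blast
  have "p i \<noteq> \<zero>" "q (m - i) \<noteq> \<zero>" using i(2) up_closed[OF u(1)] up_closed[OF u(2)] by (metis l_null, metis r_null)
  then have "2 * (n - 1) * i = d" "2 * (n - 1) * (m - i) = e" using pq by (auto simp: rees_degree_def)
  moreover have "2 * (n - 1) * i + 2 * (n - 1) * (m - i) = 2 * (n - 1) * m"
   unfolding distrib_left[symmetric] using i(1) by simp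
  ultimately show ?thesis by simp
 qed
 then show "p \<otimes>\<^bsub>?A\<^esub> q \<in> rees_degree (2 * (n - 1)) R (In n) (d + e)"
  using cring.cring_simprules(5)[OF A.M_cring c] by (simp add: rees_degree_def rees_simps)
qed

end

theorem theorem2p10:
  fixes A :: "('a, 'm) ring_scheme"
  assumes "cring A"
    and "additively_torsion_free A"
    and "\<forall>n>1. inj_on (fundamental_functional A n) (carrier (indec A n))"
    and "\<forall>n>1. projective_module A (ideal_module A (fundamental_ideal A n))"
  shows
    "(\<forall>n>1. fundamental_ideal A n =
        Idl\<^bsub>A\<^esub> (insert (add_pow A (nu n) \<one>\<^bsub>A\<^esub>) {a \<ominus>\<^bsub>A\<^esub> (a [^]\<^bsub>A\<^esub> n) | a. a \<in> carrier A})) \<and>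
     fundamental_comparison_condition A \<and>
     (\<forall>i. is_splitting A i \<longrightarrow>
        inj_on (s_map A) (carrier (sym_algebra A (indec_sum A))) \<and>
        i_sharp A i \<in> alg_iso A (sym_algebra A (indec_sum A)) (lazard A)) \<and>
     (\<exists>H. subalgebra_of A H (poly_algebra A {1::nat..}) \<and>
        (\<exists>h. h \<in> alg_iso A (lazard A) ((poly_algebra A {1::nat..})\<lparr>carrier := H\<rparr>))) \<and>
     graded_alg_isomorphic A (lazard A) (lazard_degree A)
       (tensor_algebra A {1<..} (\<lambda>n. sym_algebra A (ideal_module A (fundamental_ideal A n))))
       (tensor_degree A {1<..} (\<lambda>n. sym_algebra A (ideal_module A (fundamental_ideal A n)))
          (\<lambda>n. sym_degree (2 * (n - 1)) A (ideal_module A (fundamental_ideal A n)))) \<and>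
     graded_alg_isomorphic A (lazard A) (lazard_degree A)
       (tensor_algebra A {1<..} (\<lambda>n. rees_algebra A (fundamental_ideal A n)))
       (tensor_degree A {1<..} (\<lambda>n. rees_algebra A (fundamental_ideal A n))
          (\<lambda>n. rees_degree (2 * (n - 1)) A (fundamental_ideal A n)))"
proof -
  interpret injective_fundamental A
    using assms by (intro injective_fundamental.intro injective_fundamental_axioms.intro) auto
  show ?thesis
  proof (intro conjI allI impI)
    fix i assume "is_splitting A i"
    then interpret comparison A i by unfold_locales
    show "i_sharp A i \<in> alg_iso A (sym_algebra A (indec_sum A)) (lazard A)" by (rule i_sharp_iso)
  qed (use fundamental_ideal_eq(1)[OF torsion_free] indec_projective s_map_inj lazard_subalgebra
      sym_tensor_isomorphic rees_tensor_isomorphic in \<open>simp_all add: fundamental_comparison_condition_def\<close>)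
qed

end
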